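(* Let $\mathcal{T}=(A,T,G)$ be a regularity structure, let $p\in[1,\infty)$, $q\in[1,\infty]$, and suppose that $\alpha:=\min A<\gamma<0$. If $q=\infty$ let $\bar\alpha=\alpha$; otherwise let $\bar\alpha<\alpha$ be arbitrary. Let $r\in\mathbb{N}$ with $r>|\alpha|$. (1) For every model $(\Pi,\Gamma)$ for $\mathcal{T}$ (with global bounds) there exists a continuous linear operator $\mathcal{R}\colon\mathcal{D}^\gamma_{p,q}\to\mathcal{B}^{\bar\alpha}_{p,q}$ such that $$\left\|\,\Big\|\sup_{\eta\in\mathcal{B}^r}\frac{|\langle\mathcal{R}f-\Pi_xf(x),\eta^\lambda_x\rangle|}{\lambda^\gamma}\Big\|_{L^p(\mathrm{d}x)}\right\|_{L^q_\lambda}\lesssim\|\Pi\|\,(1+\|\Gamma\|)\,|||f|||_{\gamma,p,q},\qquad(\ast)$$ uniformly over all $f\in\mathcal{D}^\gamma_{p,q}$ and all models $(\Pi,\Gamma)$ for $\mathcal{T}$ (i.e. the implicit constant depends neither on $f$ nor on the model). (2) Let $(\Pi,\Gamma)$ and $(\overline\Pi,\overline\Gamma)$ be two models for $\mathcal{T}$, and let $\mathcal{D}^\gamma_{p,q}$ and $\overline{\mathcal{D}}^\gamma_{p,q}$ be the Besov spaces of modelled distributions with respect to $(\Pi,\Gamma)$ and $(\overline\Pi,\overline\Gamma)$, respectively. Then there exist continuous maps $\mathcal{R}\colon\mathcal{D}^\gamma_{p,q}\to\mathcal{B}^{\bar\alpha}_{p,q}$ and $\overline{\mathcal{R}}\colon\overline{\mathcal{D}}^\gamma_{p,q}\to\mathcal{B}^{\bar\alpha}_{p,q}$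 which satisfy the bound $(\ast)$ for $(\Pi,\Gamma)$ and $(\overline\Pi,\overline\Gamma)$, respectively, and such that $$\left\|\,\Big\|\sup_{\eta\in\mathcal{B}^r}\frac{|\langle\mathcal{R}f-\overline{\mathcal{R}}g-\Pi_xf(x)+\overline\Pi_xg(x),\eta^\lambda_x\rangle|}{\lambda^\gamma}\Big\|_{L^p(\mathrm{d}x)}\right\|_{L^q_\lambda}\lesssim|||f;g|||_{\gamma,p,q}+|||g|||_{\gamma,p,q}\big(\|\Pi-\overline\Pi\|+\|\Gamma-\overline\Gamma\|\big)$$ for all $f\in\mathcal{D}^\gamma_{p,q}$ and $g\in\overline{\mathcal{D}}^\gamma_{p,q}$, where the implicit constant may depend on $\Pi,\Gamma,\overline\Pi,\overline\Gamma$ but not on $f,g$, and $$|||f;g|||_{\gamma,p,q}:=\max_{\zeta\in A_\gamma}\Bigg(\big\||f(x)-g(x)|_\zeta\big\|_{L^p(\mathrm{d}x)}+\bigg(\int_{B(0,1)}\Big\|\frac{|f(x+h)-g(x+h)-\Gamma_{x+h,x}f(x)+\overline\Gamma_{x+h,x}g(x)|_\zeta}{\|h\|_{\mathfrak{s}}^{\gamma-\zeta}}\Big\|_{L^p(\mathrm{d}x)}^q\frac{\mathrm{d}h}{\|h\|_{\mathfrak{s}}^{|\mathfrak{s}|}}\bigg)^{1/q}\Bigg).$$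
   Context: **Notation.** Fix $d\ge1$ and a scaling $\mathfrak{s}=(\mathfrak{s}_1,\dots,\mathfrak{s}_d)$ of positive integers, $|\mathfrak{s}|=\mathfrak{s}_1+\dots+\mathfrak{s}_d$, $\|x\|_{\mathfrak{s}}:=\sup_i|x_i|^{1/\mathfrak{s}_i}$ for $x\in\mathbb{R}^d$; $B(x,R)$ is the ball of radius $R$ around $x$ for $\|\cdot\|_{\mathfrak{s}}$. $\mathcal{D}'$ is the space of (tempered) distributions on $\mathbb{R}^d$. $\mathcal{B}^r$ is the set of compactly supported $\phi\in\mathcal{C}^r(\mathbb{R}^d)$ (the usual Hölder space) with $\|\phi\|_{\mathcal{C}^r}\le1$ and support in $B(0,1)$. For $\lambda\in(0,1]$, $x\in\mathbb{R}^d$, $\eta^\lambda_x(y):=\lambda^{-|\mathfrak{s}|}\eta(\lambda^{-\mathfrak{s}_1}(y_1-x_1),\dots,\lambda^{-\mathfrak{s}_d}(y_d-x_d))$. $L^p=L^p(\mathbb{R}^d,\mathrm{d}x)$ and $L^q_\lambda:=L^q((0,1),\lambda^{-1}\mathrm{d}\lambda)$. Usual essential-supremum modifications are made when $q=\infty$. $a\lesssim b$ means $a\le Cb$ for a constant $C>0$. **Regularity structure.** $\mathcal{T}=(A,T,G)$ consists of: an index set $A\subset\mathbb{R}$, locally finite, bounded from below, with $0\in A$; a graded vector space $T=\bigoplus_{\alpha\in A}T_\alpha$ with each $T_\alpha$ a Banach space and $T_0\approx\mathbb{R}$ with unit vector $\mathbf{1}$; a group $G$ of linear operators on $T$ such that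 $\Gamma a-a\in\bigoplus_{\beta\in A,\beta<\alpha}T_\beta$ for all $\Gamma\in G$, $\alpha\in A$, $a\in T_\alpha$, and $\Gamma\mathbf{1}=\mathbf{1}$. For $\tau\in T$, $\|\tau\|_\alpha=|\tau|_\alpha$ denotes the norm of the projection of $\tau$ onto $T_\alpha$. For $\gamma\in\mathbb{R}$, $A_\gamma:=\{\alpha\in A:\alpha<\gamma\}$ and $T^-_\gamma:=\bigoplus_{\alpha\in A_\gamma}T_\alpha$. **Model (global bounds).** A model $(\Pi,\Gamma)$ for $\mathcal{T}$ on $\mathbb{R}^d$ consists of a map $\Gamma\colon\mathbb{R}^d\times\mathbb{R}^d\to G$ with $\Gamma_{x,y}\Gamma_{y,z}=\Gamma_{x,z}$, $\Gamma_{x,x}=1$, and continuous linear maps $\Pi_x\colon T\to\mathcal{D}'$ with $\Pi_y=\Pi_x\circ\Gamma_{x,y}$ for all $x,y,z\in\mathbb{R}^d$, such that for every $\gamma>0$ there is $C_\gamma>0$ with $$|\langle\Pi_x\tau,\phi^\lambda_x\rangle|\le C_\gamma\lambda^\alpha\|\tau\|_\alpha,\qquad\|\Gamma_{x,y}\tau\|_\beta\le C_\gamma\|x-y\|_{\mathfrak{s}}^{\alpha-\beta}\|\tau\|_\alpha$$ uniformly over $x,y\in\mathbb{R}^d$, $\lambda\in(0,1]$, $\tau\in T_\alpha$ with $\alpha\le\gamma$, $\beta\le\alpha$, and $\phi\in\mathcal{B}^r$ with $r>|\inf A|$. For the given $\gamma$, $\|\Pi\|=\|\Pi\|_\gamma$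 and $\|\Gamma\|=\|\Gamma\|_\gamma$ denote the smallest constants for which the first, respectively second, bound holds (over $\alpha\le\gamma$). For two models, $$\|\Pi-\overline\Pi\|:=\sup_{x}\sup_{\phi\in\mathcal{B}^r}\sup_{\lambda\in(0,1]}\sup_{\alpha\in A_\gamma}\sup_{\tau\in T_\alpha}\frac{|\langle\Pi_x\tau-\overline\Pi_x\tau,\phi^\lambda_x\rangle|}{\lambda^\alpha\|\tau\|_\alpha},\qquad\|\Gamma-\overline\Gamma\|:=\sup_{x,y}\sup_{\beta\le\alpha\in A_\gamma}\sup_{\tau\in T_\alpha}\frac{\|\Gamma_{x,y}\tau-\overline\Gamma_{x,y}\tau\|_\beta}{\|x-y\|_{\mathfrak{s}}^{\alpha-\beta}\|\tau\|_\alpha}.$$ **Besov space of modelled distributions.** $\mathcal{D}^\gamma_{p,q}$ (with respect to $(\Pi,\Gamma)$) is the space of measurable $f\colon\mathbb{R}^d\to T^-_\gamma$ with $$|||f|||_{\gamma,p,q}:=\sum_{\alpha\in A_\gamma}\big\||f(x)|_\alpha\big\|_{L^p(\mathrm{d}x)}+\sum_{\alpha\in A_\gamma}\bigg(\int_{B(0,1)}\Big\|\frac{|f(x+h)-\Gamma_{x+h,x}f(x)|_\alpha}{\|h\|_{\mathfrak{s}}^{\gamma-\alpha}}\Big\|_{L^p(\mathrm{d}x)}^q\frac{\mathrm{d}h}{\|h\|_{\mathfrak{s}}^{|\mathfrak{s}|}}\bigg)^{1/q}<\infty.$$ **Besov space of negative regularity.** For $\bar\alpha<0$ and an integer $r'>|\bar\alpha|$,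 $\mathcal{B}^{\bar\alpha}_{p,q}$ is the space of distributions $\xi$ on $\mathbb{R}^d$ with $\big\|\,\big\|\sup_{\eta\in\mathcal{B}^{r'}}|\langle\xi,\eta^\lambda_x\rangle|/\lambda^{\bar\alpha}\big\|_{L^p(\mathrm{d}x)}\big\|_{L^q_\lambda}<\infty$, normed by this quantity. *)

theory Defs
  imports "HOL-Analysis.Analysis"
begin

text \<open>Points of $d$-dimensional Euclidean space are elements of \<open>real ^ 'd\<close>; a scaling is a
  function \<open>s :: 'd \<Rightarrow> nat\<close> with positive values.\<close>

definition scale_deg :: "('d::finite \<Rightarrow> nat) \<Rightarrow> nat" where
  "scale_deg s = (\<Sum>i\<in>UNIV. s i)"

definition snorm :: "('d::finite \<Rightarrow> nat) \<Rightarrow> real ^ 'd \<Rightarrow> real" where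
  "snorm s x = (SUP i. \<bar>x $ i\<bar> powr (1 / real (s i)))"

definition sball :: "('d::finite \<Rightarrow> nat) \<Rightarrow> real ^ 'd \<Rightarrow> real \<Rightarrow> (real ^ 'd) set" where
  "sball s x R = {y. snorm s (y - x) < R}"

definition rescale ::
    "('d::finite \<Rightarrow> nat) \<Rightarrow> (real ^ 'd \<Rightarrow> real) \<Rightarrow> real \<Rightarrow> real ^ 'd \<Rightarrow> real ^ 'd \<Rightarrow> real" where
  "rescale s \<eta> l x = (\<lambda>y. \<eta> (\<chi> i. (y $ i - x $ i) / l ^ s i) / l ^ scale_deg s)"

definition ennreal_powr :: "ennreal \<Rightarrow> real \<Rightarrow> ennreal" where
  "ennreal_powr a t = (if a = \<infinity> then \<infinity> else ennreal (enn2real a powr t))"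

text \<open>For \<open>q = \<infinity>\<close> the infimum is the essential supremum.\<close>

definition Lnorm :: "'a measure \<Rightarrow> ennreal \<Rightarrow> ('a \<Rightarrow> ennreal) \<Rightarrow> ennreal" where
  "Lnorm M q g =
    (if q = \<infinity> then Inf {z. AE x in M. g x \<le> z}
     else ennreal_powr (\<integral>\<^sup>+x. ennreal_powr (g x) (enn2real q) \<partial>M) (1 / enn2real q))"

definition scale_measure_01 :: "real measure" where
  "scale_measure_01 = density lebesgue (\<lambda>l. indicator {0<..<1} l * ennreal (1 / l))"

definition increment_measure :: "('d::finite \<Rightarrow> nat) \<Rightarrow> (real ^ 'd) measure" where
  "increment_measure s = density lebesgue
    (\<lambda>h. indicator (sball s 0 1) h * ennreal (1 / snorm s h ^ scale_deg s))"

definition partial_deriv :: "'d::finite \<Rightarrow> (real ^ 'd \<Rightarrow> real) \<Rightarrow> real ^ 'd \<Rightarrow> real" where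
  "partial_deriv i f = (\<lambda>x. frechet_derivative f (at x) (axis i 1))"

primrec partial_derivs :: "'d::finite list \<Rightarrow> (real ^ 'd \<Rightarrow> real) \<Rightarrow> real ^ 'd \<Rightarrow> real" where
  "partial_derivs [] f = f"
| "partial_derivs (i # js) f = partial_deriv i (partial_derivs js f)"

primrec C_diff :: "nat \<Rightarrow> (real ^ 'd::finite \<Rightarrow> real) \<Rightarrow> bool" where
  "C_diff 0 f \<longleftrightarrow> continuous_on UNIV f"
| "C_diff (Suc k) f \<longleftrightarrow> (\<forall>x. f differentiable at x) \<and> (\<forall>i. C_diff k (partial_deriv i f))"

definition smooth :: "(real ^ 'd::finite \<Rightarrow> real) \<Rightarrow> bool" where
  "smooth f \<longleftrightarrow> (\<forall>k. C_diff k f)"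

definition supp :: "(real ^ 'd::finite \<Rightarrow> real) \<Rightarrow> (real ^ 'd) set" where
  "supp f = closure {x. f x \<noteq> 0}"

text \<open>The $C^r$ norm is the maximum of the sup norms of all partial derivatives of order at most
  \<open>r\<close>; repeated or permuted indices in \<open>js\<close> enumerate the multi-indices.\<close>

definition C_norm :: "nat \<Rightarrow> (real ^ 'd::finite \<Rightarrow> real) \<Rightarrow> ennreal" where
  "C_norm r f = (SUP js \<in> {js. length js \<le> r}. SUP x. ennreal \<bar>partial_derivs js f x\<bar>)"

definition unit_tests :: "('d::finite \<Rightarrow> nat) \<Rightarrow> nat \<Rightarrow> (real ^ 'd \<Rightarrow> real) set" where
  "unit_tests s r =
    {\<phi>. C_diff r \<phi> \<and> compact (supp \<phi>) \<and> supp \<phi> \<subseteq> sball s 0 1 \<and> C_norm r \<phi> \<le> 1}"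

type_synonym 'd functional = "(real ^ 'd \<Rightarrow> real) \<Rightarrow> real"

definition schwartz_norm :: "nat \<Rightarrow> (real ^ 'd::finite \<Rightarrow> real) \<Rightarrow> ennreal" where
  "schwartz_norm N f =
    (SUP js \<in> {js. length js \<le> N}. SUP x. ennreal ((1 + norm x) ^ N * \<bar>partial_derivs js f x\<bar>))"

definition schwartz :: "(real ^ 'd::finite \<Rightarrow> real) set" where
  "schwartz = {f. smooth f \<and> (\<forall>N. schwartz_norm N f < \<infinity>)}"

text \<open>Setting a distribution to zero off the Schwartz space makes equality of distributions
  coincide with equality of functions.\<close>

definition tempered :: "'d::finite functional set" where
  "tempered = {\<xi>.
     (\<forall>\<phi>\<in>schwartz. \<forall>\<psi>\<in>schwartz. \<forall>a b. \<xi> (\<lambda>y. a * \<phi> y + b * \<psi> y) = a * \<xi> \<phi> + b * \<xi> \<psi>) \<and>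
     (\<exists>C N. \<forall>\<phi>\<in>schwartz. ennreal \<bar>\<xi> \<phi>\<bar> \<le> ennreal C * schwartz_norm N \<phi>) \<and>
     (\<forall>\<phi>. \<phi> \<notin> schwartz \<longrightarrow> \<xi> \<phi> = 0)}"

text \<open>A distribution only acts on smooth functions, whereas the test functions above are merely
  $C^r$. The pairing with a compactly supported $C^r$ function is the continuous extension from
  the smooth compactly supported functions, which are dense in the $C^r$ norm; hence there is at
  most one value \<open>L\<close> below.\<close>

definition has_pairing ::
    "nat \<Rightarrow> 'd::finite functional \<Rightarrow> (real ^ 'd \<Rightarrow> real) \<Rightarrow> real \<Rightarrow> bool" where
  "has_pairing r \<xi> \<phi> L \<longleftrightarrow>
    (\<forall>u K. compact K \<longrightarrow> (\<forall>n::nat. smooth (u n) \<and> supp (u n) \<subseteq> K) \<longrightarrow>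
       (\<lambda>n. C_norm r (\<lambda>y. u n y - \<phi> y)) \<longlonglongrightarrow> 0 \<longrightarrow> (\<lambda>n. \<xi> (u n)) \<longlonglongrightarrow> L)"

text \<open>The absolute value of the pairing. It is \<open>\<infinity>\<close> (infimum of the empty set) if \<open>\<xi>\<close> does not
  extend continuously to \<open>\<phi>\<close>, so a finite bound on it includes the existence of the extension.\<close>

definition abs_pairing :: "nat \<Rightarrow> 'd::finite functional \<Rightarrow> (real ^ 'd \<Rightarrow> real) \<Rightarrow> ennreal" where
  "abs_pairing r \<xi> \<phi> = Inf {ennreal \<bar>L\<bar> | L. has_pairing r \<xi> \<phi> L}"

text \<open>The map \<open>\<Xi>\<close> assigns a distribution to every base point. Both the Besov norm (constant
  \<open>\<Xi>\<close>) and the reconstruction bounds are instances.\<close>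

definition local_norm ::
    "('d::finite \<Rightarrow> nat) \<Rightarrow> nat \<Rightarrow> real \<Rightarrow> ennreal \<Rightarrow> ennreal \<Rightarrow> (real ^ 'd \<Rightarrow> 'd functional) \<Rightarrow> ennreal"
  where
  "local_norm s r \<kappa> p q \<Xi> =
     Lnorm scale_measure_01 q (\<lambda>l. Lnorm lebesgue p (\<lambda>x.
       SUP \<eta>\<in>unit_tests s r. abs_pairing r (\<Xi> x) (rescale s \<eta> l x) / ennreal (l powr \<kappa>)))"

definition besov_norm ::
    "('d::finite \<Rightarrow> nat) \<Rightarrow> nat \<Rightarrow> real \<Rightarrow> ennreal \<Rightarrow> ennreal \<Rightarrow> 'd functional \<Rightarrow> ennreal" where
  "besov_norm s r \<kappa> p q \<xi> = local_norm s r \<kappa> p q (\<lambda>x. \<xi>)"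

definition besov ::
    "('d::finite \<Rightarrow> nat) \<Rightarrow> nat \<Rightarrow> real \<Rightarrow> ennreal \<Rightarrow> ennreal \<Rightarrow> 'd functional set" where
  "besov s r \<kappa> p q = {\<xi>\<in>tempered. besov_norm s r \<kappa> p q \<xi> < \<infinity>}"

text \<open>The space $T$ is the whole type \<open>'t\<close>; \<open>layer S a\<close> is its subspace of homogeneity \<open>a\<close>,
  with norm \<open>lnorm S a\<close>.\<close>

record 't reg_structure =
  index :: "real set"
  layer :: "real \<Rightarrow> 't set"
  lnorm :: "real \<Rightarrow> 't \<Rightarrow> real"
  str_group :: "('t \<Rightarrow> 't) set"
  unit_vec :: 't

definition decomposes ::
    "('t::real_vector) reg_structure \<Rightarrow> 't \<Rightarrow> (real \<Rightarrow> 't) \<Rightarrow> bool" where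
  "decomposes S \<tau> c \<longleftrightarrow>
     (\<forall>a\<in>index S. c a \<in> layer S a) \<and> (\<forall>a. a \<notin> index S \<longrightarrow> c a = 0) \<and>
     finite {a. c a \<noteq> 0} \<and> \<tau> = (\<Sum>a | c a \<noteq> 0. c a)"

definition component :: "('t::real_vector) reg_structure \<Rightarrow> real \<Rightarrow> 't \<Rightarrow> 't" where
  "component S a \<tau> = (THE c. decomposes S \<tau> c) a"

definition comp_norm :: "('t::real_vector) reg_structure \<Rightarrow> real \<Rightarrow> 't \<Rightarrow> real" where
  "comp_norm S a \<tau> = lnorm S a (component S a \<tau>)"

definition index_below :: "'t reg_structure \<Rightarrow> real \<Rightarrow> real set" where
  "index_below S \<gamma> = {a\<in>index S. a < \<gamma>}"

definition T_below :: "('t::real_vector) reg_structure \<Rightarrow> real \<Rightarrow> 't set" where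
  "T_below S \<gamma> = span (\<Union>a\<in>index_below S \<gamma>. layer S a)"

definition banach_on :: "('t::real_vector) set \<Rightarrow> ('t \<Rightarrow> real) \<Rightarrow> bool" where
  "banach_on V nrm \<longleftrightarrow> subspace V \<and>
     (\<forall>v\<in>V. 0 \<le> nrm v \<and> (nrm v = 0 \<longleftrightarrow> v = 0)) \<and>
     (\<forall>v\<in>V. \<forall>c. nrm (c *\<^sub>R v) = \<bar>c\<bar> * nrm v) \<and>
     (\<forall>v\<in>V. \<forall>w\<in>V. nrm (v + w) \<le> nrm v + nrm w) \<and>
     (\<forall>\<sigma>::nat \<Rightarrow> 't. range \<sigma> \<subseteq> V \<longrightarrow>
        (\<forall>\<epsilon>>0. \<exists>N. \<forall>m\<ge>N. \<forall>n\<ge>N. nrm (\<sigma> m - \<sigma> n) < \<epsilon>) \<longrightarrow>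
        (\<exists>v\<in>V. (\<lambda>n. nrm (\<sigma> n - v)) \<longlonglongrightarrow> 0))"

definition regularity_structure :: "('t::real_vector) reg_structure \<Rightarrow> bool" where
  "regularity_structure S \<longleftrightarrow>
     0 \<in> index S \<and> bdd_below (index S) \<and> (\<forall>a b. finite (index S \<inter> {a..b})) \<and>
     (\<forall>a\<in>index S. banach_on (layer S a) (lnorm S a)) \<and>
     (\<forall>\<tau>. \<exists>!c. decomposes S \<tau> c) \<and>
     layer S 0 = span {unit_vec S} \<and> lnorm S 0 (unit_vec S) = 1 \<and>
     (\<forall>g\<in>str_group S. linear g) \<and> id \<in> str_group S \<and>
     (\<forall>g\<in>str_group S. \<forall>h\<in>str_group S. g \<circ> h \<in> str_group S) \<and>
     (\<forall>g\<in>str_group S. \<exists>h\<in>str_group S. g \<circ> h = id \<and> h \<circ> g = id) \<and>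
     (\<forall>g\<in>str_group S. \<forall>a\<in>index S. \<forall>\<tau>\<in>layer S a. g \<tau> - \<tau> \<in> T_below S a) \<and>
     (\<forall>g\<in>str_group S. g (unit_vec S) = unit_vec S)"

text \<open>Real powers with the convention $0^0 = 1$ (whereas \<open>0 powr 0 = 0\<close>), needed for the bound on
  $\Gamma_{x,x}$.\<close>

definition rpow :: "real \<Rightarrow> real \<Rightarrow> real" where
  "rpow t e = (if e = 0 then 1 else t powr e)"

definition Pi_bound ::
    "('d::finite \<Rightarrow> nat) \<Rightarrow> nat \<Rightarrow> ('t::real_vector) reg_structure \<Rightarrow> real \<Rightarrow>
     (real ^ 'd \<Rightarrow> 't \<Rightarrow> 'd functional) \<Rightarrow> real \<Rightarrow> bool" where
  "Pi_bound s r S \<gamma> P C \<longleftrightarrow>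
     (\<forall>x. \<forall>l. 0 < l \<and> l \<le> 1 \<longrightarrow> (\<forall>a\<in>index S. a \<le> \<gamma> \<longrightarrow> (\<forall>\<tau>\<in>layer S a. \<forall>\<phi>\<in>unit_tests s r.
        abs_pairing r (P x \<tau>) (rescale s \<phi> l x) \<le> ennreal (C * l powr a * lnorm S a \<tau>))))"

definition Gamma_bound ::
    "('d::finite \<Rightarrow> nat) \<Rightarrow> ('t::real_vector) reg_structure \<Rightarrow> real \<Rightarrow>
     (real ^ 'd \<Rightarrow> real ^ 'd \<Rightarrow> 't \<Rightarrow> 't) \<Rightarrow> real \<Rightarrow> bool" where
  "Gamma_bound s S \<gamma> \<Gamma> C \<longleftrightarrow>
     (\<forall>x y. \<forall>a\<in>index S. a \<le> \<gamma> \<longrightarrow> (\<forall>b\<in>index S. b \<le> a \<longrightarrow> (\<forall>\<tau>\<in>layer S a.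
        comp_norm S b (\<Gamma> x y \<tau>) \<le> C * rpow (snorm s (x - y)) (a - b) * lnorm S a \<tau>)))"

text \<open>Continuity of \<open>P x\<close> is with respect to the direct sum topology on $T$ and the weak-*
  topology on distributions: it is boundedness on each layer against each Schwartz function.\<close>

definition model ::
    "('d::finite \<Rightarrow> nat) \<Rightarrow> nat \<Rightarrow> ('t::real_vector) reg_structure \<Rightarrow>
     (real ^ 'd \<Rightarrow> 't \<Rightarrow> 'd functional) \<Rightarrow> (real ^ 'd \<Rightarrow> real ^ 'd \<Rightarrow> 't \<Rightarrow> 't) \<Rightarrow> bool" where
  "model s r S P \<Gamma> \<longleftrightarrow>
     (\<forall>x y. \<Gamma> x y \<in> str_group S) \<and>
     (\<forall>x y z. \<Gamma> x y \<circ> \<Gamma> y z = \<Gamma> x z) \<and> (\<forall>x. \<Gamma> x x = id) \<and>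
     (\<forall>x \<tau>. P x \<tau> \<in> tempered) \<and> (\<forall>x \<phi>. linear (\<lambda>\<tau>. P x \<tau> \<phi>)) \<and>
     (\<forall>x. \<forall>\<phi>\<in>schwartz. \<forall>a\<in>index S. \<exists>C. \<forall>\<tau>\<in>layer S a. \<bar>P x \<tau> \<phi>\<bar> \<le> C * lnorm S a \<tau>) \<and>
     (\<forall>x y. P y = P x \<circ> \<Gamma> x y) \<and>
     (\<forall>\<gamma>>0. \<exists>C>0. Pi_bound s r S \<gamma> P C \<and> Gamma_bound s S \<gamma> \<Gamma> C)"

definition Pi_norm ::
    "('d::finite \<Rightarrow> nat) \<Rightarrow> nat \<Rightarrow> ('t::real_vector) reg_structure \<Rightarrow> real \<Rightarrow>
     (real ^ 'd \<Rightarrow> 't \<Rightarrow> 'd functional) \<Rightarrow> real" where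
  "Pi_norm s r S \<gamma> P = Inf {C. 0 \<le> C \<and> Pi_bound s r S \<gamma> P C}"

definition Gamma_norm ::
    "('d::finite \<Rightarrow> nat) \<Rightarrow> ('t::real_vector) reg_structure \<Rightarrow> real \<Rightarrow>
     (real ^ 'd \<Rightarrow> real ^ 'd \<Rightarrow> 't \<Rightarrow> 't) \<Rightarrow> real" where
  "Gamma_norm s S \<gamma> \<Gamma> = Inf {C. 0 \<le> C \<and> Gamma_bound s S \<gamma> \<Gamma> C}"

text \<open>In the two suprema a vanishing denominator forces a vanishing numerator, and \<open>0 / 0 = 0\<close>.\<close>

definition Pi_dist ::
    "('d::finite \<Rightarrow> nat) \<Rightarrow> nat \<Rightarrow> ('t::real_vector) reg_structure \<Rightarrow> real \<Rightarrow>
     (real ^ 'd \<Rightarrow> 't \<Rightarrow> 'd functional) \<Rightarrow> (real ^ 'd \<Rightarrow> 't \<Rightarrow> 'd functional) \<Rightarrow> ennreal" where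
  "Pi_dist s r S \<gamma> P P' =
     (SUP x. SUP \<phi>\<in>unit_tests s r. SUP l\<in>{0<..1}. SUP a\<in>index_below S \<gamma>. SUP \<tau>\<in>layer S a.
        abs_pairing r (\<lambda>\<psi>. P x \<tau> \<psi> - P' x \<tau> \<psi>) (rescale s \<phi> l x)
          / ennreal (l powr a * lnorm S a \<tau>))"

definition Gamma_dist ::
    "('d::finite \<Rightarrow> nat) \<Rightarrow> ('t::real_vector) reg_structure \<Rightarrow> real \<Rightarrow>
     (real ^ 'd \<Rightarrow> real ^ 'd \<Rightarrow> 't \<Rightarrow> 't) \<Rightarrow> (real ^ 'd \<Rightarrow> real ^ 'd \<Rightarrow> 't \<Rightarrow> 't) \<Rightarrow> ennreal" where
  "Gamma_dist s S \<gamma> \<Gamma> \<Gamma>' =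
     (SUP x. SUP y. SUP a\<in>index_below S \<gamma>. SUP b\<in>{b\<in>index S. b \<le> a}. SUP \<tau>\<in>layer S a.
        ennreal (comp_norm S b (\<Gamma> x y \<tau> - \<Gamma>' x y \<tau>))
          / ennreal (rpow (snorm s (x - y)) (a - b) * lnorm S a \<tau>))"

text \<open>Measurability of Banach space valued functions is strong (Bochner) measurability, i.e.
  being a pointwise limit of simple functions. It agrees with Borel measurability if the layers are
  separable. The sum of the layer norms is a norm on \<open>T_below S \<gamma>\<close>.\<close>

definition T_measurable ::
    "('t::real_vector) reg_structure \<Rightarrow> real \<Rightarrow> (real ^ 'd::finite \<Rightarrow> 't) \<Rightarrow> bool" where
  "T_measurable S \<gamma> f \<longleftrightarrow>
     (\<exists>u. (\<forall>n::nat. simple_function lebesgue (u n) \<and> range (u n) \<subseteq> T_below S \<gamma>) \<and>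
        (\<forall>x. (\<lambda>n. \<Sum>a\<in>index_below S \<gamma>. comp_norm S a (u n x - f x)) \<longlonglongrightarrow> 0))"

definition modelled_norm ::
    "('d::finite \<Rightarrow> nat) \<Rightarrow> ('t::real_vector) reg_structure \<Rightarrow> real \<Rightarrow> ennreal \<Rightarrow> ennreal \<Rightarrow>
     (real ^ 'd \<Rightarrow> real ^ 'd \<Rightarrow> 't \<Rightarrow> 't) \<Rightarrow> (real ^ 'd \<Rightarrow> 't) \<Rightarrow> ennreal" where
  "modelled_norm s S \<gamma> p q \<Gamma> f =
     (\<Sum>a\<in>index_below S \<gamma>. Lnorm lebesgue p (\<lambda>x. ennreal (comp_norm S a (f x)))) +
     (\<Sum>a\<in>index_below S \<gamma>. Lnorm (increment_measure s) q (\<lambda>h. Lnorm lebesgue p (\<lambda>x.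
        ennreal (comp_norm S a (f (x + h) - \<Gamma> (x + h) x (f x)) / snorm s h powr (\<gamma> - a)))))"

definition modelled ::
    "('d::finite \<Rightarrow> nat) \<Rightarrow> ('t::real_vector) reg_structure \<Rightarrow> real \<Rightarrow> ennreal \<Rightarrow> ennreal \<Rightarrow>
     (real ^ 'd \<Rightarrow> real ^ 'd \<Rightarrow> 't \<Rightarrow> 't) \<Rightarrow> (real ^ 'd \<Rightarrow> 't) set" where
  "modelled s S \<gamma> p q \<Gamma> =
     {f. (\<forall>x. f x \<in> T_below S \<gamma>) \<and> T_measurable S \<gamma> f \<and> modelled_norm s S \<gamma> p q \<Gamma> f < \<infinity>}"

definition modelled_dist ::
    "('d::finite \<Rightarrow> nat) \<Rightarrow> ('t::real_vector) reg_structure \<Rightarrow> real \<Rightarrow> ennreal \<Rightarrow> ennreal \<Rightarrow>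
     (real ^ 'd \<Rightarrow> real ^ 'd \<Rightarrow> 't \<Rightarrow> 't) \<Rightarrow> (real ^ 'd \<Rightarrow> real ^ 'd \<Rightarrow> 't \<Rightarrow> 't) \<Rightarrow>
     (real ^ 'd \<Rightarrow> 't) \<Rightarrow> (real ^ 'd \<Rightarrow> 't) \<Rightarrow> ennreal" where
  "modelled_dist s S \<gamma> p q \<Gamma> \<Gamma>' f g =
     (MAX a\<in>index_below S \<gamma>.
        Lnorm lebesgue p (\<lambda>x. ennreal (comp_norm S a (f x - g x))) +
        Lnorm (increment_measure s) q (\<lambda>h. Lnorm lebesgue p (\<lambda>x.
          ennreal (comp_norm S a (f (x + h) - g (x + h) - \<Gamma> (x + h) x (f x) + \<Gamma>' (x + h) x (g x))
            / snorm s h powr (\<gamma> - a)))))"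

definition continuous_map_norm ::
    "('a \<Rightarrow> 't::real_vector) set \<Rightarrow> (('a \<Rightarrow> 't) \<Rightarrow> ennreal) \<Rightarrow>
     'd::finite functional set \<Rightarrow> ('d functional \<Rightarrow> ennreal) \<Rightarrow>
     (('a \<Rightarrow> 't) \<Rightarrow> 'd functional) \<Rightarrow> bool" where
  "continuous_map_norm D nD E nE R \<longleftrightarrow> (\<forall>f\<in>D. R f \<in> E) \<and>
     (\<forall>f\<in>D. \<forall>\<epsilon>>0. \<exists>\<delta>>0. \<forall>g\<in>D. nD (\<lambda>x. g x - f x) < \<delta> \<longrightarrow> nE (\<lambda>\<phi>. R g \<phi> - R f \<phi>) < \<epsilon>)"

definition linear_map_on ::
    "('a \<Rightarrow> 't::real_vector) set \<Rightarrow> (('a \<Rightarrow> 't) \<Rightarrow> 'd::finite functional) \<Rightarrow> bool" where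
  "linear_map_on D R \<longleftrightarrow> (\<forall>f\<in>D. \<forall>g\<in>D. \<forall>a b.
     R (\<lambda>x. a *\<^sub>R f x + b *\<^sub>R g x) = (\<lambda>\<phi>. a * R f \<phi> + b * R g \<phi>))"

definition reconstruction_bound ::
    "('d::finite \<Rightarrow> nat) \<Rightarrow> nat \<Rightarrow> ('t::real_vector) reg_structure \<Rightarrow> real \<Rightarrow> ennreal \<Rightarrow> ennreal \<Rightarrow>
     (real ^ 'd \<Rightarrow> 't \<Rightarrow> 'd functional) \<Rightarrow> (real ^ 'd \<Rightarrow> real ^ 'd \<Rightarrow> 't \<Rightarrow> 't) \<Rightarrow>
     real \<Rightarrow> ((real ^ 'd \<Rightarrow> 't) \<Rightarrow> 'd functional) \<Rightarrow> bool" where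
  "reconstruction_bound s r S \<gamma> p q P \<Gamma> C R \<longleftrightarrow>
     (\<forall>f\<in>modelled s S \<gamma> p q \<Gamma>.
        local_norm s r \<gamma> p q (\<lambda>x \<phi>. R f \<phi> - P x (f x) \<phi>)
          \<le> ennreal (C * Pi_norm s r S \<gamma> P * (1 + Gamma_norm s S \<gamma> \<Gamma>))
             * modelled_norm s S \<gamma> p q \<Gamma> f)"

end

theory Submission
  imports Defs
begin

text \<open>The model attaches to every point \<open>y\<close> a distribution \<open>P y (f y)\<close> that approximates the unknown
  \<open>R f\<close> near \<open>y\<close>. The operator is built from averages. Fix a smooth density \<open>\<phi>\<close> whose moments of
  positive order below a large number vanish, and let \<open>A\<^sub>n\<close> be the average at scale $2^{-n}$. Averages
  commute, so $A_n(A_{n+1} - A_{n-1})$ telescopes to the identity, and every tempered distribution \<open>F\<close>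
  satisfies

  $F(\psi) = \sum_n \int F(\phi^{(n)}_y)\, (A_{n+1} - A_{n-1})\psi(y)\, dy$,

  where $\phi^{(n)}_y$ is the density at scale $2^{-n}$ around \<open>y\<close> (\<open>synth_tempered\<close>). The reconstruction is
  the same sum with \<open>F\<close> replaced, inside the integral, by the local approximation \<open>P y (f y)\<close>. It is linear
  in \<open>f\<close> and asks for no compatibility of the data at different scales: for \<open>\<gamma> < 0\<close> the errors of all
  scales still add up to the right order.

  Because \<open>P x (f x)\<close> is recovered from its own averages, \<open>R f - P x (f x)\<close> is again such a sum, with the data
  \<open>P y (f y - \<Gamma> y x (f x))\<close>: precisely the increments in the modelled norm. By the moments of \<open>\<phi>\<close>, a test at
  scale \<open>l\<close> around \<open>x\<close> sees a level \<open>a\<close> of the data at \<open>x + h\<close> with a weight of order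
  $\max(l, \|h\|)^{a - |s|}$ on a ball of radius three (\<open>Wsum_rescale\<close>, \<open>Syn_rescale_bound\<close>). Minkowski's
  inequality in \<open>x\<close> and Schur's test between scales and increments give the estimate (\<open>mixed_estimate\<close>);
  increments between one and three are bounded by the size of \<open>f\<close> and the norm of \<open>\<Gamma>\<close>. The constant arises
  before any model is fixed.

  For two models, $P_y a - P'_y b = P_y(a - b) + (P_y - P'_y) b$ splits the data into increments of the
  pair \<open>(f, g)\<close> and increments of \<open>g\<close> weighted by the distance of the models (\<open>core_estimate\<close>). The
  first part of the theorem is the case of \<open>g = 0\<close> and equal models. The Besov bound and with it continuity
  follow from the same kernel estimate without subtracting \<open>P x (f x)\<close> (\<open>besov_bound\<close>).\<close>

abbreviation nn_integral_lborel :: "('a::euclidean_space \<Rightarrow> ennreal) \<Rightarrow> ennreal"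
    (binder "\<integral>\<^sup>+" 10) where
  "nn_integral_lborel f \<equiv> nn_integral lborel f"

abbreviation integral_lborel :: "('a::euclidean_space \<Rightarrow> real) \<Rightarrow> real"
    (binder "\<integral>" 10) where
  "integral_lborel f \<equiv> integral\<^sup>L lborel f"

abbreviation "borel2 \<equiv> borel \<Otimes>\<^sub>M borel"

section \<open>Iterated partial derivatives\<close>

lemma C_diff_imp_continuous: "C_diff k f ==> continuous_on UNIV f"
 by (cases k)
  (auto intro!: continuous_at_imp_continuous_on differentiable_imp_continuous_within)

lemma C_diff_SucD: "C_diff (Suc k) f ==> C_diff k f"
proof (induction k arbitrary: f)
 case 0
 thus ?case using C_diff_imp_continuous[of "Suc 0"] by simp
next
 case (Suc k)
 thus ?case unfolding C_diff.simps(2)[of "Suc k"] C_diff.simps(2)[of k] by blast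
qed

lemma C_diff_mono:
 assumes "C_diff k f" "j <= k" shows "C_diff j f"
 using assms(2,1) by (induction rule: inc_induct) (auto intro: C_diff_SucD)

lemma partial_deriv_eqI:
 "(f has_derivative D) (at x) ==> partial_deriv i f x = D (axis i 1)"
 unfolding partial_deriv_def using frechet_derivative_at[of f D x] by simp

lemma has_derivative_partial_deriv:
 fixes f :: "real ^ 'd::finite => real"
 assumes "f differentiable at x"
 shows "(f has_derivative (\<lambda>v. \<Sum>i\<in>UNIV. v $ i * partial_deriv i f x)) (at x)"
proof -
 let ?D = "frechet_derivative f (at x)"
 have D: "(f has_derivative ?D) (at x)" using assms by (simp add: frechet_derivative_works)
 hence lin: "linear ?D" by (rule has_derivative_linear)
 have "?D v = (\<Sum>i\<in>UNIV. v $ i * partial_deriv i f x)" for v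
 proof -
  have "?D v = ?D (\<Sum>i\<in>UNIV. (v $ i) *\<^sub>R axis i 1)"
   using basis_expansion[of v] by (simp add: scalar_mult_eq_scaleR)
  also have "... = (\<Sum>i\<in>UNIV. (v $ i) *\<^sub>R ?D (axis i 1))"
   by (simp add: linear_sum[OF lin] linear_scale[OF lin])
  finally show ?thesis by (simp add: partial_deriv_def)
 qed
 hence "?D = (\<lambda>v. \<Sum>i\<in>UNIV. v $ i * partial_deriv i f x)" by blast
 with D show ?thesis by simp
qed

lemma partial_derivs_append:
 "partial_derivs (js @ ks) f = partial_derivs js (partial_derivs ks f)"
 by (induction js) auto

lemma C_diff_partial_derivs:
 "C_diff (length js + k) f ==> C_diff k (partial_derivs js f)"
proof (induction js arbitrary: f rule: rev_induct)
 case Nil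
 thus ?case by simp
next
 case (snoc j js)
 have "C_diff (length js + k) (partial_deriv j f)"
  using snoc.prems by simp
 from snoc.IH[OF this] show ?case by (simp add: partial_derivs_append)
qed

lemma partial_derivs_differentiable:
 assumes "C_diff r f" "length js < r" shows "partial_derivs js f differentiable at x"
proof -
 have "C_diff (length js + 1) f" using assms by (intro C_diff_mono[OF assms(1)]) simp
 hence "C_diff 1 (partial_derivs js f)" by (rule C_diff_partial_derivs)
 thus ?thesis by simp
qed

lemma partial_derivs_continuous:
 assumes "C_diff r f" "length js <= r" shows "continuous_on UNIV (partial_derivs js f)"
 using C_diff_partial_derivs[of js 0 f] C_diff_mono[OF assms] by simp

lemma smooth_C_diff: "smooth f ==> C_diff k f"
 by (simp add: smooth_def)

lemma smooth_partial_derivs: "smooth f ==> smooth (partial_derivs js f)"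
 unfolding smooth_def using C_diff_partial_derivs by blast

lemma partial_derivs_lincomb_aux:
 assumes "C_diff k f" "C_diff k g"
 shows "C_diff k (\<lambda>x. a * f x + b * g x)"
  and "length js <= k ==> partial_derivs js (\<lambda>x. a * f x + b * g x) =
     (\<lambda>x. a * partial_derivs js f x + b * partial_derivs js g x)"
proof -
 have der: "partial_deriv i (\<lambda>x. a * f x + b * g x) =
    (\<lambda>x. a * partial_deriv i f x + b * partial_deriv i g x)"
  if "C_diff (Suc 0) f" "C_diff (Suc 0) g" for f g i
 proof
  fix x
  have "f differentiable at x" "g differentiable at x" using that by auto
  hence "((\<lambda>x. a * f x + b * g x) has_derivative
    (\<lambda>v. a * (\<Sum>i\<in>UNIV. v $ i * partial_deriv i f x) +
       b * (\<Sum>i\<in>UNIV. v $ i * partial_deriv i g x))) (at x)"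
   by (intro has_derivative_add has_derivative_mult_right has_derivative_partial_deriv)
  from partial_deriv_eqI[OF this, of i]
  show "partial_deriv i (\<lambda>x. a * f x + b * g x) x =
    a * partial_deriv i f x + b * partial_deriv i g x"
   by (simp add: axis_def if_distrib if_distribR cong: if_cong)
 qed
 show "C_diff k (\<lambda>x. a * f x + b * g x)"
  using assms
 proof (induction k arbitrary: f g)
  case 0
  thus ?case by (auto intro!: continuous_intros)
 next
  case (Suc k)
  have "C_diff (Suc 0) f" "C_diff (Suc 0) g"
   using Suc.prems C_diff_mono[of "Suc k" _ "Suc 0"] by blast+
  from der[OF this] Suc show ?case
   by (auto intro!: differentiable_add differentiable_mult)
 qed
 show "partial_derivs js (\<lambda>x. a * f x + b * g x) =
     (\<lambda>x. a * partial_derivs js f x + b * partial_derivs js g x)" if "length js <= k"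
  using that
 proof (induction js)
  case Nil
  thus ?case by simp
 next
  case (Cons i js)
  have "C_diff (Suc 0) (partial_derivs js f)" "C_diff (Suc 0) (partial_derivs js g)"
   using Cons.prems
   by (intro C_diff_partial_derivs C_diff_mono[OF assms(1)] C_diff_mono[OF assms(2)], simp)+
  from der[OF this] Cons show ?case by simp
 qed
qed

lemmas C_diff_lincomb = partial_derivs_lincomb_aux(1)
lemmas partial_derivs_lincomb = partial_derivs_lincomb_aux(2)

lemma smooth_lincomb: "smooth f ==> smooth g ==> smooth (\<lambda>x. a * f x + b * g x)"
 by (simp add: smooth_def C_diff_lincomb)

lemma C_diff_cmult: "C_diff k f ==> C_diff k (\<lambda>x. a * f x)"
 using C_diff_lincomb[of k f f a 0] by simp

lemma partial_derivs_cmult: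
 "C_diff k f ==> length js <= k ==>
  partial_derivs js (\<lambda>x. a * f x) = (\<lambda>x. a * partial_derivs js f x)"
 using partial_derivs_lincomb[of k f f js a 0] by simp

lemma C_diff_diff: "C_diff k f ==> C_diff k g ==> C_diff k (\<lambda>x. f x - g x)"
 using C_diff_lincomb[of k f g 1 "-1"] by simp

lemma partial_derivs_diff:
 "C_diff k f ==> C_diff k g ==> length js <= k ==>
  partial_derivs js (\<lambda>x. f x - g x) = (\<lambda>x. partial_derivs js f x - partial_derivs js g x)"
 using partial_derivs_lincomb[of k f g js 1 "-1"] by simp

lemma smooth_diff: "smooth f ==> smooth g ==> smooth (\<lambda>x. f x - g x)"
 by (simp add: smooth_def C_diff_diff)

lemma smooth_cmult: "smooth f ==> smooth (\<lambda>x. a * f x)"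
 by (simp add: smooth_def C_diff_cmult)

lemma C_diff_zero: "C_diff k (\<lambda>x :: real ^ 'd::finite. 0)"
proof (induction k)
 case (Suc k)
 have "partial_deriv i (\<lambda>x. 0::real) = (\<lambda>x. 0)" for i :: 'd
  by (rule ext) (rule partial_deriv_eqI[of _ "\<lambda>v. 0"], simp)
 thus ?case using Suc by simp
qed simp

lemma smooth_zero: "smooth (\<lambda>x. 0)"
 by (simp add: smooth_def C_diff_zero)

lemma partial_derivs_zero: "partial_derivs js (\<lambda>x. 0) = (\<lambda>x. 0)"
 using partial_derivs_cmult[OF C_diff_zero[of "length js"], of js 0] by simp

lemma partial_derivs_sum:
 assumes "finite V" "!!v. v \<in> V ==> C_diff k (f v)"
 shows "C_diff k (\<lambda>x. \<Sum>v\<in>V. c v * f v x)"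
  and "length js <= k ==> partial_derivs js (\<lambda>x. \<Sum>v\<in>V. c v * f v x) =
     (\<lambda>x. \<Sum>v\<in>V. c v * partial_derivs js (f v) x)"
proof -
 have "C_diff k (\<lambda>x. \<Sum>v\<in>V. c v * f v x) \<and>
   (length js <= k --> partial_derivs js (\<lambda>x. \<Sum>v\<in>V. c v * f v x) =
     (\<lambda>x. \<Sum>v\<in>V. c v * partial_derivs js (f v) x))"
  using assms
 proof (induction V rule: finite_induct)
  case empty
  thus ?case by (simp add: C_diff_zero partial_derivs_zero)
 next
  case (insert v V)
  have *: "(\<lambda>x. \<Sum>v\<in>insert v V. c v * f v x) = (\<lambda>x. c v * f v x + 1 * (\<Sum>v\<in>V. c v * f v x))"
   using insert by simp
  have "C_diff k (f v)" "C_diff k (\<lambda>x. \<Sum>v\<in>V. c v * f v x)"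
   using insert by auto
  from C_diff_lincomb[OF this, of "c v" 1] partial_derivs_lincomb[OF this, of js "c v" 1]
  show ?case unfolding * using insert by auto
 qed
 thus "C_diff k (\<lambda>x. \<Sum>v\<in>V. c v * f v x)"
  and "length js <= k ==> partial_derivs js (\<lambda>x. \<Sum>v\<in>V. c v * f v x) =
     (\<lambda>x. \<Sum>v\<in>V. c v * partial_derivs js (f v) x)" by auto
qed

lemma partial_derivs_affine_aux:
 fixes c :: "'d::finite => real" and x0 :: "real ^ 'd"
 assumes "C_diff k f"
 shows "C_diff k (\<lambda>x. f (\<chi> i. c i * (x $ i - x0 $ i)))"
  and "length js <= k ==> partial_derivs js (\<lambda>x. f (\<chi> i. c i * (x $ i - x0 $ i))) =
     (\<lambda>x. prod_list (map c js) * partial_derivs js f (\<chi> i. c i * (x $ i - x0 $ i)))"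
proof -
 define A where "A x = (\<chi> i. c i * (x $ i - x0 $ i))" for x :: "real ^ 'd"
 have A: "(A has_derivative (\<lambda>v. \<chi> i. c i * v $ i)) (at x)" for x
 proof -
  have "linear (\<lambda>v :: real ^ 'd. \<chi> i. c i * v $ i)"
   by (rule linearI) (simp_all add: vec_eq_iff algebra_simps)
  hence L: "((\<lambda>v. \<chi> i. c i * v $ i) has_derivative (\<lambda>v. \<chi> i. c i * v $ i)) (at x)"
   by (intro bounded_linear_imp_has_derivative) (simp add: linear_conv_bounded_linear)
  have "A = (\<lambda>x. (\<chi> i. c i * x $ i) - (\<chi> i. c i * x0 $ i))"
   by (auto simp: A_def vec_eq_iff algebra_simps)
  with has_derivative_diff[OF L has_derivative_const] show ?thesis by simp
 qed
 have der: "(f \<circ> A) differentiable at x"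
  "partial_deriv i (f \<circ> A) x = c i * partial_deriv i f (A x)"
  if "C_diff (Suc 0) f" for f i x
 proof -
  have "f differentiable at (A x)" using that by auto
  hence d: "((f \<circ> A) has_derivative ((\<lambda>v. \<Sum>i\<in>UNIV. v $ i * partial_deriv i f (A x)) \<circ>
     (\<lambda>v. \<chi> i. c i * v $ i))) (at x)"
   by (intro diff_chain_at A has_derivative_partial_deriv)
  thus "(f \<circ> A) differentiable at x" unfolding differentiable_def by blast
  from partial_deriv_eqI[OF d, of i]
  show "partial_deriv i (f \<circ> A) x = c i * partial_deriv i f (A x)"
   by (simp add: axis_def if_distrib if_distribR cong: if_cong)
 qed
 have C: "C_diff k (f \<circ> A)" if "C_diff k f" for f k
  using that
 proof (induction k arbitrary: f)
  case 0
  have "continuous_on UNIV A"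
   by (rule continuous_at_imp_continuous_on) (use has_derivative_continuous[OF A] in blast)
  with 0 show ?case using continuous_on_compose[of UNIV A f] continuous_on_subset[of UNIV f] by simp
 next
  case (Suc k)
  have 1: "C_diff (Suc 0) f" using Suc.prems by (rule C_diff_mono) simp
  have "partial_deriv i (f \<circ> A) = (\<lambda>x. c i * (partial_deriv i f \<circ> A) x)" for i
   using der(2)[OF 1] by auto
  moreover have "C_diff k (\<lambda>x. c i * (partial_deriv i f \<circ> A) x)" for i
   using Suc by (intro C_diff_cmult) simp
  ultimately show ?case using der(1)[OF 1] by (simp del: o_apply)
 qed
 thus "C_diff k (\<lambda>x. f (\<chi> i. c i * (x $ i - x0 $ i)))"
  using assms by (auto simp: A_def o_def)
 have "length js <= k ==> partial_derivs js (f \<circ> A) = (\<lambda>x. prod_list (map c js) * (partial_derivs js f \<circ> A) x)"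
 proof (induction js)
  case Nil
  thus ?case by auto
 next
  case (Cons i js)
  have 1: "C_diff (Suc 0) (partial_derivs js f)"
   using Cons.prems by (intro C_diff_partial_derivs C_diff_mono[OF assms]) simp
  have "partial_deriv i (\<lambda>x. prod_list (map c js) * (partial_derivs js f \<circ> A) x) =
    (\<lambda>x. prod_list (map c js) * partial_deriv i (partial_derivs js f \<circ> A) x)"
   using partial_derivs_cmult[of 1 "partial_derivs js f \<circ> A" "[i]"] C[of "Suc 0", OF 1] by simp
  thus ?case using Cons der(2)[OF 1] by (simp add: mult_ac del: o_apply) (simp add: o_def)
 qed
 thus "length js <= k ==> partial_derivs js (\<lambda>x. f (\<chi> i. c i * (x $ i - x0 $ i))) =
     (\<lambda>x. prod_list (map c js) * partial_derivs js f (\<chi> i. c i * (x $ i - x0 $ i)))"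
  by (simp add: A_def o_def)
qed

text \<open>The complement of \<open>K\<close> is open, so \<open>f\<close> vanishes in a neighbourhood of each of its points.\<close>

lemma partial_derivs_eq_0_outside:
 fixes f :: "real ^ 'd::finite => real"
 assumes "closed K" "!!x. x \<notin> K ==> f x = 0" "x \<notin> K"
 shows "partial_derivs js f x = 0"
 using assms(3)
proof (induction js arbitrary: x)
 case Nil
 thus ?case using assms by simp
next
 case (Cons i js)
 have "((partial_derivs js f) has_derivative (\<lambda>v. 0)) (at x)"
 proof (rule has_derivative_transform_within_open)
  show "((\<lambda>_. 0) has_derivative (\<lambda>v. 0)) (at x)" by simp
  show "open (- K)" "x \<in> - K" using assms(1) Cons.prems by auto
  show "0 = partial_derivs js f y" if "y \<in> - K" for y using Cons.IH[of y] that by simp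
 qed
 thus ?case by (simp add: partial_deriv_eqI)
qed

lemma not_in_suppD: "x \<notin> supp f ==> f x = 0"
 unfolding supp_def using closure_subset[of "{x. f x ~= 0}"] by blast

lemma closed_supp: "closed (supp f)"
 by (simp add: supp_def)

lemma supp_subset_iff:
 assumes "closed K"
 shows "supp f \<subseteq> K \<longleftrightarrow> (\<forall>x. x \<notin> K --> f x = 0)"
proof
 assume "supp f \<subseteq> K"
 thus "\<forall>x. x \<notin> K --> f x = 0" using not_in_suppD[of _ f] by blast
next
 assume "\<forall>x. x \<notin> K --> f x = 0"
 hence "{x. f x ~= 0} \<subseteq> K" by blast
 thus "supp f \<subseteq> K" unfolding supp_def using assms by (rule closure_minimal)
qed

lemma compact_supp:
 assumes "compact K" "supp f \<subseteq> K" shows "compact (supp f)"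
proof -
 have "supp f = K \<inter> supp f" using assms by blast
 thus ?thesis using compact_Int_closed[OF assms(1) closed_supp, of f] by argo
qed

section \<open>Anisotropic geometry\<close>

definition dil :: "('d::finite => nat) => real => real ^ 'd => real ^ 'd" where
 "dil s l x = (\<chi> i. l ^ s i * x $ i)"

lemma dil_nth [simp]: "dil s l x $ i = l ^ s i * x $ i"
 by (simp add: dil_def)

lemma continuous_on_dil [continuous_intros]:
 "continuous_on A f ==> continuous_on A (\<lambda>x. dil s l (f x))"
 unfolding dil_def by (intro continuous_intros)

lemma rescale_dil: "rescale s \<eta> l x y = \<eta> (dil s (1 / l) (y - x)) / l ^ scale_deg s"
proof -
 have "(\<chi> i. (y $ i - x $ i) / l ^ s i) = dil s (1 / l) (y - x)"
  by (simp add: vec_eq_iff power_divide)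
 thus ?thesis by (simp add: rescale_def)
qed

lemma dil_one [simp]: "dil s 1 x = x"
 by (simp add: vec_eq_iff)

lemma dil_dil [simp]: "dil s a (dil s b x) = dil s (a * b) x"
 by (simp add: vec_eq_iff power_mult_distrib)

lemma lborel_integral_affine:
 fixes c :: "'d::finite => real" and t :: "real ^ 'd" and f :: "real ^ 'd => real"
 assumes c: "!!i. c i ~= 0" and f: "f \<in> borel_measurable borel"
 shows "(\<integral>y. f y) = (\<Prod>i\<in>UNIV. \<bar>c i\<bar>) * (\<integral>k. f (t + (\<chi> i. c i * k $ i)))"
proof -
 define C where "C b = (\<Sum>i\<in>UNIV. c i * b $ i)" for b :: "real ^ 'd"
 have C: "C (axis i 1) = c i" for i
  by (simp add: C_def axis_def if_distrib cong: if_cong)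
 define T where "T x = t + (\<Sum>j\<in>Basis. (C j * (x \<bullet> j)) *\<^sub>R j)" for x :: "real ^ 'd"
 have B: "(Basis :: (real ^ 'd) set) = range (\<lambda>i. axis i 1)"
  by (auto simp: Basis_vec_def)
 have inj: "inj (\<lambda>i::'d. axis i (1::real))"
  by (auto simp: inj_on_def axis_eq_axis)
 have T: "T = (\<lambda>x. t + (\<chi> i. c i * x $ i))"
 proof
  fix x
  have "(\<Sum>j\<in>Basis. (C j * (x \<bullet> j)) *\<^sub>R j) = (\<Sum>i\<in>UNIV. (c i * x $ i) *\<^sub>R axis i 1)"
   unfolding B by (simp add: sum.reindex[OF inj] C inner_axis)
  also have "... = (\<chi> i. c i * x $ i)"
   using basis_expansion[of "\<chi> i. c i * x $ i"] by (simp add: scalar_mult_eq_scaleR)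
  finally show "T x = t + (\<chi> i. c i * x $ i)" by (simp add: T_def)
 qed
 have P: "(\<Prod>j\<in>Basis. \<bar>C j\<bar>) = (\<Prod>i\<in>UNIV. \<bar>c i\<bar>)"
  unfolding B by (simp add: prod.reindex[OF inj] C)
 have Cn: "C j ~= 0" if "j \<in> Basis" for j using that c C unfolding B by auto
 have L: "lborel = density (distr lborel borel T) (\<lambda>_. ennreal (\<Prod>j\<in>Basis. \<bar>C j\<bar>))"
  unfolding T_def by (rule lborel_affine_euclidean[OF Cn])
 have cT: "continuous_on UNIV T"
  unfolding T by (intro continuous_intros)
 hence Tm: "T \<in> lborel \<rightarrow>\<^sub>M borel"
  using borel_measurable_continuous_onI[OF cT] by simp
 have f': "f \<in> borel_measurable (distr lborel borel T)" using f by simp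
 have "(\<integral>y. f y) = (\<integral>y. f y \<partial>density (distr lborel borel T) (\<lambda>_. ennreal (\<Prod>j\<in>Basis. \<bar>C j\<bar>)))"
  by (subst L) simp
 also have "... = (\<integral>y. (\<Prod>j\<in>Basis. \<bar>C j\<bar>) *\<^sub>R f y \<partial>distr lborel borel T)"
  by (rule integral_density[OF f']) (auto intro!: prod_nonneg)
 also have "... = (\<integral>k. (\<Prod>j\<in>Basis. \<bar>C j\<bar>) *\<^sub>R f (T k))"
  by (rule integral_distr[OF Tm]) (use f in simp)
 finally show ?thesis by (simp add: P T)
qed

locale scaling =
 fixes s :: "'d::finite => nat"
 assumes s_pos: "!!i. 1 <= s i"
begin

lemma s_gt0 [simp]: "0 < s i" using s_pos[of i] by simp

lemma s_ne0 [simp]: "s i ~= 0" using s_gt0[of i] by simp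

lemma snorm_Max: "snorm s x = Max (range (\<lambda>i. \<bar>x $ i\<bar> powr (1 / real (s i))))"
 unfolding snorm_def by (rule cSup_eq_Max) auto

lemma root_le_iff:
 assumes "0 <= R" shows "\<bar>t\<bar> powr (1 / real (s i)) <= R \<longleftrightarrow> \<bar>t\<bar> <= R ^ s i"
proof (cases "R = 0")
 case True
 thus ?thesis by (auto simp: powr_def power_0_left)
next
 case False
 hence R: "R > 0" using assms by simp
 have e: "R = (R ^ s i) powr (1 / real (s i))"
  using R by (simp add: powr_powr flip: powr_realpow)
 have "\<bar>t\<bar> powr (1 / real (s i)) <= (R ^ s i) powr (1 / real (s i)) \<longleftrightarrow> \<bar>t\<bar> <= R ^ s i"
  using R powr_mono2[of "1 / real (s i)" "\<bar>t\<bar>" "R ^ s i"]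
   powr_less_mono2[of "1 / real (s i)" "R ^ s i" "\<bar>t\<bar>"] by (auto simp: not_le[symmetric])
 with e show ?thesis by simp
qed

text \<open>Balls are boxes. This turns the triangle inequality into
 $a^k + b^k \le (a + b)^k$ for each coordinate and makes volumes explicit.\<close>

lemma snorm_le_iff: "0 <= R ==> snorm s x <= R \<longleftrightarrow> (\<forall>i. \<bar>x $ i\<bar> <= R ^ s i)"
 unfolding snorm_Max by (subst Max_le_iff) (auto simp: root_le_iff)

lemma snorm_nonneg [simp]: "0 <= snorm s x"
proof -
 obtain i :: 'd where True by blast
 have "\<bar>x $ i\<bar> powr (1 / real (s i)) <= snorm s x"
  unfolding snorm_Max by (rule Max_ge) auto
 thus ?thesis by (meson powr_ge_zero order_trans)
qed

lemma abs_nth_le_snorm: "\<bar>x $ i\<bar> <= snorm s x ^ s i"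
 using snorm_le_iff[of "snorm s x" x] by simp

lemma snorm_eq_0_iff: "snorm s x = 0 \<longleftrightarrow> x = 0"
proof
 assume "snorm s x = 0"
 thus "x = 0" using abs_nth_le_snorm[of x] by (auto simp: vec_eq_iff power_0_left)
next
 assume "x = 0"
 hence "snorm s x <= 0" by (subst snorm_le_iff) auto
 thus "snorm s x = 0" using snorm_nonneg[of x] by linarith
qed

lemma snorm_zero [simp]: "snorm s 0 = 0"
 by (simp add: snorm_eq_0_iff)

lemma snorm_minus [simp]: "snorm s (- x) = snorm s x"
 by (simp add: snorm_def)

lemma snorm_diff_commute: "snorm s (x - y) = snorm s (y - x)"
 using snorm_minus[of "x - y"] by simp

lemma snorm_triangle: "snorm s (x + y) <= snorm s x + snorm s y"
proof (subst snorm_le_iff, simp, rule allI)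
 fix i
 have "\<bar>(x + y) $ i\<bar> <= snorm s x ^ s i + snorm s y ^ s i"
  using abs_nth_le_snorm[of x i] abs_nth_le_snorm[of y i] by simp
 also have "... <= (snorm s x + snorm s y) ^ s i"
 proof -
  have *: "a ^ Suc n + b ^ Suc n <= (a + b) ^ Suc n" if "0 <= a" "0 <= b" for a b :: real and n
  proof -
   have "a ^ n <= (a + b) ^ n" "b ^ n <= (a + b) ^ n" using that by (auto intro: power_mono)
   hence "a * a ^ n + b * b ^ n <= a * (a + b) ^ n + b * (a + b) ^ n"
    using that by (intro add_mono mult_left_mono)
   thus ?thesis by (simp add: algebra_simps)
  qed
  obtain n where "s i = Suc n" using s_gt0[of i] by (cases "s i") auto
  thus ?thesis using * by simp
 qed
 finally show "\<bar>(x + y) $ i\<bar> <= (snorm s x + snorm s y) ^ s i" .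
qed

lemma snorm_dil: "0 <= l ==> snorm s (dil s l x) = l * snorm s x"
proof (cases "l = 0")
 case True
 hence "dil s l x = 0" by (simp add: vec_eq_iff power_0_left)
 thus ?thesis using True by simp
next
 case False
 assume "0 <= l" with False have l: "l > 0" by simp
 have le: "snorm s (dil s a y) <= a * snorm s y" if "a > 0" for a y
  using that abs_nth_le_snorm[of y]
  by (subst snorm_le_iff) (auto simp: power_mult_distrib abs_mult intro!: mult_left_mono)
 have "snorm s x = snorm s (dil s (1 / l) (dil s l x))" using l by simp
 also have "... <= (1 / l) * snorm s (dil s l x)" using l by (intro le) simp
 finally have "l * snorm s x <= snorm s (dil s l x)" using l by (simp add: field_simps)
 with le[OF l, of x] show ?thesis by simp
qed

lemma snorm_tendsto_0:
 assumes "(g \<longlongrightarrow> (0 :: real ^ 'd)) F" shows "((\<lambda>x. snorm s (g x)) \<longlongrightarrow> 0) F"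
proof (rule tendstoI)
 fix e :: real assume e: "e > 0"
 have "\<forall>\<^sub>F x in F. \<forall>i\<in>UNIV. \<bar>g x $ i\<bar> < (e / 2) ^ s i"
 proof (rule eventually_ball_finite)
  show "\<forall>i\<in>UNIV. \<forall>\<^sub>F x in F. \<bar>g x $ i\<bar> < (e / 2) ^ s i"
  proof
   fix i
   have "((\<lambda>x. \<bar>g x $ i\<bar>) \<longlongrightarrow> 0) F" using tendsto_rabs[OF tendsto_vec_nth[OF assms, of i]] by simp
   thus "\<forall>\<^sub>F x in F. \<bar>g x $ i\<bar> < (e / 2) ^ s i" using e by (intro order_tendstoD) auto
  qed
 qed simp
 thus "\<forall>\<^sub>F x in F. dist (snorm s (g x)) 0 < e"
 proof eventually_elim
  case (elim x)
  hence "snorm s (g x) <= e / 2" using e by (subst snorm_le_iff) (auto intro: less_imp_le)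
  thus ?case using e by simp
 qed
qed

lemma continuous_on_snorm [continuous_intros]:
 assumes "continuous_on A f" shows "continuous_on A (\<lambda>x. snorm s (f x))"
proof -
 have "continuous_on UNIV (snorm s)"
 proof (rule continuous_at_imp_continuous_on, rule ballI)
  fix x
  have "((\<lambda>y. snorm s (y - x)) \<longlongrightarrow> 0) (at x)"
   by (rule snorm_tendsto_0) (auto intro!: tendsto_eq_intros)
  moreover have "\<bar>snorm s y - snorm s x\<bar> <= snorm s (y - x)" for y
   using snorm_triangle[of "y - x" x] snorm_triangle[of "x - y" y]
   by (simp add: snorm_diff_commute[of x y] abs_le_iff)
  ultimately have "((\<lambda>y. snorm s y - snorm s x) \<longlongrightarrow> 0) (at x)"
   by (intro Lim_null_comparison[of "\<lambda>y. snorm s y - snorm s x" "\<lambda>y. snorm s (y - x)"])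
     (auto intro!: always_eventually)
  thus "isCont (snorm s) x" unfolding isCont_def using LIM_zero_cancel by blast
 qed
 thus ?thesis using assms by (rule continuous_on_compose2) auto
qed

lemma snorm_measurable [measurable]: "snorm s \<in> borel_measurable borel"
 by (intro borel_measurable_continuous_onI continuous_intros)

lemma scale_deg_pos: "0 < scale_deg s"
 unfolding scale_deg_def by (rule sum_pos) auto

lemma prod_power_s: "(\<Prod>i\<in>UNIV. l ^ s i) = l ^ scale_deg s" for l :: real
 by (simp add: scale_deg_def power_sum)

lemma emeasure_snorm_ball_le:
 assumes "0 <= R"
 shows "emeasure lborel {h. snorm s h <= R} <= ennreal (2 ^ CARD('d) * R ^ scale_deg s)"
proof -
 let ?b = "\<chi> i. R ^ s i"
 have ne: "cbox (- ?b) ?b ~= {}" using assms by (auto simp: interval_ne_empty_cart)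
 have "{h. snorm s h <= R} \<subseteq> cbox (- ?b) ?b"
  using assms by (auto simp: snorm_le_iff mem_box_cart abs_le_iff) (meson minus_le_iff)
 hence "emeasure lborel {h. snorm s h <= R} <= emeasure lborel (cbox (- ?b) ?b)"
  by (intro emeasure_mono) auto
 also have "... = ennreal (measure lborel (cbox (- ?b) ?b))"
  using emeasure_lborel_cbox_finite[of "- ?b" ?b] by (intro emeasure_eq_ennreal_measure) auto
 also have "measure lborel (cbox (- ?b) ?b) = (\<Prod>i\<in>UNIV. 2 * R ^ s i)"
  by (subst content_cbox_cart[OF ne]) simp
 also have "... = 2 ^ CARD('d) * R ^ scale_deg s"
  by (simp add: prod.distrib prod_power_s)
 finally show ?thesis .
qed

text \<open>Euclidean balls and anisotropic balls are comparable at unit scale.\<close>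

lemma norm_le_snorm:
 assumes "snorm s x <= R" "1 <= R" shows "norm x <= real CARD('d) * R ^ scale_deg s"
proof -
 have "\<bar>x $ i\<bar> <= R ^ scale_deg s" for i
 proof -
  have "\<bar>x $ i\<bar> <= R ^ s i" using assms snorm_le_iff[of R x] by auto
  also have "... <= R ^ scale_deg s" unfolding scale_deg_def
   using assms by (intro power_increasing member_le_sum) auto
  finally show ?thesis .
 qed
 hence "(\<Sum>i\<in>UNIV. \<bar>x $ i\<bar>) <= (\<Sum>i\<in>(UNIV :: 'd set). R ^ scale_deg s)" by (intro sum_mono)
 with norm_le_l1_cart[of x] show ?thesis by simp
qed

end

section \<open>Smoothing operators\<close>

text \<open>Averages of translates. For the dilation \<open>A k = dil s \<mu> k\<close> this is the convolution with the rescaled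
 density when \<open>\<mu> > 0\<close> and a multiple of the identity when \<open>\<mu> = 0\<close>, so both are treated at once.\<close>

definition cv ::
  "(real ^ 'd::finite => real) => (real ^ 'd => real ^ 'd) => (real ^ 'd => real) => real ^ 'd => real" where
 "cv w A \<psi> z = (\<integral>k. w k * \<psi> (z - A k))"

definition ccs :: "(real ^ 'd::finite => real) => bool" where
 "ccs w \<longleftrightarrow> continuous_on UNIV w \<and> (\<exists>a b. \<forall>k. k \<notin> cbox a b --> w k = 0)"

lemma ccs_continuous: "ccs w ==> continuous_on UNIV w"
 by (simp add: ccs_def)

lemma ccs_measurable: "ccs w ==> w \<in> borel_measurable borel"
 by (simp add: ccs_def borel_measurable_continuous_onI)

lemma ccs_integrable_mult:
 assumes "ccs w" "continuous_on UNIV g"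
 shows "integrable lborel (\<lambda>k. w k * g k)"
proof -
 obtain a b where ab: "\<forall>k. k \<notin> cbox a b --> w k = 0" using assms by (auto simp: ccs_def)
 have "integrable lborel (\<lambda>k. indicator (cbox a b) k *\<^sub>R (w k * g k))"
  using assms by (intro borel_integrable_compact)
   (auto simp: ccs_def intro!: continuous_intros intro: continuous_on_subset)
 moreover have "(\<lambda>k. indicator (cbox a b) k *\<^sub>R (w k * g k)) = (\<lambda>k. w k * g k)"
 proof
  fix k show "indicator (cbox a b) k *\<^sub>R (w k * g k) = w k * g k"
   using ab by (cases "k \<in> cbox a b") auto
 qed
 ultimately show ?thesis by simp
qed

lemma ccs_integrable: "ccs w ==> integrable lborel w"
 using ccs_integrable_mult[of w "\<lambda>_. 1"] by simp

lemma ccs_compact: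
 assumes "continuous_on UNIV w" "compact K" "!!k. k \<notin> K ==> w k = 0"
 shows "ccs w"
proof -
 obtain a where "K \<subseteq> cbox (- a) a" using bounded_subset_cbox_symmetric[OF compact_imp_bounded[OF assms(2)]] by blast
 thus ?thesis unfolding ccs_def using assms by blast
qed

lemma ccs_bounded:
 assumes "ccs w" obtains M where "0 <= M" "!!k. \<bar>w k\<bar> <= M"
proof -
 obtain a b where ab: "\<forall>k. k \<notin> cbox a b --> w k = 0" using assms by (auto simp: ccs_def)
 have "compact (w ` cbox a b)"
  using assms by (intro compact_continuous_image) (auto simp: ccs_def intro: continuous_on_subset)
 then obtain M where M: "\<forall>y\<in>w ` cbox a b. norm y <= M" using compact_imp_bounded bounded_iff by metis
 have "\<bar>w k\<bar> <= max M 0" for k using M ab by (cases "k \<in> cbox a b") auto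
 thus ?thesis by (intro that[of "max M 0"]) auto
qed

context
 fixes w :: "real ^ 'd::finite => real" and A :: "real ^ 'd => real ^ 'd"
 assumes w: "ccs w" and A: "continuous_on UNIV A"
begin

lemma cv_integrable:
 assumes "continuous_on UNIV \<psi>" shows "integrable lborel (\<lambda>k. w k * \<psi> (z - A k))"
 by (rule ccs_integrable_mult[OF w], rule continuous_on_compose2[OF assms])
   (auto intro!: continuous_intros A)

lemma cv_bound:
 assumes "continuous_on UNIV \<psi>" "!!k. w k ~= 0 ==> \<bar>\<psi> (z - A k)\<bar> <= M"
 shows "\<bar>cv w A \<psi> z\<bar> <= (\<integral>k. \<bar>w k\<bar>) * M"
proof -
 have "\<bar>cv w A \<psi> z\<bar> <= (\<integral>k. \<bar>w k * \<psi> (z - A k)\<bar>)"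
  unfolding cv_def by (rule integral_abs_bound)
 also have "... <= (\<integral>k. \<bar>w k\<bar> * M)"
 proof (rule integral_mono)
  show "integrable lborel (\<lambda>k. \<bar>w k * \<psi> (z - A k)\<bar>)"
   using cv_integrable[OF assms(1)] by simp
  show "integrable lborel (\<lambda>k. \<bar>w k\<bar> * M)" using ccs_integrable[OF w] by simp
  show "\<bar>w k * \<psi> (z - A k)\<bar> <= \<bar>w k\<bar> * M" for k
   using assms(2)[of k] by (cases "w k = 0") (auto simp: abs_mult intro: mult_left_mono)
 qed
 also have "... = (\<integral>k. \<bar>w k\<bar>) * M"
  by simp
 finally show ?thesis .
qed

lemma cv_eq_0:
 assumes "!!k. w k ~= 0 ==> \<psi> (z - A k) = 0" shows "cv w A \<psi> z = 0"
proof -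
 have "(\<lambda>k. w k * \<psi> (z - A k)) = (\<lambda>k. 0)" using assms by fastforce
 thus ?thesis by (simp add: cv_def)
qed

lemma cv_lincomb:
 assumes "continuous_on UNIV \<psi>" "continuous_on UNIV g"
 shows "cv w A (\<lambda>y. a * \<psi> y + b * g y) z = a * cv w A \<psi> z + b * cv w A g z"
 unfolding cv_def using cv_integrable[OF assms(1)] cv_integrable[OF assms(2)]
 by (simp add: algebra_simps)

lemma cv_has_derivative:
 assumes "C_diff (Suc 0) \<psi>"
 shows "cv w A \<psi> differentiable at z"
  and "partial_deriv i (cv w A \<psi>) z = cv w A (partial_deriv i \<psi>) z"
proof -
 obtain a b where ab: "\<forall>k. k \<notin> cbox a b --> w k = 0" using w by (auto simp: ccs_def)
 have eq: "cv w A g z = integral (cbox a b) (\<lambda>k. w k * g (z - A k))"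
  if "continuous_on UNIV g" for g z
 proof -
  have "(\<lambda>k. if k \<in> cbox a b then w k * g (z - A k) else 0) = (\<lambda>k. w k * g (z - A k))"
   using ab by auto
  thus ?thesis unfolding cv_def
   using integral_lborel[OF cv_integrable[OF that, of z]]
    integral_restrict_UNIV[of "cbox a b" "\<lambda>k. w k * g (z - A k)"] by simp
 qed
 have cont: "continuous_on UNIV \<psi>" "!!i. continuous_on UNIV (partial_deriv i \<psi>)"
  using assms C_diff_imp_continuous[OF assms] by auto
 have comp: "continuous_on S (\<lambda>(x, k). w k * g (x - A k))" if "continuous_on UNIV g"
  for S :: "((real ^ 'd) \<times> (real ^ 'd)) set" and g
  unfolding split_beta
  by (intro continuous_intros continuous_on_compose2[OF that]
    continuous_on_compose2[OF ccs_continuous[OF w]] continuous_on_compose2[OF A]) auto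
 define fx where "fx x k = (\<Sum>j\<in>UNIV. (w k * partial_deriv j \<psi> (x - A k)) *\<^sub>R
   blinfun_inner_right (axis j 1 :: real ^ 'd))" for x k :: "real ^ 'd"
 have fxc: "continuous_on (UNIV \<times> cbox a b) (\<lambda>(x, k). fx x k)"
 proof -
  have "continuous_on (UNIV \<times> cbox a b) (\<lambda>p. \<Sum>j\<in>UNIV.
    ((\<lambda>(x, k). w k * partial_deriv j \<psi> (x - A k)) p) *\<^sub>R
   (blinfun_inner_right (axis j 1) :: (real ^ 'd) \<Rightarrow>\<^sub>L real))"
   by (intro continuous_intros comp cont)
  thus ?thesis by (simp add: fx_def split_beta)
 qed
 have fxap: "blinfun_apply (fx x k) v = (\<Sum>j\<in>UNIV. w k * partial_deriv j \<psi> (x - A k) * v $ j)"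
  for x k v
  by (simp add: fx_def blinfun.sum_left blinfun.scaleR_left inner_axis' )
 have "((\<lambda>x. integral (cbox a b) (\<lambda>k. w k * \<psi> (x - A k))) has_derivative
   blinfun_apply (integral (cbox a b) (fx z))) (at z within UNIV)"
 proof (rule leibniz_rule[OF _ _ fxc])
  fix x k
  have d: "(\<psi> has_derivative (\<lambda>v. \<Sum>j\<in>UNIV. v $ j * partial_deriv j \<psi> (x - A k))) (at (x - A k))"
   using assms by (intro has_derivative_partial_deriv) auto
  have "((\<lambda>x. x - A k) has_derivative (\<lambda>v. v)) (at x)"
   by (auto intro!: derivative_eq_intros)
  from has_derivative_compose[OF this d]
  have "((\<lambda>x. w k * \<psi> (x - A k)) has_derivative
    (\<lambda>v. w k * (\<Sum>j\<in>UNIV. v $ j * partial_deriv j \<psi> (x - A k)))) (at x)"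
   by (rule has_derivative_mult_right)
  also have "(\<lambda>v. w k * (\<Sum>j\<in>UNIV. v $ j * partial_deriv j \<psi> (x - A k))) = blinfun_apply (fx x k)"
   by (auto simp: fxap sum_distrib_left mult_ac)
  finally show "((\<lambda>x. w k * \<psi> (x - A k)) has_derivative blinfun_apply (fx x k)) (at x within UNIV)" .
 next
  fix x
  show "(\<lambda>k. w k * \<psi> (x - A k)) integrable_on cbox a b"
   by (intro integrable_continuous continuous_intros continuous_on_compose2[OF cont(1)]
    continuous_on_subset[OF ccs_continuous[OF w]] continuous_on_subset[OF A]) auto
 qed auto
 hence D: "(cv w A \<psi> has_derivative blinfun_apply (integral (cbox a b) (fx z))) (at z)"
  using eq[OF cont(1)] by (simp add: eq[OF cont(1), abs_def])
 thus "cv w A \<psi> differentiable at z" unfolding differentiable_def by blast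
 have "continuous_on (cbox a b) (fx z)"
 proof -
  have "continuous_on (cbox a b) (\<lambda>k. (\<lambda>(x, k). fx x k) (z, k))"
   by (rule continuous_on_compose2[OF fxc]) (auto intro!: continuous_intros)
  thus ?thesis by simp
 qed
 hence int: "fx z integrable_on cbox a b" by (rule integrable_continuous)
 have "partial_deriv i (cv w A \<psi>) z = blinfun_apply (integral (cbox a b) (fx z)) (axis i 1)"
  by (rule partial_deriv_eqI[OF D])
 also have "... = integral (cbox a b) ((\<lambda>F. blinfun_apply F (axis i 1)) \<circ> fx z)"
  by (subst integral_linear[OF int]) (auto intro: bounded_linear_intros)
 also have "... = integral (cbox a b) (\<lambda>k. w k * partial_deriv i \<psi> (z - A k))"
  by (simp add: o_def fxap axis_def if_distrib cong: if_cong)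
 also have "... = cv w A (partial_deriv i \<psi>) z" by (rule eq[OF cont(2), symmetric])
 finally show "partial_deriv i (cv w A \<psi>) z = cv w A (partial_deriv i \<psi>) z" .
qed

lemma cv_C_diff: "C_diff k \<psi> ==> C_diff k (cv w A \<psi>)"
proof (induction k arbitrary: \<psi>)
 case 0
 hence cont: "continuous_on UNIV \<psi>" by simp
 obtain a b where ab: "\<forall>k. k \<notin> cbox a b --> w k = 0" using w by (auto simp: ccs_def)
 have eq: "cv w A \<psi> z = integral (cbox a b) (\<lambda>k. w k * \<psi> (z - A k))" for z
 proof -
  have "(\<lambda>k. if k \<in> cbox a b then w k * \<psi> (z - A k) else 0) = (\<lambda>k. w k * \<psi> (z - A k))"
   using ab by auto
  thus ?thesis unfolding cv_def
   using integral_lborel[OF cv_integrable[OF cont, of z]]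
    integral_restrict_UNIV[of "cbox a b" "\<lambda>k. w k * \<psi> (z - A k)"] by simp
 qed
 have "continuous_on (UNIV \<times> cbox a b) (\<lambda>(x, k). w k * \<psi> (x - A k))"
  unfolding split_beta
  by (intro continuous_intros continuous_on_compose2[OF cont]
    continuous_on_compose2[OF ccs_continuous[OF w]] continuous_on_compose2[OF A]) auto
 hence "continuous_on UNIV (\<lambda>z. integral (cbox a b) (\<lambda>k. w k * \<psi> (z - A k)))"
  by (rule integral_continuous_on_param)
 thus ?case by (simp add: eq[abs_def])
next
 case (Suc k)
 have 1: "C_diff (Suc 0) \<psi>" using Suc.prems by (rule C_diff_mono) simp
 have "partial_deriv i (cv w A \<psi>) = cv w A (partial_deriv i \<psi>)" for i
  using cv_has_derivative(2)[OF 1] by blast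
 thus ?case using Suc cv_has_derivative(1)[OF 1] by simp
qed

lemma partial_derivs_cv:
 "C_diff k \<psi> ==> length js <= k ==> partial_derivs js (cv w A \<psi>) = cv w A (partial_derivs js \<psi>)"
proof (induction js)
 case Nil
 thus ?case by simp
next
 case (Cons i js)
 have 1: "C_diff (Suc 0) (partial_derivs js \<psi>)"
  using Cons.prems by (intro C_diff_partial_derivs C_diff_mono[OF Cons.prems(1)]) simp
 have "partial_deriv i (cv w A (partial_derivs js \<psi>)) = cv w A (partial_deriv i (partial_derivs js \<psi>))"
  using cv_has_derivative(2)[OF 1] by blast
 thus ?case using Cons by simp
qed

lemma smooth_cv: "smooth \<psi> ==> smooth (cv w A \<psi>)"
 by (simp add: smooth_def cv_C_diff)

end

section \<open>Taylor expansion\<close>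

definition monomial :: "'d::finite list => real ^ 'd => real" where
 "monomial js v = prod_list (map (\<lambda>j. v $ j) js)"

lemma monomial_Nil [simp]: "monomial [] v = 1"
 and monomial_Cons [simp]: "monomial (i # js) v = v $ i * monomial js v"
 by (simp_all add: monomial_def)

lemma continuous_on_monomial [continuous_intros]:
 "continuous_on A f ==> continuous_on A (\<lambda>x. monomial js (f x))"
 by (induction js) (auto intro!: continuous_intros)

lemma finite_lists_length [simp]: "finite {js :: 'd::finite list. length js = m}"
 using finite_lists_length_eq[of "UNIV :: 'd set" m] by simp

lemma sum_lists_Suc:
 fixes f :: "'d::finite list => real"
 shows "(\<Sum>js | length js = Suc m. f js) = (\<Sum>js | length js = m. \<Sum>i\<in>UNIV. f (i # js))"
proof -
 have *: "{js :: 'd list. length js = Suc m} = (\<lambda>(js, i). i # js) ` ({js. length js = m} \<times> UNIV)"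
  by (auto simp: image_iff length_Suc_conv)
 have "inj_on (\<lambda>(js, i). i # js) ({js :: 'd list. length js = m} \<times> UNIV)"
  by (auto simp: inj_on_def)
 thus ?thesis unfolding * by (subst sum.reindex) (simp_all add: sum.cartesian_product split_beta)
qed

text \<open>The one-dimensional formula along the segment. Summing over all index lists of length \<open>m\<close> absorbs
 the multinomial coefficients.\<close>

lemma taylor_lists:
 fixes \<psi> :: "real ^ 'd::finite => real"
 assumes "C_diff r \<psi>"
 shows "\<exists>t. \<bar>t\<bar> <= 1 \<and> \<psi> (y + v) =
  (\<Sum>m<r. (\<Sum>js | length js = m. monomial js v * partial_derivs js \<psi> y) / fact m) +
  (\<Sum>js | length js = r. monomial js v * partial_derivs js \<psi> (y + t *\<^sub>R v)) / fact r"
proof -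
 define D where "D m t = (\<Sum>js | length js = m. monomial js v * partial_derivs js \<psi> (y + t *\<^sub>R v))"
  for m :: nat and t :: real
 have der: "DERIV (D m) t :> D (Suc m) t" if "m < r" for m t
 proof -
  have 1: "((\<lambda>t. monomial js v * partial_derivs js \<psi> (y + t *\<^sub>R v)) has_real_derivative
    (\<Sum>i\<in>UNIV. monomial (i # js) v * partial_derivs (i # js) \<psi> (y + t *\<^sub>R v))) (at t)"
   if "length js = m" for js
  proof -
   have "partial_derivs js \<psi> differentiable at (y + t *\<^sub>R v)"
    using assms \<open>length js = m\<close> \<open>m < r\<close> by (intro partial_derivs_differentiable[of r]) auto
   note d = has_derivative_partial_deriv[OF this]
   have "((\<lambda>t. y + t *\<^sub>R v) has_derivative (\<lambda>h. h *\<^sub>R v)) (at t)"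
    by (auto intro!: derivative_eq_intros)
   from has_derivative_mult_right[OF has_derivative_compose[OF this d], of "monomial js v"]
   show ?thesis
    unfolding has_field_derivative_def
    by (rule has_derivative_eq_rhs) (auto simp: sum_distrib_left sum_distrib_right mult_ac)
  qed
  show ?thesis unfolding D_def sum_lists_Suc
   by (rule DERIV_sum) (use 1 in auto)
 qed
 have "\<exists>t. \<bar>t\<bar> <= \<bar>1::real\<bar> \<and> D 0 1 = (\<Sum>m<r. D m 0 / fact m * 1 ^ m) + D r t / fact r * 1 ^ r"
  by (rule Maclaurin_bi_le) (use der in auto)
 moreover have "{js :: 'd list. js = []} = {[]}" by auto
 ultimately show ?thesis by (simp add: D_def)
qed

lemma lipschitz_partial:
 fixes \<psi> :: "real ^ 'd::finite => real"
 assumes "C_diff (Suc 0) \<psi>" "!!i x. \<bar>partial_deriv i \<psi> x\<bar> <= M"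
 shows "\<bar>\<psi> (y + v) - \<psi> y\<bar> <= real CARD('d) * norm v * M"
proof -
 obtain t where t: "\<psi> (y + v) = \<psi> y +
   (\<Sum>js | length js = Suc 0. monomial js v * partial_derivs js \<psi> (y + t *\<^sub>R v))"
  using taylor_lists[OF assms(1), of y v] by auto
 have "{js :: 'd list. js = []} = {[]}" by auto
 hence "\<psi> (y + v) - \<psi> y = (\<Sum>i\<in>UNIV. v $ i * partial_deriv i \<psi> (y + t *\<^sub>R v))"
  unfolding t sum_lists_Suc by simp
 also have "\<bar>...\<bar> <= (\<Sum>i\<in>(UNIV :: 'd set). norm v * M)"
  by (rule order_trans[OF sum_abs], rule sum_mono)
    (auto simp: abs_mult intro!: mult_mono component_le_norm_cart assms(2))
 finally show ?thesis by simp
qed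

context scaling
begin

definition sdeg :: "'d list => nat" where
 "sdeg js = sum_list (map s js)"

lemma monomial_dil: "monomial js (dil s l v) = l ^ sdeg js * monomial js v"
 by (induction js) (simp_all add: sdeg_def power_add)

lemma length_le_sdeg: "length js <= sdeg js"
proof (induction js)
 case (Cons a js)
 thus ?case using s_pos[of a] by (simp add: sdeg_def)
qed (simp add: sdeg_def)

lemma abs_mono_le:
 assumes "!!i. \<bar>v $ i\<bar> <= a" shows "\<bar>monomial js v\<bar> <= a ^ length js"
proof -
 have "0 <= a" using assms order_trans[OF abs_ge_zero] by blast
 thus ?thesis
  by (induction js) (auto simp: abs_mult intro!: mult_mono assms)
qed

text \<open>The moment conditions annihilate the Taylor polynomial of \<open>\<psi>\<close> at \<open>y\<close>; only the remainder of order
 \<open>r\<close> survives. A monomial of length \<open>r\<close> gains at least $\mu^r$ because $s_i \ge 1$ and $\mu \le 1$.\<close>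

lemma avg_error:
 assumes \<phi>: "ccs \<phi>" "!!k. \<phi> k ~= 0 ==> snorm s k <= 1" "(\<integral>k. \<phi> k) = 1"
  and mom: "!!js. 1 <= length js ==> length js < r ==> (\<integral>k. \<phi> k * monomial js k) = 0"
  and r: "1 <= r" and \<psi>: "C_diff r \<psi>" and \<mu>: "0 <= \<mu>" "\<mu> <= 1"
  and M: "!!js h. length js = r ==> snorm s h <= \<mu> ==> \<bar>partial_derivs js \<psi> (y - h)\<bar> <= M"
 shows "\<bar>cv \<phi> (dil s \<mu>) \<psi> y - \<psi> y\<bar> \<le>
  (\<integral>k. \<bar>\<phi> k\<bar>) * (real (card {js :: 'd list. length js = r}) * \<mu> ^ r * M)"
proof -
 let ?N = "real (card {js :: 'd list. length js = r})"
 define pol where "pol k = (\<Sum>m<r. (\<Sum>js | length js = m. monomial js (dil s \<mu> (- k)) * partial_derivs js \<psi> y) / fact m)"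
  for k
 have mono_minus: "monomial js (dil s \<mu> (- k)) = ((-1) ^ length js * \<mu> ^ sdeg js) * monomial js k" for js k
  by (induction js) (simp_all add: sdeg_def power_add algebra_simps)
 have int: "integrable lborel (\<lambda>k. \<phi> k * monomial js k)" for js
  by (rule ccs_integrable_mult[OF \<phi>(1)]) (intro continuous_intros)
 have cpol: "continuous_on UNIV pol" unfolding pol_def by (intro continuous_intros) auto
 have "(\<integral>k. \<phi> k * pol k) = (\<integral>k. (\<Sum>m<r. \<Sum>js | length js = m.
   ((-1) ^ length js * \<mu> ^ sdeg js * partial_derivs js \<psi> y / fact m) * (\<phi> k * monomial js k)))"
  unfolding pol_def mono_minus
  by (simp add: sum_distrib_left sum_divide_distrib mult_ac)
 also have "... = (\<Sum>m<r. \<Sum>js | length js = m.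
   ((-1) ^ length js * \<mu> ^ sdeg js * partial_derivs js \<psi> y / fact m) * (\<integral>k. \<phi> k * monomial js k))"
  by (subst Bochner_Integration.integral_sum, intro Bochner_Integration.integrable_sum integrable_mult_right int,
    subst Bochner_Integration.integral_sum, intro integrable_mult_right int, simp)
 also have "... = (\<Sum>m<r. if m = 0 then \<psi> y else 0)"
 proof (rule sum.cong[OF refl])
  fix m assume m: "m \<in> {..<r}"
  show "(\<Sum>js | length js = m.
   ((-1) ^ length js * \<mu> ^ sdeg js * partial_derivs js \<psi> y / fact m) * (\<integral>k. \<phi> k * monomial js k))
   = (if m = 0 then \<psi> y else 0)"
  proof (cases "m = 0")
   case True
   have "{js :: 'd list. js = []} = {[]}" by auto
   thus ?thesis using True \<phi>(3) by (simp add: sdeg_def)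
  next
   case False
   thus ?thesis using m mom by (simp add: sum.neutral)
  qed
 qed
 also have "... = \<psi> y" using r by simp
 finally have pol: "(\<integral>k. \<phi> k * pol k) = \<psi> y" .
 have cdil: "continuous_on UNIV (dil s \<mu>)" by (intro continuous_intros)
 have cont: "continuous_on UNIV \<psi>" using \<psi> by (rule C_diff_imp_continuous)
 have int2: "integrable lborel (\<lambda>k. \<phi> k * \<psi> (y - dil s \<mu> k))" "integrable lborel (\<lambda>k. \<phi> k * pol k)"
  using cv_integrable[OF \<phi>(1) cdil cont] ccs_integrable_mult[OF \<phi>(1) cpol] by auto
 have "cv \<phi> (dil s \<mu>) \<psi> y - \<psi> y = (\<integral>k. \<phi> k * (\<psi> (y - dil s \<mu> k) - pol k))"
  unfolding cv_def pol[symmetric] using int2 by (simp add: right_diff_distrib)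
 also have "\<bar>...\<bar> <= (\<integral>k. \<bar>\<phi> k * (\<psi> (y - dil s \<mu> k) - pol k)\<bar>)"
  by (rule integral_abs_bound)
 also have "... <= (\<integral>k. \<bar>\<phi> k\<bar> * (?N * \<mu> ^ r * M))"
 proof (rule integral_mono)
  show "integrable lborel (\<lambda>k. \<bar>\<phi> k * (\<psi> (y - dil s \<mu> k) - pol k)\<bar>)"
   using int2 by (simp add: right_diff_distrib)
  show "integrable lborel (\<lambda>k. \<bar>\<phi> k\<bar> * (?N * \<mu> ^ r * M))" using ccs_integrable[OF \<phi>(1)] by simp
  fix k
  show "\<bar>\<phi> k * (\<psi> (y - dil s \<mu> k) - pol k)\<bar> <= \<bar>\<phi> k\<bar> * (?N * \<mu> ^ r * M)"
  proof (cases "\<phi> k = 0")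
   case False
   hence k: "snorm s k <= 1" using \<phi>(2) by blast
   obtain t where t: "\<bar>t\<bar> <= 1" "\<psi> (y + dil s \<mu> (- k)) = pol k +
    (\<Sum>js | length js = r. monomial js (dil s \<mu> (- k)) * partial_derivs js \<psi> (y + t *\<^sub>R dil s \<mu> (- k))) / fact r"
    using taylor_lists[OF \<psi>, of y "dil s \<mu> (- k)"] unfolding pol_def by blast
   have e: "y + dil s \<mu> (- k) = y - dil s \<mu> k" by (simp add: vec_eq_iff)
   have sm: "\<bar>dil s \<mu> (- k) $ i\<bar> <= \<mu> ^ s i" for i
   proof -
    have "\<bar>k $ i\<bar> <= 1" using k snorm_le_iff[of 1 k] by simp
    thus ?thesis using \<mu> by (simp add: abs_mult mult_left_le)
   qed
   have mb: "\<bar>monomial js (dil s \<mu> (- k))\<bar> <= \<mu> ^ length js" for js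
   proof (rule abs_mono_le)
    fix i
    have "\<mu> ^ s i <= \<mu> ^ 1" using \<mu> s_pos[of i] by (intro power_decreasing) auto
    with sm[of i] show "\<bar>dil s \<mu> (- k) $ i\<bar> <= \<mu>" by simp
   qed
   have pb: "\<bar>partial_derivs js \<psi> (y + t *\<^sub>R dil s \<mu> (- k))\<bar> <= M" if "length js = r" for js
   proof -
    have "snorm s (- (t *\<^sub>R dil s \<mu> (- k))) <= \<mu>"
     using \<mu> t(1) sm by (subst snorm_minus, subst snorm_le_iff)
      (auto simp: abs_mult intro: order_trans[OF mult_left_le_one_le])
    from M[OF that this] show ?thesis by simp
   qed
   have "\<bar>\<psi> (y - dil s \<mu> k) - pol k\<bar> =
    \<bar>\<Sum>js | length js = r. monomial js (dil s \<mu> (- k)) * partial_derivs js \<psi> (y + t *\<^sub>R dil s \<mu> (- k))\<bar> / fact r"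
    using t(2) unfolding e by simp
   also have "... <= \<bar>\<Sum>js | length js = r. monomial js (dil s \<mu> (- k)) * partial_derivs js \<psi> (y + t *\<^sub>R dil s \<mu> (- k))\<bar>"
   proof -
    have "a / fact r <= a" if "0 <= a" for a :: real
     using that mult_right_mono[OF fact_ge_1[of r], of a] by (simp add: divide_le_eq mult.commute)
    thus ?thesis by simp
   qed
   also have "... <= (\<Sum>js :: 'd list | length js = r. \<mu> ^ r * M)"
    by (rule order_trans[OF sum_abs], rule sum_mono)
      (use mb pb \<mu> in "auto simp: abs_mult intro!: mult_mono")
   also have "... = ?N * \<mu> ^ r * M" by simp
   finally show ?thesis by (simp add: abs_mult mult_left_mono)
  qed simp
 qed
 also have "... = (\<integral>k. \<bar>\<phi> k\<bar>) * (?N * \<mu> ^ r * M)" by simp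
 finally show ?thesis .
qed

end

section \<open>A smooth bump\<close>

text \<open>The class of all \<open>flat p\<close> is closed under differentiation, with \<open>flat_step\<close> acting on the
 polynomials; hence its members are smooth.\<close>

definition flat :: "real poly => real => real" where
 "flat p t = (if 0 < t then poly p (1 / t) * exp (- (1 / t)) else 0)"

definition flat_step :: "real poly => real poly" where
 "flat_step p = [:0, 0, 1:] * (p - pderiv p)"

lemma poly_over_exp_tendsto_0: "((\<lambda>x. poly p x * exp (- x)) \<longlongrightarrow> (0 :: real)) at_top"
proof -
 have "((\<lambda>x. \<Sum>i\<le>degree p. coeff p i * (x ^ i / exp x)) \<longlongrightarrow> (\<Sum>i\<le>degree p. coeff p i * 0)) at_top"
  by (intro tendsto_intros tendsto_power_div_exp_0)
 thus ?thesis
  by (simp add: poly_altdef sum_distrib_right exp_minus divide_inverse mult.assoc)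
qed

lemma flat_tendsto_0: "((\<lambda>t. poly p (1 / t) * exp (- (1 / t))) \<longlongrightarrow> (0 :: real)) (at_right 0)"
 using filterlim_compose[OF poly_over_exp_tendsto_0 filterlim_inverse_at_top_right]
 by (simp add: divide_inverse)

lemma flat_has_derivative: "(flat p has_real_derivative flat (flat_step p) t) (at t)"
proof -
 consider "t > 0" | "t < 0" | "t = 0" by linarith
 thus ?thesis
 proof cases
  case 1
  have "((\<lambda>t. poly p (1 / t) * exp (- (1 / t))) has_real_derivative
   (poly (pderiv p) (1 / t) * (- (1 / t\<^sup>2)) * exp (- (1 / t)) +
    poly p (1 / t) * (exp (- (1 / t)) * (1 / t\<^sup>2)))) (at t)"
   using 1 by (auto intro!: derivative_eq_intros DERIV_chain2[OF poly_DERIV] simp: power2_eq_square)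
  also have "(poly (pderiv p) (1 / t) * (- (1 / t\<^sup>2)) * exp (- (1 / t)) +
    poly p (1 / t) * (exp (- (1 / t)) * (1 / t\<^sup>2))) = flat (flat_step p) t"
   using 1 by (simp add: flat_def flat_step_def algebra_simps power2_eq_square)
  finally show ?thesis
   by (rule has_field_derivative_transform_within_open[where S = "{0<..}"])
     (use 1 in "auto simp: flat_def")
 next
  case 2
  have "((\<lambda>t. 0) has_real_derivative flat (flat_step p) t) (at t)" using 2 by (simp add: flat_def)
  thus ?thesis
   by (rule has_field_derivative_transform_within_open[where S = "{..<0}"])
     (use 2 in "auto simp: flat_def")
 next
  case 3
  have "((\<lambda>h. flat p h / h) \<longlongrightarrow> 0) (at_right 0)"
  proof (rule Lim_transform_eventually)
   show "((\<lambda>t. poly ([:0, 1:] * p) (1 / t) * exp (- (1 / t))) \<longlongrightarrow> 0) (at_right 0)"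
    by (rule flat_tendsto_0)
   show "\<forall>\<^sub>F t in at_right 0. poly ([:0, 1:] * p) (1 / t) * exp (- (1 / t)) = flat p t / t"
    by (auto simp: eventually_at_right_less flat_def field_simps intro: eventually_mono[OF eventually_at_right_less])
  qed
  moreover have "((\<lambda>h. flat p h / h) \<longlongrightarrow> 0) (at_left 0)"
   by (rule Lim_transform_eventually[OF tendsto_const])
     (auto simp: flat_def eventually_at_filter)
  ultimately have "((\<lambda>h. flat p h / h) \<longlongrightarrow> 0) (at 0)" by (simp add: filterlim_split_at)
  thus ?thesis using 3 by (simp add: DERIV_def flat_def)
 qed
qed

text \<open>The factors are indexed by the \<open>2d\<close> faces of the cube.\<close>

definition face :: "'d::finite \<times> bool => real ^ 'd => real" where
 "face e x = 1 / 2 + (if snd e then x $ fst e else - (x $ fst e))"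

definition cube_fun :: "('d::finite \<times> bool => real poly) => real ^ 'd => real" where
 "cube_fun ps x = (\<Prod>e\<in>UNIV. flat (ps e) (face e x))"

lemma cube_fun_derivative:
 fixes ps :: "'d::finite \<times> bool => real poly"
 defines "sg \<equiv> \<lambda>(i :: 'd) (e :: 'd \<times> bool). if fst e = i then (if snd e then 1 else - 1) else (0::real)"
 shows "cube_fun ps differentiable at x"
  and "partial_deriv i (cube_fun ps) x =
   (\<Sum>e\<in>UNIV. sg i e * cube_fun (ps(e := flat_step (ps e))) x)"
proof -
 define l where "l e v = (if snd e then v $ fst e else - (v $ fst e))"
  for e :: "'d \<times> bool" and v :: "real ^ 'd"
 have 1: "((\<lambda>x. flat (ps e) (face e x)) has_derivative (\<lambda>v. flat (flat_step (ps e)) (face e x) * l e v)) (at x)"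
  for e
 proof -
  have "(face e has_derivative l e) (at x)"
  proof (cases "snd e")
   case True
   have "((\<lambda>x. 1 / 2 + x $ fst e) has_derivative (\<lambda>v. v $ fst e)) (at x)"
    by (auto intro!: derivative_eq_intros bounded_linear_imp_has_derivative bounded_linear_vec_nth)
   moreover have "face e = (\<lambda>x. 1 / 2 + x $ fst e)" "l e = (\<lambda>v. v $ fst e)"
    using True by (auto simp: face_def l_def)
   ultimately show ?thesis by simp
  next
   case False
   have "((\<lambda>x. 1 / 2 - x $ fst e) has_derivative (\<lambda>v. 0 - v $ fst e)) (at x)"
    by (intro derivative_intros bounded_linear_imp_has_derivative bounded_linear_vec_nth)
   moreover have "face e = (\<lambda>x. 1 / 2 - x $ fst e)" "l e = (\<lambda>v. 0 - v $ fst e)"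
    using False by (auto simp: face_def l_def)
   ultimately show ?thesis by simp
  qed
  from has_derivative_compose[OF this flat_has_derivative[of "ps e" "face e x", unfolded has_field_derivative_def]]
  show ?thesis .
 qed
 have D: "(cube_fun ps has_derivative (\<lambda>v. \<Sum>e\<in>UNIV. (flat (flat_step (ps e)) (face e x) * l e v) *
   (\<Prod>e'\<in>UNIV - {e}. flat (ps e') (face e' x)))) (at x)"
  unfolding cube_fun_def[abs_def] by (rule has_derivative_prod) (rule 1)
 thus "cube_fun ps differentiable at x" unfolding differentiable_def by blast
 have "partial_deriv i (cube_fun ps) x = (\<Sum>e\<in>UNIV. (flat (flat_step (ps e)) (face e x) * l e (axis i 1)) *
   (\<Prod>e'\<in>UNIV - {e}. flat (ps e') (face e' x)))"
  by (rule partial_deriv_eqI[OF D])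
 also have "... = (\<Sum>e\<in>UNIV. sg i e * cube_fun (ps(e := flat_step (ps e))) x)"
 proof (rule sum.cong[OF refl])
  fix e :: "'d \<times> bool"
  have "cube_fun (ps(e := flat_step (ps e))) x = flat (flat_step (ps e)) (face e x) *
   (\<Prod>e'\<in>UNIV - {e}. flat (ps e') (face e' x))"
   unfolding cube_fun_def by (subst prod.remove[of UNIV e]) (auto intro!: prod.cong)
  moreover have "l e (axis i 1) = sg i e" by (auto simp: l_def sg_def axis_def)
  ultimately show "(flat (flat_step (ps e)) (face e x) * l e (axis i 1)) *
   (\<Prod>e'\<in>UNIV - {e}. flat (ps e') (face e' x)) = sg i e * cube_fun (ps(e := flat_step (ps e))) x"
   by (simp add: mult_ac)
 qed
 finally show "partial_deriv i (cube_fun ps) x =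
   (\<Sum>e\<in>UNIV. sg i e * cube_fun (ps(e := flat_step (ps e))) x)" .
qed

lemma smooth_cube_fun: "smooth (cube_fun ps)"
proof -
 have "C_diff k (cube_fun ps)" for k
 proof (induction k arbitrary: ps)
  case 0
  show ?case
   by (auto intro!: continuous_at_imp_continuous_on differentiable_imp_continuous_within cube_fun_derivative(1))
 next
  case (Suc k)
  have "C_diff k (partial_deriv i (cube_fun ps))" for i
   unfolding cube_fun_derivative(2)[abs_def]
   by (rule partial_derivs_sum(1)) (auto intro: Suc.IH)
  thus ?case by (simp add: cube_fun_derivative(1))
 qed
 thus ?thesis by (simp add: smooth_def)
qed

context scaling
begin

text \<open>Richardson extrapolation: contracting a density by \<open>dil s 2\<close> multiplies its moments of degree $k$ by
 $2^{-k}$, so an affine combination of the density and its contraction kills one further degree.\<close>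

lemma exists_mollifier:
 "\<exists>\<phi> :: real ^ 'd => real. smooth \<phi> \<and> (\<forall>x. \<phi> x ~= 0 --> (\<forall>i. \<bar>x $ i\<bar> <= 1 / 2)) \<and>
   (\<integral>x. \<phi> x) = 1 \<and>
   (\<forall>js. 1 <= sdeg js \<and> sdeg js <= N --> (\<integral>x. \<phi> x * monomial js x) = 0)"
proof -
 let ?Q = "cbox (\<chi> i. - 1 / 2) (\<chi> i. 1 / 2) :: (real ^ 'd) set"
 let ?B = "box (\<chi> i. - 1 / 2) (\<chi> i. 1 / 2) :: (real ^ 'd) set"
 let ?b = "\<lambda>f. \<forall>x. f x ~= 0 --> (\<forall>i. \<bar>x $ i\<bar> <= 1 / 2)"
 have ccsI: "ccs \<phi>" if "smooth \<phi>" "?b \<phi>" for \<phi> :: "real ^ 'd => real"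
 proof (rule ccs_compact[of _ ?Q])
  show "continuous_on UNIV \<phi>" using smooth_C_diff[OF that(1), of 0] by simp
  show "\<phi> k = 0" if "k \<notin> ?Q" for k
  proof (rule ccontr)
   assume "\<phi> k ~= 0"
   hence *: "\<bar>k $ i\<bar> <= 1 / 2" for i using \<open>\<forall>x. \<phi> x ~= 0 --> _ x\<close> by blast
   have "- 1 / 2 <= k $ i \<and> k $ i <= 1 / 2" for i using *[of i] by linarith
   hence "k \<in> ?Q" by (simp add: mem_box_cart)
   with that show False by blast
  qed
 qed simp
 show ?thesis
 proof (induction N)
  case 0
  define b where "b = (cube_fun (\<lambda>_. 1) :: real ^ 'd => real)"
  have nonneg: "b x \<ge> 0" for x unfolding b_def cube_fun_def by (auto intro!: prod_nonneg simp: flat_def)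
  have supp: "?b b"
  proof (intro allI impI)
   fix x i assume "b x ~= 0"
   hence "flat 1 (face (i, c) x) ~= 0" for c unfolding b_def cube_fun_def by simp
   from this[of True] this[of False] show "\<bar>x $ i\<bar> <= 1 / 2"
    by (auto simp: flat_def face_def split: if_splits)
  qed
  have sm: "smooth b" unfolding b_def by (rule smooth_cube_fun)
  have pos: "b x > 0" if "x \<in> ?B" for x
  proof -
   have "face e x > 0" for e using that[unfolded mem_box_cart, rule_format, of "fst e"] by (auto simp: face_def)
   thus ?thesis unfolding b_def cube_fun_def by (intro prod_pos) (auto simp: flat_def)
  qed
  have int: "integrable lborel b" by (rule ccs_integrable[OF ccsI[OF sm supp]])
  have "(\<integral>x. b x) ~= 0"
  proof
   assume "(\<integral>x. b x) = 0"
   hence "AE x in lborel. b x = 0"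
    using integral_nonneg_eq_0_iff_AE[OF int] nonneg by auto
   hence "AE x in lborel. x \<notin> ?B"
   proof eventually_elim
    case (elim x)
    thus ?case using pos[of x] by linarith
   qed
   hence "emeasure lborel (?B) = 0"
    by (subst (asm) AE_iff_measurable[OF _ refl]) auto
   moreover have "(\<Prod>i\<in>(Basis :: (real ^ 'd) set). ((\<chi> i. 1 / 2) - (\<chi> i. - 1 / 2)) \<bullet> i) > 0"
    by (rule prod_pos) (auto simp: Basis_vec_def inner_axis)
   ultimately show False
    by (subst (asm) emeasure_lborel_box) (auto simp: Basis_vec_def inner_axis)
  qed
  thus ?case using supp smooth_cmult[OF sm, of "1 / (\<integral>x. b x)"]
   by (intro exI[of _ "\<lambda>x. (1 / (\<integral>x. b x)) * b x"]) auto
 next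
  case (Suc N)
  then obtain \<phi> :: "real ^ 'd => real" where \<phi>: "smooth \<phi>" "?b \<phi>"
   "(\<integral>x. \<phi> x) = 1"
   "\<forall>js. 1 <= sdeg js \<and> sdeg js <= N --> (\<integral>x. \<phi> x * monomial js x) = 0" by blast
  define \<theta> where "\<theta> x = 2 ^ scale_deg s * \<phi> (dil s 2 x)" for x
  have sm\<theta>: "smooth \<theta>"
   using partial_derivs_affine_aux(1)[OF smooth_C_diff[OF \<phi>(1)], of _ "\<lambda>i. 2 ^ s i" 0]
   unfolding \<theta>_def by (intro smooth_cmult) (simp add: smooth_def dil_def)
  have supp\<theta>: "?b \<theta>"
  proof (intro allI impI)
   fix x i assume "\<theta> x ~= 0"
   hence "\<bar>dil s 2 x $ i\<bar> <= 1 / 2" using \<phi>(2) unfolding \<theta>_def by auto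
   moreover have "1 * \<bar>x $ i\<bar> <= 2 ^ s i * \<bar>x $ i\<bar>" by (rule mult_right_mono) auto
   ultimately show "\<bar>x $ i\<bar> <= 1 / 2" by (simp add: abs_mult)
  qed
  have mom: "(\<integral>x. \<theta> x * monomial js x) = (1 / 2) ^ sdeg js * (\<integral>x. \<phi> x * monomial js x)" for js
  proof -
   have c: "continuous_on UNIV \<phi>" using smooth_C_diff[OF \<phi>(1), of 0] by simp
   have "(\<integral>y. \<phi> y * monomial js (dil s (1 / 2) y)) =
    (\<Prod>i\<in>UNIV. \<bar>2 ^ s i\<bar>) * (\<integral>k. \<phi> (0 + (\<chi> i. 2 ^ s i * k $ i)) * monomial js (dil s (1 / 2) (0 + (\<chi> i. 2 ^ s i * k $ i))))"
    by (rule lborel_integral_affine)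
      (auto intro!: borel_measurable_continuous_onI continuous_intros c)
   moreover have "0 + (\<chi> i. 2 ^ s i * k $ i) = dil s 2 k" for k :: "real ^ 'd" by (simp add: dil_def)
   moreover have "(\<integral>y. \<phi> y * monomial js (dil s (1 / 2) y)) =
     (1 / 2) ^ sdeg js * (\<integral>y. \<phi> y * monomial js y)"
    unfolding monomial_dil mult.left_commute[of "\<phi> _" "(1 / 2) ^ sdeg js"] by simp
   ultimately show ?thesis
    by (simp add: \<theta>_def prod_power_s mult.assoc)
  qed
  define q where "q = (1 / 2 :: real) ^ Suc N"
  have q: "q < 1" unfolding q_def by (rule power_Suc_less_one) auto
  define \<phi>' where "\<phi>' x = (1 / (1 - q)) * \<theta> x + (- q / (1 - q)) * \<phi> x" for x
  have int: "integrable lborel (\<lambda>x. \<theta> x * monomial js x)" "integrable lborel (\<lambda>x. \<phi> x * monomial js x)" for js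
   using ccsI[OF sm\<theta> supp\<theta>] ccsI[OF \<phi>(1,2)] by (auto intro!: ccs_integrable_mult continuous_intros)
  have mom': "(\<integral>x. \<phi>' x * monomial js x) =
    ((1 / 2) ^ sdeg js - q) / (1 - q) * (\<integral>x. \<phi> x * monomial js x)" for js
  proof -
   have "(\<integral>x. \<phi>' x * monomial js x) =
    (\<integral>x. (1 / (1 - q)) * (\<theta> x * monomial js x) + (- q / (1 - q)) * (\<phi> x * monomial js x))"
    by (simp add: \<phi>'_def algebra_simps)
   also have "... = (1 / (1 - q)) * (\<integral>x. \<theta> x * monomial js x) + (- q / (1 - q)) * (\<integral>x. \<phi> x * monomial js x)"
    by (subst Bochner_Integration.integral_add)
      (use int[of js] in "auto intro!: integrable_mult_right simp del: times_divide_eq_left")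
   also have "... = ((1 / 2) ^ sdeg js - q) / (1 - q) * (\<integral>x. \<phi> x * monomial js x)"
   proof -
    have "(1 / (1 - q)) * (a * I) + (- q / (1 - q)) * I = (a - q) / (1 - q) * I" for a I :: real
     by (simp add: diff_divide_distrib left_diff_distrib)
    thus ?thesis unfolding mom .
   qed
   finally show ?thesis .
  qed
  have "smooth \<phi>'" unfolding \<phi>'_def by (intro smooth_lincomb sm\<theta> \<phi>(1))
  moreover have "?b \<phi>'"
  proof (intro allI impI)
   fix x i assume "\<phi>' x ~= 0"
   hence "\<theta> x ~= 0 \<or> \<phi> x ~= 0" unfolding \<phi>'_def by fastforce
   thus "\<bar>x $ i\<bar> <= 1 / 2" using supp\<theta> \<phi>(2) by blast
  qed
  moreover have "(\<integral>x. \<phi>' x) = 1"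
   using mom'[of "[]"] q \<phi>(3) by (simp add: sdeg_def)
  moreover have "(\<integral>x. \<phi>' x * monomial js x) = 0" if "1 <= sdeg js" "sdeg js <= Suc N" for js
  proof (cases "sdeg js = Suc N")
   case True
   thus ?thesis by (simp add: mom' q_def)
  next
   case False
   thus ?thesis using that \<phi>(4) by (simp add: mom')
  qed
  ultimately show ?case by (intro exI[of _ \<phi>']) blast
 qed
qed

end

section \<open>Dyadic sums\<close>

abbreviation eps :: "nat => real" where
 "eps n \<equiv> (1 / 2) ^ n"

lemma eps_powr: "eps n powr \<delta> = (2 powr - \<delta>) ^ n"
proof -
 have "eps n = 2 powr - real n"
  by (simp add: powr_minus powr_realpow power_one_over inverse_eq_divide)
 hence "eps n powr \<delta> = 2 powr (- \<delta> * real n)" by (simp add: powr_powr mult.commute)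
 also have "... = (2 powr - \<delta>) powr real n" by (simp add: powr_powr)
 finally show ?thesis by (simp add: powr_realpow)
qed

lemma two_powr_less_one: "0 < \<delta> ==> (2 :: real) powr - \<delta> < 1"
 using powr_less_mono[of "- \<delta>" 0 "2 :: real"] by simp

lemma dyadic_sum_below:
 assumes "0 < \<delta>" "0 < m"
 shows "(\<Sum>n. ennreal (if eps n <= m then eps n powr \<delta> else 0)) <= ennreal (m powr \<delta> / (1 - 2 powr - \<delta>))"
proof (rule suminf_le_const[OF summableI])
 fix N
 define a where "a n = min (eps n) m powr \<delta>" for n
 have q: "1 - 2 powr - \<delta> > 0" using two_powr_less_one[OF assms(1)] by simp
 have step: "(if eps n <= m then eps n powr \<delta> else 0) * (1 - 2 powr - \<delta>) <= a n - a (Suc n)" for n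
 proof (cases "eps n <= m")
  case True
  moreover have "eps (Suc n) <= m" using True by (simp add: field_simps)
  ultimately have "a n = eps n powr \<delta>" "a (Suc n) = eps (Suc n) powr \<delta>" unfolding a_def by (auto simp: min_absorb1)
  thus ?thesis using True by (simp only: eps_powr) (simp add: algebra_simps)
 next
  case False
  have "min (eps (Suc n)) m <= min (eps n) m" by (rule min.mono) (auto simp: field_simps)
  hence "a (Suc n) <= a n" unfolding a_def using assms by (intro powr_mono2) auto
  thus ?thesis using False by simp
 qed
 have "(\<Sum>n<N. if eps n <= m then eps n powr \<delta> else 0) * (1 - 2 powr - \<delta>) <= (\<Sum>n<N. a n - a (Suc n))"
  unfolding sum_distrib_right by (rule sum_mono) (rule step)
 also have "... = a 0 - a N" by (rule sum_lessThan_telescope')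
 also have "... <= m powr \<delta>"
 proof -
  have "a 0 <= m powr \<delta>" unfolding a_def using assms by (intro powr_mono2) auto
  moreover have "0 <= a N" by (simp add: a_def)
  ultimately show ?thesis by linarith
 qed
 finally have "(\<Sum>n<N. if eps n <= m then eps n powr \<delta> else 0) <= m powr \<delta> / (1 - 2 powr - \<delta>)"
  using q by (simp add: pos_le_divide_eq)
 thus "(\<Sum>n<N. ennreal (if eps n <= m then eps n powr \<delta> else 0)) <= ennreal (m powr \<delta> / (1 - 2 powr - \<delta>))"
  by (subst sum_ennreal) (auto intro: ennreal_leI)
qed

lemma dyadic_sum_above:
 assumes "0 < \<delta>" "0 < m"
 shows "(\<Sum>n. ennreal (if m < eps n then eps n powr - \<delta> else 0)) <= ennreal (m powr - \<delta> / (1 - 2 powr - \<delta>))"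
proof (rule suminf_le_const[OF summableI])
 fix N
 define b where "b n = max (2 * eps n) m powr - \<delta>" for n
 have q: "1 - 2 powr - \<delta> > 0" using two_powr_less_one[OF assms(1)] by simp
 have step: "(if m < eps n then eps n powr - \<delta> else 0) * (1 - 2 powr - \<delta>) <= b (Suc n) - b n" for n
 proof (cases "m < eps n")
  case True
  have "m < 2 * eps n" using True assms(2) by linarith
  hence "b (Suc n) = eps n powr - \<delta>" "b n = (2 * eps n) powr - \<delta>"
   unfolding b_def using True by (auto simp: max_absorb1)
  moreover have "(2 * eps n) powr - \<delta> = 2 powr - \<delta> * eps n powr - \<delta>" by (rule powr_mult)
  ultimately show ?thesis using True by (simp add: algebra_simps)
 next
  case False
  have "max (2 * eps (Suc n)) m <= max (2 * eps n) m" by (rule max.mono) (auto simp: field_simps)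
  hence "b n <= b (Suc n)" unfolding b_def using assms
   by (intro powr_mono2') (auto simp: less_max_iff_disj)
  thus ?thesis using False by simp
 qed
 have "(\<Sum>n<N. if m < eps n then eps n powr - \<delta> else 0) * (1 - 2 powr - \<delta>) <= (\<Sum>n<N. b (Suc n) - b n)"
  unfolding sum_distrib_right by (rule sum_mono) (rule step)
 also have "... = b N - b 0" by (rule sum_lessThan_telescope)
 also have "... <= m powr - \<delta>"
 proof -
  have "b N <= m powr - \<delta>" unfolding b_def using assms by (intro powr_mono2') auto
  moreover have "0 <= b 0" by (simp add: b_def)
  ultimately show ?thesis by linarith
 qed
 finally have "(\<Sum>n<N. if m < eps n then eps n powr - \<delta> else 0) <= m powr - \<delta> / (1 - 2 powr - \<delta>)"
  using q by (simp add: pos_le_divide_eq)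
 thus "(\<Sum>n<N. ennreal (if m < eps n then eps n powr - \<delta> else 0)) <= ennreal (m powr - \<delta> / (1 - 2 powr - \<delta>))"
  by (subst sum_ennreal) (auto intro: ennreal_leI)
qed

section \<open>The mollifier and its band-pass operators\<close>

locale mollifier = scaling s for s :: "'d::finite => nat" +
 fixes \<phi> :: "real ^ 'd => real" and R :: nat
 assumes \<phi>_smooth: "smooth \<phi>"
  and \<phi>_supp: "!!x i. \<phi> x ~= 0 ==> \<bar>x $ i\<bar> <= 1 / 2"
  and \<phi>_int: "(\<integral>x. \<phi> x) = 1"
  and \<phi>_mom: "!!js. 1 <= length js ==> length js < R ==> (\<integral>x. \<phi> x * monomial js x) = 0"

lemma (in scaling) mollifier_exists: "\<exists>\<phi>. mollifier s \<phi> R"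
proof -
 obtain \<phi> :: "real ^ 'd => real" where \<phi>: "smooth \<phi>" "\<forall>x. \<phi> x ~= 0 --> (\<forall>i. \<bar>x $ i\<bar> <= 1 / 2)"
   "(\<integral>x. \<phi> x) = 1"
   "\<forall>js. 1 <= sdeg js \<and> sdeg js <= R * scale_deg s --> (\<integral>x. \<phi> x * monomial js x) = 0"
  using exists_mollifier[of "R * scale_deg s"] by blast
 have "sdeg js <= length js * scale_deg s" for js
 proof (induction js)
  case (Cons a js)
  have "s a <= scale_deg s" unfolding scale_deg_def by (intro member_le_sum) auto
  with Cons show ?case by (simp add: sdeg_def)
 qed (simp add: sdeg_def)
 moreover have "length js * scale_deg s <= R * scale_deg s" if "length js < R" for js :: "'d list"
  using that by (intro mult_le_mono1) simp
 ultimately have "sdeg js <= R * scale_deg s" if "length js < R" for js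
  using that le_trans by blast
 hence "(\<integral>x. \<phi> x * monomial js x) = 0" if "1 <= length js" "length js < R" for js
  using that \<phi>(4) length_le_sdeg[of js] by auto
 with \<phi>(1-3) show ?thesis
  by (intro exI[of _ \<phi>], unfold_locales) auto
qed

context mollifier
begin

lemma \<phi>_cont: "continuous_on UNIV \<phi>"
 using smooth_C_diff[OF \<phi>_smooth, of 0] by simp

lemma snorm_le_half:
 assumes "!!i. \<bar>x $ i\<bar> <= 1 / 2" shows "snorm s x < 1"
proof -
 have "\<bar>x $ i\<bar> powr (1 / real (s i)) < 1" for i
 proof -
  have "\<bar>x $ i\<bar> powr (1 / real (s i)) <= (1 / 2) powr (1 / real (s i))"
   using assms by (intro powr_mono2) auto
  also have "... < 1 powr (1 / real (s i))" by (intro powr_less_mono2) auto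
  finally show ?thesis by simp
 qed
 thus ?thesis unfolding snorm_Max by (subst Max_less_iff) auto
qed

lemma \<phi>_supp_snorm: "\<phi> k ~= 0 ==> snorm s k < 1"
 using \<phi>_supp by (intro snorm_le_half) blast

definition box1 :: "(real ^ 'd) set" where
 "box1 = cbox (\<chi> i. - 1 / 2) (\<chi> i. 1 / 2)"

lemma mem_box1: "x \<in> box1 \<longleftrightarrow> (\<forall>i. \<bar>x $ i\<bar> <= 1 / 2)"
proof -
 have "- 1 / 2 <= a \<and> a <= 1 / 2 \<longleftrightarrow> \<bar>a\<bar> <= 1 / 2" for a :: real by linarith
 thus ?thesis by (simp add: box1_def mem_box_cart)
qed

lemma compact_box1: "compact box1" by (simp add: box1_def)

lemma \<phi>_outside: "k \<notin> box1 ==> \<phi> k = 0"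
 using \<phi>_supp mem_box1 by blast

lemma \<phi>_ccs: "ccs \<phi>"
 using \<phi>_cont compact_box1 \<phi>_outside by (rule ccs_compact)

definition avg :: "real => (real ^ 'd => real) => real ^ 'd => real" where
 "avg \<mu> = cv \<phi> (dil s \<mu>)"

lemma cont_dil: "continuous_on UNIV (dil s \<mu>)"
 by (intro continuous_intros)

definition \<phi>L1 :: real where "\<phi>L1 = (\<integral>k. \<bar>\<phi> k\<bar>)"

lemma \<phi>L1_nonneg: "0 <= \<phi>L1" by (simp add: \<phi>L1_def)

lemmas avg_C_diff = cv_C_diff[OF \<phi>_ccs cont_dil, folded avg_def]
lemmas partial_derivs_avg = partial_derivs_cv[OF \<phi>_ccs cont_dil, folded avg_def]
lemmas smooth_avg = smooth_cv[OF \<phi>_ccs cont_dil, folded avg_def]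
lemmas avg_lincomb = cv_lincomb[OF \<phi>_ccs cont_dil, folded avg_def]

lemma avg_continuous: "continuous_on UNIV \<psi> ==> continuous_on UNIV (avg \<mu> \<psi>)"
 using avg_C_diff[of 0] by simp

lemma avg_bound:
 assumes "continuous_on UNIV \<psi>" "0 <= \<mu>" "!!h. snorm s h <= \<mu> ==> \<bar>\<psi> (y - h)\<bar> <= M"
 shows "\<bar>avg \<mu> \<psi> y\<bar> <= \<phi>L1 * M"
 unfolding avg_def \<phi>L1_def
proof (rule cv_bound[OF \<phi>_ccs cont_dil assms(1)])
 fix k assume "\<phi> k ~= 0"
 hence "snorm s k < 1" by (rule \<phi>_supp_snorm)
 hence "snorm s (dil s \<mu> k) <= \<mu>" using assms(2) by (simp add: snorm_dil mult_left_le)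
 thus "\<bar>\<psi> (y - dil s \<mu> k)\<bar> <= M" by (rule assms(3))
qed

lemma avg_eq_0:
 assumes "0 <= \<mu>" "!!h. snorm s h <= \<mu> ==> \<psi> (y - h) = 0" shows "avg \<mu> \<psi> y = 0"
 unfolding avg_def
proof (rule cv_eq_0[OF \<phi>_ccs cont_dil])
 fix k assume "\<phi> k ~= 0"
 hence "snorm s k < 1" by (rule \<phi>_supp_snorm)
 hence "snorm s (dil s \<mu> k) <= \<mu>" using assms(1) by (simp add: snorm_dil mult_left_le)
 thus "\<psi> (y - dil s \<mu> k) = 0" by (rule assms(2))
qed

definition dcount :: "nat => real" where
 "dcount r = real (card {js :: 'd list. length js = r})"

lemma avg_approx:
 assumes "1 <= r" "r <= R" "C_diff r \<psi>" "0 <= \<mu>" "\<mu> <= 1"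
  and "!!js h. length js = r ==> snorm s h <= \<mu> ==> \<bar>partial_derivs js \<psi> (y - h)\<bar> <= M"
 shows "\<bar>avg \<mu> \<psi> y - \<psi> y\<bar> <= \<phi>L1 * (dcount r * \<mu> ^ r * M)"
 unfolding avg_def \<phi>L1_def dcount_def
 by (rule avg_error[OF \<phi>_ccs _ \<phi>_int _ assms(1,3,4,5)])
   (use \<phi>_supp_snorm \<phi>_mom assms in "auto intro: less_imp_le")

lemma avg_kernel:
 assumes "0 < \<mu>" "continuous_on UNIV \<psi>"
 shows "avg \<mu> \<psi> z = (\<integral>y. rescale s \<phi> \<mu> y z * \<psi> y)"
proof -
 define f where "f y = rescale s \<phi> \<mu> y z * \<psi> y" for y
 have f: "f \<in> borel_measurable borel"
  unfolding f_def rescale_dil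
  by (intro borel_measurable_continuous_onI continuous_intros
    continuous_on_compose2[OF \<phi>_cont] continuous_on_compose2[OF assms(2)]) (use assms in auto)
 have "(\<integral>y. f y) = (\<Prod>i\<in>UNIV. \<bar>- (\<mu> ^ s i)\<bar>) * (\<integral>k. f (z + (\<chi> i. - (\<mu> ^ s i) * k $ i)))"
  by (rule lborel_integral_affine) (use f assms in auto)
 also have "(\<Prod>i\<in>UNIV. \<bar>- (\<mu> ^ s i)\<bar>) = \<mu> ^ scale_deg s"
  using assms(1) by (simp add: prod_power_s)
 also have "(\<integral>k. f (z + (\<chi> i. - (\<mu> ^ s i) * k $ i))) =
   (\<integral>k. (1 / \<mu> ^ scale_deg s) * (\<phi> k * \<psi> (z - dil s \<mu> k)))"
 proof (rule Bochner_Integration.integral_cong[OF refl])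
  fix k
  have "z + (\<chi> i. - (\<mu> ^ s i) * k $ i) = z - dil s \<mu> k" by (simp add: vec_eq_iff)
  thus "f (z + (\<chi> i. - (\<mu> ^ s i) * k $ i)) = (1 / \<mu> ^ scale_deg s) * (\<phi> k * \<psi> (z - dil s \<mu> k))"
   using assms(1) by (simp add: f_def rescale_dil)
 qed
 finally show ?thesis using assms(1) by (simp add: f_def avg_def cv_def)
qed

text \<open>Fubini's theorem; the two averaging parameters enter symmetrically.\<close>

lemma avg_commute:
 assumes "continuous_on UNIV \<psi>" shows "avg a (avg b \<psi>) y = avg b (avg a \<psi>) y"
proof -
 let ?f = "\<lambda>k h. \<phi> k * \<phi> h * \<psi> (y - dil s a k - dil s b h)"
 have "integrable lborel (\<lambda>p. indicator (box1 \<times> box1) p *\<^sub>R ?f (fst p) (snd p))"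
  by (rule borel_integrable_compact)
   (auto intro!: compact_Times compact_box1 continuous_intros
    continuous_on_compose2[OF \<phi>_cont] continuous_on_compose2[OF assms])
 moreover have "(\<lambda>p. indicator (box1 \<times> box1) p *\<^sub>R ?f (fst p) (snd p)) = (\<lambda>(k, h). ?f k h)"
 proof
  fix p
  show "indicator (box1 \<times> box1) p *\<^sub>R ?f (fst p) (snd p) = (case p of (k, h) => ?f k h)"
   by (cases p; cases "p \<in> box1 \<times> box1") (auto simp: \<phi>_outside)
 qed
 ultimately have int: "integrable (lborel \<Otimes>\<^sub>M lborel) (\<lambda>(k, h). ?f k h)"
  by (simp add: lborel_prod)
 have "avg a (avg b \<psi>) y = (\<integral>k. (\<integral>h. ?f k h))"
  unfolding avg_def cv_def by (simp add: mult.assoc)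
 also have "... = (\<integral>h. (\<integral>k. ?f k h))"
  by (rule lborel_pair.Fubini_integral[OF int, symmetric])
 also have "... = (\<integral>h. (\<integral>k. \<phi> h * (\<phi> k * \<psi> (y - dil s b h - dil s a k))))"
 proof (intro Bochner_Integration.integral_cong refl)
  fix h k
  have e: "y - dil s a k - dil s b h = y - dil s b h - dil s a k" by (simp add: algebra_simps)
  show "?f k h = \<phi> h * (\<phi> k * \<psi> (y - dil s b h - dil s a k))" unfolding e by (rule mult.assoc[THEN trans, OF mult.left_commute])
 qed
 also have "... = avg b (avg a \<psi>) y"
  unfolding avg_def cv_def by simp
 finally show ?thesis .
qed

primrec band :: "nat => (real ^ 'd => real) => real ^ 'd => real" where
 "band 0 \<psi> = avg (1 / 2) \<psi>"
| "band (Suc n) \<psi> = (\<lambda>y. avg (eps (n + 2)) \<psi> y - avg (eps n) \<psi> y)"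

text \<open>Because averages commute, the piece \<open>avg (eps n) (band n \<psi>)\<close> is a difference of two consecutive
 products \<open>avg (eps n) (avg (eps (n + 1)) \<psi>)\<close>.\<close>

lemma band_telescope:
 assumes "continuous_on UNIV \<psi>"
 shows "(\<Sum>n\<le>N. avg (eps n) (band n \<psi>) y) = avg (eps N) (avg (eps (Suc N)) \<psi>) y"
proof (induction N)
 case 0
 thus ?case by simp
next
 case (Suc N)
 have "avg (eps (Suc N)) (band (Suc N) \<psi>) y =
   avg (eps (Suc N)) (avg (eps (N + 2)) \<psi>) y - avg (eps (Suc N)) (avg (eps N) \<psi>) y"
  using avg_lincomb[OF avg_continuous[OF assms] avg_continuous[OF assms],
    of "eps (Suc N)" 1 "eps (N + 2)" "-1" "eps N" y] by (simp del: power_Suc)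
 thus ?case using Suc avg_commute[OF assms, of "eps N" "eps (Suc N)" y]
  by (simp del: power_Suc band.simps)
qed

lemma band_C_diff: "C_diff k \<psi> ==> C_diff k (band n \<psi>)"
 by (cases n) (auto intro!: C_diff_diff avg_C_diff)

lemma smooth_band: "smooth \<psi> ==> smooth (band n \<psi>)"
 by (simp add: smooth_def band_C_diff)

lemma band_continuous: "continuous_on UNIV \<psi> ==> continuous_on UNIV (band n \<psi>)"
 using band_C_diff[of 0] by simp

lemma band_lincomb:
 assumes "continuous_on UNIV \<psi>" "continuous_on UNIV g"
 shows "band n (\<lambda>y. a * \<psi> y + b * g y) z = a * band n \<psi> z + b * band n g z"
 by (cases n) (auto simp: avg_lincomb[OF assms] algebra_simps)

lemma band_eq_0:
 assumes "!!h. snorm s h <= 1 ==> \<psi> (y - h) = 0" shows "band n \<psi> y = 0"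
proof -
 have "avg \<mu> \<psi> y = 0" if "0 <= \<mu>" "\<mu> <= 1" for \<mu>
  using that assms by (intro avg_eq_0) auto
 moreover have "eps m <= 1" for m by (simp add: power_le_one)
 ultimately have "avg (eps m) \<psi> y = 0" "avg (1 / 2) \<psi> y = 0" for m by auto
 thus ?thesis by (cases n) (simp_all del: power_Suc)
qed

definition Wsum :: "real => (real ^ 'd => real) => real ^ 'd => ennreal" where
 "Wsum \<beta> \<psi> y = (\<Sum>n. ennreal (eps n powr \<beta> * \<bar>band n \<psi> y\<bar>))"

lemma band_measurable: "continuous_on UNIV \<psi> ==> band n \<psi> \<in> borel_measurable borel"
 by (intro borel_measurable_continuous_onI band_continuous)

lemma Wsum_measurable: "continuous_on UNIV \<psi> ==> Wsum \<beta> \<psi> \<in> borel_measurable borel"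
 unfolding Wsum_def using band_measurable by measurable

definition CW0 :: "nat => real => real" where
 "CW0 r \<beta> = \<phi>L1 + (2 * \<phi>L1 * dcount r * (1 / 2) powr \<beta>) / (1 - 2 powr - (\<beta> + real r))"

text \<open>Both averages in \<open>band\<close> approximate \<open>\<psi>\<close> to order \<open>r\<close> in the scale.\<close>

lemma band_bound:
 assumes r: "1 <= r" "r <= R" and \<psi>: "C_diff r \<psi>"
  and M: "!!js h. length js <= r ==> snorm s h <= 1 ==> \<bar>partial_derivs js \<psi> (y - h)\<bar> <= M"
 shows "\<bar>band (Suc n) \<psi> y\<bar> <= 2 * \<phi>L1 * dcount r * eps n ^ r * M" and "\<bar>band 0 \<psi> y\<bar> <= \<phi>L1 * M"
proof -
 have M0: "0 <= M" using M[of "[]" 0] by simp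
 have d: "0 <= dcount r" by (simp add: dcount_def)
 have a: "\<bar>avg (eps m) \<psi> y - \<psi> y\<bar> <= \<phi>L1 * (dcount r * eps m ^ r * M)" for m
 proof (rule avg_approx[OF r \<psi>])
  show "eps m <= 1" by (simp add: power_le_one)
  thus "\<bar>partial_derivs js \<psi> (y - h)\<bar> <= M" if "length js = r" "snorm s h <= eps m" for js h
   using that by (intro M) auto
 qed simp
 have "\<phi>L1 * (dcount r * eps (n + 2) ^ r * M) <= \<phi>L1 * (dcount r * eps n ^ r * M)"
  using \<phi>L1_nonneg d M0 by (intro mult_left_mono mult_right_mono power_mono) (auto simp: power_decreasing)
 thus "\<bar>band (Suc n) \<psi> y\<bar> <= 2 * \<phi>L1 * dcount r * eps n ^ r * M"
  using a[of n] a[of "n + 2"] by simp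
 show "\<bar>band 0 \<psi> y\<bar> <= \<phi>L1 * M"
  using M[of "[]"] C_diff_imp_continuous[OF \<psi>] by (auto intro!: avg_bound)
qed

lemma Wsum_bound:
 assumes r: "1 <= r" "r <= R" "0 < \<beta> + real r" and \<psi>: "C_diff r \<psi>"
  and M: "!!js h. length js <= r ==> snorm s h <= 1 ==> \<bar>partial_derivs js \<psi> (y - h)\<bar> <= M"
 shows "Wsum \<beta> \<psi> y <= ennreal (CW0 r \<beta> * M)"
proof -
 have M0: "0 <= M" using M[of "[]" 0] by simp
 let ?c = "2 * \<phi>L1 * dcount r * (1 / 2) powr \<beta> * M"
 let ?q = "2 powr - (\<beta> + real r)"
 have q: "?q < 1" using r(3) by (rule two_powr_less_one)
 have c0: "0 <= ?c" using \<phi>L1_nonneg M0 by (simp add: dcount_def)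
 have t: "eps (Suc n) powr \<beta> * \<bar>band (Suc n) \<psi> y\<bar> <= ?c * ?q ^ n" for n
 proof -
  have e1: "eps (Suc n) powr \<beta> = (1 / 2) powr \<beta> * eps n powr \<beta>"
   by (simp add: powr_mult[symmetric])
  have "eps (Suc n) powr \<beta> * \<bar>band (Suc n) \<psi> y\<bar> <= eps (Suc n) powr \<beta> * (2 * \<phi>L1 * dcount r * eps n ^ r * M)"
   using band_bound(1)[OF r(1,2) \<psi> M] by (intro mult_left_mono) auto
  also have "... = (1 / 2) powr \<beta> * eps n powr \<beta> * (2 * \<phi>L1 * dcount r * eps n ^ r * M)"
   by (simp only: e1)
  also have "(1 / 2) powr \<beta> * eps n powr \<beta> * (2 * \<phi>L1 * dcount r * eps n ^ r * M) = ?c * (eps n powr \<beta> * eps n powr real r)"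
   by (simp add: powr_realpow)
  also have "eps n powr \<beta> * eps n powr real r = ?q ^ n"
   by (subst powr_add[symmetric]) (rule eps_powr)
  finally show ?thesis .
 qed
 have "Wsum \<beta> \<psi> y = (\<Sum>n. ennreal (eps (Suc n) powr \<beta> * \<bar>band (Suc n) \<psi> y\<bar>)) + ennreal (eps 0 powr \<beta> * \<bar>band 0 \<psi> y\<bar>)"
  unfolding Wsum_def using suminf_offset[OF summableI, of "\<lambda>n. ennreal (eps n powr \<beta> * \<bar>band n \<psi> y\<bar>)" 1]
  by (simp del: band.simps power_Suc)
 also have "... <= (\<Sum>n. ennreal (?c * ?q ^ n)) + ennreal (\<phi>L1 * M)"
 proof (rule add_mono)
  show "(\<Sum>n. ennreal (eps (Suc n) powr \<beta> * \<bar>band (Suc n) \<psi> y\<bar>)) <= (\<Sum>n. ennreal (?c * ?q ^ n))"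
   by (rule suminf_le[OF _ summableI summableI]) (rule ennreal_leI[OF t])
  show "ennreal (eps 0 powr \<beta> * \<bar>band 0 \<psi> y\<bar>) <= ennreal (\<phi>L1 * M)"
   using band_bound(2)[OF r(1,2) \<psi> M] by (intro ennreal_leI) simp
 qed
 also have "(\<Sum>n. ennreal (?c * ?q ^ n)) = ennreal (\<Sum>n. ?c * ?q ^ n)"
 proof (rule suminf_ennreal2)
  show "0 <= ?c * ?q ^ n" for n using c0 by simp
  show "summable (\<lambda>n. ?c * ?q ^ n)" using q by (intro summable_mult summable_geometric) simp
 qed
 also have "(\<Sum>n. ?c * ?q ^ n) = ?c / (1 - ?q)"
  using q by (subst suminf_mult) (auto intro!: summable_geometric simp: suminf_geometric)
 also have "ennreal (?c / (1 - ?q)) + ennreal (\<phi>L1 * M) = ennreal (CW0 r \<beta> * M)"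
  using c0 q \<phi>L1_nonneg M0 by (subst ennreal_plus[symmetric]) (auto simp: CW0_def algebra_simps)
 finally show ?thesis .
qed

section \<open>Band-pass pieces of a rescaled test function\<close>

lemma \<phi>_bounded: "\<exists>M. 0 <= M \<and> (\<forall>k. \<bar>\<phi> k\<bar> <= M)"
 by (rule ccs_bounded[OF \<phi>_ccs]) blast

definition \<phi>sup :: real where "\<phi>sup = (SOME M. 0 <= M \<and> (\<forall>k. \<bar>\<phi> k\<bar> <= M))"

lemma \<phi>sup: "0 <= \<phi>sup" "\<bar>\<phi> k\<bar> <= \<phi>sup"
 using someI_ex[OF \<phi>_bounded] unfolding \<phi>sup_def by auto

lemma avg_rescale:
 assumes "0 < l"
 shows "avg \<mu> (rescale s \<eta> l x) y = avg (\<mu> / l) \<eta> (dil s (1 / l) (y - x)) / l ^ scale_deg s"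
proof -
 have "dil s (1 / l) (y - dil s \<mu> k - x) = dil s (1 / l) (y - x) - dil s (\<mu> / l) k" for k
  by (simp add: vec_eq_iff algebra_simps power_divide)
 thus ?thesis unfolding avg_def cv_def rescale_dil
  by (simp del: times_divide_eq_right add: times_divide_eq_right[symmetric] divide_inverse mult.assoc[symmetric])
qed

lemma rescale_continuous:
 assumes "continuous_on UNIV \<eta>" shows "continuous_on UNIV (rescale s \<eta> l x)"
 unfolding rescale_dil divide_inverse[of _ "l ^ scale_deg s"]
 by (intro continuous_intros continuous_on_compose2[OF assms]) auto

lemma rescale_eq_0:
 assumes "!!z. 1 <= snorm s z ==> \<eta> z = 0" "0 < l" "l <= snorm s (y - x)"
 shows "rescale s \<eta> l x y = 0"
 unfolding rescale_dil using assms by (simp add: snorm_dil)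

lemma abs_rescale_le:
 assumes "0 < l" "!!z. \<bar>\<eta> z\<bar> <= M"
 shows "\<bar>rescale s \<eta> l x y\<bar> <= M / l ^ scale_deg s"
 using assms unfolding rescale_dil by (simp add: divide_right_mono)

lemma snorm_ball_measure:
 assumes "0 <= r"
 shows "emeasure lborel {y. snorm s (y - x) <= r} <= ennreal (2 ^ CARD('d) * r ^ scale_deg s)"
proof -
 have "emeasure lborel {y. snorm s (y - x) <= r} = emeasure (distr lborel borel ((+) (- x))) {h. snorm s h <= r}"
  by (subst emeasure_distr) (auto simp: vimage_def)
 also have "... = emeasure lborel {h. snorm s h <= r}" by (simp add: lborel_distr_plus)
 finally show ?thesis using emeasure_snorm_ball_le[OF assms] by simp
qed

lemma avg_rescale_sup:
 assumes \<eta>: "continuous_on UNIV \<eta>" "!!z. \<bar>\<eta> z\<bar> <= 1" "!!z. 1 <= snorm s z ==> \<eta> z = 0"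
  and "0 < l" "0 < \<mu>"
 shows "\<bar>avg \<mu> (rescale s \<eta> l x) y\<bar> <= \<phi>sup * 2 ^ CARD('d) / \<mu> ^ scale_deg s"
proof -
 let ?B = "{w. snorm s (w - x) <= l}"
 let ?c = "\<phi>sup / \<mu> ^ scale_deg s * (1 / l ^ scale_deg s)"
 have c0: "0 <= ?c" using \<phi>sup assms by auto
 have mB: "measure lborel ?B <= 2 ^ CARD('d) * l ^ scale_deg s" "emeasure lborel ?B < \<infinity>"
 proof -
  note * = snorm_ball_measure[of l x]
  show "emeasure lborel ?B < \<infinity>" using * \<open>0 < l\<close> by (intro le_less_trans[OF *]) auto
  hence "emeasure lborel ?B = ennreal (measure lborel ?B)" by (intro emeasure_eq_ennreal_measure) auto
  with * \<open>0 < l\<close> show "measure lborel ?B <= 2 ^ CARD('d) * l ^ scale_deg s" by simp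
 qed
 have sB: "?B \<in> sets lborel" by measurable
 have "\<bar>avg \<mu> (rescale s \<eta> l x) y\<bar> = \<bar>\<integral>w. rescale s \<phi> \<mu> w y * rescale s \<eta> l x w\<bar>"
  by (subst avg_kernel[OF \<open>0 < \<mu>\<close> rescale_continuous[OF \<eta>(1)]]) simp
 also have "... <= (\<integral>w. \<bar>rescale s \<phi> \<mu> w y * rescale s \<eta> l x w\<bar>)" by (rule integral_abs_bound)
 also have "... <= (\<integral>w. ?c * indicator ?B w)"
 proof (rule integral_mono')
  show "integrable lborel (\<lambda>w. ?c * indicator ?B w)"
   using mB(2) sB by (intro integrable_mult_right) (auto simp: integrable_indicator_iff)
  fix w
  show "\<bar>rescale s \<phi> \<mu> w y * rescale s \<eta> l x w\<bar> <= ?c * indicator ?B w"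
  proof (cases "w \<in> ?B")
   case True
   have "\<bar>rescale s \<phi> \<mu> w y\<bar> * \<bar>rescale s \<eta> l x w\<bar> <= (\<phi>sup / \<mu> ^ scale_deg s) * (1 / l ^ scale_deg s)"
    using \<phi>sup assms by (intro mult_mono abs_rescale_le) auto
   thus ?thesis using True by (simp add: abs_mult)
  next
   case False
   hence "rescale s \<eta> l x w = 0" using assms by (intro rescale_eq_0) auto
   thus ?thesis using False by simp
  qed
  show "0 <= ?c * indicator ?B w" using c0 by (simp add: indicator_def)
 qed
 also have "... = ?c * measure lborel ?B" using sB by simp
 also have "... <= ?c * (2 ^ CARD('d) * l ^ scale_deg s)" using mB(1) c0 by (rule mult_left_mono)
 also have "... = \<phi>sup * 2 ^ CARD('d) / \<mu> ^ scale_deg s" using assms by simp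
 finally show ?thesis .
qed

text \<open>The constants of the coarse and of the fine scales in \<open>Wsum_rescale\<close>.\<close>

definition CW1 :: "nat => real => real" where
 "CW1 r \<beta> = (2 * \<phi>L1 * dcount r * 2 ^ r * 2 ^ (scale_deg s + r)) / (1 - 2 powr - (\<beta> + real r)) +
   (2 * \<phi>sup * 2 ^ CARD('d) * 4 ^ scale_deg s) * (1 / 4) powr (\<beta> - real (scale_deg s)) /
    (1 - 2 powr - (real (scale_deg s) - \<beta>))"

lemma CW1_nonneg: "0 < \<beta> + real r ==> \<beta> < 0 ==> 0 <= CW1 r \<beta>"
 unfolding CW1_def
 using two_powr_less_one[of "\<beta> + real r"] two_powr_less_one[of "real (scale_deg s) - \<beta>"]
  \<phi>sup(1) \<phi>L1_nonneg
 by (intro add_nonneg_nonneg divide_nonneg_nonneg mult_nonneg_nonneg) (auto simp: dcount_def)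

text \<open>Let \<open>m\<close> be the larger of the test scale \<open>l\<close> and the distance of \<open>y\<close> from \<open>x\<close>. At scales above \<open>m\<close>
 only the sup bound of the averages is used, giving a geometric series dominated by its smallest scale.
 At scales below \<open>m\<close> a piece is either out of reach of the support of the test function and vanishes, or
 \<open>m\<close> is comparable to \<open>l\<close> and the moments of the mollifier win \<open>r\<close> orders, which beats \<open>\<beta> < 0\<close> since
 \<open>\<beta> + r > 0\<close>.\<close>

lemma Wsum_rescale:
 assumes r: "1 <= r" "r <= R" "0 < \<beta> + real r" "\<beta> < 0"
  and \<eta>: "C_diff r \<eta>" "!!js z. length js <= r ==> \<bar>partial_derivs js \<eta> z\<bar> <= 1"
   "!!z. 1 <= snorm s z ==> \<eta> z = 0"
  and l: "0 < l" "l <= 1"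
 shows "Wsum \<beta> (rescale s \<eta> l x) y \<le>
  ennreal (CW1 r \<beta> * (if snorm s (y - x) < 3
    then max l (snorm s (y - x)) powr (\<beta> - real (scale_deg s)) else 0))"
proof (cases "snorm s (y - x) < 3")
 case False
 have "rescale s \<eta> l x (y - h) = 0" if "snorm s h <= 1" for h
 proof (rule rescale_eq_0[OF \<eta>(3) l(1)])
  have "snorm s (y - x) <= snorm s (y - h - x) + snorm s h"
   using snorm_triangle[of "y - h - x" h] by (simp add: algebra_simps)
  thus "l <= snorm s (y - h - x)" using False that l by linarith
 qed
 hence "band n (rescale s \<eta> l x) y = 0" for n by (intro band_eq_0) auto
 thus ?thesis by (simp add: Wsum_def)
next
 case True
 let ?d = "scale_deg s" and ?\<psi> = "rescale s \<eta> l x"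
 define m where "m = max l (snorm s (y - x))"
 have m: "0 < m" "l <= m" using l by (auto simp: m_def)
 have cont: "continuous_on UNIV \<eta>" using \<eta>(1) by (rule C_diff_imp_continuous)
 have \<eta>1: "\<bar>\<eta> z\<bar> <= 1" for z using \<eta>(2)[of "[]"] by simp
 define A where "A = 2 * \<phi>L1 * dcount r * 2 ^ r * 2 ^ (?d + r)"
 define B where "B = 2 * \<phi>sup * 2 ^ CARD('d) * 4 ^ ?d"
 have AB: "0 <= A" "0 <= B" using \<phi>L1_nonneg \<phi>sup(1) by (auto simp: A_def B_def dcount_def)
 let ?M = "A * m powr - (real ?d + real r)"
  and ?F = "\<lambda>n. if eps n <= m then eps n powr (\<beta> + real r) else 0"
  and ?S = "\<lambda>n. if m / 4 < eps n then eps n powr - (real ?d - \<beta>) else 0"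
  and ?p = "1 - 2 powr - (\<beta> + real r)"
  and ?q = "1 - 2 powr - (real ?d - \<beta>)"
 have sup: "\<bar>avg \<mu> ?\<psi> y\<bar> <= \<phi>sup * 2 ^ CARD('d) / \<mu> ^ ?d" if "0 < \<mu>" for \<mu>
  using avg_rescale_sup[OF cont \<eta>1 \<eta>(3) l(1) that] by blast
 have near: "snorm s (y - x) < l + \<mu>" if "0 <= \<mu>" "avg \<mu> ?\<psi> y ~= 0" for \<mu>
 proof (rule ccontr)
  assume *: "\<not> ?thesis"
  have "?\<psi> (y - h) = 0" if "snorm s h <= \<mu>" for h
  proof (rule rescale_eq_0[OF \<eta>(3) l(1)])
   have "snorm s (y - x) <= snorm s (y - h - x) + snorm s h"
    using snorm_triangle[of "y - h - x" h] by (simp add: algebra_simps)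
   thus "l <= snorm s (y - h - x)" using * that by linarith
  qed
  hence "avg \<mu> ?\<psi> y = 0" using \<open>0 <= \<mu>\<close> by (intro avg_eq_0)
  with that show False by simp
 qed
 have B1: "\<bar>band n ?\<psi> y\<bar> <= B * eps n powr - real ?d" for n
 proof -
  have e: "B * eps n powr - real ?d = 2 * \<phi>sup * 2 ^ CARD('d) / (eps n / 4) ^ ?d"
  proof -
   have "B * e powr - real ?d = 2 * \<phi>sup * 2 ^ CARD('d) / (e / 4) ^ ?d" if "0 < e" for e
    using that by (simp add: B_def powr_minus_divide powr_realpow power_divide)
   thus ?thesis by simp
  qed
  have mon: "\<phi>sup * 2 ^ CARD('d) / \<mu> ^ ?d <= \<phi>sup * 2 ^ CARD('d) / (eps n / 4) ^ ?d" if "eps n / 4 <= \<mu>" for \<mu>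
  proof -
   have "0 < \<mu>" using that less_le_trans[of 0 "eps n / 4" \<mu>] by simp
   thus ?thesis using that \<phi>sup(1) by (intro divide_left_mono power_mono mult_pos_pos zero_less_power) auto
  qed
  have p: "0 <= \<phi>sup * 2 ^ CARD('d) / (eps n / 4) ^ ?d" using \<phi>sup(1) by simp
  show ?thesis
  proof (cases n)
   case 0
   thus ?thesis unfolding e using sup[of "1 / 2"] mon[of "1 / 2"] p by simp
  next
   case (Suc k)
   have "\<bar>avg (eps (k + 2)) ?\<psi> y\<bar> <= \<phi>sup * 2 ^ CARD('d) / (eps n / 4) ^ ?d"
    using sup[of "eps (k + 2)"] mon[of "eps (k + 2)"] Suc by simp
   moreover have "\<bar>avg (eps k) ?\<psi> y\<bar> <= \<phi>sup * 2 ^ CARD('d) / (eps n / 4) ^ ?d"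
    using sup[of "eps k"] mon[of "eps k"] Suc by simp
   ultimately show ?thesis unfolding e unfolding Suc band.simps by linarith
  qed
 qed
 have B2: "\<bar>band (Suc k) ?\<psi> y\<bar> <= ?M * eps (Suc k) powr real r"
  if k: "eps k <= l" "m < 2 * l" for k
 proof -
  let ?z = "dil s (1 / l) (y - x)"
  have a: "\<bar>avg (eps j / l) \<eta> ?z - \<eta> ?z\<bar> <= \<phi>L1 * (dcount r * (eps j / l) ^ r * 1)" if "eps j <= l" for j
  proof (rule avg_approx[OF r(1,2) \<eta>(1)])
   show "0 <= eps j / l" "eps j / l <= 1" using that l by simp_all
   show "\<bar>partial_derivs js \<eta> (?z - h)\<bar> <= 1" if "length js = r" for js h
    using that by (intro \<eta>(2)) simp
  qed
  have mono: "(eps (k + 2) / l) ^ r <= (eps k / l) ^ r"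
   using l by (intro power_mono divide_right_mono power_decreasing) auto
  have "eps (k + 2) <= eps k" by (rule power_decreasing) auto
  hence "eps (k + 2) <= l" using k(1) by linarith
  hence "\<bar>avg (eps (k + 2) / l) \<eta> ?z - avg (eps k / l) \<eta> ?z\<bar> \<le>
    \<phi>L1 * (dcount r * (eps (k + 2) / l) ^ r * 1) + \<phi>L1 * (dcount r * (eps k / l) ^ r * 1)"
   using a[of k] a[of "k + 2"] k by linarith
  also have "... <= 2 * \<phi>L1 * dcount r * (eps k / l) ^ r"
  proof -
   have "\<phi>L1 * (dcount r * (eps (k + 2) / l) ^ r) <= \<phi>L1 * (dcount r * (eps k / l) ^ r)"
    using mono \<phi>L1_nonneg by (intro mult_left_mono) (auto simp: dcount_def)
   thus ?thesis by simp
  qed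
  finally have "\<bar>band (Suc k) ?\<psi> y\<bar> <= 2 * \<phi>L1 * dcount r * (eps k / l) ^ r / l ^ ?d"
   unfolding band.simps avg_rescale[OF l(1)] diff_divide_distrib[symmetric] abs_divide
   using l by (simp add: divide_right_mono)
  also have "... = (2 * \<phi>L1 * dcount r * 2 ^ r) * (1 / l) ^ (?d + r) * eps (Suc k) ^ r"
  proof -
   have "a * (e / l) ^ r / l ^ ?d = a * 2 ^ r * (1 / l) ^ (?d + r) * (1 / 2 * e) ^ r" for a e :: real
    by (simp add: power_divide power_add power_mult_distrib)
   thus ?thesis by simp
  qed
  also have "... <= (2 * \<phi>L1 * dcount r * 2 ^ r) * (2 / m) ^ (?d + r) * eps (Suc k) ^ r"
   using k m l \<phi>L1_nonneg
   by (intro mult_right_mono mult_left_mono power_mono) (auto simp: dcount_def field_simps)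
  also have "... = ?M * eps (Suc k) powr real r"
  proof -
   have "m powr - (real ?d + real r) = inverse (m ^ (?d + r))"
    unfolding powr_minus of_nat_add[symmetric] using m by (simp only: powr_realpow)
   moreover have "eps (Suc k) powr real r = eps (Suc k) ^ r" by (rule powr_realpow) simp
   moreover have "(2 / m) ^ (?d + r) = 2 ^ (?d + r) * inverse (m ^ (?d + r))"
    unfolding power_divide by (rule divide_inverse)
   ultimately show ?thesis by (simp only: A_def mult_ac)
  qed
  finally show ?thesis .
 qed
 have dich: "band n ?\<psi> y = 0 \<or> m / 4 < eps n \<or>
   (eps n <= m \<and> \<bar>band n ?\<psi> y\<bar> <= ?M * eps n powr real r)" for n
 proof (cases "band n ?\<psi> y = 0")
  case nz: False
  show ?thesis
  proof (cases n)
   case 0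
   hence "snorm s (y - x) < l + 1 / 2" using nz by (intro near) auto
   thus ?thesis using 0 l by (simp add: m_def)
  next
   case (Suc k)
   have le: "eps (k + 2) <= eps k" by (intro power_decreasing) auto
   have "avg (eps (k + 2)) ?\<psi> y ~= 0 \<or> avg (eps k) ?\<psi> y ~= 0" using nz Suc by auto
   hence nr: "snorm s (y - x) < l + eps k"
   proof
    assume "avg (eps (k + 2)) ?\<psi> y ~= 0"
    hence "snorm s (y - x) < l + eps (k + 2)" by (intro near) auto
    with le show ?thesis by linarith
   next
    assume "avg (eps k) ?\<psi> y ~= 0"
    thus ?thesis by (intro near) auto
   qed
   show ?thesis
   proof (cases "eps k <= l")
    case True
    hence "m < 2 * l" using nr l by (simp add: m_def)
    from B2[OF True this] True m Suc show ?thesis by simp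
   next
    case False
    have "0 < eps k" by simp
    hence "l < 2 * eps k" "snorm s (y - x) < 2 * eps k" using False nr by linarith+
    hence "m < 2 * eps k" by (simp add: m_def)
    hence "m < 4 * eps n" using Suc by simp
    thus ?thesis by simp
   qed
  qed
 qed simp
 have piece: "ennreal (eps n powr \<beta> * \<bar>band n ?\<psi> y\<bar>) \<le>
   ennreal ?M * ennreal (?F n) +
   ennreal B * ennreal (?S n)" for n
 proof -
  have "eps n powr \<beta> * \<bar>band n ?\<psi> y\<bar> \<le>
   ?M * (?F n) +
   B * (?S n)"
   (is "?L <= ?T1 + ?T2")
  proof -
   have T: "0 <= ?T1" "0 <= ?T2" using AB by auto
   have e1: "eps n powr (\<beta> + real r) = eps n powr \<beta> * eps n powr real r" by (rule powr_add)
   have e2: "eps n powr - (real ?d - \<beta>) = eps n powr \<beta> * eps n powr - real ?d"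
    by (subst powr_add[symmetric]) simp
   consider "band n ?\<psi> y = 0" | "m / 4 < eps n" |
    "eps n <= m" "\<bar>band n ?\<psi> y\<bar> <= ?M * eps n powr real r"
    using dich[of n] by blast
   thus ?thesis
   proof cases
    case 1
    hence "?L = 0" by simp
    thus ?thesis using T by linarith
   next
    case 2
    have "?L <= eps n powr \<beta> * (B * eps n powr - real ?d)" by (intro mult_left_mono B1) simp
    also have "... = ?T2" using 2 unfolding e2 by simp
    finally show ?thesis using T by linarith
   next
    case 3
    have "?L <= eps n powr \<beta> * (?M * eps n powr real r)"
     by (intro mult_left_mono 3(2)) simp
    also have "... = ?T1" using 3(1) unfolding e1 by simp
    finally show ?thesis using T by linarith
   qed
  qed
  thus ?thesis using AB by (simp add: ennreal_mult[symmetric] ennreal_plus[symmetric] ennreal_leI del: ennreal_plus)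
 qed
 have m4: "0 < m / 4" using m by simp
 have d\<beta>: "0 < real ?d - \<beta>" using r(4) by simp
 have "Wsum \<beta> ?\<psi> y <= (\<Sum>n. ennreal ?M * ennreal (?F n) +
   ennreal B * ennreal (?S n))"
  unfolding Wsum_def by (rule suminf_le[OF piece summableI summableI])
 also have "... = ennreal ?M * (\<Sum>n. ennreal (?F n)) +
   ennreal B * (\<Sum>n. ennreal (?S n))"
  by (simp only: suminf_add[OF summableI summableI, symmetric] ennreal_suminf_cmult)
 also have "... <= ennreal ?M * ennreal (m powr (\<beta> + real r) / ?p) +
   ennreal B * ennreal ((m / 4) powr - (real ?d - \<beta>) / ?q)"
  by (intro add_mono mult_left_mono dyadic_sum_below[OF r(3) m(1)] dyadic_sum_above[OF d\<beta> m4]) auto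
 also have "... = ennreal (?M * (m powr (\<beta> + real r) / ?p) +
   B * ((m / 4) powr - (real ?d - \<beta>) / ?q))"
  using AB two_powr_less_one[OF r(3)] two_powr_less_one[OF d\<beta>] m
  by (subst ennreal_mult[symmetric], simp, simp, subst ennreal_mult[symmetric], simp, simp, subst ennreal_plus) auto
 also have "?M * (m powr (\<beta> + real r) / ?p) +
   B * ((m / 4) powr - (real ?d - \<beta>) / ?q) = CW1 r \<beta> * m powr (\<beta> - real ?d)"
 proof -
  have 1: "m powr - (real ?d + real r) * m powr (\<beta> + real r) = m powr (\<beta> - real ?d)"
   by (subst powr_add[symmetric]) (simp add: algebra_simps)
  have 2: "(m / 4) powr - (real ?d - \<beta>) = (1 / 4) powr (\<beta> - real ?d) * m powr (\<beta> - real ?d)"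
   using m powr_mult[of "1 / 4" m "\<beta> - real ?d"] by simp
  have "?M * (m powr (\<beta> + real r) / ?p) =
    A / ?p * m powr (\<beta> - real ?d)"
   unfolding 1[symmetric] by simp
  thus ?thesis unfolding CW1_def A_def[symmetric] B_def[symmetric] 2
   by (simp only: distrib_right) simp
 qed
 finally show ?thesis using True by (simp add: m_def)
qed

end

section \<open>Tempered distributions on compactly supported functions\<close>

lemma smooth_imp_continuous: "smooth f ==> continuous_on UNIV f"
 using smooth_C_diff[of f 0] by simp

lemma schwartz_norm_le:
 assumes "!!js x. length js <= N ==> (1 + norm x) ^ N * \<bar>partial_derivs js f x\<bar> <= M"
 shows "schwartz_norm N f <= ennreal M"
 unfolding schwartz_norm_def using assms by (auto intro!: SUP_least ennreal_leI)

lemma schwartz_norm_ge: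
 assumes "length js <= N"
 shows "ennreal ((1 + norm x) ^ N * \<bar>partial_derivs js f x\<bar>) <= schwartz_norm N f"
 unfolding schwartz_norm_def
 by (rule SUP_upper2[of js], use assms in simp, rule SUP_upper) simp

lemma C_norm_ge: "length js <= r ==> ennreal \<bar>partial_derivs js f x\<bar> <= C_norm r f"
 unfolding C_norm_def by (rule SUP_upper2[of js], simp, rule SUP_upper) simp

lemma partial_derivs_bounded:
 fixes f :: "real ^ 'd::finite => real"
 assumes "C_diff N f" "!!x. \<rho> < norm x ==> f x = 0"
 shows "\<exists>M\<ge>0. \<forall>js x. length js <= N --> \<bar>partial_derivs js f x\<bar> <= M"
proof -
 have fin: "finite {js :: 'd list. length js <= N}"
  using finite_lists_length_le[of "UNIV :: 'd set" N] by simp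
 have zero: "partial_derivs js f x = 0" if "x \<notin> cball 0 \<rho>" for js x
  by (rule partial_derivs_eq_0_outside[of "cball 0 \<rho>"]) (use assms that in auto)
 have "\<exists>M. \<forall>x. \<bar>partial_derivs js f x\<bar> <= M" if "length js <= N" for js
 proof -
  have "ccs (partial_derivs js f)"
   by (rule ccs_compact[of _ "cball 0 \<rho>"])
     (use partial_derivs_continuous[OF assms(1) that] zero in auto)
  thus ?thesis using ccs_bounded by metis
 qed
 then obtain M where M: "\<forall>js. length js <= N --> (\<forall>x. \<bar>partial_derivs js f x\<bar> <= M js)" by metis
 have "\<bar>partial_derivs js f x\<bar> <= (\<Sum>ks :: 'd list | length ks <= N. \<bar>M ks\<bar>)" if "length js <= N" for js x
 proof -
  have "\<bar>partial_derivs js f x\<bar> <= \<bar>M js\<bar>" using M that abs_ge_self order_trans by blast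
  also have "... <= (\<Sum>ks :: 'd list | length ks <= N. \<bar>M ks\<bar>)" using fin that by (intro member_le_sum) auto
  finally show ?thesis .
 qed
 thus ?thesis by (intro exI[of _ "\<Sum>ks :: 'd list | length ks <= N. \<bar>M ks\<bar>"]) (auto intro: sum_nonneg)
qed

lemma schwartz_norm_compact:
 assumes "0 <= \<rho>" "!!x. \<rho> < norm x ==> f x = 0"
  and M: "!!js x. length js <= N ==> \<bar>partial_derivs js f x\<bar> <= M"
 shows "schwartz_norm N f <= ennreal ((1 + \<rho>) ^ N * M)"
proof (rule schwartz_norm_le)
 fix js :: "'a list" and x assume js: "length js <= N"
 have M0: "0 <= M" using M[OF js] abs_ge_zero order_trans by blast
 show "(1 + norm x) ^ N * \<bar>partial_derivs js f x\<bar> <= (1 + \<rho>) ^ N * M"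
 proof (cases "norm x <= \<rho>")
  case True
  thus ?thesis using M[OF js] assms(1) by (intro mult_mono power_mono) auto
 next
  case False
  have "partial_derivs js f x = 0"
   by (rule partial_derivs_eq_0_outside[of "cball 0 \<rho>"]) (use assms False in auto)
  thus ?thesis using assms(1) M0 by simp
 qed
qed

lemma schwartz_compact:
 assumes "smooth f" "!!x. \<rho> < norm x ==> f x = 0"
 shows "f \<in> schwartz"
proof -
 have "schwartz_norm N f < \<infinity>" for N
 proof -
  obtain M where "\<forall>js x. length js <= N --> \<bar>partial_derivs js f x\<bar> <= M"
   using partial_derivs_bounded[OF smooth_C_diff[OF assms(1)] assms(2)] by blast
  hence "schwartz_norm N f <= ennreal ((1 + \<bar>\<rho>\<bar>) ^ N * M)"
   using assms(2) by (intro schwartz_norm_compact) auto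
  thus ?thesis by (rule le_less_trans) simp
 qed
 with assms(1) show ?thesis by (simp add: schwartz_def)
qed

lemma tempered_lincomb:
 "\<xi> \<in> tempered ==> \<phi> \<in> schwartz ==> \<psi> \<in> schwartz ==>
  \<xi> (\<lambda>y. a * \<phi> y + b * \<psi> y) = a * \<xi> \<phi> + b * \<xi> \<psi>"
 unfolding tempered_def by blast

lemma tempered_zero: "\<xi> \<in> tempered ==> \<xi> (\<lambda>y. 0) = 0"
 using tempered_lincomb[of \<xi> "\<lambda>y. 0" "\<lambda>y. 0" 0 0] schwartz_compact[OF smooth_zero] by simp

lemma tempered_cmult: "\<xi> \<in> tempered ==> \<phi> \<in> schwartz ==> \<xi> (\<lambda>y. a * \<phi> y) = a * \<xi> \<phi>"
 using tempered_lincomb[of \<xi> \<phi> \<phi> a 0] by simp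

lemma tempered_diff:
 "\<xi> \<in> tempered ==> \<phi> \<in> schwartz ==> \<psi> \<in> schwartz ==> \<xi> (\<lambda>y. \<phi> y - \<psi> y) = \<xi> \<phi> - \<xi> \<psi>"
 using tempered_lincomb[of \<xi> \<phi> \<psi> 1 "-1"] by simp

lemma smooth_sum:
 assumes "finite V" "!!v. v \<in> V ==> smooth (f v)"
 shows "smooth (\<lambda>x. \<Sum>v\<in>V. c v * f v x)"
 unfolding smooth_def using assms by (intro allI partial_derivs_sum(1)) (simp_all add: smooth_C_diff)

lemma tempered_sum:
 assumes "\<xi> \<in> tempered" "finite V" "!!v. v \<in> V ==> smooth (f v)" "!!v x. v \<in> V ==> \<rho> < norm x ==> f v x = 0"
 shows "\<xi> (\<lambda>x. \<Sum>v\<in>V. c v * f v x) = (\<Sum>v\<in>V. c v * \<xi> (f v))"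
 using assms(2,3,4)
proof (induction V rule: finite_induct)
 case empty
 thus ?case using tempered_zero[OF assms(1)] by simp
next
 case (insert v V)
 have eq: "(\<lambda>x. \<Sum>v\<in>insert v V. c v * f v x) = (\<lambda>x. c v * f v x + 1 * (\<Sum>v\<in>V. c v * f v x))"
  using insert by simp
 have "smooth (\<lambda>x. \<Sum>v\<in>V. c v * f v x)" using insert by (intro smooth_sum) auto
 hence 1: "(\<lambda>x. \<Sum>v\<in>V. c v * f v x) \<in> schwartz"
  by (rule schwartz_compact[of _ \<rho>]) (use insert in "auto intro!: sum.neutral")
 have 2: "f v \<in> schwartz" using insert by (intro schwartz_compact[of _ \<rho>]) auto
 show ?case unfolding eq tempered_lincomb[OF assms(1) 2 1] using insert by simp
qed

text \<open>On functions supported in a fixed ball the polynomial weight of a Schwartz seminorm is bounded.\<close>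

lemma tempered_compact_bound:
 fixes \<xi> :: "'d::finite functional"
 assumes "\<xi> \<in> tempered" "0 <= \<rho>"
 obtains C N where "0 <= C"
  "!!f M. smooth f ==> (!!x. \<rho> < norm x ==> f x = 0) ==>
   (!!js x. length js <= N ==> \<bar>partial_derivs js f x\<bar> <= M) ==> \<bar>\<xi> f\<bar> <= C * M"
proof -
 obtain C N where C: "\<forall>\<phi>\<in>schwartz. ennreal \<bar>\<xi> \<phi>\<bar> <= ennreal C * schwartz_norm N \<phi>"
  using assms(1) unfolding tempered_def by blast
 show ?thesis
 proof (rule that[of "max C 0 * (1 + \<rho>) ^ N" N])
  show "0 <= max C 0 * (1 + \<rho>) ^ N" using assms by simp
  fix f :: "real ^ 'd => real" and M
  assume f: "smooth f" "!!x. \<rho> < norm x ==> f x = 0"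
   "!!js x. length js <= N ==> \<bar>partial_derivs js f x\<bar> <= M"
  have M0: "0 <= M" using f(3)[of "[]" 0] by simp
  have "ennreal \<bar>\<xi> f\<bar> <= ennreal C * schwartz_norm N f"
   using C schwartz_compact[OF f(1,2)] by blast
  also have "... <= ennreal (max C 0) * ennreal ((1 + \<rho>) ^ N * M)"
   by (intro mult_mono schwartz_norm_compact assms f ennreal_leI) auto
  also have "... = ennreal (max C 0 * ((1 + \<rho>) ^ N * M))" by (rule ennreal_mult[symmetric]) (use M0 assms in auto)
  finally have "\<bar>\<xi> f\<bar> <= max C 0 * ((1 + \<rho>) ^ N * M)"
   using M0 assms by (subst (asm) ennreal_le_iff) auto
  thus "\<bar>\<xi> f\<bar> <= max C 0 * (1 + \<rho>) ^ N * M" by (simp add: mult.assoc)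
 qed
qed

text \<open>Integrals against a compactly supported density are limits of finite sums, with one rate for
 all Lipschitz integrands; a partition of unity keeps everything continuous.\<close>

lemma riemann_sums:
 fixes w :: "real ^ 'd::finite => real"
 assumes w: "ccs w" "!!x. \<rho> < norm x ==> w x = 0" and \<delta>: "0 < \<delta>"
 obtains V c where "finite V" "V \<subseteq> cball 0 \<rho>"
  "!!H L. continuous_on UNIV H ==> 0 <= L ==>
   (!!x y. norm x <= \<rho> ==> norm y <= \<rho> ==> \<bar>H x - H y\<bar> <= L * norm (x - y)) ==>
   \<bar>(\<integral>y. w y * H y) - (\<Sum>v\<in>V. c v * H v)\<bar> <= L * \<delta> * (\<integral>y. \<bar>w y\<bar>)"
proof -
 obtain V where V: "finite V" "V \<subseteq> cball (0 :: real ^ 'd) \<rho>" "cball 0 \<rho> \<subseteq> (\<Union>x\<in>V. ball x \<delta>)"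
 proof (rule compactE_image[of "cball (0 :: real ^ 'd) \<rho>" "cball 0 \<rho>" "\<lambda>v. ball v \<delta>"])
  show "cball 0 \<rho> \<subseteq> (\<Union>x\<in>cball (0 :: real ^ 'd) \<rho>. ball x \<delta>)"
   using \<delta> centre_in_ball by blast
 qed auto
 define b where "b v y = max 0 (\<delta> - norm (y - v))" for v y :: "real ^ 'd"
 define p where "p v y = b v y / (\<Sum>u\<in>V. b u y)" for v y
 have b0: "0 <= b v y" for v y by (simp add: b_def)
 have pos: "0 < (\<Sum>u\<in>V. b u y)" if y: "norm y <= \<rho>" for y
 proof -
  obtain v where "v \<in> V" "y \<in> ball v \<delta>" using V(3) y by (auto simp: subset_iff)
  thus ?thesis using V(1) b0 by (intro sum_pos2[of V v]) (auto simp: b_def dist_norm norm_minus_commute)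
 qed
 have p0: "0 <= p v y" for v y unfolding p_def by (intro divide_nonneg_nonneg sum_nonneg b0)
 have p1: "(\<Sum>v\<in>V. p v y) = 1" if "norm y <= \<rho>" for y
  unfolding p_def sum_divide_distrib[symmetric] using pos[OF that] by simp
 have pnear: "norm (y - v) <= \<delta>" if "p v y ~= 0" for v y
  using that unfolding p_def b_def by (auto simp: max_def split: if_splits)
 have bm: "b v \<in> borel_measurable borel" for v
  unfolding b_def by (intro borel_measurable_continuous_onI continuous_intros)
 have pm: "p v \<in> borel_measurable borel" for v
  unfolding p_def using bm by measurable
 have ple: "\<bar>w y * p v y\<bar> <= \<bar>w y\<bar>" if "v \<in> V" for v y
 proof (cases "norm y <= \<rho>")
  case True
  have "p v y <= (\<Sum>u\<in>V. p u y)" using that V(1) p0 by (intro member_le_sum) auto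
  hence "p v y <= 1" using p1[OF True] by simp
  thus ?thesis using p0[of v y] by (simp add: abs_mult mult_left_le)
 qed (simp add: w)
 have wi: "integrable lborel w" by (rule ccs_integrable[OF w(1)])
 have wm: "w \<in> borel_measurable borel" by (rule ccs_measurable[OF w(1)])
 have wpi: "integrable lborel (\<lambda>y. w y * p v y)" if "v \<in> V" for v
  by (rule Bochner_Integration.integrable_bound[OF wi])
    (use ple[OF that] wm pm in "auto intro!: borel_measurable_times")
 define c where "c v = (\<integral>y. w y * p v y)" for v
 show ?thesis
 proof (rule that[of V c])
  fix H :: "real ^ 'd => real" and L
  assume H: "continuous_on UNIV H" "0 <= L"
   "!!x y. norm x <= \<rho> ==> norm y <= \<rho> ==> \<bar>H x - H y\<bar> <= L * norm (x - y)"
  have Hi: "integrable lborel (\<lambda>y. w y * H y)" by (rule ccs_integrable_mult[OF w(1) H(1)])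
  have si: "integrable lborel (\<lambda>y. \<Sum>v\<in>V. (w y * p v y) * H v)"
   by (intro Bochner_Integration.integrable_sum integrable_mult_left wpi)
  have "(\<Sum>v\<in>V. c v * H v) = (\<Sum>v\<in>V. \<integral>y. (w y * p v y) * H v)"
   unfolding c_def by simp
  also have "... = (\<integral>y. (\<Sum>v\<in>V. (w y * p v y) * H v))"
   by (rule Bochner_Integration.integral_sum[symmetric]) (intro integrable_mult_left wpi)
  finally have "\<bar>(\<integral>y. w y * H y) - (\<Sum>v\<in>V. c v * H v)\<bar> =
    \<bar>\<integral>y. w y * H y - (\<Sum>v\<in>V. (w y * p v y) * H v)\<bar>"
   using Hi si by simp
  also have "... <= (\<integral>y. \<bar>w y * H y - (\<Sum>v\<in>V. (w y * p v y) * H v)\<bar>)" by (rule integral_abs_bound)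
  also have "... <= (\<integral>y. \<bar>w y\<bar> * (L * \<delta>))"
  proof (rule integral_mono)
   show "integrable lborel (\<lambda>y. \<bar>w y * H y - (\<Sum>v\<in>V. (w y * p v y) * H v)\<bar>)"
    using Hi si by (intro integrable_abs Bochner_Integration.integrable_diff)
   show "integrable lborel (\<lambda>y. \<bar>w y\<bar> * (L * \<delta>))" using wi by (intro integrable_mult_left integrable_abs)
   fix y
   show "\<bar>w y * H y - (\<Sum>v\<in>V. (w y * p v y) * H v)\<bar> <= \<bar>w y\<bar> * (L * \<delta>)"
   proof (cases "norm y <= \<rho>")
    case True
    have "H y = (\<Sum>v\<in>V. p v y * H y)" using p1[OF True] by (simp add: sum_distrib_right[symmetric])
    hence "w y * H y - (\<Sum>v\<in>V. (w y * p v y) * H v) = w y * (\<Sum>v\<in>V. p v y * (H y - H v))"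
     by (simp add: right_diff_distrib sum_subtractf sum_distrib_left mult.assoc)
    moreover have "\<bar>\<Sum>v\<in>V. p v y * (H y - H v)\<bar> <= (\<Sum>v\<in>V. p v y * (L * \<delta>))"
    proof (rule order_trans[OF sum_abs], rule sum_mono)
     fix v assume v: "v \<in> V"
     have "\<bar>H y - H v\<bar> <= L * \<delta>" if "p v y ~= 0"
     proof -
      have "\<bar>H y - H v\<bar> <= L * norm (y - v)" using V(2) v True by (intro H(3)) auto
      also have "... <= L * \<delta>" using pnear[OF that] H(2) by (intro mult_left_mono)
      finally show ?thesis .
     qed
     thus "\<bar>p v y * (H y - H v)\<bar> <= p v y * (L * \<delta>)"
      using p0[of v y] by (cases "p v y = 0") (auto simp: abs_mult intro: mult_left_mono)
    qed
    moreover have "(\<Sum>v\<in>V. p v y * (L * \<delta>)) = L * \<delta>"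
     using p1[OF True] by (simp add: sum_distrib_right[symmetric])
    ultimately show ?thesis by (simp add: abs_mult mult_left_mono)
   qed (simp add: w(2))
  qed
  also have "... = L * \<delta> * (\<integral>y. \<bar>w y\<bar>)" by simp
  finally show "\<bar>(\<integral>y. w y * H y) - (\<Sum>v\<in>V. c v * H v)\<bar> <= L * \<delta> * (\<integral>y. \<bar>w y\<bar>)" .
 qed (use V in auto)
qed

context mollifier
begin

lemma rescale_C_diff:
 assumes "C_diff k \<eta>" shows "C_diff k (rescale s \<eta> l x)"
proof -
 have "C_diff k (\<lambda>y. (1 / l ^ scale_deg s) * \<eta> (\<chi> i. (1 / l ^ s i) * (y $ i - x $ i)))"
  by (intro C_diff_cmult partial_derivs_affine_aux(1) assms)
 thus ?thesis by (simp add: rescale_def[abs_def] )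
qed

lemma smooth_rescale: "smooth \<eta> ==> smooth (rescale s \<eta> l x)"
 by (simp add: smooth_def rescale_C_diff)

lemma rescale_translate: "rescale s \<eta> l y z = rescale s \<eta> l 0 (z - y)"
 by (simp add: rescale_def)

lemma partial_derivs_rescale_translate:
 assumes "smooth \<eta>"
 shows "partial_derivs js (rescale s \<eta> l y) z = partial_derivs js (rescale s \<eta> l 0) (z - y)"
proof -
 have 1: "C_diff (length js) (rescale s \<eta> l 0)" using assms by (intro rescale_C_diff smooth_C_diff)
 have e: "(\<chi> i. 1 * (z $ i - y $ i)) = z - y" for z :: "real ^ 'd" by (simp add: vec_eq_iff)
 have "prod_list (map (\<lambda>_. 1) js) = (1 :: real)" by (induction js) auto
 with partial_derivs_affine_aux(2)[OF 1 order_refl, of "\<lambda>_. 1" y]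
 show ?thesis unfolding e by (simp add: rescale_translate[of \<eta> l y, abs_def])
qed

definition rad1 :: real where "rad1 = real CARD('d)"

lemma norm_le_rad1: "snorm s x <= 1 ==> norm x <= rad1"
 using norm_le_snorm[of x 1] by (simp add: rad1_def)

lemma rad1_nonneg: "0 <= rad1" by (simp add: rad1_def)

lemma rescale_far:
 assumes "!!z. 1 <= snorm s z ==> \<eta> z = 0" "0 < l" "l <= 1" "norm y + rad1 < norm x"
 shows "rescale s \<eta> l y x = 0"
proof (rule rescale_eq_0[OF assms(1,2)])
 have "norm x <= norm (x - y) + norm y" using norm_triangle_ineq[of "x - y" y] by simp
 hence "rad1 < norm (x - y)" using assms(4) by linarith
 hence "1 < snorm s (x - y)" using norm_le_rad1[of "x - y"] by linarith
 thus "l <= snorm s (x - y)" using assms(3) by linarith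
qed

lemma \<phi>_zero_snorm: "1 <= snorm s z ==> \<phi> z = 0"
 using \<phi>_supp_snorm[of z] by linarith

lemma rescale_\<phi>_far:
 "0 < l ==> l <= 1 ==> norm y + rad1 < norm x ==> rescale s \<phi> l y x = 0"
 by (rule rescale_far) (use \<phi>_zero_snorm in auto)

lemma rescale_\<phi>_schwartz: "0 < l ==> l <= 1 ==> rescale s \<phi> l y \<in> schwartz"
 by (rule schwartz_compact[of _ "norm y + rad1"])
   (auto intro!: smooth_rescale \<phi>_smooth rescale_\<phi>_far)

lemma rescale_\<phi>_lipschitz:
 assumes l: "0 < l" "l <= 1"
 shows "\<exists>L\<ge>0. \<forall>js z y y'. length js <= N -->
  \<bar>partial_derivs js (rescale s \<phi> l 0) (z - y) - partial_derivs js (rescale s \<phi> l 0) (z - y')\<bar> <= L * norm (y - y')"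
proof -
 let ?f = "rescale s \<phi> l 0"
 have sm: "smooth ?f" by (rule smooth_rescale[OF \<phi>_smooth])
 obtain M where M: "0 <= M" "\<forall>js x. length js <= Suc N --> \<bar>partial_derivs js ?f x\<bar> <= M"
  using partial_derivs_bounded[OF smooth_C_diff[OF sm], of rad1 "Suc N"]
   rescale_\<phi>_far[OF l, of 0] by auto
 have "\<bar>partial_derivs js ?f (z - y) - partial_derivs js ?f (z - y')\<bar> <= (real CARD('d) * M) * norm (y - y')"
  if "length js <= N" for js z y y'
 proof -
  have "\<bar>partial_derivs js ?f ((z - y') + (y' - y)) - partial_derivs js ?f (z - y')\<bar> <= real CARD('d) * norm (y' - y) * M"
  proof (rule lipschitz_partial)
   show "C_diff (Suc 0) (partial_derivs js ?f)" by (rule smooth_C_diff[OF smooth_partial_derivs[OF sm]])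
   show "\<bar>partial_deriv i (partial_derivs js ?f) x\<bar> <= M" for i x
    using M(2)[rule_format, of "i # js" x] that by simp
  qed
  thus ?thesis by (simp add: norm_minus_commute mult_ac)
 qed
 thus ?thesis using M(1) by (intro exI[of _ "real CARD('d) * M"]) auto
qed

lemma tempered_\<phi>_lipschitz:
 assumes F: "F \<in> tempered" and l: "0 < l" "l <= 1" and \<rho>: "0 <= \<rho>"
 shows "\<exists>L\<ge>0. \<forall>y y'. norm y <= \<rho> --> norm y' <= \<rho> -->
  \<bar>F (rescale s \<phi> l y) - F (rescale s \<phi> l y')\<bar> <= L * norm (y - y')"
proof -
 obtain C N where C: "0 <= C"
  "!!f M. smooth f ==> (!!x. \<rho> + rad1 < norm x ==> f x = 0) ==>
   (!!js x. length js <= N ==> \<bar>partial_derivs js f x\<bar> <= M) ==> \<bar>F f\<bar> <= C * M"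
  using tempered_compact_bound[OF F, of "\<rho> + rad1"] \<rho> rad1_nonneg by (metis add_nonneg_nonneg)
 obtain L where L: "0 <= L" "!!js z y y'. length js <= N ==>
  \<bar>partial_derivs js (rescale s \<phi> l 0) (z - y) - partial_derivs js (rescale s \<phi> l 0) (z - y')\<bar> <= L * norm (y - y')"
  using rescale_\<phi>_lipschitz[OF l, of N] by blast
 have "\<bar>F (rescale s \<phi> l y) - F (rescale s \<phi> l y')\<bar> <= (C * L) * norm (y - y')"
  if y: "norm y <= \<rho>" "norm y' <= \<rho>" for y y'
 proof -
  let ?f = "\<lambda>z. rescale s \<phi> l y z - rescale s \<phi> l y' z"
  have "\<bar>F ?f\<bar> <= C * (L * norm (y - y'))"
  proof (rule C(2))
   show "smooth ?f" by (intro smooth_diff smooth_rescale \<phi>_smooth)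
   show "?f x = 0" if "\<rho> + rad1 < norm x" for x
    using rescale_\<phi>_far[OF l, of y x] rescale_\<phi>_far[OF l, of y' x] that y by simp
   show "\<bar>partial_derivs js ?f x\<bar> <= L * norm (y - y')" if js: "length js <= N" for js x
   proof -
    have "partial_derivs js ?f x = partial_derivs js (rescale s \<phi> l y) x - partial_derivs js (rescale s \<phi> l y') x"
     by (subst partial_derivs_diff[of "length js"]) (auto intro!: smooth_C_diff smooth_rescale \<phi>_smooth)
    thus ?thesis using L(2)[OF js]
     by (simp only: partial_derivs_rescale_translate[OF \<phi>_smooth, where y = y]
       partial_derivs_rescale_translate[OF \<phi>_smooth, where y = y'])
   qed
  qed
  moreover have "F ?f = F (rescale s \<phi> l y) - F (rescale s \<phi> l y')"
   by (rule tempered_diff[OF F rescale_\<phi>_schwartz[OF l] rescale_\<phi>_schwartz[OF l]])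
  ultimately show ?thesis by (simp add: mult.assoc)
 qed
 thus ?thesis using C(1) L(1) by (intro exI[of _ "C * L"]) auto
qed

lemma tempered_\<phi>_continuous:
 assumes F: "F \<in> tempered" and l: "0 < l" "l <= 1"
 shows "continuous_on UNIV (\<lambda>y. F (rescale s \<phi> l y))"
proof (rule continuous_at_imp_continuous_on, rule ballI)
 fix y0 :: "real ^ 'd"
 obtain L where L: "0 <= L" "!!y y'. norm y <= norm y0 + 1 ==> norm y' <= norm y0 + 1 ==>
  \<bar>F (rescale s \<phi> l y) - F (rescale s \<phi> l y')\<bar> <= L * norm (y - y')"
  using tempered_\<phi>_lipschitz[OF F l, of "norm y0 + 1"] by auto
 have "((\<lambda>y. F (rescale s \<phi> l y) - F (rescale s \<phi> l y0)) \<longlongrightarrow> 0) (at y0)"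
 proof (rule Lim_null_comparison[where g = "\<lambda>y. L * norm (y - y0)"])
  have "\<forall>\<^sub>F y in at y0. dist y y0 < 1" by (auto simp: eventually_at intro!: exI[of _ 1])
  thus "\<forall>\<^sub>F y in at y0. norm (F (rescale s \<phi> l y) - F (rescale s \<phi> l y0)) <= L * norm (y - y0)"
  proof eventually_elim
   case (elim y)
   have "norm y <= norm (y - y0) + norm y0" using norm_triangle_ineq[of "y - y0" y0] by simp
   hence "norm y <= norm y0 + 1" using elim by (simp add: dist_norm)
   thus ?case using L(2)[of y y0] by simp
  qed
  have "((\<lambda>y. L * norm (y - y0)) \<longlongrightarrow> L * norm (y0 - y0)) (at y0)" by (intro tendsto_intros)
  thus "((\<lambda>y. L * norm (y - y0)) \<longlongrightarrow> 0) (at y0)" by simp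
 qed
 thus "isCont (\<lambda>y. F (rescale s \<phi> l y)) y0" unfolding isCont_def by (rule LIM_zero_cancel)
qed

lemma avg_far:
 assumes "0 <= \<mu>" "\<mu> <= 1" "!!x. \<rho> < norm x ==> w x = 0" "\<rho> + rad1 < norm y"
 shows "avg \<mu> w y = 0"
proof (rule avg_eq_0[OF assms(1)])
 fix h assume "snorm s h <= \<mu>"
 hence "norm h <= rad1" using assms(2) norm_le_rad1[of h] by linarith
 moreover have "norm y <= norm (y - h) + norm h" using norm_triangle_ineq[of "y - h" h] by simp
 ultimately show "w (y - h) = 0" using assms(4) by (intro assms(3)) linarith
qed

text \<open>The Riemann sums of the convolution converge together with all their derivatives, so a continuous
 functional may be pulled under the integral.\<close>

lemma tempered_avg:
 assumes F: "F \<in> tempered" and l: "0 < l" "l <= 1"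
  and w: "smooth w" "!!x. \<rho> < norm x ==> w x = 0" and \<rho>: "0 <= \<rho>"
 shows "F (avg l w) = (\<integral>y. w y * F (rescale s \<phi> l y))"
proof -
 let ?f = "rescale s \<phi> l 0"
 let ?J = "\<integral>y. w y * F (rescale s \<phi> l y)"
 have fsm: "smooth ?f" by (rule smooth_rescale[OF \<phi>_smooth])
 have wc: "ccs w"
  by (rule ccs_compact[of _ "cball 0 \<rho>"]) (use w smooth_imp_continuous in auto)
 have avg_eq: "avg l w = cv w (\<lambda>y. y) ?f"
 proof
  fix z
  have "avg l w z = (\<integral>y. rescale s \<phi> l y z * w y)"
   by (rule avg_kernel[OF l(1) smooth_imp_continuous[OF w(1)]])
  also have "... = (\<integral>y. w y * ?f (z - y))"
   by (intro Bochner_Integration.integral_cong refl, subst rescale_translate) (rule mult.commute)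
  finally show "avg l w z = cv w (\<lambda>y. y) ?f z" unfolding cv_def .
 qed
 obtain C N where C: "0 <= C"
  "!!f M. smooth f ==> (!!x. \<rho> + rad1 < norm x ==> f x = 0) ==>
   (!!js x. length js <= N ==> \<bar>partial_derivs js f x\<bar> <= M) ==> \<bar>F f\<bar> <= C * M"
  using tempered_compact_bound[OF F, of "\<rho> + rad1"] \<rho> rad1_nonneg by (metis add_nonneg_nonneg)
 obtain L where L: "0 <= L" "!!js z y y'. length js <= N ==>
  \<bar>partial_derivs js ?f (z - y) - partial_derivs js ?f (z - y')\<bar> <= L * norm (y - y')"
  using rescale_\<phi>_lipschitz[OF l, of N] by blast
 obtain L' where L': "0 <= L'" "!!y y'. norm y <= \<rho> ==> norm y' <= \<rho> ==>
  \<bar>F (rescale s \<phi> l y) - F (rescale s \<phi> l y')\<bar> <= L' * norm (y - y')"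
  using tempered_\<phi>_lipschitz[OF F l \<rho>] by blast
 let ?I = "\<integral>y. \<bar>w y\<bar>"
 have I0: "0 <= ?I" by simp
 have key: "\<bar>F (avg l w) - ?J\<bar> <= (C * L * ?I + L' * ?I) * \<delta>" if \<delta>: "0 < \<delta>" for \<delta>
 proof -
  obtain V c where V: "finite V" "V \<subseteq> cball 0 \<rho>"
   "!!H L. continuous_on UNIV H ==> 0 <= L ==>
   (!!x y. norm x <= \<rho> ==> norm y <= \<rho> ==> \<bar>H x - H y\<bar> <= L * norm (x - y)) ==>
   \<bar>(\<integral>y. w y * H y) - (\<Sum>v\<in>V. c v * H v)\<bar> <= L * \<delta> * ?I"
   using riemann_sums[OF wc w(2) \<delta>] by blast
  define S where "S z = (\<Sum>v\<in>V. c v * rescale s \<phi> l v z)" for z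
  have Ssm: "smooth S" unfolding S_def using V(1) by (intro smooth_sum smooth_rescale \<phi>_smooth)
  have far: "rescale s \<phi> l v x = 0" if "v \<in> V" "\<rho> + rad1 < norm x" for v x
   using that V(2) by (intro rescale_\<phi>_far[OF l]) auto
  have FS: "F S = (\<Sum>v\<in>V. c v * F (rescale s \<phi> l v))"
   unfolding S_def by (rule tempered_sum[OF F V(1), of _ "\<rho> + rad1"]) (auto intro: smooth_rescale \<phi>_smooth far)
  have asm: "smooth (avg l w)" by (rule smooth_avg[OF w(1)])
  have "\<bar>F (\<lambda>z. avg l w z - S z)\<bar> <= C * (L * \<delta> * ?I)"
  proof (rule C(2))
   show "smooth (\<lambda>z. avg l w z - S z)" by (intro smooth_diff asm Ssm)
   show "avg l w x - S x = 0" if "\<rho> + rad1 < norm x" for x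
    using avg_far[of l \<rho> w x] l w(2) that far[OF _ that] unfolding S_def by (simp add: sum.neutral)
   show "\<bar>partial_derivs js (\<lambda>z. avg l w z - S z) x\<bar> <= L * \<delta> * ?I" if js: "length js <= N" for js x
   proof -
    have 1: "partial_derivs js (avg l w) x = (\<integral>y. w y * partial_derivs js ?f (x - y))"
     unfolding avg_eq
     by (subst partial_derivs_cv[OF wc continuous_on_id smooth_C_diff[OF fsm] order_refl]) (simp add: cv_def)
    have 2: "partial_derivs js S x = (\<Sum>v\<in>V. c v * partial_derivs js ?f (x - v))"
     unfolding S_def
    proof (subst partial_derivs_sum(2)[OF V(1), of "length js"])
     show "C_diff (length js) (rescale s \<phi> l v)" for v by (intro smooth_C_diff smooth_rescale \<phi>_smooth)
     show "(\<Sum>v\<in>V. c v * partial_derivs js (rescale s \<phi> l v) x) = (\<Sum>v\<in>V. c v * partial_derivs js ?f (x - v))"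
      by (intro sum.cong refl arg_cong2[where f = times] partial_derivs_rescale_translate \<phi>_smooth)
    qed simp
    have 3: "partial_derivs js (\<lambda>z. avg l w z - S z) x = partial_derivs js (avg l w) x - partial_derivs js S x"
     by (subst partial_derivs_diff[OF smooth_C_diff[OF asm] smooth_C_diff[OF Ssm] order_refl]) simp
    show ?thesis unfolding 1 2 3
    proof (rule V(3))
     show "continuous_on UNIV (\<lambda>y. partial_derivs js ?f (x - y))"
      by (intro continuous_on_compose2[OF smooth_imp_continuous[OF smooth_partial_derivs[OF fsm]]] continuous_intros) auto
    qed (use L js in auto)
   qed
  qed
  moreover have "F (\<lambda>z. avg l w z - S z) = F (avg l w) - F S"
  proof (rule tempered_diff[OF F])
   show "avg l w \<in> schwartz"
    by (rule schwartz_compact[OF asm, of "\<rho> + rad1"]) (use avg_far[of l \<rho> w] l w(2) in auto)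
   show "S \<in> schwartz"
    by (rule schwartz_compact[OF Ssm, of "\<rho> + rad1"]) (auto simp: S_def far intro!: sum.neutral)
  qed
  moreover have "\<bar>?J - (\<Sum>v\<in>V. c v * F (rescale s \<phi> l v))\<bar> <= L' * \<delta> * ?I"
   by (rule V(3)[OF tempered_\<phi>_continuous[OF F l] L'])
  ultimately have "\<bar>F (avg l w) - ?J\<bar> <= C * (L * \<delta> * ?I) + L' * \<delta> * ?I"
   unfolding FS by linarith
  also have "... = (C * L * ?I + L' * ?I) * \<delta>" by (simp add: algebra_simps)
  finally show ?thesis .
 qed
 let ?c = "C * L * ?I + L' * ?I"
 have c0: "0 <= ?c" using C(1) L(1) L'(1) I0 by simp
 have "\<bar>F (avg l w) - ?J\<bar> <= 0"
 proof (rule field_le_epsilon)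
  fix e :: real assume e: "0 < e"
  have "?c * (e / (?c + 1)) <= e" using c0 e by (simp add: field_simps mult_nonneg_nonneg)
  moreover have "0 < e / (?c + 1)" using c0 e by (simp add: add_nonneg_pos)
  ultimately show "\<bar>F (avg l w) - ?J\<bar> <= 0 + e"
   using key[of "e / (?c + 1)"] by linarith
 qed
 thus ?thesis by simp
qed

end

section \<open>Synthesis of a distribution from local data\<close>

text \<open>Data \<open>G\<close> for the averages of an unknown distribution, prescribed independently at each dyadic scale
 and each point, and growing at most like the weights allow.\<close>

definition dominated ::
  "(nat => real ^ 'd::finite => real) => real set => (real => real ^ 'd => real) => bool" where
 "dominated G B u \<longleftrightarrow> finite B \<and> (\<forall>n. G n \<in> borel_measurable borel) \<and>
   (\<forall>\<beta>\<in>B. u \<beta> \<in> borel_measurable borel \<and> (\<forall>y. 0 <= u \<beta> y)) \<and>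
   (\<forall>n y. \<bar>G n y\<bar> <= (\<Sum>\<beta>\<in>B. eps n powr \<beta> * u \<beta> y))"

lemma schwartz_lincomb:
 fixes f g :: "real ^ 'd::finite => real"
 assumes "f \<in> schwartz" "g \<in> schwartz" shows "(\<lambda>y. a * f y + b * g y) \<in> schwartz"
proof -
 have sm: "smooth f" "smooth g" using assms by (auto simp: schwartz_def)
 have "schwartz_norm N (\<lambda>y. a * f y + b * g y) < \<infinity>" for N
 proof -
  have fin: "schwartz_norm N f < \<infinity>" "schwartz_norm N g < \<infinity>" using assms by (auto simp: schwartz_def)
  define F where "F = enn2real (schwartz_norm N f)"
  define G where "G = enn2real (schwartz_norm N g)"
  have e: "ennreal F = schwartz_norm N f" "ennreal G = schwartz_norm N g" "0 <= F" "0 <= G"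
   using fin by (auto simp: F_def G_def)
  have "schwartz_norm N (\<lambda>y. a * f y + b * g y) <= ennreal (\<bar>a\<bar> * F + \<bar>b\<bar> * G)"
  proof (rule schwartz_norm_le)
   fix js :: "'d list" and x :: "real ^ 'd" assume js: "length js <= N"
   have p: "0 <= (1 + norm x) ^ N" by simp
   have 1: "(1 + norm x) ^ N * \<bar>partial_derivs js f x\<bar> <= F" "(1 + norm x) ^ N * \<bar>partial_derivs js g x\<bar> <= G"
    by (rule ennreal_le_iff[THEN iffD1, OF e(3)], unfold e(1), rule schwartz_norm_ge[OF js])
      (rule ennreal_le_iff[THEN iffD1, OF e(4)], unfold e(2), rule schwartz_norm_ge[OF js])
   have "partial_derivs js (\<lambda>y. a * f y + b * g y) x = a * partial_derivs js f x + b * partial_derivs js g x"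
    by (subst partial_derivs_lincomb[OF smooth_C_diff[OF sm(1)] smooth_C_diff[OF sm(2)] order_refl]) simp
   also have "\<bar>...\<bar> <= \<bar>a\<bar> * \<bar>partial_derivs js f x\<bar> + \<bar>b\<bar> * \<bar>partial_derivs js g x\<bar>"
    by (rule order_trans[OF abs_triangle_ineq]) (simp add: abs_mult)
   finally have "(1 + norm x) ^ N * \<bar>partial_derivs js (\<lambda>y. a * f y + b * g y) x\<bar> \<le>
    (1 + norm x) ^ N * (\<bar>a\<bar> * \<bar>partial_derivs js f x\<bar> + \<bar>b\<bar> * \<bar>partial_derivs js g x\<bar>)"
    using p by (rule mult_left_mono)
   also have "... = \<bar>a\<bar> * ((1 + norm x) ^ N * \<bar>partial_derivs js f x\<bar>) + \<bar>b\<bar> * ((1 + norm x) ^ N * \<bar>partial_derivs js g x\<bar>)"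
    by (simp add: algebra_simps)
   also have "... <= \<bar>a\<bar> * F + \<bar>b\<bar> * G" by (intro add_mono mult_left_mono 1) auto
   finally show "(1 + norm x) ^ N * \<bar>partial_derivs js (\<lambda>y. a * f y + b * g y) x\<bar> <= \<bar>a\<bar> * F + \<bar>b\<bar> * G" .
  qed
  thus ?thesis by (rule le_less_trans) simp
 qed
 thus ?thesis using smooth_lincomb[OF sm] by (simp add: schwartz_def)
qed

context mollifier
begin

text \<open>If \<open>G n y\<close> is the average of a distribution at scale \<open>eps n\<close> around \<open>y\<close>, the sum recovers that
 distribution. For other data it defines a new one.\<close>

definition synth :: "(nat => real ^ 'd => real) => (real ^ 'd => real) => real => bool" where
 "synth G \<psi> L \<longleftrightarrow> (\<forall>n. integrable lborel (\<lambda>y. G n y * band n \<psi> y)) \<and>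
   (\<lambda>n. \<integral>y. G n y * band n \<psi> y) sums L"

definition Syn :: "(nat => real ^ 'd => real) => (real ^ 'd => real) => real" where
 "Syn G \<psi> = (\<Sum>n. \<integral>y. G n y * band n \<psi> y)"

lemma synth_Syn: "synth G \<psi> L ==> Syn G \<psi> = L"
 unfolding synth_def Syn_def by (blast intro: sums_unique[symmetric])

lemma synth_lincomb_data:
 assumes "synth G \<psi> L" "synth H \<psi> M" shows "synth (\<lambda>n y. a * G n y + b * H n y) \<psi> (a * L + b * M)"
proof -
 have e: "(\<lambda>y. (a * G n y + b * H n y) * band n \<psi> y) = (\<lambda>y. a * (G n y * band n \<psi> y) + b * (H n y * band n \<psi> y))" for n
  by (simp add: algebra_simps)
 have i: "integrable lborel (\<lambda>y. G n y * band n \<psi> y)" "integrable lborel (\<lambda>y. H n y * band n \<psi> y)" for n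
  using assms by (auto simp: synth_def)
 have "integrable lborel (\<lambda>y. a * (G n y * band n \<psi> y) + b * (H n y * band n \<psi> y))" for n
  using i by (intro Bochner_Integration.integrable_add integrable_mult_right)
 moreover have "(\<integral>y. a * (G n y * band n \<psi> y) + b * (H n y * band n \<psi> y)) =
   a * (\<integral>y. G n y * band n \<psi> y) + b * (\<integral>y. H n y * band n \<psi> y)" for n
  using i[of n] by (subst Bochner_Integration.integral_add) (auto intro: integrable_mult_right)
 ultimately show ?thesis unfolding synth_def e
  using assms by (auto simp: synth_def intro!: sums_add sums_mult)
qed

lemma synth_lincomb_test:
 assumes "continuous_on UNIV \<psi>" "continuous_on UNIV g" "synth G \<psi> L" "synth G g M"
 shows "synth G (\<lambda>y. a * \<psi> y + b * g y) (a * L + b * M)"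
proof -
 have e: "(\<lambda>y. G n y * band n (\<lambda>y. a * \<psi> y + b * g y) y) = (\<lambda>y. a * (G n y * band n \<psi> y) + b * (G n y * band n g y))" for n
  by (simp add: band_lincomb[OF assms(1,2)] algebra_simps)
 have i: "integrable lborel (\<lambda>y. G n y * band n \<psi> y)" "integrable lborel (\<lambda>y. G n y * band n g y)" for n
  using assms by (auto simp: synth_def)
 have "integrable lborel (\<lambda>y. a * (G n y * band n \<psi> y) + b * (G n y * band n g y))" for n
  using i by (intro Bochner_Integration.integrable_add integrable_mult_right)
 moreover have "(\<integral>y. a * (G n y * band n \<psi> y) + b * (G n y * band n g y)) =
   a * (\<integral>y. G n y * band n \<psi> y) + b * (\<integral>y. G n y * band n g y)" for n
  using i[of n] by (subst Bochner_Integration.integral_add) (auto intro: integrable_mult_right)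
 ultimately show ?thesis unfolding synth_def e
  using assms by (auto simp: synth_def intro!: sums_add sums_mult)
qed

definition Wint :: "real set => (real => real ^ 'd => real) => (real ^ 'd => real) => ennreal" where
 "Wint B u \<psi> = (\<Sum>\<beta>\<in>B. \<integral>\<^sup>+y. ennreal (u \<beta> y) * Wsum \<beta> \<psi> y)"

text \<open>Absolute convergence: \<open>Wsum\<close> collects the contributions of all scales at one point.\<close>

lemma synth_dominated:
 assumes dom: "dominated G B u" and cont: "continuous_on UNIV \<psi>" and fin: "Wint B u \<psi> < \<infinity>"
 shows "synth G \<psi> (Syn G \<psi>)" and "ennreal \<bar>Syn G \<psi>\<bar> <= Wint B u \<psi>"
proof -
 have G[measurable]: "G n \<in> borel_measurable borel" for n using dom by (simp add: dominated_def)
 have u[measurable]: "\<beta> \<in> B ==> u \<beta> \<in> borel_measurable borel" for \<beta> using dom by (simp add: dominated_def)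
 have u0: "\<beta> \<in> B ==> 0 <= u \<beta> y" for \<beta> y using dom by (simp add: dominated_def)
 have bm[measurable]: "band n \<psi> \<in> borel_measurable borel" for n by (rule band_measurable[OF cont])
 have finB: "finite B" using dom by (simp add: dominated_def)
 define I where "I n = (\<integral>y. G n y * band n \<psi> y)" for n
 define J where "J n = (\<integral>\<^sup>+y. ennreal \<bar>G n y * band n \<psi> y\<bar>)" for n
 let ?b = "\<lambda>n \<beta> y. ennreal (eps n powr \<beta> * \<bar>band n \<psi> y\<bar>)"
 have pt: "ennreal \<bar>G n y * band n \<psi> y\<bar> <= (\<Sum>\<beta>\<in>B. ennreal (u \<beta> y) * ?b n \<beta> y)" for n y
 proof -
  have "\<bar>G n y * band n \<psi> y\<bar> <= (\<Sum>\<beta>\<in>B. eps n powr \<beta> * u \<beta> y) * \<bar>band n \<psi> y\<bar>"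
   unfolding abs_mult using dom by (intro mult_right_mono) (auto simp: dominated_def)
  also have "... = (\<Sum>\<beta>\<in>B. u \<beta> y * (eps n powr \<beta> * \<bar>band n \<psi> y\<bar>))"
   unfolding sum_distrib_right by (intro sum.cong refl) (simp only: mult_ac)
  finally have "ennreal \<bar>G n y * band n \<psi> y\<bar> <= ennreal (\<Sum>\<beta>\<in>B. u \<beta> y * (eps n powr \<beta> * \<bar>band n \<psi> y\<bar>))"
   by (rule ennreal_leI)
  also have "... = (\<Sum>\<beta>\<in>B. ennreal (u \<beta> y * (eps n powr \<beta> * \<bar>band n \<psi> y\<bar>)))"
   using u0 by (intro sum_ennreal[symmetric]) auto
  also have "... = (\<Sum>\<beta>\<in>B. ennreal (u \<beta> y) * ?b n \<beta> y)"
   using u0 by (intro sum.cong refl ennreal_mult) auto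
  finally show ?thesis .
 qed
 have "(\<Sum>n. J n) = (\<integral>\<^sup>+y. (\<Sum>n. ennreal \<bar>G n y * band n \<psi> y\<bar>))"
  unfolding J_def by (rule nn_integral_suminf[symmetric]) measurable
 also have "... <= (\<integral>\<^sup>+y. (\<Sum>\<beta>\<in>B. ennreal (u \<beta> y) * Wsum \<beta> \<psi> y))"
 proof (rule nn_integral_mono)
  fix y
  have "(\<Sum>n. ennreal \<bar>G n y * band n \<psi> y\<bar>) <= (\<Sum>n. \<Sum>\<beta>\<in>B. ennreal (u \<beta> y) * ?b n \<beta> y)"
   by (rule suminf_le[OF pt summableI summableI])
  also have "... = (\<Sum>\<beta>\<in>B. \<Sum>n. ennreal (u \<beta> y) * ?b n \<beta> y)"
   by (rule suminf_sum) (rule summableI)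
  also have "... = (\<Sum>\<beta>\<in>B. ennreal (u \<beta> y) * Wsum \<beta> \<psi> y)"
   unfolding Wsum_def by (simp only: ennreal_suminf_cmult)
  finally show "(\<Sum>n. ennreal \<bar>G n y * band n \<psi> y\<bar>) <= (\<Sum>\<beta>\<in>B. ennreal (u \<beta> y) * Wsum \<beta> \<psi> y)" .
 qed
 also have "... = Wint B u \<psi>"
  unfolding Wint_def using Wsum_measurable[OF cont] by (intro nn_integral_sum) measurable
 finally have sJ: "(\<Sum>n. J n) <= Wint B u \<psi>" .
 hence sJfin: "(\<Sum>n. J n) < \<infinity>" using fin by (rule le_less_trans)
 have Jfin: "J n < \<infinity>" for n
 proof -
  have "J n <= (\<Sum>n. J n)" using sum_le_suminf[of J "{n}"] by (simp add: summableI)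
  thus ?thesis using sJfin by (rule le_less_trans)
 qed
 have int: "integrable lborel (\<lambda>y. G n y * band n \<psi> y)" for n
  by (rule integrableI_bounded) (use Jfin[of n] in "auto simp: J_def")
 have IJ: "ennreal \<bar>I n\<bar> <= J n" for n
  using integral_norm_bound_ennreal[OF int, of n] by (simp add: I_def J_def)
 have sI: "(\<Sum>n. ennreal \<bar>I n\<bar>) <= (\<Sum>n. J n)"
  by (rule suminf_le[OF IJ summableI summableI])
 hence sab: "summable (\<lambda>n. \<bar>I n\<bar>)"
  using le_less_trans[OF sI sJfin] by (intro summable_suminf_not_top) simp_all
 hence sm: "summable I" by (rule summable_rabs_cancel)
 hence "I sums Syn G \<psi>" unfolding Syn_def I_def[symmetric] by (rule summable_sums)
 thus "synth G \<psi> (Syn G \<psi>)" unfolding synth_def using int by (simp add: I_def[abs_def])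
 have "\<bar>Syn G \<psi>\<bar> <= (\<Sum>n. \<bar>I n\<bar>)" unfolding Syn_def I_def[symmetric] by (rule summable_rabs[OF sab])
 hence "ennreal \<bar>Syn G \<psi>\<bar> <= ennreal (\<Sum>n. \<bar>I n\<bar>)" by (rule ennreal_leI)
 also have "... = (\<Sum>n. ennreal \<bar>I n\<bar>)" by (rule suminf_ennreal2[symmetric]) (use sab in auto)
 finally show "ennreal \<bar>Syn G \<psi>\<bar> <= Wint B u \<psi>" by (rule order_trans[OF _ order_trans[OF sI sJ]])
qed

text \<open>The partial sums telescope to the pairing with a twofold average of \<open>\<psi>\<close> at scale \<open>eps N\<close>, which
 converges to \<open>\<psi>\<close> with all derivatives. Consequently the difference between a synthesised distribution
 and a given one is itself a synthesis, of the difference of the data.\<close>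

lemma synth_tempered:
 assumes F: "F \<in> tempered" and R: "1 <= R" and \<psi>: "smooth \<psi>" "!!x. \<rho> < norm x ==> \<psi> x = 0"
 shows "synth (\<lambda>n y. F (rescale s \<phi> (eps n) y)) \<psi> (F \<psi>)"
proof -
 define \<rho>1 where "\<rho>1 = \<bar>\<rho>\<bar> + rad1"
 have \<rho>1: "0 <= \<rho>1" using rad1_nonneg by (simp add: \<rho>1_def)
 have cont: "continuous_on UNIV \<psi>" by (rule smooth_imp_continuous[OF \<psi>(1)])
 have eps: "0 < eps n" "0 <= eps n" "eps n <= 1" for n by (auto simp: power_le_one)
 have far1: "avg \<mu> \<psi> y = 0" if "0 <= \<mu>" "\<mu> <= 1" "\<rho>1 < norm y" for \<mu> y
  using that \<psi>(2) by (intro avg_far[of \<mu> "\<bar>\<rho>\<bar>"]) (auto simp: \<rho>1_def)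
 have bfar: "band n \<psi> y = 0" if "\<rho>1 < norm y" for n y
  using that far1 eps by (cases n) (auto simp del: power_Suc)
 have bsm: "smooth (band n \<psi>)" for n by (rule smooth_band[OF \<psi>(1)])
 have bcc: "ccs (band n \<psi>)" for n
  by (rule ccs_compact[of _ "cball 0 \<rho>1"]) (use bfar band_continuous[OF cont] in auto)
 have int: "integrable lborel (\<lambda>y. F (rescale s \<phi> (eps n) y) * band n \<psi> y)" for n
  using ccs_integrable_mult[OF bcc tempered_\<phi>_continuous[OF F eps(1,3)]] by (simp add: mult.commute)
 have piece: "(\<integral>y. F (rescale s \<phi> (eps n) y) * band n \<psi> y) = F (avg (eps n) (band n \<psi>))" for n
  using tempered_avg[OF F eps(1,3) bsm bfar \<rho>1] by (simp add: mult.commute)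
 have asch: "avg (eps n) (band n \<psi>) \<in> schwartz" for n
  by (rule schwartz_compact[of _ "\<rho>1 + rad1"])
    (auto intro!: smooth_avg bsm avg_far[of _ \<rho>1] bfar eps)
 define \<Psi> where "\<Psi> N = avg (eps N) (avg (eps (Suc N)) \<psi>)" for N
 have \<Psi>sm: "smooth (\<Psi> N)" for N unfolding \<Psi>_def by (intro smooth_avg \<psi>)
 have \<Psi>far: "\<Psi> N y = 0" if "\<rho>1 + rad1 < norm y" for N y
  unfolding \<Psi>_def using that by (intro avg_far[of _ \<rho>1] far1 eps) auto
 have psum: "(\<Sum>n\<le>N. F (avg (eps n) (band n \<psi>))) = F (\<Psi> N)" for N
 proof -
  have "\<Psi> N = (\<lambda>y. \<Sum>n\<le>N. 1 * avg (eps n) (band n \<psi>) y)"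
   unfolding \<Psi>_def using band_telescope[OF cont, where N = N] by (auto simp del: power_Suc)
  hence "F (\<Psi> N) = (\<Sum>n\<le>N. 1 * F (avg (eps n) (band n \<psi>)))"
   by (simp only:) (rule tempered_sum[OF F, of _ _ "\<rho>1 + rad1"],
     auto intro!: smooth_avg bsm avg_far[of _ \<rho>1] bfar eps)
  thus ?thesis by simp
 qed
 obtain C N where C: "0 <= C"
  "!!f M. smooth f ==> (!!x. \<rho>1 + rad1 < norm x ==> f x = 0) ==>
   (!!js x. length js <= N ==> \<bar>partial_derivs js f x\<bar> <= M) ==> \<bar>F f\<bar> <= C * M"
 proof (rule tempered_compact_bound[OF F add_nonneg_nonneg[OF \<rho>1 rad1_nonneg]])
  fix C N
  assume "0 <= C" "!!f M. smooth f ==> (!!x. \<rho>1 + rad1 < norm x ==> f x = 0) ==>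
   (!!js x. length js <= N ==> \<bar>partial_derivs js f x\<bar> <= M) ==> \<bar>F f\<bar> <= C * M"
  thus thesis by (rule that)
 qed
 have "\<exists>M\<ge>0. \<forall>js x. length js <= Suc N --> \<bar>partial_derivs js \<psi> x\<bar> <= M"
  by (rule partial_derivs_bounded[OF smooth_C_diff[OF \<psi>(1)] \<psi>(2)])
 then obtain M where M: "0 <= M" "!!js x. length js <= Suc N ==> \<bar>partial_derivs js \<psi> x\<bar> <= M"
  by auto
 define c where "c = \<phi>L1 * (dcount 1 * M)"
 have c0: "0 <= c" using \<phi>L1_nonneg M by (simp add: c_def dcount_def)
 have close: "\<bar>F (\<Psi> n) - F \<psi>\<bar> <= (C * (\<phi>L1 * c + c)) * eps n" for n
 proof -
  have \<psi>far: "\<psi> x = 0" if "\<rho>1 + rad1 < norm x" for x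
   using that rad1_nonneg by (intro \<psi>(2)) (simp add: \<rho>1_def)
  have "\<bar>F (\<lambda>y. \<Psi> n y - \<psi> y)\<bar> <= C * ((\<phi>L1 * c + c) * eps n)"
  proof (rule C(2))
   show "smooth (\<lambda>y. \<Psi> n y - \<psi> y)" by (intro smooth_diff \<Psi>sm \<psi>)
   show "\<Psi> n x - \<psi> x = 0" if "\<rho>1 + rad1 < norm x" for x using \<Psi>far[OF that] \<psi>far[OF that] by simp
   show "\<bar>partial_derivs js (\<lambda>y. \<Psi> n y - \<psi> y) x\<bar> <= (\<phi>L1 * c + c) * eps n" if js: "length js <= N" for js x
   proof -
    let ?g = "partial_derivs js \<psi>"
    have gsm: "smooth ?g" by (rule smooth_partial_derivs[OF \<psi>(1)])
    have gc: "continuous_on UNIV ?g" by (rule smooth_imp_continuous[OF gsm])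
    have app: "\<bar>avg (eps m) ?g z - ?g z\<bar> <= c * eps m" for m z
    proof -
     have "\<bar>avg (eps m) ?g z - ?g z\<bar> <= \<phi>L1 * (dcount 1 * eps m ^ 1 * M)"
     proof (rule avg_approx[OF order_refl R smooth_C_diff[OF gsm] eps(2,3)])
      fix ks :: "'d list" and h assume "length ks = 1"
      thus "\<bar>partial_derivs ks ?g (z - h)\<bar> <= M"
       using M(2)[of "ks @ js"] js by (simp add: partial_derivs_append)
     qed
     thus ?thesis by (simp add: c_def mult_ac)
    qed
    have "partial_derivs js (\<lambda>y. \<Psi> n y - \<psi> y) x = partial_derivs js (\<Psi> n) x - ?g x"
     by (subst partial_derivs_diff[OF smooth_C_diff[OF \<Psi>sm] smooth_C_diff[OF \<psi>(1)] order_refl]) simp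
    also have "partial_derivs js (\<Psi> n) = avg (eps n) (avg (eps (Suc n)) ?g)"
     unfolding \<Psi>_def
     by (subst partial_derivs_avg[OF smooth_C_diff[OF smooth_avg[OF \<psi>(1)]] order_refl],
       subst partial_derivs_avg[OF smooth_C_diff[OF \<psi>(1)] order_refl]) simp
    finally have e: "partial_derivs js (\<lambda>y. \<Psi> n y - \<psi> y) x = avg (eps n) (avg (eps (Suc n)) ?g) x - ?g x" .
    have "avg (eps n) (\<lambda>y. 1 * avg (eps (Suc n)) ?g y + (-1) * ?g y) x =
     1 * avg (eps n) (avg (eps (Suc n)) ?g) x + (-1) * avg (eps n) ?g x"
     by (rule avg_lincomb[OF avg_continuous[OF gc] gc])
    moreover have "\<bar>avg (eps n) (\<lambda>y. 1 * avg (eps (Suc n)) ?g y + (-1) * ?g y) x\<bar> <= \<phi>L1 * (c * eps (Suc n))"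
     by (rule avg_bound) (use app[of "Suc n"] eps in \<open>auto intro!: continuous_intros avg_continuous gc simp del: power_Suc\<close>)
    moreover have "\<phi>L1 * (c * eps (Suc n)) <= \<phi>L1 * (c * eps n)"
     using \<phi>L1_nonneg c0 by (intro mult_left_mono) auto
    ultimately have "\<bar>avg (eps n) (avg (eps (Suc n)) ?g) x - avg (eps n) ?g x\<bar> <= \<phi>L1 * (c * eps n)"
     by linarith
    thus ?thesis unfolding e unfolding distrib_right mult.assoc using app[of n x] by linarith
   qed
  qed
  moreover have "F (\<lambda>y. \<Psi> n y - \<psi> y) = F (\<Psi> n) - F \<psi>"
   by (rule tempered_diff[OF F schwartz_compact[OF \<Psi>sm \<Psi>far] schwartz_compact[OF \<psi>]])
  ultimately show ?thesis by (simp add: mult.assoc)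
 qed
 have "(\<lambda>n. F (\<Psi> n) - F \<psi>) \<longlonglongrightarrow> 0"
 proof (rule Lim_null_comparison)
  show "\<forall>\<^sub>F n in sequentially. norm (F (\<Psi> n) - F \<psi>) <= (C * (\<phi>L1 * c + c)) * eps n"
   using close by simp
  show "(\<lambda>n. (C * (\<phi>L1 * c + c)) * eps n) \<longlonglongrightarrow> 0"
   by (rule tendsto_mult_right_zero) (rule LIMSEQ_power_zero, simp)
 qed
 hence "(\<lambda>N. \<Sum>n\<le>N. F (avg (eps n) (band n \<psi>))) \<longlonglongrightarrow> F \<psi>"
  unfolding psum by (rule LIM_zero_cancel)
 hence "(\<lambda>n. F (avg (eps n) (band n \<psi>))) sums F \<psi>" unfolding sums_def_le .
 thus ?thesis unfolding synth_def piece using int by blast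
qed

lemma Wsum_compact:
 assumes r: "1 <= r" "r <= R" "0 < \<beta> + real r" and \<psi>: "C_diff r \<psi>" "!!x. \<rho> < norm x ==> \<psi> x = 0"
  and M: "!!js x. length js <= r ==> \<bar>partial_derivs js \<psi> x\<bar> <= M"
 shows "Wsum \<beta> \<psi> y <= ennreal (CW0 r \<beta> * M) * indicator (cball 0 (\<rho> + rad1)) y"
proof (cases "norm y <= \<rho> + rad1")
 case True
 thus ?thesis using Wsum_bound[OF r \<psi>(1), of y M] M by simp
next
 case False
 have "band n \<psi> y = 0" for n
 proof (rule band_eq_0)
  fix h assume "snorm s h <= 1"
  hence "norm h <= rad1" by (rule norm_le_rad1)
  moreover have "norm y <= norm (y - h) + norm h" using norm_triangle_ineq[of "y - h" h] by simp
  ultimately show "\<psi> (y - h) = 0" using False by (intro \<psi>(2)) linarith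
 qed
 thus ?thesis by (simp add: Wsum_def)
qed

lemma CW0_nonneg: "0 < \<beta> + real r ==> 0 <= CW0 r \<beta>"
 unfolding CW0_def using two_powr_less_one[of "\<beta> + real r"] \<phi>L1_nonneg
 by (intro add_nonneg_nonneg divide_nonneg_nonneg mult_nonneg_nonneg) (auto simp: dcount_def)

definition locint :: "real set => (real => real ^ 'd => real) => bool" where
 "locint B u \<longleftrightarrow> (\<forall>\<beta>\<in>B. \<forall>\<rho>. (\<integral>\<^sup>+y. ennreal (u \<beta> y) * indicator (cball 0 \<rho>) y) < \<infinity>)"

definition Wconst :: "nat => real set => (real => real ^ 'd => real) => real => ennreal" where
 "Wconst r B u \<rho> = (\<Sum>\<beta>\<in>B. ennreal (CW0 r \<beta>) * (\<integral>\<^sup>+y. ennreal (u \<beta> y) * indicator (cball 0 (\<rho> + rad1)) y))"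

lemma Wconst_finite: "finite B ==> locint B u ==> Wconst r B u \<rho> < \<infinity>"
 unfolding Wconst_def locint_def by (simp add: ennreal_mult_less_top)

lemma Wint_compact:
 assumes dom: "dominated G B u"
  and r: "1 <= r" "r <= R" "!!\<beta>. \<beta> \<in> B ==> 0 < \<beta> + real r"
  and \<psi>: "C_diff r \<psi>" "!!x. \<rho> < norm x ==> \<psi> x = 0"
  and M: "!!js x. length js <= r ==> \<bar>partial_derivs js \<psi> x\<bar> <= M"
 shows "Wint B u \<psi> <= Wconst r B u \<rho> * ennreal M"
 unfolding Wint_def Wconst_def sum_distrib_right
proof (rule sum_mono)
 fix \<beta> assume \<beta>: "\<beta> \<in> B"
 have u[measurable]: "u \<beta> \<in> borel_measurable borel" using dom \<beta> by (simp add: dominated_def)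
 have [measurable]: "cball (0 :: real ^ 'd) (\<rho> + rad1) \<in> sets borel" by simp
 have M0: "0 <= M" using M[of "[]" 0] by simp
 have "(\<integral>\<^sup>+y. ennreal (u \<beta> y) * Wsum \<beta> \<psi> y) \<le>
   (\<integral>\<^sup>+y. (ennreal (CW0 r \<beta>) * ennreal M) * (ennreal (u \<beta> y) * indicator (cball 0 (\<rho> + rad1)) y))"
 proof (rule nn_integral_mono)
  fix y
  have "ennreal (u \<beta> y) * Wsum \<beta> \<psi> y <= ennreal (u \<beta> y) * (ennreal (CW0 r \<beta> * M) * indicator (cball 0 (\<rho> + rad1)) y)"
   by (intro mult_left_mono Wsum_compact[OF r(1,2) r(3)[OF \<beta>] \<psi> M]) auto
  thus "ennreal (u \<beta> y) * Wsum \<beta> \<psi> y <= (ennreal (CW0 r \<beta>) * ennreal M) * (ennreal (u \<beta> y) * indicator (cball 0 (\<rho> + rad1)) y)"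
   using CW0_nonneg[OF r(3)[OF \<beta>]] M0 by (simp add: ennreal_mult mult_ac)
 qed
 also have "... = (ennreal (CW0 r \<beta>) * ennreal M) * (\<integral>\<^sup>+y. ennreal (u \<beta> y) * indicator (cball 0 (\<rho> + rad1)) y)"
  by (rule nn_integral_cmult) measurable
 finally show "(\<integral>\<^sup>+y. ennreal (u \<beta> y) * Wsum \<beta> \<psi> y) \<le>
  ennreal (CW0 r \<beta>) * (\<integral>\<^sup>+y. ennreal (u \<beta> y) * indicator (cball 0 (\<rho> + rad1)) y) * ennreal M"
  by (simp add: mult_ac)
qed

lemma Wint_compact_finite:
 assumes dom: "dominated G B u" and loc: "locint B u"
  and r: "1 <= r" "r <= R" "!!\<beta>. \<beta> \<in> B ==> 0 < \<beta> + real r"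
  and \<psi>: "C_diff r \<psi>" "!!x. \<rho> < norm x ==> \<psi> x = 0"
 shows "Wint B u \<psi> < \<infinity>"
proof -
 have "\<exists>M\<ge>0. \<forall>js x. length js <= r --> \<bar>partial_derivs js \<psi> x\<bar> <= M"
  by (rule partial_derivs_bounded[OF \<psi>])
 then obtain M where M: "!!js x. length js <= r ==> \<bar>partial_derivs js \<psi> x\<bar> <= M" by auto
 have "Wint B u \<psi> <= Wconst r B u \<rho> * ennreal M" by (rule Wint_compact[OF dom r \<psi> M])
 also have "... < \<infinity>" using Wconst_finite[OF _ loc, of r \<rho>] dom by (simp add: dominated_def ennreal_mult_less_top)
 finally show ?thesis .
qed

text \<open>The bound by the \<open>C\<^sup>r\<close> norm extends the synthesis continuously from smooth test functions.\<close>

lemma Syn_has_pairing: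
 assumes dom: "dominated G B u" and loc: "locint B u"
  and r: "1 <= r" "r <= R" "!!\<beta>. \<beta> \<in> B ==> 0 < \<beta> + real r"
  and \<Xi>: "!!\<psi> \<rho>. smooth \<psi> ==> (!!x. \<rho> < norm x ==> \<psi> x = 0) ==> \<Xi> \<psi> = Syn G \<psi>"
  and \<psi>: "C_diff r \<psi>" "!!x. \<rho> < norm x ==> \<psi> x = 0"
 shows "has_pairing r \<Xi> \<psi> (Syn G \<psi>)"
 unfolding has_pairing_def
proof (intro allI impI)
 fix v K
 assume K: "compact K" and v: "\<forall>n::nat. smooth (v n) \<and> supp (v n) \<subseteq> K"
  and lim: "(\<lambda>n. C_norm r (\<lambda>y. v n y - \<psi> y)) \<longlonglongrightarrow> 0"
 obtain \<rho>0 where \<rho>0: "\<forall>x\<in>K. norm x <= \<rho>0"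
  using compact_imp_bounded[OF K] unfolding bounded_iff by (elim exE)
 define \<rho>1 where "\<rho>1 = max \<rho> \<rho>0"
 have vfar: "v n x = 0" if "\<rho>1 < norm x" for n x
 proof -
  have "x \<notin> K" using that \<rho>0 by (auto simp: \<rho>1_def)
  thus ?thesis using v not_in_suppD[of x "v n"] by blast
 qed
 have \<psi>far: "\<psi> x = 0" if "\<rho>1 < norm x" for x using that \<psi>(2) by (simp add: \<rho>1_def)
 let ?e = "\<lambda>n. C_norm r (\<lambda>y. v n y - \<psi> y)"
 let ?c = "Wconst r B u \<rho>1"
 have cfin: "?c < \<infinity>" using Wconst_finite[OF _ loc] dom by (simp add: dominated_def)
 have vC: "C_diff r (v n)" for n using v smooth_C_diff by blast
 have d: "ennreal \<bar>\<Xi> (v n) - Syn G \<psi>\<bar> <= ?c * ?e n" if fin: "?e n < 1" for n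
 proof -
  define M where "M = enn2real (?e n)"
  have "?e n < top" using fin by (rule less_trans) simp
  hence M: "ennreal M = ?e n" "0 <= M" by (simp_all add: M_def)
  have dC: "C_diff r (\<lambda>y. 1 * v n y + (-1) * \<psi> y)" by (rule C_diff_lincomb[OF vC \<psi>(1)])
  have dfar: "1 * v n x + (-1) * \<psi> x = 0" if "\<rho>1 < norm x" for x using vfar[OF that] \<psi>far[OF that] by simp
  have Mb: "\<bar>partial_derivs js (\<lambda>y. 1 * v n y + (-1) * \<psi> y) x\<bar> <= M" if "length js <= r" for js x
  proof (rule ennreal_le_iff[THEN iffD1, OF M(2)], unfold M(1))
   show "ennreal \<bar>partial_derivs js (\<lambda>y. 1 * v n y + (-1) * \<psi> y) x\<bar> <= ?e n"
    using C_norm_ge[OF that, of "\<lambda>y. v n y - \<psi> y" x] by simp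
  qed
  have fv: "Wint B u (v n) < \<infinity>" by (rule Wint_compact_finite[OF dom loc r vC vfar])
  have f\<psi>: "Wint B u \<psi> < \<infinity>" by (rule Wint_compact_finite[OF dom loc r \<psi>])
  have le: "Wint B u (\<lambda>y. 1 * v n y + (-1) * \<psi> y) <= ?c * ennreal M"
   by (rule Wint_compact[OF dom r dC dfar Mb])
  hence fd: "Wint B u (\<lambda>y. 1 * v n y + (-1) * \<psi> y) < \<infinity>"
  proof (rule le_less_trans)
   show "?c * ennreal M < \<infinity>" using cfin by (simp add: ennreal_mult_less_top)
  qed
  have "synth G (\<lambda>y. 1 * v n y + (-1) * \<psi> y) (1 * Syn G (v n) + (-1) * Syn G \<psi>)"
   by (rule synth_lincomb_test[OF C_diff_imp_continuous[OF vC] C_diff_imp_continuous[OF \<psi>(1)]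
     synth_dominated(1)[OF dom C_diff_imp_continuous[OF vC] fv]
     synth_dominated(1)[OF dom C_diff_imp_continuous[OF \<psi>(1)] f\<psi>]])
  hence "Syn G (\<lambda>y. 1 * v n y + (-1) * \<psi> y) = Syn G (v n) - Syn G \<psi>"
   using synth_Syn by fastforce
  moreover have "\<Xi> (v n) = Syn G (v n)" using v vfar by (intro \<Xi>[of _ \<rho>1]) auto
  ultimately show ?thesis
   using synth_dominated(2)[OF dom C_diff_imp_continuous[OF dC] fd] le M(1) by simp
 qed
 have lim2: "(\<lambda>n. ?c * ?e n) \<longlonglongrightarrow> ?c * 0" using cfin[unfolded infinity_ennreal_def] by (rule ennreal_tendsto_cmult) (rule lim)
 show "(\<lambda>n. \<Xi> (v n)) \<longlonglongrightarrow> Syn G \<psi>"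
 proof (rule tendstoI)
  fix \<epsilon> :: real assume \<epsilon>: "0 < \<epsilon>"
  have "\<forall>\<^sub>F n in sequentially. ?c * ?e n < ennreal \<epsilon>"
   by (rule order_tendstoD(2)[OF lim2]) (use \<epsilon> in simp)
  moreover have "\<forall>\<^sub>F n in sequentially. ?e n < 1" by (rule order_tendstoD(2)[OF lim]) simp
  ultimately show "\<forall>\<^sub>F n in sequentially. dist (\<Xi> (v n)) (Syn G \<psi>) < \<epsilon>"
  proof eventually_elim
   case (elim n)
   have "ennreal \<bar>\<Xi> (v n) - Syn G \<psi>\<bar> < ennreal \<epsilon>" using d[OF elim(2)] elim(1) by (rule le_less_trans)
   thus ?case by (simp add: dist_real_def ennreal_less_iff)
  qed
 qed
qed

text \<open>The weight with which data at distance \<open>h\<close> enter a test at scale \<open>l\<close>. Test functions have radius at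
 most one and averages reach one further unit on either side, hence the cutoff at three.\<close>

definition ker :: "real => real ^ 'd => real => real" where
 "ker l h \<beta> = (if snorm s h < 3 then max l (snorm s h) powr (\<beta> - real (scale_deg s)) else 0)"

lemma unit_testsD:
 assumes "\<eta> \<in> unit_tests s r"
 shows "C_diff r \<eta>" and "length js <= r ==> \<bar>partial_derivs js \<eta> z\<bar> <= 1"
  and "1 <= snorm s z ==> \<eta> z = 0"
proof -
 show "C_diff r \<eta>" using assms by (simp add: unit_tests_def)
 show "\<bar>partial_derivs js \<eta> z\<bar> <= 1" if "length js <= r"
 proof -
  have "C_norm r \<eta> <= ennreal 1" using assms by (simp add: unit_tests_def)
  with C_norm_ge[OF that, of \<eta> z] have "ennreal \<bar>partial_derivs js \<eta> z\<bar> <= ennreal 1" by (rule order_trans)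
  thus ?thesis by (subst (asm) ennreal_le_iff) auto
 qed
 show "\<eta> z = 0" if "1 <= snorm s z"
 proof (rule not_in_suppD)
  show "z \<notin> supp \<eta>" using assms that by (auto simp: unit_tests_def sball_def)
 qed
qed

lemma Syn_rescale_bound:
 assumes dom: "dominated G B u" and loc: "locint B u"
  and r: "1 <= r" "r <= R" "!!\<beta>. \<beta> \<in> B ==> 0 < \<beta> + real r" "!!\<beta>. \<beta> \<in> B ==> \<beta> < 0"
  and \<Xi>: "!!\<psi> \<rho>. smooth \<psi> ==> (!!x. \<rho> < norm x ==> \<psi> x = 0) ==> \<Xi> \<psi> = Syn G \<psi>"
  and \<eta>: "\<eta> \<in> unit_tests s r" and l: "0 < l" "l <= 1"
 shows "abs_pairing r \<Xi> (rescale s \<eta> l x) \<le>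
  (\<Sum>\<beta>\<in>B. \<integral>\<^sup>+y. ennreal (u \<beta> y) * ennreal (CW1 r \<beta> * ker l (y - x) \<beta>))"
proof -
 let ?\<psi> = "rescale s \<eta> l x"
 note ud = unit_testsD[OF \<eta>]
 have C: "C_diff r ?\<psi>" by (rule rescale_C_diff[OF ud(1)])
 have far: "?\<psi> y = 0" if "norm x + rad1 < norm y" for y
  using ud(3) l that by (intro rescale_far)
 have "has_pairing r \<Xi> ?\<psi> (Syn G ?\<psi>)"
 proof (rule Syn_has_pairing[OF dom loc r(1,2) _ _ C])
  show "0 < \<beta> + real r" if "\<beta> \<in> B" for \<beta> using that by (rule r(3))
  show "\<Xi> \<psi> = Syn G \<psi>" if "smooth \<psi>" "!!x. \<rho> < norm x ==> \<psi> x = 0" for \<psi> \<rho>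
   using that by (rule \<Xi>)
 qed (rule far)
 hence "abs_pairing r \<Xi> ?\<psi> <= ennreal \<bar>Syn G ?\<psi>\<bar>"
  unfolding abs_pairing_def by (intro Inf_lower) blast
 also have "... <= Wint B u ?\<psi>"
  by (rule synth_dominated(2)[OF dom C_diff_imp_continuous[OF C] Wint_compact_finite[OF dom loc r(1,2,3) C far]])
 also have "... <= (\<Sum>\<beta>\<in>B. \<integral>\<^sup>+y. ennreal (u \<beta> y) * ennreal (CW1 r \<beta> * ker l (y - x) \<beta>))"
  unfolding Wint_def ker_def
  by (intro sum_mono nn_integral_mono mult_left_mono Wsum_rescale r ud l) auto
 finally show ?thesis .
qed

text \<open>Outside a ball the seminorms of \<open>\<psi>\<close> decay faster than the weights grow.\<close>

lemma Syn_tempered: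
 assumes dom: "dominated G B u" and R: "1 <= R" "!!\<beta>. \<beta> \<in> B ==> 0 < \<beta> + real R"
  and fin: "!!\<beta>. \<beta> \<in> B ==> (\<integral>\<^sup>+y. ennreal (u \<beta> y / (1 + norm y) ^ N)) < \<infinity>"
 shows "(\<lambda>\<psi>. if \<psi> \<in> schwartz then Syn G \<psi> else 0) \<in> tempered"
  and "\<psi> \<in> schwartz ==> synth G \<psi> (Syn G \<psi>)"
proof -
 define N' where "N' = N + R"
 have finB: "finite B" using dom by (simp add: dominated_def)
 define A where "A \<beta> = CW0 R \<beta> * (1 + rad1) ^ N'" for \<beta>
 have A0: "0 <= A \<beta>" if "\<beta> \<in> B" for \<beta>
  using CW0_nonneg[OF R(2)[OF that]] rad1_nonneg by (simp add: A_def)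
 define K where "K = (\<Sum>\<beta>\<in>B. ennreal (A \<beta>) * (\<integral>\<^sup>+y. ennreal (u \<beta> y / (1 + norm y) ^ N)))"
 have Kfin: "K < \<infinity>" unfolding K_def using fin finB by (simp add: ennreal_mult_less_top)
 have W: "Wint B u \<psi> <= K * schwartz_norm N' \<psi>" if \<psi>: "\<psi> \<in> schwartz" for \<psi>
 proof -
  have sm: "smooth \<psi>" using \<psi> by (simp add: schwartz_def)
  have sfin: "schwartz_norm N' \<psi> < \<infinity>" using \<psi> by (simp add: schwartz_def)
  define S where "S = enn2real (schwartz_norm N' \<psi>)"
  have S: "ennreal S = schwartz_norm N' \<psi>" "0 <= S" using sfin by (auto simp: S_def)
  have pw: "Wsum \<beta> \<psi> y <= ennreal (A \<beta> * S / (1 + norm y) ^ N)" if \<beta>: "\<beta> \<in> B" for \<beta> y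
  proof -
   have "Wsum \<beta> \<psi> y <= ennreal (CW0 R \<beta> * (S * (1 + rad1) ^ N' / (1 + norm y) ^ N'))"
   proof (rule Wsum_bound[OF R(1) order_refl R(2)[OF \<beta>] smooth_C_diff[OF sm]])
    fix js :: "'d list" and h assume js: "length js <= R" and h: "snorm s h <= 1"
    have js': "length js <= N'" using js by (simp add: N'_def)
    have "(1 + norm (y - h)) ^ N' * \<bar>partial_derivs js \<psi> (y - h)\<bar> <= S"
     by (rule ennreal_le_iff[THEN iffD1, OF S(2)], unfold S(1), rule schwartz_norm_ge[OF js'])
    moreover have "(1 + norm y) ^ N' <= ((1 + rad1) * (1 + norm (y - h))) ^ N'"
    proof (rule power_mono)
     have "norm y <= norm (y - h) + norm h" using norm_triangle_ineq[of "y - h" h] by simp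
     hence "1 + norm y <= 1 + norm (y - h) + rad1" using norm_le_rad1[OF h] by linarith
     also have "... <= (1 + rad1) * (1 + norm (y - h))"
      using rad1_nonneg by (simp add: algebra_simps)
     finally show "1 + norm y <= (1 + rad1) * (1 + norm (y - h))" .
    qed simp
    ultimately have "(1 + norm y) ^ N' * \<bar>partial_derivs js \<psi> (y - h)\<bar> <= (1 + rad1) ^ N' * S"
    proof -
     assume a: "(1 + norm (y - h)) ^ N' * \<bar>partial_derivs js \<psi> (y - h)\<bar> <= S"
      and b: "(1 + norm y) ^ N' <= ((1 + rad1) * (1 + norm (y - h))) ^ N'"
     have "(1 + norm y) ^ N' * \<bar>partial_derivs js \<psi> (y - h)\<bar> \<le>
      ((1 + rad1) * (1 + norm (y - h))) ^ N' * \<bar>partial_derivs js \<psi> (y - h)\<bar>"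
      using b by (rule mult_right_mono) simp
     also have "... = (1 + rad1) ^ N' * ((1 + norm (y - h)) ^ N' * \<bar>partial_derivs js \<psi> (y - h)\<bar>)"
      by (simp only: power_mult_distrib mult.assoc)
     also have "... <= (1 + rad1) ^ N' * S" using a by (rule mult_left_mono) (use rad1_nonneg in simp)
     finally show ?thesis .
    qed
    moreover have "0 < (1 + norm y) ^ N'" by (intro zero_less_power) (simp add: add_pos_nonneg)
    ultimately show "\<bar>partial_derivs js \<psi> (y - h)\<bar> <= S * (1 + rad1) ^ N' / (1 + norm y) ^ N'"
     by (simp only: pos_le_divide_eq mult.commute)
   qed
   also have "... <= ennreal (A \<beta> * S / (1 + norm y) ^ N)"
   proof (rule ennreal_leI)
    have "(A \<beta> * S) / (1 + norm y) ^ N' <= (A \<beta> * S) / (1 + norm y) ^ N"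
     using A0[OF \<beta>] S by (intro divide_left_mono power_increasing mult_pos_pos zero_less_power)
       (auto simp: N'_def add_pos_nonneg)
    thus "CW0 R \<beta> * (S * (1 + rad1) ^ N' / (1 + norm y) ^ N') <= A \<beta> * S / (1 + norm y) ^ N"
     by (simp add: A_def mult_ac)
   qed
   finally show ?thesis .
  qed
  have "Wint B u \<psi> <= (\<Sum>\<beta>\<in>B. \<integral>\<^sup>+y. (ennreal (A \<beta>) * ennreal S) * ennreal (u \<beta> y / (1 + norm y) ^ N))"
   unfolding Wint_def
  proof (intro sum_mono nn_integral_mono)
   fix \<beta> y assume \<beta>: "\<beta> \<in> B"
   have u0: "0 <= u \<beta> y" using dom \<beta> by (simp add: dominated_def)
   have "ennreal (u \<beta> y) * Wsum \<beta> \<psi> y <= ennreal (u \<beta> y) * ennreal (A \<beta> * S / (1 + norm y) ^ N)"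
    by (intro mult_left_mono pw[OF \<beta>]) simp
   also have "... = (ennreal (A \<beta>) * ennreal S) * ennreal (u \<beta> y / (1 + norm y) ^ N)"
    using u0 A0[OF \<beta>] S(2) by (simp add: ennreal_mult[symmetric] mult_ac)
   finally show "ennreal (u \<beta> y) * Wsum \<beta> \<psi> y <= (ennreal (A \<beta>) * ennreal S) * ennreal (u \<beta> y / (1 + norm y) ^ N)" .
  qed
  also have "... = (\<Sum>\<beta>\<in>B. (ennreal (A \<beta>) * ennreal S) * (\<integral>\<^sup>+y. ennreal (u \<beta> y / (1 + norm y) ^ N)))"
  proof (intro sum.cong refl nn_integral_cmult)
   fix \<beta> assume "\<beta> \<in> B"
   hence [measurable]: "u \<beta> \<in> borel_measurable borel" using dom by (simp add: dominated_def)
   show "(\<lambda>y. ennreal (u \<beta> y / (1 + norm y) ^ N)) \<in> borel_measurable lborel" by measurable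
  qed
  also have "... = K * schwartz_norm N' \<psi>" unfolding K_def S(1) sum_distrib_right by (intro sum.cong refl) (simp only: mult_ac)
  finally show ?thesis .
 qed
 have Wfin: "Wint B u \<psi> < \<infinity>" if "\<psi> \<in> schwartz" for \<psi>
 proof -
  have "K * schwartz_norm N' \<psi> < \<infinity>"
   using Kfin that by (simp add: ennreal_mult_less_top schwartz_def)
  thus ?thesis using W[OF that] by (rule le_less_trans[rotated])
 qed
 have cs: "continuous_on UNIV \<psi>" if "\<psi> \<in> schwartz" for \<psi>
  using that smooth_imp_continuous by (auto simp: schwartz_def)
 show syn: "synth G \<psi> (Syn G \<psi>)" if "\<psi> \<in> schwartz" for \<psi>
  by (rule synth_dominated(1)[OF dom cs[OF that] Wfin[OF that]])
 have "\<exists>C N. \<forall>\<psi>\<in>schwartz. ennreal \<bar>Syn G \<psi>\<bar> <= ennreal C * schwartz_norm N \<psi>"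
 proof (intro exI ballI)
  fix \<psi> :: "real ^ 'd => real" assume \<psi>: "\<psi> \<in> schwartz"
  have "ennreal \<bar>Syn G \<psi>\<bar> <= K * schwartz_norm N' \<psi>"
   using synth_dominated(2)[OF dom cs[OF \<psi>] Wfin[OF \<psi>]] W[OF \<psi>] by (rule order_trans)
  thus "ennreal \<bar>Syn G \<psi>\<bar> <= ennreal (enn2real K) * schwartz_norm N' \<psi>" using Kfin by simp
 qed
 moreover have "Syn G (\<lambda>y. a * \<psi> y + b * g y) = a * Syn G \<psi> + b * Syn G g"
  if "\<psi> \<in> schwartz" "g \<in> schwartz" for \<psi> g a b
  by (rule synth_Syn[OF synth_lincomb_test[OF cs[OF that(1)] cs[OF that(2)] syn[OF that(1)] syn[OF that(2)]]])
 ultimately show "(\<lambda>\<psi>. if \<psi> \<in> schwartz then Syn G \<psi> else 0) \<in> tempered"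
  unfolding tempered_def by (simp add: schwartz_lincomb)
qed

end

section \<open>Mixed Lebesgue norms\<close>

lemma ennreal_powr_ennreal: "0 <= x ==> ennreal_powr (ennreal x) t = ennreal (x powr t)"
 by (simp add: ennreal_powr_def)

lemma ennreal_powr_top [simp]: "ennreal_powr top t = top" "ennreal_powr \<infinity> t = \<infinity>"
 by (simp_all add: ennreal_powr_def)

lemma ennreal_powr_zero [simp]: "ennreal_powr 0 t = 0"
 by (simp add: ennreal_powr_def)

lemma ennreal_powr_mono:
 assumes "a <= b" "0 <= t" shows "ennreal_powr a t <= ennreal_powr b t"
proof (cases b rule: ennreal_cases)
 case (real y)
 then obtain x where x: "a = ennreal x" "0 <= x" "x <= y"
  using assms by (cases a rule: ennreal_cases) (auto simp: top_unique)
 thus ?thesis using real assms by (simp add: ennreal_powr_ennreal ennreal_leI powr_mono2)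
qed simp

lemma ennreal_powr_mult:
 "0 < t ==> ennreal_powr (a * b) t = ennreal_powr a t * ennreal_powr b t"
proof -
 assume t: "0 < t"
 have tp: "ennreal_powr (top * c) t = top * ennreal_powr c t" for c
 proof (cases "c = 0")
  case False
  hence "top * c = top" by (simp add: ennreal_top_mult)
  moreover have "ennreal_powr c t ~= 0"
  proof (cases c rule: ennreal_cases)
   case (real x)
   thus ?thesis using False by (simp add: ennreal_powr_ennreal ennreal_eq_0_iff)
  qed simp
  ultimately show ?thesis by (simp add: ennreal_top_mult)
 qed simp
 show ?thesis
 proof (cases a rule: ennreal_cases)
  case (real x)
  thus ?thesis
  proof (cases b rule: ennreal_cases)
   case (real y)
   thus ?thesis using \<open>a = ennreal x\<close> \<open>0 <= x\<close>
    by (simp add: ennreal_mult[symmetric] ennreal_powr_ennreal powr_mult)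
  next
   case top
   thus ?thesis using tp[of a] by (simp add: mult.commute)
  qed
 next
  case top
  thus ?thesis using tp[of b] by simp
 qed
qed

lemma ennreal_powr_inverse:
 "0 < t ==> ennreal_powr (ennreal_powr a t) (1 / t) = a"
 "0 < t ==> ennreal_powr (ennreal_powr a (1 / t)) t = a"
 by (cases a rule: ennreal_cases; simp add: ennreal_powr_ennreal powr_powr)+

lemma ennreal_powr_measurable [measurable]:
 assumes [measurable]: "f \<in> borel_measurable M"
 shows "(\<lambda>x. ennreal_powr (f x) t) \<in> borel_measurable M"
 unfolding ennreal_powr_def by measurable

lemma nn_integral_lebesgue: "(\<integral>\<^sup>+x. f x \<partial>lebesgue) = (\<integral>\<^sup>+x. f x)"
 by (rule nn_integral_completion)

lemma Lnorm_fin: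
 "q ~= \<infinity> ==> Lnorm M q g = ennreal_powr (\<integral>\<^sup>+x. ennreal_powr (g x) (enn2real q) \<partial>M) (1 / enn2real q)"
 by (simp add: Lnorm_def)

lemma Lnorm_infinity: "Lnorm M \<infinity> g = Inf {z. AE x in M. g x <= z}"
 by (simp add: Lnorm_def)

lemma enn2real_ge1: "1 <= q ==> q ~= \<infinity> ==> 1 <= enn2real q"
 by (cases q rule: ennreal_cases) (auto simp: ennreal_1[symmetric] ennreal_le_iff simp del: ennreal_1)

lemma Lnorm_mono_AE:
 assumes "AE x in M. f x <= g x" shows "Lnorm M q f <= Lnorm M q g"
proof (cases "q = \<infinity>")
 case True
 have "{z. AE x in M. g x <= z} \<subseteq> {z. AE x in M. f x <= z}"
 proof
  fix z assume "z \<in> {z. AE x in M. g x <= z}"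
  hence "AE x in M. g x <= z" by simp
  with assms have "AE x in M. f x <= z" by eventually_elim (rule order_trans)
  thus "z \<in> {z. AE x in M. f x <= z}" by simp
 qed
 thus ?thesis unfolding True Lnorm_infinity by (rule Inf_superset_mono)
next
 case False
 have "AE x in M. ennreal_powr (f x) (enn2real q) <= ennreal_powr (g x) (enn2real q)"
  using assms by eventually_elim (simp add: ennreal_powr_mono)
 thus ?thesis unfolding Lnorm_fin[OF False]
  by (intro ennreal_powr_mono nn_integral_mono_AE) auto
qed

lemma Lnorm_mono: "(!!x. f x <= g x) ==> Lnorm M q f <= Lnorm M q g"
 by (rule Lnorm_mono_AE) simp

lemma Lnorm_cong_AE: "AE x in M. f x = g x ==> Lnorm M q f = Lnorm M q g"
 by (rule antisym; rule Lnorm_mono_AE) auto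

text \<open>The infimum is the limit of a sequence, so only countably many null sets are discarded.\<close>

lemma AE_Lnorm_infinity: "AE x in M. f x <= Lnorm M \<infinity> f"
proof -
 let ?A = "{z. AE x in M. f x <= z}"
 have "?A ~= {}" by (auto intro!: exI[of _ top])
 then obtain z :: "nat => ennreal" where z: "range z \<subseteq> ?A" "Inf ?A = (INF i. z i)"
  using ennreal_Inf_countable_INF by metis
 hence "AE x in M. \<forall>i. f x <= z i" by (subst AE_all_countable) auto
 thus ?thesis unfolding Lnorm_infinity z(2) by eventually_elim (auto intro: INF_greatest)
qed

lemma Lnorm_cmult:
 assumes "1 <= q" "f \<in> borel_measurable M" "0 <= c"
 shows "Lnorm M q (\<lambda>x. ennreal c * f x) <= ennreal c * Lnorm M q f"
  and "q ~= \<infinity> ==> Lnorm M q (\<lambda>x. ennreal c * f x) = ennreal c * Lnorm M q f"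
proof -
 show eq: "Lnorm M q (\<lambda>x. ennreal c * f x) = ennreal c * Lnorm M q f" if q: "q ~= \<infinity>"
 proof -
  let ?t = "enn2real q"
  have t: "0 < ?t" using enn2real_ge1[OF assms(1) q] by simp
  note assms(2)[measurable]
  have "(\<integral>\<^sup>+x. ennreal_powr (ennreal c * f x) ?t \<partial>M) = ennreal_powr (ennreal c) ?t * (\<integral>\<^sup>+x. ennreal_powr (f x) ?t \<partial>M)"
   unfolding ennreal_powr_mult[OF t] by (rule nn_integral_cmult) measurable
  thus ?thesis unfolding Lnorm_fin[OF q]
   using t by (simp add: ennreal_powr_mult ennreal_powr_inverse)
 qed
 show "Lnorm M q (\<lambda>x. ennreal c * f x) <= ennreal c * Lnorm M q f"
 proof (cases "q = \<infinity>")
  case True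
  have "AE x in M. ennreal c * f x <= ennreal c * Lnorm M \<infinity> f"
   using AE_Lnorm_infinity[of f M] by eventually_elim (rule mult_left_mono, simp_all)
  thus ?thesis unfolding True unfolding Lnorm_infinity[of M "\<lambda>x. ennreal c * f x"]
   by (intro Inf_lower) simp
 qed (simp add: eq)
qed

lemma add_le_twice_max: "a + b <= 2 * max a b" for a b :: ennreal
 by (subst mult_2) (intro add_mono max.cobounded1 max.cobounded2)

text \<open>From $a + b \le 2 \max(a, b)$, uniformly in \<open>q\<close>.\<close>

lemma Lnorm_add:
 assumes q: "1 <= q" and [measurable]: "f \<in> borel_measurable M" "g \<in> borel_measurable M"
 shows "Lnorm M q (\<lambda>x. f x + g x) <= 4 * (Lnorm M q f + Lnorm M q g)"
proof (cases "q = \<infinity>")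
 case True
 have "AE x in M. f x + g x <= Lnorm M \<infinity> f + Lnorm M \<infinity> g"
  using AE_Lnorm_infinity[of f M] AE_Lnorm_infinity[of g M] by eventually_elim (rule add_mono)
 hence "Lnorm M \<infinity> (\<lambda>x. f x + g x) <= Lnorm M \<infinity> f + Lnorm M \<infinity> g"
  unfolding Lnorm_infinity[of M "\<lambda>x. f x + g x"] by (intro Inf_lower) simp
 also have "... <= 4 * (Lnorm M \<infinity> f + Lnorm M \<infinity> g)"
  using mult_right_mono[of 1 4 "Lnorm M \<infinity> f + Lnorm M \<infinity> g"] by simp
 finally show ?thesis unfolding True .
next
 case False
 let ?t = "enn2real q"
 have t: "1 <= ?t" using enn2real_ge1[OF q False] .
 define F where "F = (\<integral>\<^sup>+x. ennreal_powr (f x) ?t \<partial>M)"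
 define G where "G = (\<integral>\<^sup>+x. ennreal_powr (g x) ?t \<partial>M)"
 have pt: "ennreal_powr (f x + g x) ?t <= ennreal_powr 2 ?t * (ennreal_powr (f x) ?t + ennreal_powr (g x) ?t)" for x
 proof -
  have "ennreal_powr (f x + g x) ?t <= ennreal_powr (2 * max (f x) (g x)) ?t"
   by (rule ennreal_powr_mono[OF add_le_twice_max]) simp
  also have "... = ennreal_powr 2 ?t * ennreal_powr (max (f x) (g x)) ?t"
   using t by (intro ennreal_powr_mult) simp
  also have "... <= ennreal_powr 2 ?t * (ennreal_powr (f x) ?t + ennreal_powr (g x) ?t)"
   by (rule mult_left_mono) (auto simp: max_def)
  finally show ?thesis .
 qed
 have "(\<integral>\<^sup>+x. ennreal_powr (f x + g x) ?t \<partial>M) <= (\<integral>\<^sup>+x. ennreal_powr 2 ?t * (ennreal_powr (f x) ?t + ennreal_powr (g x) ?t) \<partial>M)"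
  by (rule nn_integral_mono) (rule pt)
 also have "... = ennreal_powr 2 ?t * (F + G)"
  unfolding F_def G_def by (subst nn_integral_cmult) (simp_all add: nn_integral_add)
 also have "... <= ennreal_powr 2 ?t * (2 * max F G)" by (intro mult_left_mono add_le_twice_max) simp
 also have "... <= ennreal_powr 2 ?t * (ennreal_powr 2 ?t * max F G)"
 proof (intro mult_left_mono mult_right_mono)
  have "ennreal_powr (ennreal 2) 1 <= ennreal_powr (ennreal 2) ?t"
   using t powr_mono[of 1 ?t "2 :: real"] by (simp only: ennreal_powr_ennreal) (simp add: ennreal_leI)
  moreover have "ennreal_powr (ennreal 2) 1 = ennreal 2" by (subst ennreal_powr_ennreal) auto
  ultimately show "2 <= ennreal_powr 2 ?t" by simp
 qed auto
 also have "... = ennreal_powr 4 ?t * max F G"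
 proof -
  have "ennreal_powr 2 ?t * ennreal_powr 2 ?t = ennreal_powr (2 * 2) ?t"
   using t by (intro ennreal_powr_mult[symmetric]) simp
  moreover have "(2 :: ennreal) * 2 = 4" by simp
  ultimately show ?thesis by (simp only: mult.assoc[symmetric])
 qed
 finally have "Lnorm M q (\<lambda>x. f x + g x) <= ennreal_powr (ennreal_powr 4 ?t * max F G) (1 / ?t)"
  unfolding Lnorm_fin[OF False] by (intro ennreal_powr_mono) auto
 also have "... = 4 * ennreal_powr (max F G) (1 / ?t)"
  using t by (subst ennreal_powr_mult) (auto simp: ennreal_powr_inverse)
 also have "... <= 4 * (Lnorm M q f + Lnorm M q g)"
  unfolding Lnorm_fin[OF False] F_def[symmetric] G_def[symmetric]
  by (rule mult_left_mono) (auto simp: max_def)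
 finally show ?thesis .
qed

lemma Lnorm_zero [simp]: "1 <= q ==> Lnorm M q (\<lambda>x. 0) = 0"
 using Lnorm_cmult(1)[of q "\<lambda>x. 0" M 0] by simp

lemma Lnorm_sum:
 assumes q: "1 <= q" and "finite B" "!!\<beta>. \<beta> \<in> B ==> f \<beta> \<in> borel_measurable M"
 shows "Lnorm M q (\<lambda>x. \<Sum>\<beta>\<in>B. f \<beta> x) <= 4 ^ card B * (\<Sum>\<beta>\<in>B. Lnorm M q (f \<beta>))"
 using assms(2,3)
proof (induction B rule: finite_induct)
 case empty
 thus ?case using q by simp
next
 case (insert b B)
 have "Lnorm M q (\<lambda>x. \<Sum>\<beta>\<in>insert b B. f \<beta> x) = Lnorm M q (\<lambda>x. f b x + (\<Sum>\<beta>\<in>B. f \<beta> x))"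
  using insert by simp
 also have "... <= 4 * (Lnorm M q (f b) + Lnorm M q (\<lambda>x. \<Sum>\<beta>\<in>B. f \<beta> x))"
  using insert by (intro Lnorm_add q borel_measurable_sum) auto
 also have "... <= 4 * (4 ^ card B * Lnorm M q (f b) + 4 ^ card B * (\<Sum>\<beta>\<in>B. Lnorm M q (f \<beta>)))"
 proof (intro mult_left_mono add_mono)
  have "(1 :: ennreal) <= 4 ^ card B" by (rule one_le_power) simp
  thus "Lnorm M q (f b) <= 4 ^ card B * Lnorm M q (f b)"
   using mult_right_mono[of 1 "4 ^ card B" "Lnorm M q (f b)"] by simp
 qed (use insert in auto)
 also have "... = 4 ^ card (insert b B) * (\<Sum>\<beta>\<in>insert b B. Lnorm M q (f \<beta>))"
  using insert by (simp add: distrib_left mult.assoc)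
 finally show ?case .
qed

lemma young_powr:
 fixes u m t :: real
 assumes "1 <= t" "0 <= u" "0 < m"
 shows "t * m powr (t - 1) * u <= u powr t + (t - 1) * m powr t"
proof (cases "t = 1")
 case False
 hence t: "1 < t" using assms by simp
 have "u * m powr (t - 1) <= u powr t / t + (m powr (t - 1)) powr (t / (t - 1)) / (t / (t - 1))"
 proof (rule Youngs_inequality)
  show "1 < t / (t - 1)" using t by (simp add: field_simps)
  show "1 / t + 1 / (t / (t - 1)) = 1" using t by (simp add: field_simps)
 qed (use t assms in auto)
 also have "(m powr (t - 1)) powr (t / (t - 1)) = m powr t" using t by (simp add: powr_powr)
 finally have "t * (u * m powr (t - 1)) <= t * (u powr t / t + m powr t / (t / (t - 1)))"
  using t by (intro mult_left_mono) auto
 also have "... = u powr t + (t - 1) * m powr t" using t by (simp add: field_simps)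
 finally show ?thesis by (simp add: mult_ac)
qed (use assms in auto)

text \<open>Young's inequality under the integral, optimised over its free parameter.\<close>

lemma nn_integral_jensen:
 assumes [measurable]: "u \<in> borel_measurable M" "w \<in> borel_measurable M"
  and t: "1 <= t" and W: "0 < W" "(\<integral>\<^sup>+x. w x \<partial>M) <= ennreal W"
 shows "ennreal_powr (\<integral>\<^sup>+x. u x * w x \<partial>M) t <= ennreal (W powr (t - 1)) * (\<integral>\<^sup>+x. ennreal_powr (u x) t * w x \<partial>M)"
proof -
 define U where "U = (\<integral>\<^sup>+x. u x * w x \<partial>M)"
 define V where "V = (\<integral>\<^sup>+x. ennreal_powr (u x) t * w x \<partial>M)"
 have young: "ennreal (t * m powr (t - 1)) * U <= V + ennreal ((t - 1) * m powr t) * ennreal W" if m: "0 < m" for m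
 proof -
  have pt: "ennreal (t * m powr (t - 1)) * (u x * w x) <= ennreal_powr (u x) t * w x + ennreal ((t - 1) * m powr t) * w x" for x
  proof -
   have "ennreal (t * m powr (t - 1)) * u x <= ennreal_powr (u x) t + ennreal ((t - 1) * m powr t)"
   proof (cases "u x" rule: ennreal_cases)
    case (real v)
    thus ?thesis using young_powr[OF t real(1) m] t
     by (simp add: ennreal_powr_ennreal ennreal_mult[symmetric] ennreal_plus[symmetric] ennreal_leI del: ennreal_plus)
   qed simp
   hence "ennreal (t * m powr (t - 1)) * u x * w x <= (ennreal_powr (u x) t + ennreal ((t - 1) * m powr t)) * w x"
    by (rule mult_right_mono) simp
   thus ?thesis by (simp add: distrib_right mult.assoc)
  qed
  have "ennreal (t * m powr (t - 1)) * U = (\<integral>\<^sup>+x. ennreal (t * m powr (t - 1)) * (u x * w x) \<partial>M)"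
   unfolding U_def by (rule nn_integral_cmult[symmetric]) measurable
  also have "... <= (\<integral>\<^sup>+x. ennreal_powr (u x) t * w x + ennreal ((t - 1) * m powr t) * w x \<partial>M)"
   by (rule nn_integral_mono) (rule pt)
  also have "... = V + ennreal ((t - 1) * m powr t) * (\<integral>\<^sup>+x. w x \<partial>M)"
   unfolding V_def by (simp add: nn_integral_add nn_integral_cmult)
  also have "... <= V + ennreal ((t - 1) * m powr t) * ennreal W"
   by (intro add_left_mono mult_left_mono W) simp
  finally show ?thesis .
 qed
 show ?thesis unfolding U_def[symmetric] V_def[symmetric]
 proof (cases V rule: ennreal_cases)
  case top
  thus "ennreal_powr U t <= ennreal (W powr (t - 1)) * V"
   using W by (simp add: ennreal_mult_top ennreal_eq_0_iff)
 next
  case (real v)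
  have "ennreal t * U <= V + ennreal (t - 1) * ennreal W" using young[of 1] by simp
  also have "... < top" using real t W by (simp add: ennreal_mult[symmetric] ennreal_plus[symmetric] del: ennreal_plus)
  finally have "U ~= top" using t by (auto simp: ennreal_mult_top)
  then obtain a where a: "U = ennreal a" "0 <= a" by (cases U rule: ennreal_cases) auto
  show "ennreal_powr U t <= ennreal (W powr (t - 1)) * V"
  proof (cases "a = 0")
   case True
   thus ?thesis using a by simp
  next
   case False
   hence ap: "0 < a" using a by simp
   define m where "m = a / W"
   have m: "0 < m" using ap W by (simp add: m_def)
   have "t * m powr (t - 1) * a <= v + (t - 1) * m powr t * W"
    using young[OF m] t real a W
    by (simp add: ennreal_mult[symmetric] ennreal_plus[symmetric] ennreal_le_iff del: ennreal_plus)
   moreover have "m powr t * W = m powr (t - 1) * a"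
   proof -
    have "m powr t = m powr (t - 1) * m" using m by (simp add: powr_mult_base mult.commute)
    thus ?thesis using W by (simp add: m_def)
   qed
   ultimately have "t * (m powr (t - 1) * a) <= v + (t - 1) * (m powr (t - 1) * a)"
    by (simp only: mult.assoc)
   hence "m powr (t - 1) * a <= v" by (simp add: left_diff_distrib)
   moreover have "m powr (t - 1) * a = a powr t / W powr (t - 1)"
   proof -
    have "a powr t = a powr (t - 1) * a" using ap by (simp add: powr_mult_base mult.commute)
    thus ?thesis using ap W by (simp add: m_def powr_divide)
   qed
   ultimately have "a powr t <= W powr (t - 1) * v" using W by (simp add: pos_divide_le_eq mult.commute)
   thus ?thesis using a real by (simp add: ennreal_powr_ennreal ennreal_mult[symmetric] ennreal_leI)
  qed
 qed
qed

text \<open>Minkowski's integral inequality, deduced from Jensen's inequality with weight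
 \<open>h \<mapsto> \<parallel>g(\<cdot>, h)\<parallel>\<close>.\<close>

lemma minkowski_integral:
 fixes g :: "'a::euclidean_space => 'b::euclidean_space => ennreal"
 assumes q: "1 <= q" "q ~= \<infinity>"
  and g: "(\<lambda>(x, h). g x h) \<in> borel_measurable (lborel \<Otimes>\<^sub>M lborel)"
 shows "Lnorm lborel q (\<lambda>x. \<integral>\<^sup>+h. g x h) <= (\<integral>\<^sup>+h. Lnorm lborel q (\<lambda>x. g x h))"
proof -
 let ?t = "enn2real q"
 have t: "1 <= ?t" "0 < ?t" using enn2real_ge1[OF q] by auto
 have gm[measurable]: "(\<lambda>p. g (fst p) (snd p)) \<in> borel_measurable (lborel \<Otimes>\<^sub>M lborel)"
  using g by (simp add: split_beta)
 have gx[measurable]: "(\<lambda>h. g x h) \<in> borel_measurable lborel" for x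
  using measurable_compose[OF measurable_Pair1' gm, of x] by simp
 have gh[measurable]: "(\<lambda>x. g x h) \<in> borel_measurable lborel" for h
  using measurable_compose[OF measurable_Pair2' gm, of h] by simp
 define G where "G h = Lnorm lborel q (\<lambda>x. g x h)" for h
 have gm': "(\<lambda>p. ennreal_powr (g (snd p) (fst p)) ?t) \<in> borel_measurable (lborel \<Otimes>\<^sub>M lborel)"
  using measurable_compose[OF measurable_pair_swap' gm] by (auto simp: split_beta)
 have Gm[measurable]: "G \<in> borel_measurable lborel"
  unfolding G_def Lnorm_fin[OF q(2)]
  using lborel.borel_measurable_nn_integral[of "\<lambda>h x. ennreal_powr (g x h) ?t" lborel] gm'
  by (auto simp: split_beta intro!: ennreal_powr_measurable)
 have Gt: "(\<integral>\<^sup>+x. ennreal_powr (g x h) ?t) = ennreal_powr (G h) ?t" for h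
  unfolding G_def Lnorm_fin[OF q(2)] using t by (simp add: ennreal_powr_inverse)
 define W where "W = (\<integral>\<^sup>+h. G h)"
 define u where "u x h = g x h * inverse (G h)" for x h
 let ?U = "\<lambda>x. \<integral>\<^sup>+h. ennreal_powr (u x h) ?t * G h"
 have um[measurable]: "(\<lambda>p. u (fst p) (snd p)) \<in> borel_measurable (lborel \<Otimes>\<^sub>M lborel)"
  unfolding u_def by measurable
 have ux[measurable]: "(\<lambda>h. u x h) \<in> borel_measurable lborel" for x unfolding u_def by measurable
 show ?thesis unfolding G_def[symmetric] W_def[symmetric]
 proof (cases "W = top")
  case False
  have dom: "AE x in lborel. AE h in lborel. g x h <= u x h * G h"
  proof -
   have fin: "AE h in lborel. G h ~= top"
    using nn_integral_PInf_AE[OF Gm] False unfolding W_def infinity_ennreal_def by simp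
   have "AE h in lborel. AE x in lborel. g x h <= u x h * G h"
    using fin
   proof eventually_elim
    case (elim h)
    show ?case
    proof (cases "G h = 0")
     case True
     hence "(\<integral>\<^sup>+x. ennreal_powr (g x h) ?t) = 0" unfolding Gt by simp
     hence "AE x in lborel. ennreal_powr (g x h) ?t = 0" by (subst (asm) nn_integral_0_iff_AE) auto
     thus ?thesis
     proof eventually_elim
      case (elim x)
      hence "g x h = 0" using ennreal_powr_inverse(1)[OF t(2), of "g x h"] by simp
      thus ?case by simp
     qed
    next
     case False
     hence "inverse (G h) * G h = 1" using elim
      by (subst mult.commute) (simp add: divide_ennreal_def[symmetric] ennreal_divide_self less_top)
     thus ?thesis by (simp add: u_def mult.assoc)
    qed
   qed
   moreover have "{p \<in> space (lborel \<Otimes>\<^sub>M lborel). g (fst p) (snd p) <= u (fst p) (snd p) * G (snd p)}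
     \<in> sets (lborel \<Otimes>\<^sub>M lborel)"
    by measurable
   ultimately show ?thesis by (subst lborel_pair.AE_commute) auto
  qed
  have "Lnorm lborel q (\<lambda>x. \<integral>\<^sup>+h. g x h) <= ennreal W'" if W': "W < ennreal W'" for W'
  proof -
   have W'0: "0 < W'"
   proof (rule ccontr)
    assume "\<not> 0 < W'"
    hence "ennreal W' = 0" by (simp add: ennreal_neg)
    with W' show False by simp
   qed
   have "ennreal_powr (\<integral>\<^sup>+h. g x h) ?t <= ennreal (W' powr (?t - 1)) * ?U x"
    if "AE h in lborel. g x h <= u x h * G h" for x
   proof -
    have "ennreal_powr (\<integral>\<^sup>+h. g x h) ?t <= ennreal_powr (\<integral>\<^sup>+h. u x h * G h) ?t"
     using that by (intro ennreal_powr_mono nn_integral_mono_AE) auto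
    also have "... <= ennreal (W' powr (?t - 1)) * ?U x"
     using W' unfolding W_def by (intro nn_integral_jensen t W'0) (auto intro: less_imp_le)
    finally show ?thesis .
   qed
   with dom have AE1: "AE x in lborel. ennreal_powr (\<integral>\<^sup>+h. g x h) ?t <= ennreal (W' powr (?t - 1)) * ?U x"
    by (auto elim: eventually_mono)
   have m2: "(\<lambda>p. ennreal_powr (u (fst p) (snd p)) ?t * G (snd p)) \<in> borel_measurable (lborel \<Otimes>\<^sub>M lborel)"
    by measurable
   have m3: "?U \<in> borel_measurable lborel"
    using lborel.borel_measurable_nn_integral[of "\<lambda>x h. ennreal_powr (u x h) ?t * G h" lborel] m2
    by (simp add: split_beta)
   have "(\<integral>\<^sup>+x. ennreal_powr (\<integral>\<^sup>+h. g x h) ?t) \<le>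
    (\<integral>\<^sup>+x. ennreal (W' powr (?t - 1)) * ?U x)"
    by (rule nn_integral_mono_AE[OF AE1])
   also have "... = ennreal (W' powr (?t - 1)) * (\<integral>\<^sup>+x. ?U x)"
    by (rule nn_integral_cmult[OF m3])
   also have "(\<integral>\<^sup>+x. ?U x) =
     (\<integral>\<^sup>+h. (\<integral>\<^sup>+x. ennreal_powr (u x h) ?t * G h))"
    using lborel_pair.Fubini'[of "\<lambda>x h. ennreal_powr (u x h) ?t * G h"] m2 by (simp add: split_beta)
   also have "... <= W" unfolding W_def
   proof (rule nn_integral_mono)
    fix h
    have "(\<integral>\<^sup>+x. ennreal_powr (u x h) ?t * G h) = ennreal_powr (inverse (G h)) ?t * (G h * ennreal_powr (G h) ?t)"
    proof -
     have "(\<integral>\<^sup>+x. ennreal_powr (u x h) ?t * G h) =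
      (\<integral>\<^sup>+x. (ennreal_powr (inverse (G h)) ?t * G h) * ennreal_powr (g x h) ?t)"
      unfolding u_def ennreal_powr_mult[OF t(2)] by (simp add: mult_ac)
     also have "... = (ennreal_powr (inverse (G h)) ?t * G h) * ennreal_powr (G h) ?t"
      unfolding Gt[symmetric] by (rule nn_integral_cmult) measurable
     finally show ?thesis by (simp add: mult_ac)
    qed
    also have "... = ennreal_powr (inverse (G h) * G h) ?t * G h"
     unfolding ennreal_powr_mult[OF t(2)] by (simp add: mult_ac)
    also have "... <= 1 * G h"
    proof (rule mult_right_mono)
     have "inverse (G h) * G h <= 1"
      by (cases "G h = 0 \<or> G h = top")
        (auto simp: mult.commute divide_ennreal_def[symmetric] ennreal_divide_self less_top)
     hence "ennreal_powr (inverse (G h) * G h) ?t <= ennreal_powr (ennreal 1) ?t" by (intro ennreal_powr_mono) auto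
     thus "ennreal_powr (inverse (G h) * G h) ?t <= 1" by (simp only: ennreal_powr_ennreal) simp
    qed simp
    finally show "(\<integral>\<^sup>+x. ennreal_powr (u x h) ?t * G h) <= G h" by simp
   qed
   also have "W <= ennreal W'" using W' by simp
   finally have "(\<integral>\<^sup>+x. ennreal_powr (\<integral>\<^sup>+h. g x h) ?t) <= ennreal (W' powr (?t - 1)) * ennreal W'"
    by (simp add: mult_left_mono)
   also have "... = ennreal_powr (ennreal W') ?t"
    using W'0 by (simp add: ennreal_powr_ennreal ennreal_mult[symmetric] powr_mult_base mult.commute)
   finally have "Lnorm lborel q (\<lambda>x. \<integral>\<^sup>+h. g x h) <= ennreal_powr (ennreal_powr (ennreal W') ?t) (1 / ?t)"
    unfolding Lnorm_fin[OF q(2)] by (intro ennreal_powr_mono) auto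
   thus ?thesis using t by (simp add: ennreal_powr_inverse)
  qed
  note bd = this
  show "Lnorm lborel q (\<lambda>x. \<integral>\<^sup>+h. g x h) <= W"
  proof (rule dense_ge)
   fix z assume z: "W < z"
   show "Lnorm lborel q (\<lambda>x. \<integral>\<^sup>+h. g x h) <= z"
    using z bd by (cases z rule: ennreal_cases) auto
  qed
 qed simp
qed

section \<open>Regularity structures\<close>

locale reg_struct =
 fixes S :: "('t::real_vector) reg_structure"
 assumes regular: "regularity_structure S"
begin

abbreviation "\<N> \<equiv> comp_norm S"

lemma banach_layer: "a \<in> index S ==> banach_on (layer S a) (lnorm S a)"
 using regular by (simp add: regularity_structure_def)

lemma layer_subspace: "a \<in> index S ==> subspace (layer S a)"
 using banach_layer by (simp add: banach_on_def)

lemma lnorm_nonneg: "a \<in> index S ==> \<tau> \<in> layer S a ==> 0 <= lnorm S a \<tau>"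
 using banach_layer by (simp add: banach_on_def)

lemma lnorm_eq_0: "a \<in> index S ==> \<tau> \<in> layer S a ==> lnorm S a \<tau> = 0 \<longleftrightarrow> \<tau> = 0"
 using banach_layer by (simp add: banach_on_def)

lemma lnorm_triangle: "a \<in> index S ==> \<tau> \<in> layer S a ==> \<sigma> \<in> layer S a ==> lnorm S a (\<tau> + \<sigma>) <= lnorm S a \<tau> + lnorm S a \<sigma>"
 using banach_layer by (simp add: banach_on_def)

lemma lnorm_scale: "a \<in> index S ==> \<tau> \<in> layer S a ==> lnorm S a (c *\<^sub>R \<tau>) = \<bar>c\<bar> * lnorm S a \<tau>"
 using banach_layer by (simp add: banach_on_def)

lemma decomposes_ex1: "\<exists>!c. decomposes S \<tau> c"
 using regular by (simp add: regularity_structure_def)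

lemma decomposes_component: "decomposes S \<tau> (\<lambda>a. component S a \<tau>)"
proof -
 have "decomposes S \<tau> (THE c. decomposes S \<tau> c)" using decomposes_ex1 by (rule theI')
 moreover have "(\<lambda>a. component S a \<tau>) = (THE c. decomposes S \<tau> c)" by (simp add: component_def)
 ultimately show ?thesis by simp
qed

lemma component_eqI: "decomposes S \<tau> c ==> component S a \<tau> = c a"
 using decomposes_ex1[of \<tau>] decomposes_component[of \<tau>] by (metis (no_types))

lemma component_layer: "a \<in> index S ==> component S a \<tau> \<in> layer S a"
 using decomposes_component[of \<tau>] by (simp add: decomposes_def)

lemma component_outside: "a \<notin> index S ==> component S a \<tau> = 0"
 using decomposes_component[of \<tau>] by (simp add: decomposes_def)

lemma component_lincomb:
 "component S a (x *\<^sub>R \<tau> + y *\<^sub>R \<sigma>) = x *\<^sub>R component S a \<tau> + y *\<^sub>R component S a \<sigma>"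
proof (rule component_eqI)
 note d1 = decomposes_component[of \<tau>] and d2 = decomposes_component[of \<sigma>]
 let ?A = "{a. component S a \<tau> ~= 0}" and ?B = "{a. component S a \<sigma> ~= 0}"
 let ?c = "\<lambda>a. x *\<^sub>R component S a \<tau> + y *\<^sub>R component S a \<sigma>"
 have fin: "finite (?A \<union> ?B)" using d1 d2 by (simp add: decomposes_def)
 have sub: "{a. ?c a ~= 0} \<subseteq> ?A \<union> ?B" by auto
 have \<tau>: "\<tau> = (\<Sum>a\<in>?A \<union> ?B. component S a \<tau>)"
  using d1 fin by (subst sum.mono_neutral_right[of "?A \<union> ?B" ?A]) (auto simp: decomposes_def)
 have \<sigma>: "\<sigma> = (\<Sum>a\<in>?A \<union> ?B. component S a \<sigma>)"
  using d2 fin by (subst sum.mono_neutral_right[of "?A \<union> ?B" ?B]) (auto simp: decomposes_def)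
 have "x *\<^sub>R \<tau> + y *\<^sub>R \<sigma> = (\<Sum>a\<in>?A \<union> ?B. ?c a)"
  by (subst \<tau>, subst \<sigma>) (simp add: scaleR_sum_right sum.distrib)
 also have "... = (\<Sum>a | ?c a ~= 0. ?c a)"
  using fin sub by (intro sum.mono_neutral_right) auto
 finally have "x *\<^sub>R \<tau> + y *\<^sub>R \<sigma> = (\<Sum>a | ?c a ~= 0. ?c a)" .
 moreover have "?c a \<in> layer S a" if "a \<in> index S" for a
  using layer_subspace[OF that] component_layer[OF that] by (intro subspace_add subspace_scale)
 moreover have "finite {a. ?c a ~= 0}" using sub fin by (rule finite_subset)
 ultimately show "decomposes S (x *\<^sub>R \<tau> + y *\<^sub>R \<sigma>) ?c"
  by (simp add: decomposes_def component_outside)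
qed

lemma component_add: "component S a (\<tau> + \<sigma>) = component S a \<tau> + component S a \<sigma>"
 using component_lincomb[of a 1 \<tau> 1 \<sigma>] by simp

lemma component_diff: "component S a (\<tau> - \<sigma>) = component S a \<tau> - component S a \<sigma>"
 using component_lincomb[of a 1 \<tau> "-1" \<sigma>] by simp

lemma component_scale: "component S a (x *\<^sub>R \<tau>) = x *\<^sub>R component S a \<tau>"
 using component_lincomb[of a x \<tau> 0 \<tau>] by simp

lemma component_zero [simp]: "component S a 0 = 0"
 using component_scale[of a 0 0] by simp

lemma component_of_layer:
 assumes "a \<in> index S" "\<tau> \<in> layer S a"
 shows "component S b \<tau> = (if b = a then \<tau> else 0)"
proof (rule component_eqI)
 have e: "{b. (if b = a then \<tau> else 0) ~= 0} = (if \<tau> = 0 then {} else {a})" by auto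
 show "decomposes S \<tau> (\<lambda>b. if b = a then \<tau> else 0)"
  unfolding decomposes_def e using assms layer_subspace by (auto intro: subspace_0)
qed

lemma comp_norm_nonneg: "a \<in> index S ==> 0 <= \<N> a \<tau>"
 unfolding comp_norm_def by (intro lnorm_nonneg component_layer)

lemma comp_norm_add: "a \<in> index S ==> \<N> a (\<tau> + \<sigma>) <= \<N> a \<tau> + \<N> a \<sigma>"
 unfolding comp_norm_def component_add by (intro lnorm_triangle component_layer)

lemma comp_norm_minus: "a \<in> index S ==> \<N> a (- \<tau>) = \<N> a \<tau>"
 unfolding comp_norm_def using component_scale[of a "-1" \<tau>]
  lnorm_scale[where a = a and \<tau> = "component S a \<tau>" and c = "-1"] component_layer[of a \<tau>] by simp

lemma comp_norm_diff: "a \<in> index S ==> \<N> a (\<tau> - \<sigma>) <= \<N> a \<tau> + \<N> a \<sigma>"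
 using comp_norm_add[of a \<tau> "- \<sigma>"] by (simp add: comp_norm_minus)

lemma comp_norm_zero [simp]: "a \<in> index S ==> \<N> a 0 = 0"
 unfolding comp_norm_def using lnorm_eq_0[of a 0] layer_subspace[of a] by (simp add: subspace_0)

lemma comp_norm_abs_diff: "a \<in> index S ==> \<bar>\<N> a \<tau> - \<N> a \<sigma>\<bar> <= \<N> a (\<tau> - \<sigma>)"
 using comp_norm_add[of a "\<tau> - \<sigma>" \<sigma>] comp_norm_add[of a "\<sigma> - \<tau>" \<tau>] comp_norm_minus[of a "\<tau> - \<sigma>"]
 by (simp add: abs_le_iff)

lemma index_below_index: "a \<in> index_below S \<gamma> ==> a \<in> index S" "a \<in> index_below S \<gamma> ==> a < \<gamma>"
 by (auto simp: index_below_def)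

lemma finite_index_below: "finite (index_below S \<gamma>)"
proof -
 obtain m where m: "\<forall>a\<in>index S. m <= a"
  using regular unfolding regularity_structure_def bdd_below_def by auto
 have "index_below S \<gamma> \<subseteq> index S \<inter> {m..\<gamma>}" using m by (auto simp: index_below_def)
 moreover have "finite (index S \<inter> {m..\<gamma>})" using regular by (simp add: regularity_structure_def)
 ultimately show ?thesis by (rule finite_subset)
qed

lemma subspace_T_below: "subspace (T_below S \<gamma>)"
 by (simp add: T_below_def)

lemma T_below_component:
 assumes "\<tau> \<in> T_below S \<gamma>" "a \<notin> index_below S \<gamma>" shows "component S a \<tau> = 0"
 using assms(1) unfolding T_below_def
proof (induction rule: span_induct_alt)
 case base
 thus ?case by simp
next
 case (step c x y)
 then obtain b where "b \<in> index_below S \<gamma>" "x \<in> layer S b" by blast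
 hence "component S a x = 0"
  using component_of_layer[of b x a] assms(2) index_below_index(1) by auto
 thus ?case using step by (simp add: component_add component_scale)
qed

lemma T_below_sum:
 assumes "\<tau> \<in> T_below S \<gamma>" shows "\<tau> = (\<Sum>a\<in>index_below S \<gamma>. component S a \<tau>)"
proof -
 have d: "\<tau> = (\<Sum>a | component S a \<tau> ~= 0. component S a \<tau>)"
  using decomposes_component[of \<tau>] by (simp add: decomposes_def)
 also have "... = (\<Sum>a\<in>index_below S \<gamma>. component S a \<tau>)"
  using finite_index_below T_below_component[OF assms] by (intro sum.mono_neutral_left) auto
 finally show ?thesis .
qed

lemma layer_T_below: "a \<in> index_below S \<gamma> ==> \<tau> \<in> layer S a ==> \<tau> \<in> T_below S \<gamma>"
 unfolding T_below_def by (rule span_base) blast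

lemma component_T_below: "a \<in> index_below S \<gamma> ==> component S a \<tau> \<in> T_below S \<gamma>"
 by (rule layer_T_below) (auto intro: component_layer index_below_index)

lemma group_linear: "g \<in> str_group S ==> linear g"
 using regular by (simp add: regularity_structure_def)

lemma group_triangular:
 "g \<in> str_group S ==> a \<in> index S ==> \<tau> \<in> layer S a ==> g \<tau> - \<tau> \<in> T_below S a"
 using regular by (simp add: regularity_structure_def)

lemma component_group:
 assumes "g \<in> str_group S" "a \<in> index S" "\<tau> \<in> layer S a" "a <= b"
 shows "component S b (g \<tau> - \<tau>) = 0"
 using group_triangular[OF assms(1-3)] assms(4)
 by (intro T_below_component[of _ a]) (auto simp: index_below_def)

lemma group_T_below:
 assumes "g \<in> str_group S" "\<tau> \<in> T_below S \<gamma>" shows "g \<tau> \<in> T_below S \<gamma>"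
proof -
 have lin: "linear g" using assms(1) by (rule group_linear)
 have 1: "g (component S a \<tau>) \<in> T_below S \<gamma>" if a: "a \<in> index_below S \<gamma>" for a
 proof -
  let ?c = "component S a \<tau>"
  have "g ?c - ?c \<in> T_below S a"
   using a by (intro group_triangular[OF assms(1)] component_layer) (auto simp: index_below_def)
  moreover have "T_below S a \<subseteq> T_below S \<gamma>"
   unfolding T_below_def using a by (intro span_mono) (auto simp: index_below_def)
  ultimately have "(g ?c - ?c) + ?c \<in> T_below S \<gamma>"
   using component_T_below[OF a] subspace_T_below by (intro subspace_add) auto
  thus ?thesis by simp
 qed
 have "g \<tau> = (\<Sum>a\<in>index_below S \<gamma>. g (component S a \<tau>))"
  by (subst T_below_sum[OF assms(2)]) (rule linear_sum[OF lin])
 thus ?thesis using 1 subspace_T_below by (simp add: subspace_sum)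
qed

definition nrm :: "real => 't => real" where
 "nrm \<gamma> \<tau> = (\<Sum>a\<in>index_below S \<gamma>. \<N> a \<tau>)"

lemma comp_norm_le_nrm: "a \<in> index_below S \<gamma> ==> \<N> a \<tau> <= nrm \<gamma> \<tau>"
 unfolding nrm_def by (intro member_le_sum finite_index_below comp_norm_nonneg) (auto simp: index_below_def)

lemma nrm_nonneg: "0 <= nrm \<gamma> \<tau>"
 unfolding nrm_def by (intro sum_nonneg comp_norm_nonneg) (auto simp: index_below_def)

lemma nrm_add: "nrm \<gamma> (\<tau> + \<sigma>) <= nrm \<gamma> \<tau> + nrm \<gamma> \<sigma>"
 unfolding nrm_def sum.distrib[symmetric] by (intro sum_mono comp_norm_add) (auto simp: index_below_def)

text \<open>Below distance \<open>D\<close> all powers of the distance that occur are at most \<open>D powr (\<gamma> - \<alpha>)\<close>. The lemma is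
 stated for an arbitrary linear map so that it also covers differences of transports.\<close>

lemma transport_crude:
 assumes T: "linear T" and bd: "!!a \<sigma>. a \<in> index_below S \<gamma> ==> \<sigma> \<in> layer S a ==>
   \<N> b (T \<sigma>) <= (if b <= a then \<kappa> * rpow t (a - b) * lnorm S a \<sigma> else 0)"
  and \<alpha>: "!!a. a \<in> index S ==> \<alpha> <= a"
  and \<kappa>: "0 <= \<kappa>" and b: "b \<in> index_below S \<gamma>" and \<tau>: "\<tau> \<in> T_below S \<gamma>" and D: "0 <= t" "t <= D" "1 <= D"
 shows "\<N> b (T \<tau>) <= \<kappa> * D powr (\<gamma> - \<alpha>) * nrm \<gamma> \<tau>"
proof -
 have bi: "b \<in> index S" using b by (rule index_below_index)
 have sumle: "\<N> b (\<Sum>a\<in>I. f a) <= (\<Sum>a\<in>I. \<N> b (f a))" if "finite I" for I :: "real set" and f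
  using that by (induction I rule: finite_induct) (auto intro: order_trans[OF comp_norm_add[OF bi]] simp: bi)
 have rp: "rpow t e <= D powr (\<gamma> - \<alpha>)" if "0 <= e" "e <= \<gamma> - \<alpha>" for e
 proof -
  have "1 <= D powr (\<gamma> - \<alpha>)" using D that by (intro ge_one_powr_ge_zero) auto
  moreover have "t powr e <= D powr e" using D that by (intro powr_mono2) auto
  moreover have "D powr e <= D powr (\<gamma> - \<alpha>)" using D that by (intro powr_mono) auto
  ultimately show ?thesis by (simp add: rpow_def)
 qed
 have "\<N> b (T \<tau>) = \<N> b (\<Sum>a\<in>index_below S \<gamma>. T (component S a \<tau>))"
  by (subst T_below_sum[OF \<tau>]) (simp add: linear_sum[OF T])
 also have "... <= (\<Sum>a\<in>index_below S \<gamma>. \<N> b (T (component S a \<tau>)))"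
  by (rule sumle[OF finite_index_below])
 also have "... <= (\<Sum>a\<in>index_below S \<gamma>. \<kappa> * D powr (\<gamma> - \<alpha>) * \<N> a \<tau>)"
 proof (rule sum_mono)
  fix a assume a: "a \<in> index_below S \<gamma>"
  have c: "component S a \<tau> \<in> layer S a" by (rule component_layer[OF index_below_index(1)[OF a]])
  have n0: "0 <= lnorm S a (component S a \<tau>)" by (rule lnorm_nonneg[OF index_below_index(1)[OF a] c])
  have "\<N> b (T (component S a \<tau>)) <= (if b <= a then \<kappa> * rpow t (a - b) * lnorm S a (component S a \<tau>) else 0)"
   by (rule bd[OF a c])
  also have "... <= \<kappa> * D powr (\<gamma> - \<alpha>) * lnorm S a (component S a \<tau>)"
   using rp[of "a - b"] index_below_index(2)[OF a] \<alpha>[OF bi] \<kappa> n0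
   by (auto intro!: mult_right_mono mult_left_mono)
  finally show "\<N> b (T (component S a \<tau>)) <= \<kappa> * D powr (\<gamma> - \<alpha>) * \<N> a \<tau>"
   by (simp add: comp_norm_def)
 qed
 also have "... = \<kappa> * D powr (\<gamma> - \<alpha>) * nrm \<gamma> \<tau>" by (simp add: nrm_def sum_distrib_left)
 finally show ?thesis .
qed

end

locale model_bounds = scaling s + reg_struct S
 for s :: "'d::finite => nat" and S :: "('t::real_vector) reg_structure" +
 fixes r :: nat and \<gamma> \<alpha> :: real
  and P :: "real ^ 'd => 't => 'd functional" and \<Gamma> :: "real ^ 'd => real ^ 'd => 't => 't"
 assumes model: "model s r S P \<Gamma>"
  and \<alpha>: "!!a. a \<in> index S ==> \<alpha> <= a" "\<alpha> < \<gamma>" and \<gamma>: "\<gamma> < 0"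
begin

lemma Gamma_group: "\<Gamma> x y \<in> str_group S"
 and Gamma_comp: "\<Gamma> x y (\<Gamma> y z \<tau>) = \<Gamma> x z \<tau>"
 and Gamma_id: "\<Gamma> x x \<tau> = \<tau>"
 and P_tempered: "P x \<tau> \<in> tempered"
 and P_linear: "linear (\<lambda>\<tau>. P x \<tau> \<psi>)"
 and P_Gamma: "P y \<tau> = P x (\<Gamma> x y \<tau>)"
 using model unfolding model_def by (auto simp: fun_eq_iff)

lemma Gamma_linear: "linear (\<Gamma> x y)"
 by (rule group_linear[OF Gamma_group])

lemma model_const: "\<exists>C\<ge>0. Pi_bound s r S \<gamma> P C \<and> Gamma_bound s S \<gamma> \<Gamma> C"
proof -
 obtain C where C: "0 < C" "Pi_bound s r S 1 P C" "Gamma_bound s S 1 \<Gamma> C"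
  using model unfolding model_def by (meson zero_less_one)
 have "Pi_bound s r S \<gamma> P C" using C(2) \<gamma> unfolding Pi_bound_def by (meson less_imp_le order_trans zero_less_one)
 moreover have "Gamma_bound s S \<gamma> \<Gamma> C" using C(3) \<gamma> unfolding Gamma_bound_def by (meson less_imp_le order_trans zero_less_one)
 ultimately show ?thesis using C(1) by (intro exI[of _ C]) simp
qed

abbreviation "\<Pi>n \<equiv> Pi_norm s r S \<gamma> P"
abbreviation "\<Gamma>n \<equiv> Gamma_norm s S \<gamma> \<Gamma>"

lemma le_Inf_bound:
 fixes X :: "real set" and A B :: real
 assumes "X ~= {}" "!!C. C \<in> X ==> A <= C * B" "0 <= B"
 shows "A <= Inf X * B"
proof (cases "B = 0")
 case True
 thus ?thesis using assms by auto
next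
 case False
 hence "A / B <= Inf X" using assms by (intro cInf_greatest) (auto simp: divide_le_eq)
 thus ?thesis using False assms(3) by (simp add: divide_le_eq)
qed

lemma Pi_norm_nonneg: "0 <= \<Pi>n"
 unfolding Pi_norm_def using model_const by (intro cInf_greatest) auto

lemma Gamma_norm_nonneg: "0 <= \<Gamma>n"
 unfolding Gamma_norm_def using model_const by (intro cInf_greatest) auto

lemma Gamma_norm_bound: "Gamma_bound s S \<gamma> \<Gamma> \<Gamma>n"
 unfolding Gamma_bound_def
proof (intro allI ballI impI)
 fix x y a b \<tau>
 assume a: "a \<in> index S" "a <= \<gamma>" and b: "b \<in> index S" "b <= a" and \<tau>: "\<tau> \<in> layer S a"
 have "\<N> b (\<Gamma> x y \<tau>) <= Inf {C. 0 <= C \<and> Gamma_bound s S \<gamma> \<Gamma> C} * (rpow (snorm s (x - y)) (a - b) * lnorm S a \<tau>)"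
 proof (rule le_Inf_bound)
  show "{C. 0 <= C \<and> Gamma_bound s S \<gamma> \<Gamma> C} ~= {}" using model_const by auto
  show "\<N> b (\<Gamma> x y \<tau>) <= C * (rpow (snorm s (x - y)) (a - b) * lnorm S a \<tau>)"
   if "C \<in> {C. 0 <= C \<and> Gamma_bound s S \<gamma> \<Gamma> C}" for C
   using that a b \<tau> unfolding Gamma_bound_def by (simp add: mult.assoc)
  show "0 <= rpow (snorm s (x - y)) (a - b) * lnorm S a \<tau>"
   using lnorm_nonneg[OF a(1) \<tau>] by (simp add: rpow_def)
 qed
 thus "\<N> b (\<Gamma> x y \<tau>) <= \<Gamma>n * rpow (snorm s (x - y)) (a - b) * lnorm S a \<tau>"
  by (simp add: Gamma_norm_def mult.assoc)
qed

text \<open>The infimum defining the norm of a model is itself an admissible constant, because each bound is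
 linear in the constant.\<close>

lemma Pi_norm_bound: "Pi_bound s r S \<gamma> P \<Pi>n"
 unfolding Pi_bound_def
proof (intro allI ballI impI)
 fix x :: "real ^ 'd" and l a :: real and \<tau> and \<psi> :: "real ^ 'd => real"
 assume l: "0 < l \<and> l <= 1" and a: "a \<in> index S" "a <= \<gamma>" and \<tau>: "\<tau> \<in> layer S a" and \<psi>: "\<psi> \<in> unit_tests s r"
 let ?A = "abs_pairing r (P x \<tau>) (rescale s \<psi> l x)"
 let ?X = "{C. 0 <= C \<and> Pi_bound s r S \<gamma> P C}"
 have X: "?X ~= {}" using model_const by auto
 have A: "?A <= ennreal (C * (l powr a * lnorm S a \<tau>))" if "C \<in> ?X" for C
  using that l a \<tau> \<psi> unfolding Pi_bound_def by (simp add: mult.assoc)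
 obtain C where "C \<in> ?X" using X by blast
 from A[OF this] have fin: "?A < top" by (rule le_less_trans) simp
 have n0: "0 <= l powr a * lnorm S a \<tau>" using lnorm_nonneg[OF a(1) \<tau>] by simp
 have "enn2real ?A <= Inf ?X * (l powr a * lnorm S a \<tau>)"
 proof (rule le_Inf_bound[OF X _ n0])
  fix C assume C: "C \<in> ?X"
  show "enn2real ?A <= C * (l powr a * lnorm S a \<tau>)"
   using A[OF C] C n0 by (intro enn2real_leI) auto
 qed
 hence "ennreal (enn2real ?A) <= ennreal (\<Pi>n * (l powr a * lnorm S a \<tau>))"
  unfolding Pi_norm_def by (rule ennreal_leI)
 thus "?A <= ennreal (\<Pi>n * l powr a * lnorm S a \<tau>)" using fin by (simp add: mult.assoc)
qed

lemma Gamma_layer: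
 assumes "a \<in> index_below S \<gamma>" "b \<in> index_below S \<gamma>" "\<tau> \<in> layer S a"
 shows "\<N> b (\<Gamma> x y \<tau>) <= (if b <= a then \<Gamma>n * rpow (snorm s (x - y)) (a - b) * lnorm S a \<tau> else 0)"
proof (cases "b <= a")
 case True
 thus ?thesis using Gamma_norm_bound assms unfolding Gamma_bound_def by (auto simp: index_below_def)
next
 case False
 have ai: "a \<in> index S" and bi: "b \<in> index S" using assms by (auto simp: index_below_def)
 have "component S b (\<Gamma> x y \<tau>) = component S b (\<Gamma> x y \<tau> - \<tau>) + component S b \<tau>"
  by (simp add: component_diff)
 also have "... = 0"
  using component_group[OF Gamma_group ai assms(3), of b x y] component_of_layer[OF ai assms(3), of b] False by simp
 finally have "\<N> b (\<Gamma> x y \<tau>) = 0"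
  unfolding comp_norm_def using comp_norm_zero[OF bi] by (simp add: comp_norm_def)
 thus ?thesis using False by simp
qed

lemma Gamma_crude:
 assumes b: "b \<in> index_below S \<gamma>" and \<tau>: "\<tau> \<in> T_below S \<gamma>" and D: "snorm s (x - y) <= D" "1 <= D"
 shows "\<N> b (\<Gamma> x y \<tau>) <= \<Gamma>n * D powr (\<gamma> - \<alpha>) * nrm \<gamma> \<tau>"
 by (rule transport_crude[OF Gamma_linear Gamma_layer[OF _ b] \<alpha>(1) Gamma_norm_nonneg b \<tau> snorm_nonneg D])

definition modulus :: "real => real" where
 "modulus t = (\<Sum>b\<in>index_below S \<gamma>. \<Sum>a\<in>index_below S \<gamma>. if b < a then t powr (a - b) else 0)"

lemma modulus_tendsto:
 assumes "(f \<longlongrightarrow> 0) F" "\<forall>\<^sub>F x in F. 0 <= f x"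
 shows "((\<lambda>x. modulus (f x)) \<longlongrightarrow> 0) F"
proof -
 have "((\<lambda>x. modulus (f x)) \<longlongrightarrow> (\<Sum>b\<in>index_below S \<gamma>. \<Sum>a\<in>index_below S \<gamma>. 0)) F"
  unfolding modulus_def
 proof (intro tendsto_sum)
  fix a b
  show "((\<lambda>x. if b < a then f x powr (a - b) else 0) \<longlongrightarrow> 0) F"
  proof (cases "b < a")
   case True
   have "((\<lambda>x. f x powr (a - b)) \<longlongrightarrow> 0 powr (a - b)) F"
    using assms True by (intro tendsto_powr') auto
   thus ?thesis using True by simp
  qed simp
 qed
 thus ?thesis by simp
qed

text \<open>The diagonal part of a transport is the identity, so only strictly positive powers of the distance
 remain.\<close>

lemma Gamma_near:
 assumes \<tau>: "\<tau> \<in> T_below S \<gamma>"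
 shows "nrm \<gamma> (\<Gamma> x y \<tau> - \<tau>) <= \<Gamma>n * modulus (snorm s (x - y)) * nrm \<gamma> \<tau>"
proof -
 let ?I = "index_below S \<gamma>" and ?t = "snorm s (x - y)"
 have one: "\<N> b (\<Gamma> x y \<tau> - \<tau>) <= (\<Sum>a\<in>?I. (if b < a then \<Gamma>n * ?t powr (a - b) * \<N> a \<tau> else 0))"
  if b: "b \<in> ?I" for b
 proof -
  have bi: "b \<in> index S" using b by (simp add: index_below_def)
  have sumle: "\<N> b (\<Sum>a\<in>I. f a) <= (\<Sum>a\<in>I. \<N> b (f a))" if "finite I" for I :: "real set" and f
   using that by (induction I rule: finite_induct) (auto intro: order_trans[OF comp_norm_add[OF bi]] simp: bi)
  have "\<Gamma> x y \<tau> - \<tau> = (\<Sum>a\<in>?I. \<Gamma> x y (component S a \<tau>)) - (\<Sum>a\<in>?I. component S a \<tau>)"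
   using T_below_sum[OF \<tau>] linear_sum[OF Gamma_linear, of x y "\<lambda>a. component S a \<tau>" ?I] by metis
  hence "\<Gamma> x y \<tau> - \<tau> = (\<Sum>a\<in>?I. \<Gamma> x y (component S a \<tau>) - component S a \<tau>)"
   by (simp add: sum_subtractf)
  hence "\<N> b (\<Gamma> x y \<tau> - \<tau>) <= (\<Sum>a\<in>?I. \<N> b (\<Gamma> x y (component S a \<tau>) - component S a \<tau>))"
   using sumle[OF finite_index_below] by simp
  also have "... <= (\<Sum>a\<in>?I. (if b < a then \<Gamma>n * ?t powr (a - b) * \<N> a \<tau> else 0))"
  proof (rule sum_mono)
   fix a assume a: "a \<in> ?I"
   hence ai: "a \<in> index S" and c: "component S a \<tau> \<in> layer S a" by (auto simp: index_below_def intro: component_layer)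
   show "\<N> b (\<Gamma> x y (component S a \<tau>) - component S a \<tau>) <= (if b < a then \<Gamma>n * ?t powr (a - b) * \<N> a \<tau> else 0)"
   proof (cases "b < a")
    case True
    have "component S b (component S a \<tau>) = 0" using component_of_layer[OF ai c, of b] True by simp
    hence "\<N> b (\<Gamma> x y (component S a \<tau>) - component S a \<tau>) = \<N> b (\<Gamma> x y (component S a \<tau>))"
     by (simp add: comp_norm_def component_diff)
    also have "... <= \<Gamma>n * ?t powr (a - b) * \<N> a \<tau>"
     using Gamma_layer[OF a b c, of x y] True by (simp add: rpow_def comp_norm_def)
    finally show ?thesis using True by simp
   next
    case False
    hence "component S b (\<Gamma> x y (component S a \<tau>) - component S a \<tau>) = 0"
     by (intro component_group[OF Gamma_group ai c]) simp
    thus ?thesis using False comp_norm_zero[OF bi] by (simp add: comp_norm_def)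
   qed
  qed
  finally show ?thesis .
 qed
 have "nrm \<gamma> (\<Gamma> x y \<tau> - \<tau>) <= (\<Sum>b\<in>?I. \<Sum>a\<in>?I. (if b < a then \<Gamma>n * ?t powr (a - b) * \<N> a \<tau> else 0))"
  unfolding nrm_def[of \<gamma> "\<Gamma> x y \<tau> - \<tau>"] by (rule sum_mono) (rule one)
 also have "... <= (\<Sum>b\<in>?I. \<Sum>a\<in>?I. \<Gamma>n * nrm \<gamma> \<tau> * (if b < a then ?t powr (a - b) else 0))"
 proof (intro sum_mono)
  fix a b assume a: "a \<in> ?I"
  have "(\<Gamma>n * ?t powr (a - b)) * \<N> a \<tau> <= (\<Gamma>n * ?t powr (a - b)) * nrm \<gamma> \<tau>"
   using Gamma_norm_nonneg by (intro mult_left_mono comp_norm_le_nrm[OF a]) simp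
  thus "(if b < a then \<Gamma>n * ?t powr (a - b) * \<N> a \<tau> else 0) <= \<Gamma>n * nrm \<gamma> \<tau> * (if b < a then ?t powr (a - b) else 0)"
   by (simp add: mult_ac)
 qed
 also have "... = \<Gamma>n * modulus ?t * nrm \<gamma> \<tau>"
  by (simp add: modulus_def sum_distrib_left[symmetric] mult_ac)
 finally show ?thesis .
qed

lemma Gamma_T_below: "\<tau> \<in> T_below S \<gamma> ==> \<Gamma> x y \<tau> \<in> T_below S \<gamma>"
 by (rule group_T_below[OF Gamma_group])

lemma nrm_Gamma:
 assumes "\<tau> \<in> T_below S \<gamma>" "snorm s (x - y) <= D" "1 <= D"
 shows "nrm \<gamma> (\<Gamma> x y \<tau>) <= real (card (index_below S \<gamma>)) * (\<Gamma>n * D powr (\<gamma> - \<alpha>) * nrm \<gamma> \<tau>)"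
 unfolding nrm_def[of \<gamma> "\<Gamma> x y \<tau>"] using Gamma_crude[OF _ assms] by (rule sum_bounded_above)

text \<open>The two base points are moved one after the other, each time by the composition law and
 \<open>Gamma_near\<close>.\<close>

lemma Gamma_continuous:
 assumes \<tau>: "\<tau> \<in> T_below S \<gamma>"
 shows "((\<lambda>p. nrm \<gamma> (\<Gamma> (fst p) (snd p) \<tau> - \<Gamma> z y \<tau>)) \<longlongrightarrow> 0) (at (z, y))"
proof -
 define D where "D = snorm s (z - y) + 1"
 define K where "K = real (card (index_below S \<gamma>)) * (\<Gamma>n * D powr (\<gamma> - \<alpha>))"
 have D: "snorm s (z - y) <= D" "1 <= D" by (auto simp: D_def)
 have K0: "0 <= K" using Gamma_norm_nonneg by (simp add: K_def)
 have m0: "0 <= modulus t" for t unfolding modulus_def by (intro sum_nonneg) auto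
 let ?m1 = "\<lambda>p. modulus (snorm s (fst p - z))" and ?m2 = "\<lambda>p. modulus (snorm s (y - snd p))"
 have b: "nrm \<gamma> (\<Gamma> (fst p) (snd p) \<tau> - \<Gamma> z y \<tau>) \<le>
  \<Gamma>n * ?m1 p * (K * (\<Gamma>n * ?m2 p * nrm \<gamma> \<tau> + nrm \<gamma> \<tau>)) + K * (\<Gamma>n * ?m2 p * nrm \<gamma> \<tau>)" for p
 proof -
  obtain z' y' where p: "p = (z', y')" by (cases p)
  let ?\<sigma> = "\<Gamma> y y' \<tau>"
  let ?c = "\<Gamma>n * modulus (snorm s (y - y')) * nrm \<gamma> \<tau>"
  have \<sigma>: "?\<sigma> \<in> T_below S \<gamma>" by (rule Gamma_T_below[OF \<tau>])
  have z\<sigma>: "\<Gamma> z y ?\<sigma> \<in> T_below S \<gamma>" by (rule Gamma_T_below[OF \<sigma>])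
  have d\<sigma>: "?\<sigma> - \<tau> \<in> T_below S \<gamma>" using \<sigma> \<tau> subspace_T_below by (rule subspace_diff[rotated])
  have n1: "nrm \<gamma> (?\<sigma> - \<tau>) <= ?c" by (rule Gamma_near[OF \<tau>])
  have n2: "nrm \<gamma> ?\<sigma> <= ?c + nrm \<gamma> \<tau>"
   using nrm_add[of \<gamma> "?\<sigma> - \<tau>" \<tau>] n1 by simp
  have n3: "nrm \<gamma> (\<Gamma> z y ?\<sigma>) <= K * (?c + nrm \<gamma> \<tau>)"
  proof -
   have "nrm \<gamma> (\<Gamma> z y ?\<sigma>) <= K * nrm \<gamma> ?\<sigma>" using nrm_Gamma[OF \<sigma> D] by (simp add: K_def mult.assoc)
   also have "... <= K * (?c + nrm \<gamma> \<tau>)" by (rule mult_left_mono[OF n2 K0])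
   finally show ?thesis .
  qed
  have n4: "nrm \<gamma> (\<Gamma> z y (?\<sigma> - \<tau>)) <= K * ?c"
  proof -
   have "nrm \<gamma> (\<Gamma> z y (?\<sigma> - \<tau>)) <= K * nrm \<gamma> (?\<sigma> - \<tau>)" using nrm_Gamma[OF d\<sigma> D] by (simp add: K_def mult.assoc)
   also have "... <= K * ?c" by (rule mult_left_mono[OF n1 K0])
   finally show ?thesis .
  qed
  have n5: "nrm \<gamma> (\<Gamma> z' z (\<Gamma> z y ?\<sigma>) - \<Gamma> z y ?\<sigma>) <= \<Gamma>n * modulus (snorm s (z' - z)) * (K * (?c + nrm \<gamma> \<tau>))"
  proof -
   have "nrm \<gamma> (\<Gamma> z' z (\<Gamma> z y ?\<sigma>) - \<Gamma> z y ?\<sigma>) <= \<Gamma>n * modulus (snorm s (z' - z)) * nrm \<gamma> (\<Gamma> z y ?\<sigma>)"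
    by (rule Gamma_near[OF z\<sigma>])
   also have "... <= \<Gamma>n * modulus (snorm s (z' - z)) * (K * (?c + nrm \<gamma> \<tau>))"
    using Gamma_norm_nonneg m0 by (intro mult_left_mono n3) simp
   finally show ?thesis .
  qed
  have "\<Gamma> z' y' \<tau> - \<Gamma> z y \<tau> = (\<Gamma> z' z (\<Gamma> z y ?\<sigma>) - \<Gamma> z y ?\<sigma>) + \<Gamma> z y (?\<sigma> - \<tau>)"
   by (simp add: Gamma_comp linear_diff[OF Gamma_linear])
  hence "nrm \<gamma> (\<Gamma> z' y' \<tau> - \<Gamma> z y \<tau>) <= nrm \<gamma> (\<Gamma> z' z (\<Gamma> z y ?\<sigma>) - \<Gamma> z y ?\<sigma>) + nrm \<gamma> (\<Gamma> z y (?\<sigma> - \<tau>))"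
   using nrm_add by metis
  thus ?thesis unfolding p fst_conv snd_conv using n4 n5 by linarith
 qed
 have m1: "(?m1 \<longlongrightarrow> 0) (at (z, y))"
  by (intro modulus_tendsto snorm_tendsto_0) (auto intro!: tendsto_eq_intros)
 have m2: "(?m2 \<longlongrightarrow> 0) (at (z, y))"
  by (intro modulus_tendsto snorm_tendsto_0) (auto intro!: tendsto_eq_intros)
 have "((\<lambda>p. \<Gamma>n * ?m1 p * (K * (\<Gamma>n * ?m2 p * nrm \<gamma> \<tau> + nrm \<gamma> \<tau>)) + K * (\<Gamma>n * ?m2 p * nrm \<gamma> \<tau>)) \<longlongrightarrow>
   \<Gamma>n * 0 * (K * (\<Gamma>n * 0 * nrm \<gamma> \<tau> + nrm \<gamma> \<tau>)) + K * (\<Gamma>n * 0 * nrm \<gamma> \<tau>)) (at (z, y))"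
  by (intro tendsto_intros m1 m2)
 hence lim: "((\<lambda>p. \<Gamma>n * ?m1 p * (K * (\<Gamma>n * ?m2 p * nrm \<gamma> \<tau> + nrm \<gamma> \<tau>)) + K * (\<Gamma>n * ?m2 p * nrm \<gamma> \<tau>)) \<longlongrightarrow> 0) (at (z, y))"
  by simp
 show ?thesis
  by (rule Lim_null_comparison[OF _ lim]) (use b nrm_nonneg in auto)
qed

end

section \<open>Kernel estimates\<close>

lemma nn_integral_density_lebesgue:
 fixes f w :: "'a::euclidean_space => ennreal"
 assumes "w \<in> borel_measurable borel" "f \<in> borel_measurable borel"
 shows "(\<integral>\<^sup>+x. f x \<partial>density lebesgue w) = (\<integral>\<^sup>+x. w x * f x)"
 using assms by (subst nn_integral_density) (auto simp: nn_integral_lebesgue intro: measurable_completion)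

lemma AE_density_lebesgue:
 fixes w :: "'a::euclidean_space => ennreal"
 assumes "w \<in> borel_measurable borel"
 shows "(AE x in density lebesgue w. Q x) \<longleftrightarrow> (AE x in lebesgue. 0 < w x --> Q x)"
 using assms by (subst AE_density) (auto intro: measurable_completion)

lemma AE_lborel_lebesgue: "(AE x in lborel. Q x) ==> (AE x in lebesgue. Q x)"
 by (rule AE_completion)

lemma ennreal_le_suminf: "f j <= (\<Sum>j. f j)" for f :: "nat => ennreal"
 using sum_le_suminf[OF summableI, of "{j}" f] by simp

lemma nn_integral_has_integral_indicator:
 fixes f :: "real => real"
 assumes "(f has_integral I) \<Omega>" "!!x. 0 <= f x"
 shows "(\<integral>\<^sup>+x. ennreal (f x) * indicator \<Omega> x) = ennreal I"
proof -
 have "(\<integral>\<^sup>+x. ennreal (indicator \<Omega> x * f x)) = ennreal I"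
  by (rule nn_integral_has_integral_lebesgue[OF assms(2,1)])
 moreover have "ennreal (indicator \<Omega> x * f x) = ennreal (f x) * indicator \<Omega> x" for x
  by (cases "x \<in> \<Omega>") simp_all
 ultimately show ?thesis by simp
qed

context scaling
begin

text \<open>A geometric series over the dyadic balls of radius $2^j l$.\<close>

lemma kernel_mass:
 assumes \<delta>: "0 < \<delta>"
 shows "\<exists>C>0. \<forall>l>0. (\<integral>\<^sup>+h. ennreal (max l (snorm s h) powr (- \<delta> - real (scale_deg s)))) <= ennreal (C * l powr - \<delta>)"
proof -
 let ?d = "real (scale_deg s)"
 define q where "q = (2 :: real) powr - \<delta>"
 have q: "0 < q" "q < 1" using two_powr_less_one[OF \<delta>] by (auto simp: q_def)
 define c where "c = 2 ^ CARD('d) * (2 :: real) powr (\<delta> + ?d)"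
 have c: "0 < c" by (simp add: c_def)
 have "(\<integral>\<^sup>+h. ennreal (max l (snorm s h) powr (- \<delta> - ?d))) <= ennreal (c / (1 - q) * l powr - \<delta>)" if l: "0 < l" for l
 proof -
  let ?t = "\<lambda>j h. ennreal ((2 ^ j * l / 2) powr (- \<delta> - ?d)) * indicator {h. snorm s h <= 2 ^ j * l} h"
  have pt: "ennreal (max l (snorm s h) powr (- \<delta> - ?d)) <= (\<Sum>j. ?t j h)" for h
  proof -
   have "\<exists>j. snorm s h <= 2 ^ j * l"
   proof -
    obtain j where "snorm s h / l < 2 ^ j" using real_arch_pow[of 2 "snorm s h / l"] by auto
    thus ?thesis using l by (intro exI[of _ j]) (simp add: divide_less_eq)
   qed
   then obtain j where j: "snorm s h <= 2 ^ j * l" "!!i. i < j ==> \<not> snorm s h <= 2 ^ i * l"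
    using exists_least_iff[of "\<lambda>j. snorm s h <= 2 ^ j * l"] by auto
   have "2 ^ j * l / 2 <= max l (snorm s h)"
   proof (cases j)
    case 0
    thus ?thesis using l by simp
   next
    case (Suc i)
    thus ?thesis using j(2)[of i] by simp
   qed
   hence "max l (snorm s h) powr (- \<delta> - ?d) <= (2 ^ j * l / 2) powr (- \<delta> - ?d)"
    using l \<delta> by (intro powr_mono2') auto
   hence "ennreal (max l (snorm s h) powr (- \<delta> - ?d)) <= ?t j h"
    using j(1) by (simp add: ennreal_leI)
   also have "... <= (\<Sum>j. ?t j h)" by (rule ennreal_le_suminf)
   finally show ?thesis .
  qed
  have "(\<integral>\<^sup>+h. ennreal (max l (snorm s h) powr (- \<delta> - ?d))) <= (\<integral>\<^sup>+h. (\<Sum>j. ?t j h))"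
   by (rule nn_integral_mono) (rule pt)
  also have "... = (\<Sum>j. \<integral>\<^sup>+h. ?t j h)" by (rule nn_integral_suminf) measurable
  also have "... <= (\<Sum>j. ennreal (c * l powr - \<delta> * q ^ j))"
  proof (rule suminf_le[OF _ summableI summableI])
   fix j
   let ?R = "2 ^ j * l"
   have R: "0 < ?R" using l by simp
   have "(\<integral>\<^sup>+h. ?t j h) = ennreal ((?R / 2) powr (- \<delta> - ?d)) * emeasure lborel {h. snorm s h <= ?R}"
    by (rule nn_integral_cmult_indicator) measurable
   also have "... <= ennreal ((?R / 2) powr (- \<delta> - ?d)) * ennreal (2 ^ CARD('d) * ?R ^ scale_deg s)"
    using R by (intro mult_left_mono emeasure_snorm_ball_le) auto
   also have "... = ennreal ((?R / 2) powr (- \<delta> - ?d) * (2 ^ CARD('d) * ?R ^ scale_deg s))"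
    by (rule ennreal_mult[symmetric]) (use R in auto)
   also have "(?R / 2) powr (- \<delta> - ?d) * (2 ^ CARD('d) * ?R ^ scale_deg s) = c * l powr - \<delta> * q ^ j"
   proof -
    have 1: "(?R / 2) powr (- \<delta> - ?d) = ?R powr (- \<delta> - ?d) * 2 powr (\<delta> + ?d)"
    proof -
     have "(2 :: real) powr (\<delta> + ?d) = 2 powr - (- \<delta> - ?d)" by (simp add: add.commute)
     also have "... = 1 / 2 powr (- \<delta> - ?d)" by (rule powr_minus_divide)
     finally show ?thesis using R by (subst powr_divide) simp_all
    qed
    have 2: "?R powr (- \<delta> - ?d) * ?R ^ scale_deg s = ?R powr - \<delta>"
     using R by (simp only: powr_realpow[symmetric] powr_add[symmetric]) simp
    have 3: "?R powr - \<delta> = q ^ j * l powr - \<delta>"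
    proof -
     have "?R powr - \<delta> = (2 ^ j) powr - \<delta> * l powr - \<delta>" by (rule powr_mult)
     also have "((2 :: real) ^ j) powr - \<delta> = q ^ j"
      unfolding q_def by (simp add: powr_powr mult.commute flip: powr_realpow)
     finally show ?thesis .
    qed
    have "(?R / 2) powr (- \<delta> - ?d) * (2 ^ CARD('d) * ?R ^ scale_deg s) = c * (?R powr (- \<delta> - ?d) * ?R ^ scale_deg s)"
     unfolding 1 c_def by (simp only: mult_ac)
    thus ?thesis unfolding 2 3 by (simp only: mult_ac)
   qed
   finally show "(\<integral>\<^sup>+h. ?t j h) <= ennreal (c * l powr - \<delta> * q ^ j)" .
  qed
  also have "... = ennreal (\<Sum>j. c * l powr - \<delta> * q ^ j)"
   by (rule suminf_ennreal2) (use c q in "auto intro!: summable_mult summable_geometric")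
  also have "(\<Sum>j. c * l powr - \<delta> * q ^ j) = c / (1 - q) * l powr - \<delta>"
   using q by (subst suminf_mult) (auto intro!: summable_geometric simp: suminf_geometric)
  finally show ?thesis .
 qed
 thus ?thesis using c q by (intro exI[of _ "c / (1 - q)"]) auto
qed

text \<open>Split at \<open>l = t\<close>: below, the power of \<open>l\<close> is integrable because \<open>\<gamma> < 0\<close>; above, the integrand
 decays faster than $1/l$.\<close>

lemma kernel_mass_scale:
 assumes \<gamma>: "\<gamma> < 0" and t: "0 < t"
 shows "(\<integral>\<^sup>+l. indicator {0<..<1} l * ennreal (1 / l) * ennreal (l powr - \<gamma> * max l t powr (\<gamma> - real (scale_deg s))))
  <= ennreal ((1 / - \<gamma> + 1) * t powr - real (scale_deg s))"
proof -
 let ?d = "real (scale_deg s)"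
 have d: "1 <= ?d" using scale_deg_pos by simp
 have i1: "((\<lambda>l. l powr (- \<gamma> - 1)) has_integral (t powr (- \<gamma> - 1 + 1) / (- \<gamma> - 1 + 1))) {0..t}"
  using \<gamma> t by (intro has_integral_powr_from_0) auto
 have i2: "((\<lambda>l. l powr (- ?d - 1)) has_integral (- (t powr (- ?d - 1 + 1)) / (- ?d - 1 + 1))) {t..}"
  using d t by (intro has_integral_powr_to_inf) auto
 have j1: "(\<integral>\<^sup>+l. ennreal (l powr (- \<gamma> - 1)) * indicator {0..t} l) = ennreal (t powr - \<gamma> / - \<gamma>)"
  using nn_integral_has_integral_indicator[OF i1] by simp
 have j2: "(\<integral>\<^sup>+l. ennreal (l powr (- ?d - 1)) * indicator {t..} l) = ennreal (t powr - ?d / ?d)"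
  using nn_integral_has_integral_indicator[OF i2] by simp
 have "(\<integral>\<^sup>+l. indicator {0<..<1} l * ennreal (1 / l) * ennreal (l powr - \<gamma> * max l t powr (\<gamma> - ?d))) \<le>
  (\<integral>\<^sup>+l. ennreal (t powr (\<gamma> - ?d)) * (ennreal (l powr (- \<gamma> - 1)) * indicator {0..t} l) + ennreal (l powr (- ?d - 1)) * indicator {t..} l)"
 proof (rule nn_integral_mono)
  fix l :: real
  show "indicator {0<..<1} l * ennreal (1 / l) * ennreal (l powr - \<gamma> * max l t powr (\<gamma> - ?d)) \<le>
   ennreal (t powr (\<gamma> - ?d)) * (ennreal (l powr (- \<gamma> - 1)) * indicator {0..t} l) + ennreal (l powr (- ?d - 1)) * indicator {t..} l"
  proof (cases "l \<in> {0<..<1}")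
   case True
   hence l: "0 < l" by simp
   have e: "1 / l * l powr a = l powr (a - 1)" for a using l by (simp add: powr_diff)
   show ?thesis
   proof (cases "l <= t")
    case True
    have "1 / l * (l powr - \<gamma> * max l t powr (\<gamma> - ?d)) = t powr (\<gamma> - ?d) * l powr (- \<gamma> - 1)"
     unfolding max_absorb2[OF True] e[symmetric] by (simp only: mult_ac)
    hence "ennreal (1 / l) * ennreal (l powr - \<gamma> * max l t powr (\<gamma> - ?d)) = ennreal (t powr (\<gamma> - ?d)) * ennreal (l powr (- \<gamma> - 1))"
     using l by (simp add: ennreal_mult[symmetric])
    thus ?thesis using True l \<open>l \<in> {0<..<1}\<close> by (simp add: indicator_def)
   next
    case False
    have "1 / l * (l powr - \<gamma> * max l t powr (\<gamma> - ?d)) = l powr (- ?d - 1)"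
    proof -
     have "max l t = l" using False by simp
     moreover have "l powr - \<gamma> * l powr (\<gamma> - ?d) = l powr - ?d" by (simp add: powr_add[symmetric])
     ultimately show ?thesis using e[of "- ?d"] by simp
    qed
    hence "ennreal (1 / l) * ennreal (l powr - \<gamma> * max l t powr (\<gamma> - ?d)) = ennreal (l powr (- ?d - 1))"
     using l by (simp add: ennreal_mult[symmetric])
    thus ?thesis using False l \<open>l \<in> {0<..<1}\<close> by (simp add: indicator_def)
   qed
  qed simp
 qed
 also have "... = ennreal (t powr (\<gamma> - ?d)) * ennreal (t powr - \<gamma> / - \<gamma>) + ennreal (t powr - ?d / ?d)"
  by (subst nn_integral_add, measurable, subst nn_integral_cmult, measurable) (simp only: j1 j2)
 also have "... = ennreal (t powr (\<gamma> - ?d) * (t powr - \<gamma> / - \<gamma>) + t powr - ?d / ?d)"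
 proof -
  have nn: "0 <= t powr - \<gamma> / - \<gamma>" using \<gamma> by (intro divide_nonneg_pos) auto
  have "ennreal (t powr (\<gamma> - ?d)) * ennreal (t powr - \<gamma> / - \<gamma>) = ennreal (t powr (\<gamma> - ?d) * (t powr - \<gamma> / - \<gamma>))"
   by (rule ennreal_mult[symmetric]) (use nn in auto)
  moreover have "0 <= t powr (\<gamma> - ?d) * (t powr - \<gamma> / - \<gamma>)" by (rule mult_nonneg_nonneg[OF powr_ge_zero nn])
  moreover have "0 <= t powr - ?d / ?d" by simp
  ultimately show ?thesis by (simp only: ennreal_plus)
 qed
 also have "... <= ennreal ((1 / - \<gamma> + 1) * t powr - ?d)"
 proof (rule ennreal_leI)
  have "t powr (\<gamma> - ?d) * t powr - \<gamma> = t powr - ?d" by (simp add: powr_add[symmetric])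
  moreover have "t powr - ?d / ?d <= t powr - ?d / 1" using d by (intro divide_left_mono) auto
  ultimately show "t powr (\<gamma> - ?d) * (t powr - \<gamma> / - \<gamma>) + t powr - ?d / ?d <= (1 / - \<gamma> + 1) * t powr - ?d"
   by (simp only: times_divide_eq_right distrib_right) simp
 qed
 finally show ?thesis .
qed

definition ball_measure :: "real => (real ^ 'd) measure" where
 "ball_measure c = density lebesgue (\<lambda>h. indicator (sball s 0 c) h * ennreal (1 / snorm s h ^ scale_deg s))"

lemma ball_measure_1: "increment_measure s = ball_measure 1"
 by (simp add: increment_measure_def ball_measure_def)

lemma sball_measurable [measurable]: "sball s 0 c \<in> sets borel"
 unfolding sball_def by simp

lemma ball_weight_measurable [measurable]:
 "(\<lambda>h. indicator (sball s 0 c) h * ennreal (1 / snorm s h ^ scale_deg s)) \<in> borel_measurable borel"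
 by measurable

lemma scale_weight_measurable: "(\<lambda>l::real. indicator {0<..<1} l * ennreal (1 / l)) \<in> borel_measurable borel"
 by measurable

lemma AE_ball_measure: "(AE h in ball_measure c. Q h) \<longleftrightarrow> (AE h in lebesgue. snorm s h < c --> h ~= 0 --> Q h)"
proof -
 have "0 < indicator (sball s 0 c) h * ennreal (1 / snorm s h ^ scale_deg s) \<longleftrightarrow> snorm s h < c \<and> h ~= 0" for h :: "real ^ 'd"
 proof (cases "snorm s h < c \<and> h ~= 0")
  case True
  hence "snorm s h ~= 0" by (simp add: snorm_eq_0_iff)
  hence "0 < snorm s h" using snorm_nonneg[of h] by linarith
  thus ?thesis using True by (simp add: sball_def)
 next
  case False
  then consider "h = 0" | "\<not> snorm s h < c" by blast
  thus ?thesis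
  proof cases
   case 1
   thus ?thesis using scale_deg_pos by (simp add: power_0_left)
  next
   case 2
   thus ?thesis by (simp add: sball_def)
  qed
 qed
 hence eq: "(0 < indicator (sball s 0 c) h * ennreal (1 / snorm s h ^ scale_deg s) --> Q h) \<longleftrightarrow>
   (snorm s h < c --> h ~= 0 --> Q h)" for h by blast
 show ?thesis unfolding ball_measure_def AE_density_lebesgue[OF ball_weight_measurable] eq ..
qed

lemma AE_lebesgue_nonzero: "AE h in lebesgue. h ~= (0 :: real ^ 'd)"
 by (rule AE_lborel_lebesgue) (rule AE_lborel_singleton)

definition sker :: "real => real => real ^ 'd => real" where
 "sker \<gamma> l h = (if snorm s h < 3 then l powr - \<gamma> * max l (snorm s h) powr (\<gamma> - real (scale_deg s)) else 0)"

lemma sker_measurable [measurable]: "(\<lambda>(l, h). sker \<gamma> l h) \<in> borel_measurable borel2"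
 unfolding sker_def split_beta by measurable

text \<open>Schur's test. The kernel \<open>sker\<close> has bounded mass in the increment by \<open>kernel_mass\<close> and bounded mass in
 the scale by \<open>kernel_mass_scale\<close>; it therefore maps \<open>L\<^sup>q\<close> of the increments to \<open>L\<^sup>q\<close> of the scales
 for every \<open>q\<close>, with the same constant.\<close>

lemma schur_scales:
 assumes \<gamma>: "\<gamma> < 0"
 shows "\<exists>C>0. \<forall>q a. 1 <= q --> a \<in> borel_measurable borel -->
  Lnorm scale_measure_01 q (\<lambda>l. \<integral>\<^sup>+h. a h * ennreal (sker \<gamma> l h)) <= ennreal C * Lnorm (ball_measure 3) q a"
proof -
 let ?d = "real (scale_deg s)"
 obtain C1 where C1: "0 < C1" "!!l. 0 < l ==> (\<integral>\<^sup>+h. ennreal (max l (snorm s h) powr (- (- \<gamma>) - ?d))) <= ennreal (C1 * l powr - (- \<gamma>))"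
  using kernel_mass[of "- \<gamma>"] \<gamma> by auto
 define C where "C = max (max 1 C1) (1 / - \<gamma> + 1)"
 have C: "1 <= C" "C1 <= C" "1 / - \<gamma> + 1 <= C" by (auto simp: C_def)
 have [measurable]: "(\<lambda>h. sker \<gamma> l h) \<in> borel_measurable borel" for l unfolding sker_def by measurable
 have S1: "(\<integral>\<^sup>+h. ennreal (sker \<gamma> l h)) <= ennreal C" if l: "0 < l" for l
 proof -
  have "(\<integral>\<^sup>+h. ennreal (sker \<gamma> l h)) <= (\<integral>\<^sup>+h. ennreal (l powr - \<gamma>) * ennreal (max l (snorm s h) powr (- (- \<gamma>) - ?d)))"
   by (rule nn_integral_mono) (auto simp: sker_def ennreal_mult[symmetric])
  also have "... = ennreal (l powr - \<gamma>) * (\<integral>\<^sup>+h. ennreal (max l (snorm s h) powr (- (- \<gamma>) - ?d)))"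
   by (rule nn_integral_cmult) measurable
  also have "... <= ennreal (l powr - \<gamma>) * ennreal (C1 * l powr - (- \<gamma>))" by (intro mult_left_mono C1 l) simp
  also have "... = ennreal C1" using C1(1) l by (simp add: ennreal_mult[symmetric] powr_add[symmetric] mult.left_commute)
  also have "... <= ennreal C" using C by (intro ennreal_leI)
  finally show ?thesis .
 qed
 have S2: "(\<integral>\<^sup>+l. indicator {0<..<1} l * ennreal (1 / l) * ennreal (sker \<gamma> l h)) \<le>
   ennreal C * (indicator (sball s 0 3) h * ennreal (1 / snorm s h ^ scale_deg s))" if h: "h ~= 0" for h :: "real ^ 'd"
 proof (cases "snorm s h < 3")
  case True
  have t: "0 < snorm s h" using h snorm_nonneg[of h] snorm_eq_0_iff[of h] by linarith
  have "(\<integral>\<^sup>+l. indicator {0<..<1} l * ennreal (1 / l) * ennreal (sker \<gamma> l h)) <= ennreal ((1 / - \<gamma> + 1) * snorm s h powr - ?d)"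
   using kernel_mass_scale[OF \<gamma> t] True by (simp add: sker_def)
  also have "... <= ennreal (C * snorm s h powr - ?d)" using C(3) by (intro ennreal_leI mult_right_mono) auto
  also have "... = ennreal C * ennreal (1 / snorm s h ^ scale_deg s)"
   using C(1) t by (simp add: ennreal_mult[symmetric] powr_minus_divide powr_realpow)
  finally show ?thesis using True by (simp add: sball_def)
 qed (simp add: sker_def)
 have "Lnorm scale_measure_01 q (\<lambda>l. \<integral>\<^sup>+h. a h * ennreal (sker \<gamma> l h)) <= ennreal C * Lnorm (ball_measure 3) q a"
  if q: "1 <= q" and a[measurable]: "a \<in> borel_measurable borel" for q and a :: "real ^ 'd => ennreal"
 proof (cases "q = \<infinity>")
  case True
  let ?z = "Lnorm (ball_measure 3) \<infinity> a"
  have "AE h in lebesgue. snorm s h < 3 --> h ~= 0 --> a h <= ?z"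
   using AE_Lnorm_infinity[of a "ball_measure 3"] unfolding AE_ball_measure .
  with AE_lebesgue_nonzero have ae: "AE h in lebesgue. snorm s h < 3 --> a h <= ?z"
   by eventually_elim simp
  have "(\<integral>\<^sup>+h. a h * ennreal (sker \<gamma> l h)) <= ennreal C * ?z" if l: "0 < l" for l
  proof -
   have "(\<integral>\<^sup>+h. a h * ennreal (sker \<gamma> l h)) = (\<integral>\<^sup>+h. a h * ennreal (sker \<gamma> l h) \<partial>lebesgue)"
    by (simp add: nn_integral_lebesgue)
   also have "... <= (\<integral>\<^sup>+h. ?z * ennreal (sker \<gamma> l h) \<partial>lebesgue)"
    by (rule nn_integral_mono_AE) (use ae in "eventually_elim, auto simp: sker_def intro: mult_right_mono")
   also have "... = ?z * (\<integral>\<^sup>+h. ennreal (sker \<gamma> l h))"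
    unfolding nn_integral_lebesgue by (rule nn_integral_cmult) measurable
   also have "... <= ?z * ennreal C" by (intro mult_left_mono S1 l) simp
   finally show ?thesis by (simp add: mult.commute)
  qed
  hence "AE l in scale_measure_01. (\<integral>\<^sup>+h. a h * ennreal (sker \<gamma> l h)) <= ennreal C * ?z"
   unfolding scale_measure_01_def
   by (subst AE_density_lebesgue[OF scale_weight_measurable]) (auto simp: indicator_def intro!: AE_I2)
  thus ?thesis unfolding True unfolding Lnorm_infinity[of scale_measure_01] by (intro Inf_lower) simp
 next
  case False
  let ?t = "enn2real q"
  have t: "1 <= ?t" using enn2real_ge1[OF q False] .
  let ?w = "\<lambda>l::real. indicator {0<..<1} l * ennreal (1 / l)"
  let ?K = "\<lambda>l h. ennreal (C powr (?t - 1)) * (?w l * (ennreal_powr (a h) ?t * ennreal (sker \<gamma> l h)))"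
   and ?v = "\<lambda>h. indicator (sball s 0 3) h * ennreal (1 / snorm s h ^ scale_deg s)"
  define V where "V l = (\<integral>\<^sup>+h. a h * ennreal (sker \<gamma> l h))" for l
  have m1: "(\<lambda>p. a (snd p) * ennreal (sker \<gamma> (fst p) (snd p))) \<in> borel_measurable borel2"
   unfolding sker_def by measurable
  have Vm[measurable]: "V \<in> borel_measurable borel"
   using lborel.borel_measurable_nn_integral[of "\<lambda>l h. a h * ennreal (sker \<gamma> l h)" borel] m1
   by (simp add: V_def[abs_def] split_beta)
  have "(\<integral>\<^sup>+l. ennreal_powr (V l) ?t \<partial>scale_measure_01) = (\<integral>\<^sup>+l. ?w l * ennreal_powr (V l) ?t)"
   unfolding scale_measure_01_def by (rule nn_integral_density_lebesgue[OF scale_weight_measurable]) measurable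
  also have "... <= (\<integral>\<^sup>+l. (\<integral>\<^sup>+h. ?K l h))"
  proof (rule nn_integral_mono)
   fix l :: real
   show "?w l * ennreal_powr (V l) ?t <= (\<integral>\<^sup>+h. ?K l h)"
   proof (cases "0 < l")
    case True
    have "ennreal_powr (V l) ?t <= ennreal (C powr (?t - 1)) * (\<integral>\<^sup>+h. ennreal_powr (a h) ?t * ennreal (sker \<gamma> l h))"
     unfolding V_def using C(1) by (intro nn_integral_jensen t S1 True) auto
    hence "?w l * ennreal_powr (V l) ?t <= ?w l * (ennreal (C powr (?t - 1)) * (\<integral>\<^sup>+h. ennreal_powr (a h) ?t * ennreal (sker \<gamma> l h)))"
     by (rule mult_left_mono) simp
    also have "... = (\<integral>\<^sup>+h. ?K l h)"
     by (subst nn_integral_cmult, measurable, subst nn_integral_cmult, measurable) (simp only: mult_ac)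
    finally show ?thesis .
   qed simp
  qed
  also have "... = (\<integral>\<^sup>+h. (\<integral>\<^sup>+l. ?K l h))"
  proof (rule lborel_pair.Fubini'[symmetric])
   show "(\<lambda>(l, h). ?K l h) \<in> borel_measurable (lborel \<Otimes>\<^sub>M lborel)"
    unfolding sker_def split_beta by measurable
  qed
  also have "... <= (\<integral>\<^sup>+h. ennreal_powr (ennreal C) ?t * (?v h * ennreal_powr (a h) ?t))"
  proof (rule nn_integral_mono_AE)
   have "AE h in lborel. h ~= (0 :: real ^ 'd)" by (rule AE_lborel_singleton)
   thus "AE h in lborel. (\<integral>\<^sup>+l. ?K l h) \<le>
     ennreal_powr (ennreal C) ?t * (?v h * ennreal_powr (a h) ?t)"
   proof eventually_elim
    case (elim h)
    have [measurable]: "(\<lambda>l. sker \<gamma> l h) \<in> borel_measurable borel" unfolding sker_def by measurable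
    have "(\<integral>\<^sup>+l. ?K l h) =
     (\<integral>\<^sup>+l. (ennreal (C powr (?t - 1)) * ennreal_powr (a h) ?t) * (?w l * ennreal (sker \<gamma> l h)))"
     by (simp only: mult_ac)
    also have "... = (ennreal (C powr (?t - 1)) * ennreal_powr (a h) ?t) * (\<integral>\<^sup>+l. ?w l * ennreal (sker \<gamma> l h))"
     by (rule nn_integral_cmult) measurable
    also have "... <= (ennreal (C powr (?t - 1)) * ennreal_powr (a h) ?t) * (ennreal C * ?v h)"
     using S2[OF elim] by (intro mult_left_mono) auto
    also have "... = (ennreal (C powr (?t - 1)) * ennreal C) * (?v h * ennreal_powr (a h) ?t)"
     by (simp only: mult_ac)
    also have "ennreal (C powr (?t - 1)) * ennreal C = ennreal_powr (ennreal C) ?t"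
     using C(1) by (simp add: ennreal_powr_ennreal ennreal_mult[symmetric] powr_mult_base mult.commute)
    finally show ?case .
   qed
  qed
  also have "... = ennreal_powr (ennreal C) ?t * (\<integral>\<^sup>+h. ?v h * ennreal_powr (a h) ?t)"
   by (rule nn_integral_cmult) measurable
  also have "(\<integral>\<^sup>+h. ?v h * ennreal_powr (a h) ?t) = (\<integral>\<^sup>+h. ennreal_powr (a h) ?t \<partial>ball_measure 3)"
   unfolding ball_measure_def by (rule nn_integral_density_lebesgue[symmetric]) measurable
  finally have "Lnorm scale_measure_01 q V <= ennreal_powr (ennreal_powr (ennreal C) ?t * (\<integral>\<^sup>+h. ennreal_powr (a h) ?t \<partial>ball_measure 3)) (1 / ?t)"
   unfolding Lnorm_fin[OF False] by (intro ennreal_powr_mono) auto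
  also have "... = ennreal C * Lnorm (ball_measure 3) q a"
   unfolding Lnorm_fin[OF False] using t by (simp add: ennreal_powr_mult ennreal_powr_inverse)
  finally show ?thesis by (simp add: V_def[abs_def])
 qed
 thus ?thesis using C(1) by (intro exI[of _ C]) auto
qed

text \<open>The annulus between radius one and three has finite measure.\<close>

lemma ball_measure_split:
 "\<exists>C>0. \<forall>q a z. 1 <= q --> a \<in> borel_measurable borel -->
   (\<forall>h :: real ^ 'd. 1 <= snorm s h --> snorm s h < 3 --> a h <= z) -->
   Lnorm (ball_measure 3) q a <= ennreal C * (Lnorm (increment_measure s) q a + z)"
proof -
 define V where "V = (2 :: real) ^ CARD('d) * 3 ^ scale_deg s"
 have V: "1 <= V"
 proof -
  have "1 * 1 <= (2 :: real) ^ CARD('d) * 3 ^ scale_deg s" by (intro mult_mono one_le_power) auto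
  thus ?thesis by (simp add: V_def)
 qed
 have "Lnorm (ball_measure 3) q a <= ennreal (4 * V) * (Lnorm (increment_measure s) q a + z)"
  if q: "1 <= q" and a[measurable]: "a \<in> borel_measurable borel"
   and z: "!!h :: real ^ 'd. 1 <= snorm s h ==> snorm s h < 3 ==> a h <= z" for q z and a :: "real ^ 'd => ennreal"
 proof -
  let ?A = "{h :: real ^ 'd. snorm s h < 1}" and ?B = "{h :: real ^ 'd. 1 <= snorm s h}"
  define a1 where "a1 h = a h * indicator ?A h" for h
  define a2 where "a2 h = a h * indicator ?B h" for h
  have [measurable]: "a1 \<in> borel_measurable borel" "a2 \<in> borel_measurable borel"
   unfolding a1_def a2_def by measurable
  have am: "a1 \<in> borel_measurable (ball_measure 3)" "a2 \<in> borel_measurable (ball_measure 3)"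
   unfolding ball_measure_def by (auto intro!: measurable_completion)
  have e: "a = (\<lambda>h. a1 h + a2 h)" by (auto simp: a1_def a2_def indicator_def fun_eq_iff)
  have 1: "Lnorm (ball_measure 3) q a1 <= Lnorm (increment_measure s) q a"
  proof (cases "q = \<infinity>")
   case True
   let ?z = "Lnorm (ball_measure 1) \<infinity> a"
   have "AE h in ball_measure 3. a1 h <= ?z"
    using AE_Lnorm_infinity[of a "ball_measure 1"] unfolding AE_ball_measure
    by eventually_elim (auto simp: a1_def indicator_def)
   thus ?thesis unfolding True ball_measure_1 unfolding Lnorm_infinity[of "ball_measure 3"] by (intro Inf_lower) simp
  next
   case False
   let ?t = "enn2real q"
   have "(\<integral>\<^sup>+h. ennreal_powr (a1 h) ?t \<partial>ball_measure 3) = (\<integral>\<^sup>+h. ennreal_powr (a h) ?t \<partial>ball_measure 1)"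
    unfolding ball_measure_def
    by (subst (1 2) nn_integral_density_lebesgue)
      (auto simp: a1_def sball_def indicator_def intro!: nn_integral_cong)
   thus ?thesis unfolding Lnorm_fin[OF False] ball_measure_1 by simp
  qed
  have 2: "Lnorm (ball_measure 3) q a2 <= ennreal V * z"
  proof (cases "q = \<infinity>")
   case True
   have "AE h in ball_measure 3. a2 h <= z"
    unfolding AE_ball_measure by (rule AE_I2) (auto simp: a2_def indicator_def z)
   hence "Lnorm (ball_measure 3) \<infinity> a2 <= z" unfolding Lnorm_infinity by (intro Inf_lower) simp
   also have "... <= ennreal V * z" using mult_right_mono[of 1 "ennreal V" z] V by simp
   finally show ?thesis unfolding True .
  next
   case False
   let ?t = "enn2real q"
   have t: "1 <= ?t" using enn2real_ge1[OF q False] .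
   have "(\<integral>\<^sup>+h. ennreal_powr (a2 h) ?t \<partial>ball_measure 3) =
    (\<integral>\<^sup>+h. indicator (sball s 0 3) h * ennreal (1 / snorm s h ^ scale_deg s) * ennreal_powr (a2 h) ?t)"
    unfolding ball_measure_def by (rule nn_integral_density_lebesgue) measurable
   also have "... <= (\<integral>\<^sup>+h. ennreal_powr z ?t * indicator {h. snorm s h <= 3} h)"
   proof (rule nn_integral_mono)
    fix h :: "real ^ 'd"
    show "indicator (sball s 0 3) h * ennreal (1 / snorm s h ^ scale_deg s) * ennreal_powr (a2 h) ?t <= ennreal_powr z ?t * indicator {h. snorm s h <= 3} h"
    proof (cases "1 <= snorm s h \<and> snorm s h < 3")
     case True
     have "1 / snorm s h ^ scale_deg s <= 1" using True by (simp add: divide_le_eq one_le_power)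
     hence "ennreal (1 / snorm s h ^ scale_deg s) * ennreal_powr (a2 h) ?t <= ennreal 1 * ennreal_powr z ?t"
      using True z[of h] by (intro mult_mono ennreal_powr_mono ennreal_leI) (auto simp: a2_def)
     thus ?thesis using True by (simp add: sball_def)
    qed (auto simp: a2_def sball_def indicator_def)
   qed
   also have "... = ennreal_powr z ?t * emeasure lborel {h. snorm s h <= 3}"
    by (rule nn_integral_cmult_indicator) measurable
   also have "... <= ennreal_powr z ?t * ennreal_powr (ennreal V) ?t"
   proof (rule mult_left_mono)
    have "emeasure lborel {h. snorm s h <= 3} <= ennreal V" using emeasure_snorm_ball_le[of 3] by (simp add: V_def)
    also have "... <= ennreal_powr (ennreal V) ?t"
     using V t powr_mono[of 1 ?t V] by (simp add: ennreal_powr_ennreal ennreal_leI)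
    finally show "emeasure lborel {h. snorm s h <= 3} <= ennreal_powr (ennreal V) ?t" .
   qed simp
   finally have "Lnorm (ball_measure 3) q a2 <= ennreal_powr (ennreal_powr z ?t * ennreal_powr (ennreal V) ?t) (1 / ?t)"
    unfolding Lnorm_fin[OF False] by (intro ennreal_powr_mono) auto
   also have "... = ennreal V * z" using t by (simp add: ennreal_powr_mult ennreal_powr_inverse mult.commute)
   finally show ?thesis .
  qed
  have "Lnorm (ball_measure 3) q a <= 4 * (Lnorm (ball_measure 3) q a1 + Lnorm (ball_measure 3) q a2)"
   by (subst e) (rule Lnorm_add[OF q am])
  also have "... <= 4 * (ennreal V * Lnorm (increment_measure s) q a + ennreal V * z)"
   using 1 2 mult_right_mono[of 1 "ennreal V" "Lnorm (increment_measure s) q a"] V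
   by (intro mult_left_mono add_mono) (auto intro: order_trans)
  also have "... = ennreal (4 * V) * (Lnorm (increment_measure s) q a + z)"
   using V by (simp add: ennreal_mult distrib_left mult.assoc)
  finally show ?thesis .
 qed
 thus ?thesis using V by (intro exI[of _ "4 * V"]) auto
qed

text \<open>This is where \<open>q < \<infinity>\<close> costs a small loss of regularity: the constant function is not in \<open>L\<^sup>q\<close> for
 the scale-invariant measure.\<close>

lemma scale_power_norm:
 assumes q: "1 <= q" and e: "if q = \<infinity> then 0 <= e else 0 < e"
 shows "\<exists>C>0. \<forall>z. Lnorm scale_measure_01 q (\<lambda>l. z * ennreal (l powr e)) <= ennreal C * z"
proof (cases "q = \<infinity>")
 case True
 have "Lnorm scale_measure_01 q (\<lambda>l. z * ennreal (l powr e)) <= ennreal 1 * z" for z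
 proof -
  have "AE l in scale_measure_01. z * ennreal (l powr e) <= z"
   unfolding scale_measure_01_def
  proof (subst AE_density_lebesgue[OF scale_weight_measurable], rule AE_I2, rule impI)
   fix l :: real assume "0 < indicator {0<..<1} l * ennreal (1 / l)"
   hence "l \<in> {0<..<1}" by (rule contrapos_pp) simp
   hence l: "0 < l" "l < 1" by auto
   have "l powr e <= 1 powr e" using l e True by (intro powr_mono2) auto
   hence "z * ennreal (l powr e) <= z * ennreal 1" by (intro mult_left_mono ennreal_leI) auto
   thus "z * ennreal (l powr e) <= z" by simp
  qed
  thus ?thesis unfolding True Lnorm_infinity by (intro Inf_lower) simp
 qed
 thus ?thesis by (intro exI[of _ 1]) auto
next
 case False
 let ?t = "enn2real q"
 have t: "1 <= ?t" using enn2real_ge1[OF q False] .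
 have e: "0 < e" using assms False by simp
 define I where "I = 1 / (e * ?t)"
 have I: "0 < I" using e t by (simp add: I_def)
 have i1: "((\<lambda>l. l powr (e * ?t - 1)) has_integral (1 powr (e * ?t - 1 + 1) / (e * ?t - 1 + 1))) {0..1::real}"
  using e t by (intro has_integral_powr_from_0) auto
 have j1: "(\<integral>\<^sup>+l. ennreal (l powr (e * ?t - 1)) * indicator {0..1} l) = ennreal I"
  using nn_integral_has_integral_indicator[OF i1] by (simp add: I_def)
 have "Lnorm scale_measure_01 q (\<lambda>l. z * ennreal (l powr e)) <= ennreal (I powr (1 / ?t)) * z" for z
 proof -
  have "(\<integral>\<^sup>+l. ennreal_powr (z * ennreal (l powr e)) ?t \<partial>scale_measure_01) =
   (\<integral>\<^sup>+l. indicator {0<..<1} l * ennreal (1 / l) * ennreal_powr (z * ennreal (l powr e)) ?t)"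
   unfolding scale_measure_01_def by (rule nn_integral_density_lebesgue[OF scale_weight_measurable]) measurable
  also have "... <= (\<integral>\<^sup>+l. ennreal_powr z ?t * (ennreal (l powr (e * ?t - 1)) * indicator {0..1} l))"
  proof (rule nn_integral_mono)
   fix l :: real
   show "indicator {0<..<1} l * ennreal (1 / l) * ennreal_powr (z * ennreal (l powr e)) ?t <= ennreal_powr z ?t * (ennreal (l powr (e * ?t - 1)) * indicator {0..1} l)"
   proof (cases "l \<in> {0<..<1}")
    case True
    hence l: "0 < l" by simp
    have e1: "1 / l * l powr (e * ?t) = l powr (e * ?t - 1)" using l by (simp add: powr_diff)
    have "ennreal (1 / l) * ennreal ((l powr e) powr ?t) = ennreal (1 / l * l powr (e * ?t))"
     using l by (simp add: ennreal_mult[symmetric] powr_powr)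
    hence "ennreal (1 / l) * ennreal ((l powr e) powr ?t) = ennreal (l powr (e * ?t - 1))" unfolding e1 .
    thus ?thesis using True t by (simp add: ennreal_powr_mult ennreal_powr_ennreal mult.left_commute)
   qed simp
  qed
  also have "... = ennreal_powr z ?t * ennreal I" by (subst nn_integral_cmult) (simp_all add: j1)
  finally have "Lnorm scale_measure_01 q (\<lambda>l. z * ennreal (l powr e)) <= ennreal_powr (ennreal_powr z ?t * ennreal I) (1 / ?t)"
   unfolding Lnorm_fin[OF False] by (intro ennreal_powr_mono) auto
  also have "... = ennreal (I powr (1 / ?t)) * z"
   using t I by (simp add: ennreal_powr_mult ennreal_powr_inverse ennreal_powr_ennreal mult.commute)
  finally show ?thesis .
 qed
 thus ?thesis using I by (intro exI[of _ "I powr (1 / ?t)"]) auto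
qed

end

section \<open>The mixed norm of a kernel average\<close>

lemma Lnorm_lebesgue: "q ~= \<infinity> ==> Lnorm lebesgue q f = Lnorm lborel q f"
 by (simp add: Lnorm_fin nn_integral_lebesgue)

lemma nn_integral_translate:
 fixes f :: "'a::euclidean_space => ennreal"
 assumes "f \<in> borel_measurable borel"
 shows "(\<integral>\<^sup>+x. f (x + h)) = (\<integral>\<^sup>+x. f x)"
proof -
 have "(\<integral>\<^sup>+x. f x) = (\<integral>\<^sup>+x. f x \<partial>distr lborel borel ((+) h))" by (simp add: lborel_distr_plus)
 also have "... = (\<integral>\<^sup>+x. f (h + x))" by (rule nn_integral_distr) (use assms in auto)
 finally show ?thesis by (simp add: add.commute)
qed

lemma Lnorm_translate:
 fixes f :: "'a::euclidean_space => ennreal"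
 assumes "q ~= \<infinity>" "f \<in> borel_measurable borel"
 shows "Lnorm lborel q (\<lambda>x. f (x + h)) = Lnorm lborel q f"
 unfolding Lnorm_fin[OF assms(1)]
 using nn_integral_translate[of "\<lambda>x. ennreal_powr (f x) (enn2real q)" h] assms(2)
 by (simp add: ennreal_powr_measurable)

lemma Lnorm_joint_measurable:
 fixes g :: "'a::euclidean_space => 'b::euclidean_space => ennreal"
 assumes "q ~= \<infinity>" "(\<lambda>(x, h). g x h) \<in> borel_measurable borel2"
 shows "(\<lambda>h. Lnorm lborel q (\<lambda>x. g x h)) \<in> borel_measurable borel"
proof -
 have 1: "(\<lambda>p. g (fst p) (snd p)) \<in> borel_measurable borel2"
  using assms(2) by (simp add: split_beta)
 have "(\<lambda>p. g (snd p) (fst p)) \<in> borel_measurable borel2"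
  using measurable_compose[OF measurable_pair_swap' 1] by (auto simp: split_beta)
 hence "(\<lambda>p. ennreal_powr (g (snd p) (fst p)) (enn2real q)) \<in> borel_measurable (borel \<Otimes>\<^sub>M lborel)"
  by (simp add: ennreal_powr_measurable cong: measurable_cong_sets sets_pair_measure_cong)
 hence "(\<lambda>h. \<integral>\<^sup>+x. ennreal_powr (g x h) (enn2real q)) \<in> borel_measurable borel"
  using lborel.borel_measurable_nn_integral[of "\<lambda>h x. ennreal_powr (g x h) (enn2real q)" borel]
  by (simp add: split_beta)
 thus ?thesis unfolding Lnorm_fin[OF assms(1)] by (rule ennreal_powr_measurable)
qed

lemma section_measurable:
 fixes g :: "'a::euclidean_space => 'b::euclidean_space => ennreal"
 assumes "(\<lambda>(x, h). g x h) \<in> borel_measurable borel2"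
 shows "(\<lambda>h. g x h) \<in> borel_measurable borel" "(\<lambda>x. g x h) \<in> borel_measurable borel"
proof -
 have 1: "(\<lambda>p. g (fst p) (snd p)) \<in> borel_measurable borel2"
  using assms by (simp add: split_beta)
 show "(\<lambda>h. g x h) \<in> borel_measurable borel"
  using measurable_compose[OF measurable_Pair1' 1, of x] by simp
 show "(\<lambda>x. g x h) \<in> borel_measurable borel"
  using measurable_compose[OF measurable_Pair2' 1, of h] by simp
qed

text \<open>Minkowski's inequality moves the norm in the base point inside the integral over increments.\<close>

lemma Lnorm_kernel_sum:
 fixes g :: "'i => 'a::euclidean_space => 'b::euclidean_space => ennreal"
 assumes p: "1 <= p" "p ~= \<infinity>" and B: "finite B"
  and g: "!!i. i \<in> B ==> (\<lambda>(x, h). g i x h) \<in> borel_measurable borel2"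
  and w: "!!i. i \<in> B ==> w i \<in> borel_measurable borel" "!!i h. i \<in> B ==> 0 <= w i h"
 shows "Lnorm lborel p (\<lambda>x. \<Sum>i\<in>B. \<integral>\<^sup>+h. g i x h * ennreal (w i h)) \<le>
  4 ^ card B * (\<Sum>i\<in>B. \<integral>\<^sup>+h. ennreal (w i h) * Lnorm lborel p (\<lambda>x. g i x h))"
proof -
 define T where "T i x = (\<integral>\<^sup>+h. g i x h * ennreal (w i h))" for i x
 have gm: "(\<lambda>(x, h). g i x h * ennreal (w i h)) \<in> borel_measurable borel2" if "i \<in> B" for i
  using g[OF that] w(1)[OF that] unfolding split_beta by measurable
 have "Lnorm lborel p (\<lambda>x. \<Sum>i\<in>B. T i x) <= 4 ^ card B * (\<Sum>i\<in>B. Lnorm lborel p (T i))"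
 proof (rule Lnorm_sum[OF p(1) B])
  fix i assume "i \<in> B"
  thus "T i \<in> borel_measurable lborel"
   using lborel.borel_measurable_nn_integral[of "\<lambda>x h. g i x h * ennreal (w i h)" borel] gm
   by (simp add: T_def[abs_def])
 qed
 also have "... <= 4 ^ card B * (\<Sum>i\<in>B. \<integral>\<^sup>+h. ennreal (w i h) * Lnorm lborel p (\<lambda>x. g i x h))"
 proof (intro mult_left_mono sum_mono)
  fix i assume i: "i \<in> B"
  have "Lnorm lborel p (T i) <= (\<integral>\<^sup>+h. Lnorm lborel p (\<lambda>x. g i x h * ennreal (w i h)))"
   unfolding T_def[abs_def]
   by (rule minkowski_integral[OF p]) (use gm[OF i] in "simp cong: measurable_cong_sets sets_pair_measure_cong")
  also have "... = (\<integral>\<^sup>+h. ennreal (w i h) * Lnorm lborel p (\<lambda>x. g i x h))"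
  proof (rule nn_integral_cong)
   fix h
   have "(\<lambda>x. g i x h) \<in> borel_measurable lborel" using section_measurable(2)[OF g[OF i], of h] by simp
   from Lnorm_cmult(2)[OF p(1) this w(2)[OF i] p(2), of h]
   show "Lnorm lborel p (\<lambda>x. g i x h * ennreal (w i h)) = ennreal (w i h) * Lnorm lborel p (\<lambda>x. g i x h)"
    by (simp only: mult.commute[of _ "ennreal (w i h)"])
  qed
  finally show "Lnorm lborel p (T i) <= (\<integral>\<^sup>+h. ennreal (w i h) * Lnorm lborel p (\<lambda>x. g i x h))" .
 qed simp
 finally show ?thesis by (simp only: T_def)
qed

context mollifier
begin

text \<open>Since \<open>e < \<gamma>\<close>, the surplus power of the distance in the kernel is bounded by that power of the
 increment which the modelled norm provides.\<close>

lemma ker_le_sker: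
 assumes "e < \<gamma>" "0 < l" "h ~= 0"
 shows "ker l h e * l powr - \<gamma> <= snorm s h powr (e - \<gamma>) * sker \<gamma> l h"
proof (cases "snorm s h < 3")
 case True
 let ?m = "max l (snorm s h)" and ?d = "real (scale_deg s)"
 have t: "0 < snorm s h" using assms(3) snorm_nonneg[of h] snorm_eq_0_iff[of h] by (simp add: less_le)
 have m: "0 < ?m" using assms by simp
 have "?m powr (e - ?d) = ?m powr (e - \<gamma>) * ?m powr (\<gamma> - ?d)" by (simp add: powr_add[symmetric])
 also have "... <= snorm s h powr (e - \<gamma>) * ?m powr (\<gamma> - ?d)"
  using assms t by (intro mult_right_mono powr_mono2') auto
 finally have "?m powr (e - ?d) * l powr - \<gamma> <= snorm s h powr (e - \<gamma>) * ?m powr (\<gamma> - ?d) * l powr - \<gamma>"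
  by (rule mult_right_mono) simp
 thus ?thesis using True by (simp add: ker_def sker_def mult_ac)
qed (simp add: ker_def sker_def)

lemma ker_nonneg: "0 <= ker l h e" by (simp add: ker_def)

lemma sker_nonneg: "0 <= sker \<gamma> l h" by (simp add: sker_def)

lemma ker_measurable [measurable]: "(\<lambda>h. ker l h e) \<in> borel_measurable borel"
 unfolding ker_def by measurable

lemma AE_scales: "AE l in scale_measure_01. 0 < l \<and> l < 1"
 unfolding scale_measure_01_def
proof (subst AE_density_lebesgue[OF scale_weight_measurable], rule AE_I2, rule impI)
 fix l :: real assume "0 < indicator {0<..<1} l * ennreal (1 / l)"
 hence "l \<in> {0<..<1}" by (rule contrapos_pp) simp
 thus "0 < l \<and> l < 1" by simp
qed

definition mix_bound :: "real => 'i set => ('i => real) => real => bool" where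
 "mix_bound \<gamma> B e C \<longleftrightarrow> 0 < C \<and> (\<forall>p q (Z :: real ^ 'd => real => ennreal) K gg z. 1 <= p --> p ~= \<infinity> --> 1 <= q -->
  (\<forall>i\<in>B. 0 <= K i \<and> (\<lambda>(x, h). gg i x h) \<in> borel_measurable borel2) -->
  (\<forall>x l. 0 < l --> l < 1 --> Z x l <= (\<Sum>i\<in>B. \<integral>\<^sup>+h. gg i x h * ennreal (K i * ker l h (e i)))) -->
  (\<forall>i\<in>B. \<forall>h. 1 <= snorm s h --> snorm s h < 3 --> Lnorm lborel p (\<lambda>x. gg i x h) <= z i) -->
  Lnorm scale_measure_01 q (\<lambda>l. Lnorm lebesgue p (\<lambda>x. Z x l / ennreal (l powr \<gamma>))) \<le>
   ennreal C * (\<Sum>i\<in>B. ennreal (K i) * (Lnorm (increment_measure s) q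
     (\<lambda>h. Lnorm lborel p (\<lambda>x. gg i x h) * ennreal (snorm s h powr (e i - \<gamma>))) + z i)))"

text \<open>Minkowski in the base point reduces to a kernel acting on \<open>L\<^sup>p\<close> norms of increments, to which Schur's
 test applies. Increments longer than one are not seen by the modelled norm and enter through \<open>z\<close>.\<close>

lemma mixed_estimate:
 assumes \<gamma>: "\<gamma> < 0" and B: "finite (B :: 'i set)" and e: "!!i. i \<in> B ==> e i < \<gamma>"
 shows "\<exists>C. mix_bound \<gamma> B e C"
proof -
 obtain C1 where C1: "0 < C1" "!!q a. 1 <= q ==> a \<in> borel_measurable borel ==>
  Lnorm scale_measure_01 q (\<lambda>l. \<integral>\<^sup>+h. a h * ennreal (sker \<gamma> l h)) <= ennreal C1 * Lnorm (ball_measure 3) q a"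
  using schur_scales[OF \<gamma>] by auto
 obtain C2 where C2: "0 < C2" "!!q a z. 1 <= q ==> a \<in> borel_measurable borel ==>
   (\<forall>h :: real ^ 'd. 1 <= snorm s h --> snorm s h < 3 --> a h <= z) ==>
   Lnorm (ball_measure 3) q a <= ennreal C2 * (Lnorm (increment_measure s) q a + z)"
  using ball_measure_split by auto
 define n where "n = card B"
 define C where "C = 4 ^ n * 4 ^ n * C1 * C2"
 have C: "0 < C" using C1 C2 by (simp add: C_def)
 show ?thesis unfolding mix_bound_def
 proof (intro exI[of _ C] conjI allI impI C)
  fix p q :: ennreal and Z :: "real ^ 'd => real => ennreal" and K :: "'i => real"
   and gg :: "'i => real ^ 'd => real ^ 'd => ennreal" and z :: "'i => ennreal"
  assume p: "1 <= p" "p ~= \<infinity>" and q: "1 <= q"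
   and Kg: "\<forall>i\<in>B. 0 <= K i \<and> (\<lambda>(x, h). gg i x h) \<in> borel_measurable borel2"
   and Z: "\<forall>x l. 0 < l --> l < 1 --> Z x l <= (\<Sum>i\<in>B. \<integral>\<^sup>+h. gg i x h * ennreal (K i * ker l h (e i)))"
   and z: "\<forall>i\<in>B. \<forall>h. 1 <= snorm s h --> snorm s h < 3 --> Lnorm lborel p (\<lambda>x. gg i x h) <= z i"
  have K0: "0 <= K i" if "i \<in> B" for i using Kg that by blast
  have gm: "(\<lambda>(x, h). gg i x h) \<in> borel_measurable borel2" if "i \<in> B" for i using Kg that by blast
  define G where "G i h = Lnorm lborel p (\<lambda>x. gg i x h)" for i h
  have Gm: "G i \<in> borel_measurable borel" if "i \<in> B" for i
   unfolding G_def by (rule Lnorm_joint_measurable[OF p(2) gm[OF that]])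
  define a where "a i h = G i h * ennreal (snorm s h powr (e i - \<gamma>))" for i h
  have am: "a i \<in> borel_measurable borel" if "i \<in> B" for i
   unfolding a_def using Gm[OF that] by measurable
  define V where "V i l = (\<integral>\<^sup>+h. a i h * ennreal (sker \<gamma> l h))" for i l
  have Vm: "V i \<in> borel_measurable borel" if "i \<in> B" for i
  proof -
   have "(\<lambda>p. a i (snd p) * ennreal (sker \<gamma> (fst p) (snd p))) \<in> borel_measurable borel2"
    unfolding sker_def using am[OF that] by measurable
   thus ?thesis
    using lborel.borel_measurable_nn_integral[of "\<lambda>l h. a i h * ennreal (sker \<gamma> l h)" borel]
    by (simp add: V_def[abs_def] split_beta)
  qed
  have inner: "Lnorm lebesgue p (\<lambda>x. Z x l / ennreal (l powr \<gamma>)) <= (\<Sum>i\<in>B. ennreal (4 ^ n * K i) * V i l)"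
   if l: "0 < l" "l < 1" for l
  proof -
   define w where "w i h = K i * (snorm s h powr (e i - \<gamma>) * sker \<gamma> l h)" for i and h :: "real ^ 'd"
   have w0: "0 <= w i h" if "i \<in> B" for i h unfolding w_def using sker_nonneg K0[OF that] by simp
   have wm: "w i \<in> borel_measurable borel" for i unfolding w_def[abs_def] sker_def by measurable
   have pt: "Z x l / ennreal (l powr \<gamma>) <= (\<Sum>i\<in>B. \<integral>\<^sup>+h. gg i x h * ennreal (w i h))" for x
   proof -
    let ?Z = "\<lambda>i h. gg i x h * ennreal (K i * ker l h (e i))"
    have inv: "X / ennreal (l powr \<gamma>) = X * ennreal (l powr - \<gamma>)" for X
     using l by (simp add: divide_ennreal_def inverse_ennreal powr_minus)
    have "Z x l / ennreal (l powr \<gamma>) <= (\<Sum>i\<in>B. \<integral>\<^sup>+h. ?Z i h) * ennreal (l powr - \<gamma>)"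
     unfolding inv using Z l by (intro mult_right_mono) auto
    also have "... = (\<Sum>i\<in>B. (\<integral>\<^sup>+h. ?Z i h) * ennreal (l powr - \<gamma>))"
     by (rule sum_distrib_right)
    also have "... <= (\<Sum>i\<in>B. \<integral>\<^sup>+h. gg i x h * ennreal (w i h))"
    proof (rule sum_mono)
     fix i assume i: "i \<in> B"
     note gx = section_measurable(1)[OF gm[OF i], of x]
     have "(\<integral>\<^sup>+h. ?Z i h) * ennreal (l powr - \<gamma>) = (\<integral>\<^sup>+h. ?Z i h * ennreal (l powr - \<gamma>))"
      by (rule nn_integral_multc[symmetric]) (use gx in measurable)
     also have "... <= (\<integral>\<^sup>+h. gg i x h * ennreal (w i h))"
     proof (rule nn_integral_mono_AE)
      have "AE h in lborel. h ~= (0 :: real ^ 'd)" by (rule AE_lborel_singleton)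
      thus "AE h in lborel. ?Z i h * ennreal (l powr - \<gamma>) <= gg i x h * ennreal (w i h)"
      proof eventually_elim
       case (elim h)
       have "ennreal (K i * ker l h (e i)) * ennreal (l powr - \<gamma>) = ennreal (K i * (ker l h (e i) * l powr - \<gamma>))"
        using K0[OF i] ker_nonneg by (simp add: ennreal_mult[symmetric] mult.assoc)
       also have "... <= ennreal (w i h)"
        unfolding w_def by (intro ennreal_leI mult_left_mono ker_le_sker e i l elim K0)
       finally have "gg i x h * (ennreal (K i * ker l h (e i)) * ennreal (l powr - \<gamma>)) <= gg i x h * ennreal (w i h)"
        by (rule mult_left_mono) simp
       thus ?case by (simp only: mult.assoc)
      qed
     qed
     finally show "(\<integral>\<^sup>+h. ?Z i h) * ennreal (l powr - \<gamma>) <= (\<integral>\<^sup>+h. gg i x h * ennreal (w i h))" .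
    qed
    finally show ?thesis .
   qed
   have "Lnorm lebesgue p (\<lambda>x. Z x l / ennreal (l powr \<gamma>)) <= Lnorm lborel p (\<lambda>x. \<Sum>i\<in>B. \<integral>\<^sup>+h. gg i x h * ennreal (w i h))"
    unfolding Lnorm_lebesgue[OF p(2)] by (rule Lnorm_mono) (rule pt)
   also have "... <= 4 ^ card B * (\<Sum>i\<in>B. \<integral>\<^sup>+h. ennreal (w i h) * G i h)"
    unfolding G_def by (rule Lnorm_kernel_sum[OF p B gm wm w0])
   also have "... = (\<Sum>i\<in>B. ennreal (4 ^ n * K i) * V i l)"
    unfolding sum_distrib_left
   proof (intro sum.cong refl)
    fix i assume i: "i \<in> B"
    have "ennreal (w i h) * G i h = ennreal (K i) * (a i h * ennreal (sker \<gamma> l h))" for h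
    proof -
     have "ennreal (w i h) = ennreal (K i) * (ennreal (snorm s h powr (e i - \<gamma>)) * ennreal (sker \<gamma> l h))"
      unfolding w_def using K0[OF i] sker_nonneg by (simp add: ennreal_mult)
     thus ?thesis unfolding a_def by (simp only: mult_ac)
    qed
    moreover have "(\<integral>\<^sup>+h. ennreal (K i) * (a i h * ennreal (sker \<gamma> l h))) = ennreal (K i) * V i l"
     unfolding V_def sker_def by (rule nn_integral_cmult) (use am[OF i] in measurable)
    moreover have "ennreal (4 ^ n * K i) = 4 ^ card B * ennreal (K i)"
     using K0[OF i] by (subst ennreal_mult) (auto simp: n_def ennreal_power[symmetric])
    ultimately show "4 ^ card B * (\<integral>\<^sup>+h. ennreal (w i h) * G i h) = ennreal (4 ^ n * K i) * V i l"
     by (simp only: mult.assoc)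
   qed
   finally show ?thesis .
  qed
  have sm: "measurable scale_measure_01 (borel :: ennreal measure) = measurable lebesgue borel"
   unfolding scale_measure_01_def by (rule measurable_cong_sets) auto
  have Vm': "V i \<in> borel_measurable scale_measure_01" if "i \<in> B" for i
   unfolding sm using Vm[OF that] by (intro measurable_completion) simp
  have "Lnorm scale_measure_01 q (\<lambda>l. Lnorm lebesgue p (\<lambda>x. Z x l / ennreal (l powr \<gamma>))) \<le>
   Lnorm scale_measure_01 q (\<lambda>l. \<Sum>i\<in>B. ennreal (4 ^ n * K i) * V i l)"
   by (rule Lnorm_mono_AE) (use AE_scales in "eventually_elim, use inner in blast")
  also have "... <= 4 ^ card B * (\<Sum>i\<in>B. Lnorm scale_measure_01 q (\<lambda>l. ennreal (4 ^ n * K i) * V i l))"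
   by (rule Lnorm_sum[OF q B]) (use Vm' in auto)
  also have "... <= 4 ^ card B * (\<Sum>i\<in>B. ennreal (4 ^ n * K i) * (ennreal C1 * (ennreal C2 * (Lnorm (increment_measure s) q (a i) + z i))))"
  proof (intro mult_left_mono sum_mono)
   fix i assume i: "i \<in> B"
   have "Lnorm scale_measure_01 q (\<lambda>l. ennreal (4 ^ n * K i) * V i l) <= ennreal (4 ^ n * K i) * Lnorm scale_measure_01 q (V i)"
    by (rule Lnorm_cmult(1)[OF q Vm'[OF i]]) (use K0[OF i] in simp)
   also have "... <= ennreal (4 ^ n * K i) * (ennreal C1 * Lnorm (ball_measure 3) q (a i))"
    unfolding V_def by (intro mult_left_mono C1(2) q am i) simp
   also have "... <= ennreal (4 ^ n * K i) * (ennreal C1 * (ennreal C2 * (Lnorm (increment_measure s) q (a i) + z i)))"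
   proof (intro mult_left_mono C2(2) q am i allI impI)
    fix h :: "real ^ 'd" assume h: "1 <= snorm s h" "snorm s h < 3"
    have "snorm s h powr (e i - \<gamma>) <= 1 powr (e i - \<gamma>)" using h e[OF i] by (intro powr_mono2') auto
    hence "a i h <= G i h * ennreal 1" unfolding a_def by (intro mult_left_mono ennreal_leI) auto
    also have "... <= z i" using z i h by (simp add: G_def)
    finally show "a i h <= z i" .
   qed auto
   finally show "Lnorm scale_measure_01 q (\<lambda>l. ennreal (4 ^ n * K i) * V i l) \<le>
    ennreal (4 ^ n * K i) * (ennreal C1 * (ennreal C2 * (Lnorm (increment_measure s) q (a i) + z i)))" .
  qed simp
  also have "... = ennreal C * (\<Sum>i\<in>B. ennreal (K i) * (Lnorm (increment_measure s) q (a i) + z i))"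
   unfolding sum_distrib_left
  proof (intro sum.cong refl)
   fix i assume i: "i \<in> B"
   have 1: "ennreal (4 ^ n * K i) = ennreal (4 ^ n) * ennreal (K i)" using K0[OF i] by (intro ennreal_mult) auto
   have 2: "ennreal C = ennreal (4 ^ n) * ennreal (4 ^ n) * ennreal C1 * ennreal C2"
    unfolding C_def using C1(1) C2(1) by (simp add: ennreal_mult)
   have 3: "(4 :: ennreal) ^ card B = ennreal (4 ^ n)" by (simp add: n_def ennreal_power[symmetric])
   show "4 ^ card B * (ennreal (4 ^ n * K i) * (ennreal C1 * (ennreal C2 * (Lnorm (increment_measure s) q (a i) + z i)))) =
     ennreal C * (ennreal (K i) * (Lnorm (increment_measure s) q (a i) + z i))"
    unfolding 1 2 3 by (simp only: mult_ac)
  qed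
  finally show "Lnorm scale_measure_01 q (\<lambda>l. Lnorm lebesgue p (\<lambda>x. Z x l / ennreal (l powr \<gamma>))) \<le>
   ennreal C * (\<Sum>i\<in>B. ennreal (K i) * (Lnorm (increment_measure s) q
     (\<lambda>h. Lnorm lborel p (\<lambda>x. gg i x h) * ennreal (snorm s h powr (e i - \<gamma>))) + z i))"
   by (simp add: a_def[abs_def] G_def)
 qed
qed

text \<open>By $t \le 1 + t^p$ it suffices to integrate the weight and the \<open>p\<close>-th power.\<close>

lemma poly_weight_finite:
 "(\<integral>\<^sup>+y. ennreal (1 / (1 + norm (y :: real ^ 'd)) ^ (CARD('d) + 2))) < \<infinity>"
proof -
 let ?N = "CARD('d) + 2"
 define b :: "nat => real ^ 'd" where "b k = (\<chi> i. real k + 1)" for k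
 let ?t = "\<lambda>k y. ennreal (1 / (1 + real k) ^ ?N) * indicator (cbox (- b k) (b k)) y"
 have pt: "ennreal (1 / (1 + norm y) ^ ?N) <= (\<Sum>k. ?t k y)" for y :: "real ^ 'd"
 proof -
  define k where "k = nat \<lfloor>norm y\<rfloor>"
  have "real k = of_int \<lfloor>norm y\<rfloor>" unfolding k_def by simp
  hence k: "real k <= norm y" "norm y <= real k + 1" using floor_correct[of "norm y"] by linarith+
  have "y \<in> cbox (- b k) (b k)"
   using k component_le_norm_cart[of y] by (auto simp: b_def mem_box_cart abs_le_iff) (smt (verit))+
  moreover have "1 / (1 + norm y) ^ ?N <= 1 / (1 + real k) ^ ?N"
   using k by (intro divide_left_mono power_mono mult_pos_pos zero_less_power) (auto simp: add_pos_nonneg)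
  ultimately have "ennreal (1 / (1 + norm y) ^ ?N) <= ?t k y" by (simp add: ennreal_leI)
  also have "... <= (\<Sum>k. ?t k y)" by (rule ennreal_le_suminf)
  finally show ?thesis .
 qed
 have "(\<integral>\<^sup>+y. ennreal (1 / (1 + norm (y :: real ^ 'd)) ^ ?N)) <= (\<integral>\<^sup>+y. (\<Sum>k. ?t k y))"
  by (rule nn_integral_mono) (rule pt)
 also have "... = (\<Sum>k. \<integral>\<^sup>+y. ?t k y)" by (rule nn_integral_suminf) measurable
 also have "... <= (\<Sum>k. ennreal (2 ^ CARD('d) * (1 / real (Suc k) ^ 2)))"
 proof (rule suminf_le[OF _ summableI summableI])
  fix k
  have ne: "cbox (- b k) (b k) ~= {}" by (auto simp: interval_ne_empty_cart b_def)
  have "emeasure lborel (cbox (- b k) (b k)) = ennreal (measure lborel (cbox (- b k) (b k)))"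
   using emeasure_lborel_cbox_finite[of "- b k" "b k"] by (intro emeasure_eq_ennreal_measure) auto
  also have "measure lborel (cbox (- b k) (b k)) = 2 ^ CARD('d) * (1 + real k) ^ CARD('d)"
  proof -
   have "measure lborel (cbox (- b k) (b k)) = (\<Prod>i\<in>(UNIV :: 'd set). 2 * (1 + real k))"
    by (subst content_cbox_cart[OF ne]) (simp add: b_def algebra_simps)
   thus ?thesis by (simp add: power_mult_distrib[symmetric])
  qed
  finally have em: "emeasure lborel (cbox (- b k) (b k)) = ennreal (2 ^ CARD('d) * (1 + real k) ^ CARD('d))" .
  have "(\<integral>\<^sup>+y. ?t k y) = ennreal (1 / (1 + real k) ^ ?N) * emeasure lborel (cbox (- b k) (b k))"
   by (rule nn_integral_cmult_indicator) simp
  also have "... = ennreal (1 / (1 + real k) ^ ?N * (2 ^ CARD('d) * (1 + real k) ^ CARD('d)))"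
   unfolding em by (rule ennreal_mult[symmetric]) auto
  also have "1 / (1 + real k) ^ ?N * (2 ^ CARD('d) * (1 + real k) ^ CARD('d)) = 2 ^ CARD('d) * (1 / real (Suc k) ^ 2)"
  proof -
   have "1 / a ^ (n + 2) * (c * a ^ n) = c * (1 / a ^ 2)" if "0 < a" for a c :: real and n :: nat
    using that by (simp add: power_add power2_eq_square field_simps)
   moreover have "real (Suc k) = 1 + real k" by simp
   ultimately show ?thesis by (simp only:)
  qed
  finally show "(\<integral>\<^sup>+y. ?t k y) <= ennreal (2 ^ CARD('d) * (1 / real (Suc k) ^ 2))" by simp
 qed
 also have "... < \<infinity>"
 proof -
  have "summable (\<lambda>k. 1 / real (Suc k) ^ 2)"
   using inverse_power_summable[of 2, where 'a = real] by (subst summable_Suc_iff) (simp add: inverse_eq_divide)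
  hence "summable (\<lambda>k. 2 ^ CARD('d) * (1 / real (Suc k) ^ 2))" by (rule summable_mult)
  thus ?thesis by (subst suminf_ennreal2) auto
 qed
 finally show ?thesis .
qed

lemma Lp_weight_finite:
 fixes v :: "real ^ 'd => real"
 assumes p: "1 <= p" "p ~= \<infinity>" and v: "v \<in> borel_measurable borel" "!!y. 0 <= v y"
  and fin: "Lnorm lborel p (\<lambda>y. ennreal (v y)) < \<infinity>"
 shows "(\<integral>\<^sup>+y. ennreal (v y / (1 + norm y) ^ (CARD('d) + 2))) < \<infinity>"
proof -
 note v(1)[measurable]
 let ?t = "enn2real p" and ?N = "CARD('d) + 2"
 have t: "1 <= ?t" using enn2real_ge1[OF p] .
 have "(\<integral>\<^sup>+y. ennreal_powr (ennreal (v y)) ?t) ~= top"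
 proof
  assume "(\<integral>\<^sup>+y. ennreal_powr (ennreal (v y)) ?t) = top"
  thus False using fin by (simp add: Lnorm_fin[OF p(2)])
 qed
 hence fin2: "(\<integral>\<^sup>+y. ennreal (v y powr ?t)) < \<infinity>"
  using v(2) by (simp add: ennreal_powr_ennreal less_top)
 have pt: "ennreal (v y / (1 + norm y) ^ ?N) <= ennreal (1 / (1 + norm y) ^ ?N) + ennreal (v y powr ?t)" for y
 proof -
  have w1: "1 <= (1 + norm y) ^ ?N" by (rule one_le_power) simp
  have "0 <= 1 / z \<and> 1 / z <= 1" if "1 <= z" for z :: real using that by simp
  from this[OF w1] have w: "0 <= 1 / (1 + norm y) ^ ?N" "1 / (1 + norm y) ^ ?N <= 1" by blast+
  have "v y / (1 + norm y) ^ ?N <= 1 / (1 + norm y) ^ ?N + v y powr ?t"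
  proof (cases "v y <= 1")
   case True
   hence "v y / (1 + norm y) ^ ?N <= 1 / (1 + norm y) ^ ?N" by (intro divide_right_mono) auto
   thus ?thesis using powr_ge_zero[of "v y" ?t] by linarith
  next
   case False
   have "v y / (1 + norm y) ^ ?N = v y * (1 / (1 + norm y) ^ ?N)" by simp
   also have "... <= v y * 1" using w v(2) by (intro mult_left_mono) auto
   also have "... <= v y powr ?t" using False t powr_mono[of 1 ?t "v y"] by simp
   finally show ?thesis using w(1) by linarith
  qed
  hence "ennreal (v y / (1 + norm y) ^ ?N) <= ennreal (1 / (1 + norm y) ^ ?N + v y powr ?t)" by (rule ennreal_leI)
  also have "... = ennreal (1 / (1 + norm y) ^ ?N) + ennreal (v y powr ?t)" using w by (intro ennreal_plus) auto
  finally show ?thesis .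
 qed
 have "(\<integral>\<^sup>+y. ennreal (v y / (1 + norm y) ^ ?N)) <= (\<integral>\<^sup>+y. ennreal (1 / (1 + norm y) ^ ?N) + ennreal (v y powr ?t))"
  by (rule nn_integral_mono) (rule pt)
 also have "... = (\<integral>\<^sup>+y. ennreal (1 / (1 + norm (y :: real ^ 'd)) ^ ?N)) + (\<integral>\<^sup>+y. ennreal (v y powr ?t))"
  by (rule nn_integral_add) measurable
 also have "... < \<infinity>" using poly_weight_finite fin2 by simp
 finally show ?thesis .
qed

lemma weight_local:
 fixes v :: "real ^ 'd => real"
 assumes "!!y. 0 <= v y" "v \<in> borel_measurable borel"
  "(\<integral>\<^sup>+y. ennreal (v y / (1 + norm y) ^ N)) < \<infinity>"
 shows "(\<integral>\<^sup>+y. ennreal (v y) * indicator (cball 0 \<rho>) y) < \<infinity>"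
proof -
 note assms(2)[measurable]
 have pt: "ennreal (v y) * indicator (cball 0 \<rho>) y <= ennreal ((1 + \<bar>\<rho>\<bar>) ^ N) * ennreal (v y / (1 + norm y) ^ N)" for y
 proof (cases "norm y <= \<rho>")
  case True
  have "(1 + norm y) ^ N <= (1 + \<bar>\<rho>\<bar>) ^ N" using True by (intro power_mono) auto
  moreover have "0 < (1 + norm y) ^ N" by (intro zero_less_power add_pos_nonneg) auto
  ultimately have "1 <= (1 + \<bar>\<rho>\<bar>) ^ N / (1 + norm y) ^ N" by (simp add: le_divide_eq)
  hence "v y * 1 <= v y * ((1 + \<bar>\<rho>\<bar>) ^ N / (1 + norm y) ^ N)" using assms(1) by (intro mult_left_mono) auto
  hence "ennreal (v y) <= ennreal ((1 + \<bar>\<rho>\<bar>) ^ N * (v y / (1 + norm y) ^ N))" by (intro ennreal_leI) (simp add: mult.commute)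
  also have "... = ennreal ((1 + \<bar>\<rho>\<bar>) ^ N) * ennreal (v y / (1 + norm y) ^ N)" using assms(1) by (intro ennreal_mult) auto
  finally show ?thesis using True by simp
 qed simp
 have "(\<integral>\<^sup>+y. ennreal (v y) * indicator (cball 0 \<rho>) y) <= (\<integral>\<^sup>+y. ennreal ((1 + \<bar>\<rho>\<bar>) ^ N) * ennreal (v y / (1 + norm y) ^ N))"
  by (rule nn_integral_mono) (rule pt)
 also have "... = ennreal ((1 + \<bar>\<rho>\<bar>) ^ N) * (\<integral>\<^sup>+y. ennreal (v y / (1 + norm y) ^ N))"
  by (rule nn_integral_cmult) measurable
 also have "... < \<infinity>" using assms(3) by (simp add: ennreal_mult_less_top)
 finally show ?thesis .
qed

end

section \<open>Borel sections\<close>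

context reg_struct
begin

text \<open>Strongly Borel measurable sections. Modelled distributions are only Lebesgue measurable, but Fubini's
 theorem for the joint function of point and increment asks for Borel measurability.\<close>

definition bsec :: "real => (real ^ 'd::finite => 't) => bool" where
 "bsec \<gamma> f \<longleftrightarrow> (\<forall>x. f x \<in> T_below S \<gamma>) \<and>
   (\<exists>u. (\<forall>n::nat. simple_function borel (u n) \<and> range (u n) \<subseteq> T_below S \<gamma>) \<and>
    (\<forall>x. (\<lambda>n. nrm \<gamma> (u n x - f x)) \<longlonglongrightarrow> 0))"

lemma bsec_T_below: "bsec \<gamma> f ==> f x \<in> T_below S \<gamma>"
 by (simp add: bsec_def)

lemma nrm_zero [simp]: "nrm \<gamma> 0 = 0"
 unfolding nrm_def by (intro sum.neutral) (auto simp: index_below_def)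

lemma bsec_zero: "bsec \<gamma> (\<lambda>x. 0)"
 unfolding bsec_def using subspace_0[OF subspace_T_below]
 by (auto intro!: exI[of _ "\<lambda>n x. 0"])

lemma nrm_scale: "nrm \<gamma> (c *\<^sub>R \<tau>) = \<bar>c\<bar> * nrm \<gamma> \<tau>"
 unfolding nrm_def sum_distrib_left comp_norm_def component_scale
 by (intro sum.cong refl lnorm_scale component_layer) (auto simp: index_below_def)

lemma bsec_lincomb:
 assumes "bsec \<gamma> f" "bsec \<gamma> g" shows "bsec \<gamma> (\<lambda>x. a *\<^sub>R f x + b *\<^sub>R g x)"
proof -
 obtain u where u: "!!n. simple_function borel (u n)" "!!n x. u n x \<in> T_below S \<gamma>" "!!x. (\<lambda>n. nrm \<gamma> (u n x - f x)) \<longlonglongrightarrow> 0"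
  using assms(1) unfolding bsec_def by blast
 obtain v where v: "!!n. simple_function borel (v n)" "!!n x. v n x \<in> T_below S \<gamma>" "!!x. (\<lambda>n. nrm \<gamma> (v n x - g x)) \<longlonglongrightarrow> 0"
  using assms(2) unfolding bsec_def by blast
 have T: "a *\<^sub>R \<tau> + b *\<^sub>R \<sigma> \<in> T_below S \<gamma>" if "\<tau> \<in> T_below S \<gamma>" "\<sigma> \<in> T_below S \<gamma>" for \<tau> \<sigma>
  using that subspace_T_below by (intro subspace_add subspace_scale)
 have sf: "simple_function borel (\<lambda>x. a *\<^sub>R u n x + b *\<^sub>R v n x)" for n
  using simple_function_compose2[OF u(1)[of n] v(1)[of n], of "\<lambda>x y. a *\<^sub>R x + b *\<^sub>R y"] .
 have lim: "(\<lambda>n. nrm \<gamma> ((a *\<^sub>R u n x + b *\<^sub>R v n x) - (a *\<^sub>R f x + b *\<^sub>R g x))) \<longlonglongrightarrow> 0" for x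
 proof (rule Lim_null_comparison)
  have le: "nrm \<gamma> ((a *\<^sub>R u n x + b *\<^sub>R v n x) - (a *\<^sub>R f x + b *\<^sub>R g x)) <= \<bar>a\<bar> * nrm \<gamma> (u n x - f x) + \<bar>b\<bar> * nrm \<gamma> (v n x - g x)" for n
  proof -
   have e: "(a *\<^sub>R u n x + b *\<^sub>R v n x) - (a *\<^sub>R f x + b *\<^sub>R g x) = a *\<^sub>R (u n x - f x) + b *\<^sub>R (v n x - g x)"
    by (simp add: algebra_simps)
   show ?thesis unfolding e using nrm_add[of \<gamma> "a *\<^sub>R (u n x - f x)" "b *\<^sub>R (v n x - g x)"] by (simp add: nrm_scale)
  qed
  show "\<forall>\<^sub>F n in sequentially. norm (nrm \<gamma> ((a *\<^sub>R u n x + b *\<^sub>R v n x) - (a *\<^sub>R f x + b *\<^sub>R g x))) \<le>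
   \<bar>a\<bar> * nrm \<gamma> (u n x - f x) + \<bar>b\<bar> * nrm \<gamma> (v n x - g x)"
   using le nrm_nonneg by (auto intro!: always_eventually)
  have "(\<lambda>n. \<bar>a\<bar> * nrm \<gamma> (u n x - f x) + \<bar>b\<bar> * nrm \<gamma> (v n x - g x)) \<longlonglongrightarrow> \<bar>a\<bar> * 0 + \<bar>b\<bar> * 0"
   by (intro tendsto_intros u v)
  thus "(\<lambda>n. \<bar>a\<bar> * nrm \<gamma> (u n x - f x) + \<bar>b\<bar> * nrm \<gamma> (v n x - g x)) \<longlonglongrightarrow> 0" by simp
 qed
 show ?thesis unfolding bsec_def
 proof (intro conjI allI exI[of _ "\<lambda>n x. a *\<^sub>R u n x + b *\<^sub>R v n x"])
  show "a *\<^sub>R f x + b *\<^sub>R g x \<in> T_below S \<gamma>" for x using assms bsec_T_below by (intro T) auto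
  show "range (\<lambda>x. a *\<^sub>R u n x + b *\<^sub>R v n x) \<subseteq> T_below S \<gamma>" for n using T u(2) v(2) by auto
 qed (use sf lim in auto)
qed

lemma bsec_diff: "bsec \<gamma> f ==> bsec \<gamma> g ==> bsec \<gamma> (\<lambda>x. f x - g x)"
 using bsec_lincomb[of \<gamma> f g 1 "-1"] by simp

text \<open>A simple section takes finitely many values, so only the measurability of \<open>\<Phi>\<close> at fixed vectors is
 used for it; continuity in the vector passes to the limit.\<close>

lemma bsec_measurable:
 assumes f: "bsec \<gamma> f" and pr: "pr \<in> M \<rightarrow>\<^sub>M borel"
  and \<Phi>: "!!\<tau>. \<tau> \<in> T_below S \<gamma> ==> (\<lambda>z. \<Phi> z \<tau> :: real) \<in> borel_measurable M"
  and cont: "!!z \<tau> \<sigma>. \<tau> \<in> T_below S \<gamma> ==> (!!n. \<sigma> n \<in> T_below S \<gamma>) ==> (\<lambda>n::nat. nrm \<gamma> (\<sigma> n - \<tau>)) \<longlonglongrightarrow> 0 ==>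
   (\<lambda>n. \<Phi> z (\<sigma> n)) \<longlonglongrightarrow> \<Phi> z \<tau>"
 shows "(\<lambda>z. \<Phi> z (f (pr z))) \<in> borel_measurable M"
proof -
 obtain u where u: "!!n. simple_function borel (u n)" "!!n x. u n x \<in> T_below S \<gamma>" "!!x. (\<lambda>n. nrm \<gamma> (u n x - f x)) \<longlonglongrightarrow> 0"
  using f unfolding bsec_def by blast
 have fin: "finite (range (u n))" for n using simple_functionD(1)[OF u(1)[of n]] by simp
 show ?thesis
 proof (rule borel_measurable_LIMSEQ_real)
  show "(\<lambda>n. \<Phi> z (u n (pr z))) \<longlonglongrightarrow> \<Phi> z (f (pr z))" for z
   using cont[of "f (pr z)" "\<lambda>n. u n (pr z)" z] u bsec_T_below[OF f] by blast
  show "(\<lambda>z. \<Phi> z (u n (pr z))) \<in> borel_measurable M" for n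
  proof (rule measurable_compose_countable'[where I = "range (u n)"])
   show "(\<lambda>z. \<Phi> z \<tau>) \<in> borel_measurable M" if "\<tau> \<in> range (u n)" for \<tau>
    using that u(2) by (intro \<Phi>) auto
   have "u n \<in> borel \<rightarrow>\<^sub>M count_space UNIV" by (rule measurable_simple_function[OF u(1)])
   hence "(\<lambda>z. u n (pr z)) \<in> M \<rightarrow>\<^sub>M count_space UNIV" using measurable_compose[OF pr] by blast
   thus "(\<lambda>z. u n (pr z)) \<in> M \<rightarrow>\<^sub>M count_space (range (u n))"
    by (rule measurable_count_space_extend[rotated 2]) auto
   show "countable (range (u n))" using fin by (rule countable_finite)
  qed
 qed
qed

lemma comp_norm_tendsto:
 assumes "b \<in> index_below S \<gamma>" "(\<lambda>n::nat. nrm \<gamma> (\<sigma> n - \<tau>)) \<longlonglongrightarrow> 0"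
 shows "(\<lambda>n. \<N> b (\<sigma> n)) \<longlonglongrightarrow> \<N> b \<tau>"
proof (rule LIM_zero_cancel, rule Lim_null_comparison[OF _ assms(2)])
 have bi: "b \<in> index S" using assms(1) by (simp add: index_below_def)
 have "norm (\<N> b (\<sigma> n) - \<N> b \<tau>) <= nrm \<gamma> (\<sigma> n - \<tau>)" for n
  using comp_norm_abs_diff[OF bi, of "\<sigma> n" \<tau>] comp_norm_le_nrm[OF assms(1), of "\<sigma> n - \<tau>"] by simp
 thus "\<forall>\<^sub>F n in sequentially. norm (\<N> b (\<sigma> n) - \<N> b \<tau>) <= nrm \<gamma> (\<sigma> n - \<tau>)" by simp
qed

lemma bsec_comp_norm_measurable:
 assumes "bsec \<gamma> f" "b \<in> index_below S \<gamma>"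
 shows "(\<lambda>x. \<N> b (f x)) \<in> borel_measurable borel"
 using bsec_measurable[OF assms(1), of "\<lambda>x. x" borel "\<lambda>_ \<tau>. \<N> b \<tau>"] comp_norm_tendsto[OF assms(2)] by auto

text \<open>Each of the approximating simple functions is Borel off a null set; cut off on the union of these
 null sets.\<close>

lemma T_measurable_Borel_version:
 fixes f :: "real ^ 'd::finite => 't"
 assumes f: "!!x. f x \<in> T_below S \<gamma>" "T_measurable S \<gamma> f"
 shows "\<exists>g. bsec \<gamma> g \<and> (AE x in lborel. f x = g x)"
proof -
 obtain u where u: "!!n. simple_function lebesgue (u n)" "!!n x. u n x \<in> T_below S \<gamma>"
  "!!x. (\<lambda>n. nrm \<gamma> (u n x - f x)) \<longlonglongrightarrow> 0"
  using f(2) unfolding T_measurable_def nrm_def by blast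
 have "\<exists>v. simple_function lborel v \<and> (AE x in lborel. u n x = v x)" for n
  using completion_ex_simple_function[OF u(1)[of n]] by blast
 then obtain v where v: "!!n. simple_function lborel (v n)" "!!n. AE x in lborel. u n x = v n x" by metis
 have "AE x in lborel. \<forall>n. u n x = v n x" using v(2) by (subst AE_all_countable) blast
 then obtain N where N: "{x \<in> space lborel. \<not> (\<forall>n. u n x = v n x)} \<subseteq> N" "emeasure lborel N = 0" "N \<in> sets lborel"
  by (rule AE_E)
 define w where "w n x = (if x \<in> N then 0 else v n x)" for n x
 define g where "g x = (if x \<in> N then 0 else f x)" for x
 have wu: "w n x = (if x \<in> N then 0 else u n x)" for n x
 proof (cases "x \<in> N")
  case False
  hence "u n x = v n x" using N(1) by auto
  thus ?thesis by (simp add: w_def)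
 qed (simp add: w_def)
 have z: "0 \<in> T_below S \<gamma>" by (rule subspace_0[OF subspace_T_below])
 have "simple_function lborel (w n)" for n
  unfolding w_def by (rule simple_function_If_set) (use v(1) N(3) in auto)
 hence "simple_function borel (w n)" for n
  by (simp add: simple_function_def)
 moreover have "range (w n) \<subseteq> T_below S \<gamma>" for n using u(2) z by (auto simp: wu)
 moreover have "(\<lambda>n. nrm \<gamma> (w n x - g x)) \<longlonglongrightarrow> 0" for x
  using u(3)[of x] by (cases "x \<in> N") (auto simp: wu g_def)
 moreover have "g x \<in> T_below S \<gamma>" for x using f(1) z by (simp add: g_def)
 ultimately have "bsec \<gamma> g" unfolding bsec_def by blast
 moreover have "AE x in lborel. x \<notin> N" using N(2,3) by (intro AE_not_in) (auto simp: null_sets_def)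
 hence "AE x in lborel. f x = g x" by eventually_elim (simp add: g_def)
 ultimately show ?thesis by blast
qed

end

section \<open>Testing models against the mollifier\<close>

text \<open>The constant sequence forces any admissible value of the pairing to be the value of the functional.\<close>

lemma abs_pairing_ge:
 assumes "smooth \<psi>" "!!x. \<rho> < norm x ==> \<psi> x = 0"
 shows "ennreal \<bar>\<xi> \<psi>\<bar> <= abs_pairing r \<xi> \<psi>"
 unfolding abs_pairing_def
proof (rule Inf_greatest)
 fix z assume "z \<in> {ennreal \<bar>L\<bar> | L. has_pairing r \<xi> \<psi> L}"
 then obtain L where L: "z = ennreal \<bar>L\<bar>" "has_pairing r \<xi> \<psi> L" by blast
 have "supp \<psi> \<subseteq> cball 0 \<rho>" by (subst supp_subset_iff) (auto intro: assms(2))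
 moreover have "C_norm r (\<lambda>y. \<psi> y - \<psi> y) = 0"
 proof -
  have "C_norm r (\<lambda>y. \<psi> y - \<psi> y) <= 0"
   unfolding C_norm_def by (intro SUP_least) (simp add: partial_derivs_zero)
  thus ?thesis by simp
 qed
 ultimately have "(\<lambda>n :: nat. \<xi> \<psi>) \<longlonglongrightarrow> L"
  using L(2)[unfolded has_pairing_def, rule_format, of "cball 0 \<rho>" "\<lambda>n. \<psi>"] assms(1) by simp
 hence "L = \<xi> \<psi>" by (rule LIMSEQ_unique) simp
 thus "ennreal \<bar>\<xi> \<psi>\<bar> <= z" using L(1) by simp
qed

locale setting = mollifier s \<phi> R + reg_struct S
 for s :: "'d::finite => nat" and \<phi> :: "real ^ 'd => real" and R :: nat
  and S :: "('t::real_vector) reg_structure" +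
 fixes r :: nat and \<gamma> \<alpha> :: real
 assumes index_ge: "!!a. a \<in> index S ==> \<alpha> <= a" and \<alpha>_less: "\<alpha> < \<gamma>" and \<gamma>_neg: "\<gamma> < 0"
  and r_bounds: "1 <= r" "r <= R" "\<bar>\<alpha>\<bar> < real r"
begin

abbreviation (input) "\<A> \<equiv> index_below S \<gamma>"
abbreviation (input) "\<T> \<equiv> T_below S \<gamma>"

lemma index_range: assumes "a \<in> \<A>" shows "a \<in> index S" "\<alpha> <= a" "a < \<gamma>" "a < 0" "0 < a + real r"
 using assms index_ge[of a] \<gamma>_neg r_bounds by (auto simp: index_below_def)

lemma \<phi>_unit_test: "\<exists>M>0. (\<lambda>x. (1 / M) * \<phi> x) \<in> unit_tests s r"
proof -
 have far: "\<phi> x = 0" if "rad1 < norm x" for x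
  using \<phi>_supp_snorm[of x] norm_le_rad1[of x] that by linarith
 have C: "C_diff r \<phi>" using \<phi>_smooth by (rule smooth_C_diff)
 have "\<exists>M\<ge>0. \<forall>js x. length js <= r --> \<bar>partial_derivs js \<phi> x\<bar> <= M"
  by (rule partial_derivs_bounded[OF C far])
 then obtain M where M: "0 <= M" "!!js x. length js <= r ==> \<bar>partial_derivs js \<phi> x\<bar> <= M" by auto
 let ?f = "\<lambda>x. (1 / (M + 1)) * \<phi> x"
 have sub: "supp ?f \<subseteq> box1"
  using \<phi>_outside compact_imp_closed[OF compact_box1] by (subst supp_subset_iff) auto
 have "compact (supp ?f)" by (rule compact_supp[OF compact_box1 sub])
 moreover have "supp ?f \<subseteq> sball s 0 1"
  using sub snorm_le_half by (auto simp: sball_def mem_box1)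
 moreover have "C_norm r ?f <= 1"
  unfolding C_norm_def
 proof (intro SUP_least)
  fix js :: "'d list" and x assume js: "js \<in> {js. length js <= r}"
  have "\<bar>partial_derivs js ?f x\<bar> = \<bar>partial_derivs js \<phi> x\<bar> / (M + 1)"
   using js M(1) by (subst partial_derivs_cmult[OF C]) (auto simp: abs_mult)
  also have "... <= 1" using M(1) M(2)[of js x] js by simp
  finally show "ennreal \<bar>partial_derivs js ?f x\<bar> <= 1" using ennreal_leI by fastforce
 qed
 ultimately have "?f \<in> unit_tests s r" using C by (simp add: unit_tests_def C_diff_cmult del: times_divide_eq_left)
 thus ?thesis using M(1) by (intro exI[of _ "M + 1"]) auto
qed

definition \<phi>M :: real where "\<phi>M = (SOME M. 0 < M \<and> (\<lambda>x. (1 / M) * \<phi> x) \<in> unit_tests s r)"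

lemma \<phi>M: "0 < \<phi>M" "(\<lambda>x. (1 / \<phi>M) * \<phi> x) \<in> unit_tests s r"
 using someI_ex[OF \<phi>_unit_test] unfolding \<phi>M_def by auto

text \<open>Up to a constant, the mollifier is itself a test function of the class over which the model
 bounds are uniform.\<close>

lemma layered_bound:
 assumes lin: "!!\<psi>. linear (\<lambda>\<tau>. F \<tau> \<psi>)" and hom: "!!\<tau> \<psi> c. \<psi> \<in> schwartz ==> F \<tau> (\<lambda>z. c * \<psi> z) = c * F \<tau> \<psi>"
  and bd: "!!a \<tau> \<eta>. a \<in> \<A> ==> \<tau> \<in> layer S a ==> \<eta> \<in> unit_tests s r ==>
   abs_pairing r (F \<tau>) (rescale s \<eta> l y) <= ennreal (K * l powr a * lnorm S a \<tau>)"
  and K: "0 <= K" and l: "0 < l" "l <= 1" and \<tau>: "\<tau> \<in> \<T>"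
 shows "\<bar>F \<tau> (rescale s \<phi> l y)\<bar> <= (\<Sum>a\<in>\<A>. l powr a * (\<phi>M * K * \<N> a \<tau>))"
proof -
 let ?\<psi> = "rescale s \<phi> l y"
 have one: "\<bar>F \<sigma> ?\<psi>\<bar> <= l powr a * (\<phi>M * K * lnorm S a \<sigma>)" if a: "a \<in> \<A>" and \<sigma>: "\<sigma> \<in> layer S a" for a \<sigma>
 proof -
  let ?\<eta> = "rescale s (\<lambda>x. (1 / \<phi>M) * \<phi> x) l y"
  have e: "?\<eta> = (\<lambda>z. (1 / \<phi>M) * ?\<psi> z)" by (simp add: rescale_def)
  have n0: "0 <= lnorm S a \<sigma>" using lnorm_nonneg \<sigma> index_range(1)[OF a] by blast
  have "ennreal \<bar>F \<sigma> ?\<eta>\<bar> <= abs_pairing r (F \<sigma>) ?\<eta>"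
  proof (rule abs_pairing_ge)
   show "smooth ?\<eta>" unfolding e by (intro smooth_cmult smooth_rescale \<phi>_smooth)
   show "?\<eta> x = 0" if "norm y + rad1 < norm x" for x
    unfolding e using rescale_\<phi>_far[OF l that] by simp
  qed
  also have "... <= ennreal (K * l powr a * lnorm S a \<sigma>)" by (rule bd[OF a \<sigma> \<phi>M(2)])
  finally have "\<bar>F \<sigma> ?\<eta>\<bar> <= K * l powr a * lnorm S a \<sigma>" using K n0 by (simp add: ennreal_le_iff)
  moreover have "\<bar>F \<sigma> ?\<eta>\<bar> = \<bar>F \<sigma> ?\<psi>\<bar> / \<phi>M"
   unfolding e hom[OF rescale_\<phi>_schwartz[OF l]] using \<phi>M(1) by (simp add: abs_mult)
  ultimately show ?thesis using \<phi>M(1) by (simp add: divide_le_eq mult_ac)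
 qed
 have "F \<tau> ?\<psi> = (\<Sum>a\<in>\<A>. F (component S a \<tau>) ?\<psi>)"
  by (subst T_below_sum[OF \<tau>]) (rule linear_sum[OF lin])
 also have "\<bar>...\<bar> <= (\<Sum>a\<in>\<A>. \<bar>F (component S a \<tau>) ?\<psi>\<bar>)" by (rule sum_abs)
 also have "... <= (\<Sum>a\<in>\<A>. l powr a * (\<phi>M * K * \<N> a \<tau>))"
  unfolding comp_norm_def by (intro sum_mono one) (auto intro: component_layer index_range)
 finally show ?thesis .
qed

text \<open>The part of the modelled norm that ignores the model.\<close>

definition size :: "ennreal => (real ^ 'd => 't) => ennreal" where
 "size p f = (\<Sum>a\<in>\<A>. Lnorm lborel p (\<lambda>x. ennreal (\<N> a (f x))))"

lemma Lnorm_le_size: "a \<in> \<A> ==> Lnorm lborel p (\<lambda>x. ennreal (\<N> a (f x))) <= size p f"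
 unfolding size_def by (rule member_le_sum) (auto simp: finite_index_below)

lemma size_zero: "1 <= p ==> size p (\<lambda>x. 0) = 0"
 unfolding size_def by (intro sum.neutral ballI) (simp add: index_range)

end

locale reconstruction = setting s \<phi> R S r \<gamma> \<alpha> + model_bounds s S r \<gamma> \<alpha> P \<Gamma>
 for s :: "'d::finite => nat" and \<phi> R and S :: "('t::real_vector) reg_structure" and r \<gamma> \<alpha>
  and P :: "real ^ 'd => 't => 'd functional" and \<Gamma> :: "real ^ 'd => real ^ 'd => 't => 't"
begin

lemma P_rescale_le:
 assumes l: "0 < l" "l <= 1" and \<tau>: "\<tau> \<in> \<T>"
 shows "\<bar>P y \<tau> (rescale s \<phi> l y)\<bar> <= (\<Sum>a\<in>\<A>. l powr a * (\<phi>M * \<Pi>n * \<N> a \<tau>))"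
proof (rule layered_bound[OF P_linear _ _ Pi_norm_nonneg l \<tau>])
 show "P y \<tau> (\<lambda>z. c * \<psi> z) = c * P y \<tau> \<psi>" if "\<psi> \<in> schwartz" for \<tau> \<psi> c
  by (rule tempered_cmult[OF P_tempered that])
 show "abs_pairing r (P y \<tau>) (rescale s \<eta> l y) <= ennreal (\<Pi>n * l powr a * lnorm S a \<tau>)"
  if "a \<in> \<A>" "\<tau> \<in> layer S a" "\<eta> \<in> unit_tests s r" for a \<tau> \<eta>
  using Pi_norm_bound l that index_range(1,3)[OF that(1)] unfolding Pi_bound_def by simp
qed

lemma P_rescale_nrm:
 assumes l: "0 < l" "l <= 1" and \<tau>: "\<tau> \<in> \<T>"
 shows "\<bar>P y \<tau> (rescale s \<phi> l y)\<bar> <= l powr \<alpha> * \<phi>M * \<Pi>n * nrm \<gamma> \<tau>"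
proof -
 have "\<bar>P y \<tau> (rescale s \<phi> l y)\<bar> <= (\<Sum>a\<in>\<A>. l powr a * (\<phi>M * \<Pi>n * \<N> a \<tau>))"
  by (rule P_rescale_le[OF assms])
 also have "... <= (\<Sum>a\<in>\<A>. l powr \<alpha> * (\<phi>M * \<Pi>n * \<N> a \<tau>))"
 proof (intro sum_mono mult_right_mono)
  fix a assume a: "a \<in> \<A>"
  show "l powr a <= l powr \<alpha>" using l index_range(2)[OF a] by (intro powr_mono') auto
  show "0 <= \<phi>M * \<Pi>n * \<N> a \<tau>"
   using \<phi>M(1) Pi_norm_nonneg comp_norm_nonneg[OF index_range(1)[OF a]] by simp
 qed
 also have "... = l powr \<alpha> * \<phi>M * \<Pi>n * nrm \<gamma> \<tau>" by (simp add: nrm_def sum_distrib_left mult_ac)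
 finally show ?thesis .
qed

text \<open>Moving the base point changes the test function, which is harmless for a fixed distribution, and
 transports the vector, which is controlled by \<open>Gamma_near\<close>.\<close>

lemma P_base_continuous:
 assumes l: "0 < l" "l <= 1" and \<tau>: "\<tau> \<in> \<T>"
 shows "continuous_on UNIV (\<lambda>y. P y \<tau> (rescale s \<phi> l y))"
proof (rule continuous_at_imp_continuous_on, rule ballI)
 fix y0 :: "real ^ 'd"
 let ?h = "\<lambda>y. P y0 \<tau> (rescale s \<phi> l y)"
 let ?K = "l powr \<alpha> * \<phi>M * \<Pi>n"
 have K0: "0 <= ?K" using \<phi>M(1) Pi_norm_nonneg by simp
 have h: "(?h \<longlongrightarrow> ?h y0) (at y0)"
  using tempered_\<phi>_continuous[OF P_tempered l, of y0 \<tau>] by (simp add: continuous_on_def)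
 have d: "norm (P y \<tau> (rescale s \<phi> l y) - ?h y) <= ?K * (\<Gamma>n * modulus (snorm s (y - y0)) * nrm \<gamma> \<tau>)" for y
 proof -
  have "P y \<tau> (rescale s \<phi> l y) - ?h y = - P y (\<Gamma> y y0 \<tau> - \<tau>) (rescale s \<phi> l y)"
   by (simp add: P_Gamma[of y0 \<tau> y] linear_diff[OF P_linear])
  hence "norm (P y \<tau> (rescale s \<phi> l y) - ?h y) <= ?K * nrm \<gamma> (\<Gamma> y y0 \<tau> - \<tau>)"
   using P_rescale_nrm[OF l, of "\<Gamma> y y0 \<tau> - \<tau>" y] Gamma_T_below[OF \<tau>] \<tau> subspace_T_below
   by (simp add: subspace_diff)
  also have "... <= ?K * (\<Gamma>n * modulus (snorm s (y - y0)) * nrm \<gamma> \<tau>)"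
   by (rule mult_left_mono[OF Gamma_near[OF \<tau>] K0])
  finally show ?thesis .
 qed
 have m: "((\<lambda>y. modulus (snorm s (y - y0))) \<longlongrightarrow> 0) (at y0)"
  by (intro modulus_tendsto snorm_tendsto_0) (auto intro!: tendsto_eq_intros)
 have "((\<lambda>y. ?K * (\<Gamma>n * modulus (snorm s (y - y0)) * nrm \<gamma> \<tau>)) \<longlongrightarrow> ?K * (\<Gamma>n * 0 * nrm \<gamma> \<tau>)) (at y0)"
  by (intro tendsto_intros m)
 hence m0: "((\<lambda>y. ?K * (\<Gamma>n * modulus (snorm s (y - y0)) * nrm \<gamma> \<tau>)) \<longlongrightarrow> 0) (at y0)" by simp
 have "((\<lambda>y. P y \<tau> (rescale s \<phi> l y) - ?h y) \<longlongrightarrow> 0) (at y0)"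
  by (rule Lim_null_comparison[OF always_eventually m0]) (intro allI d)
 from tendsto_add[OF this h] show "isCont (\<lambda>y. P y \<tau> (rescale s \<phi> l y)) y0"
  by (simp add: isCont_def)
qed

lemma P_section_measurable:
 assumes f: "bsec \<gamma> f" and l: "0 < l" "l <= 1"
 shows "(\<lambda>y. P y (f y) (rescale s \<phi> l y)) \<in> borel_measurable borel"
proof (rule bsec_measurable[OF f, where pr = "\<lambda>y. y" and \<Phi> = "\<lambda>y \<tau>. P y \<tau> (rescale s \<phi> l y)"])
 show "(\<lambda>y. P y \<tau> (rescale s \<phi> l y)) \<in> borel_measurable borel" if "\<tau> \<in> \<T>" for \<tau>
  by (intro borel_measurable_continuous_onI P_base_continuous l that)
 fix y \<tau> and \<sigma> :: "nat => 't"
 assume \<tau>: "\<tau> \<in> \<T>" "!!n. \<sigma> n \<in> \<T>" and lim: "(\<lambda>n. nrm \<gamma> (\<sigma> n - \<tau>)) \<longlonglongrightarrow> 0"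
 let ?K = "l powr \<alpha> * \<phi>M * \<Pi>n"
 have d: "norm (P y (\<sigma> n) (rescale s \<phi> l y) - P y \<tau> (rescale s \<phi> l y)) <= ?K * nrm \<gamma> (\<sigma> n - \<tau>)" for n
  using P_rescale_nrm[OF l, of "\<sigma> n - \<tau>" y] \<tau> subspace_T_below
  by (simp add: subspace_diff linear_diff[OF P_linear])
 have d0: "(\<lambda>n. ?K * nrm \<gamma> (\<sigma> n - \<tau>)) \<longlonglongrightarrow> 0" using tendsto_mult_left[OF lim, of ?K] by simp
 have "(\<lambda>n. P y (\<sigma> n) (rescale s \<phi> l y) - P y \<tau> (rescale s \<phi> l y)) \<longlonglongrightarrow> 0"
  by (rule Lim_null_comparison[OF always_eventually d0]) (intro allI d)
 thus "(\<lambda>n. P y (\<sigma> n) (rescale s \<phi> l y)) \<longlonglongrightarrow> P y \<tau> (rescale s \<phi> l y)" by (rule LIM_zero_cancel)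
qed simp

section \<open>The reconstruction operator\<close>

definition dat :: "(real ^ 'd => 't) => nat => real ^ 'd => real" where
 "dat f n y = P y (f y) (rescale s \<phi> (eps n) y)"

definition wt :: "(real ^ 'd => 't) => real => real ^ 'd => real" where
 "wt f a y = \<phi>M * \<Pi>n * \<N> a (f y)"

text \<open>The reconstruction prescribes as average around \<open>y\<close> the one of the local approximation at \<open>y\<close>.\<close>

definition rec :: "(real ^ 'd => 't) => 'd functional" where
 "rec f \<psi> = (if \<psi> \<in> schwartz then Syn (dat f) \<psi> else 0)"

lemma eps_range: "0 < eps n" "eps n <= 1"
 by (auto simp: power_le_one)

lemma dat_measurable: "bsec \<gamma> f ==> dat f n \<in> borel_measurable borel"
 unfolding dat_def[abs_def] using P_section_measurable eps_range by simp

lemma wt_nonneg: "a \<in> \<A> ==> 0 <= wt f a y"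
 unfolding wt_def using \<phi>M(1) Pi_norm_nonneg comp_norm_nonneg[OF index_range(1)] by simp

lemma wt_measurable: "bsec \<gamma> f ==> a \<in> \<A> ==> wt f a \<in> borel_measurable borel"
 unfolding wt_def[abs_def] by (intro borel_measurable_times borel_measurable_const bsec_comp_norm_measurable)

lemma dat_dominated: "bsec \<gamma> f ==> dominated (dat f) \<A> (wt f)"
 unfolding dominated_def
proof (intro conjI allI ballI)
 fix n y assume f: "bsec \<gamma> f"
 show "\<bar>dat f n y\<bar> <= (\<Sum>a\<in>\<A>. eps n powr a * wt f a y)"
  unfolding dat_def wt_def by (rule P_rescale_le[OF eps_range bsec_T_below[OF f]])
qed (auto simp: dat_measurable wt_measurable wt_nonneg finite_index_below)

lemma wt_weight:
 assumes p: "1 <= p" "p ~= \<infinity>" and f: "bsec \<gamma> f" "size p f < \<infinity>" and a: "a \<in> \<A>"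
 shows "(\<integral>\<^sup>+y. ennreal (wt f a y / (1 + norm y) ^ (CARD('d) + 2))) < \<infinity>"
proof (rule Lp_weight_finite[OF p wt_measurable[OF f(1) a] wt_nonneg[OF a]])
 have c: "0 <= \<phi>M * \<Pi>n" using \<phi>M(1) Pi_norm_nonneg by simp
 have m: "(\<lambda>y. ennreal (\<N> a (f y))) \<in> borel_measurable lborel"
  using bsec_comp_norm_measurable[OF f(1) a] by simp
 have "(\<lambda>y. ennreal (wt f a y)) = (\<lambda>y. ennreal (\<phi>M * \<Pi>n) * ennreal (\<N> a (f y)))"
  unfolding wt_def using c comp_norm_nonneg[OF index_range(1)[OF a]] by (intro ext ennreal_mult) auto
 hence "Lnorm lborel p (\<lambda>y. ennreal (wt f a y)) = Lnorm lborel p (\<lambda>y. ennreal (\<phi>M * \<Pi>n) * ennreal (\<N> a (f y)))"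
  by simp
 also have "... <= ennreal (\<phi>M * \<Pi>n) * Lnorm lborel p (\<lambda>y. ennreal (\<N> a (f y)))"
  by (rule Lnorm_cmult(1)[OF p(1) m c])
 also have "... < \<infinity>" using le_less_trans[OF Lnorm_le_size[OF a] f(2)] by (simp add: ennreal_mult_less_top)
 finally show "Lnorm lborel p (\<lambda>y. ennreal (wt f a y)) < \<infinity>" .
qed

lemma wt_locint:
 assumes p: "1 <= p" "p ~= \<infinity>" and f: "bsec \<gamma> f" "size p f < \<infinity>"
 shows "locint \<A> (wt f)"
 unfolding locint_def using weight_local[OF wt_nonneg wt_measurable[OF f(1)] wt_weight[OF p f]] by blast

lemma rec_tempered:
 assumes p: "1 <= p" "p ~= \<infinity>" and f: "bsec \<gamma> f" "size p f < \<infinity>"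
 shows "rec f \<in> tempered" and "\<psi> \<in> schwartz ==> synth (dat f) \<psi> (rec f \<psi>)"
proof -
 have R: "1 <= R" "!!a. a \<in> \<A> ==> 0 < a + real R" using r_bounds index_range(5) by (auto, fastforce)
 note T = Syn_tempered[OF dat_dominated[OF f(1)] R wt_weight[OF p f]]
 show "rec f \<in> tempered" unfolding rec_def[abs_def] by (rule T(1))
 show "synth (dat f) \<psi> (rec f \<psi>)" if "\<psi> \<in> schwartz"
 proof -
  have "synth (dat f) \<psi> (Syn (dat f) \<psi>)" by (rule T(2)[OF _ _ that])
  thus ?thesis using that by (simp add: rec_def)
 qed
qed

lemma rec_zero: "rec (\<lambda>x. 0) = (\<lambda>\<psi>. 0)"
proof
 fix \<psi>
 have "dat (\<lambda>x. 0) = (\<lambda>n y. 0)" by (simp add: dat_def[abs_def] linear_0[OF P_linear])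
 thus "rec (\<lambda>x. 0) \<psi> = 0" by (simp add: rec_def Syn_def)
qed

lemma rec_lincomb:
 assumes p: "1 <= p" "p ~= \<infinity>" and f: "bsec \<gamma> f" "size p f < \<infinity>" and g: "bsec \<gamma> g" "size p g < \<infinity>"
 shows "rec (\<lambda>x. a *\<^sub>R f x + b *\<^sub>R g x) = (\<lambda>\<psi>. a * rec f \<psi> + b * rec g \<psi>)"
proof
 fix \<psi>
 show "rec (\<lambda>x. a *\<^sub>R f x + b *\<^sub>R g x) \<psi> = a * rec f \<psi> + b * rec g \<psi>"
 proof (cases "\<psi> \<in> schwartz")
  case True
  have "dat (\<lambda>x. a *\<^sub>R f x + b *\<^sub>R g x) = (\<lambda>n y. a * dat f n y + b * dat g n y)"
   by (simp add: dat_def[abs_def] linear_add[OF P_linear] linear_scale[OF P_linear])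
  hence "synth (dat (\<lambda>x. a *\<^sub>R f x + b *\<^sub>R g x)) \<psi> (a * rec f \<psi> + b * rec g \<psi>)"
   using synth_lincomb_data[OF rec_tempered(2)[OF p f True] rec_tempered(2)[OF p g True]] by simp
  thus ?thesis using True by (simp add: rec_def synth_Syn)
 qed (simp add: rec_def)
qed

lemma rec_cong_AE:
 assumes f: "bsec \<gamma> f" and g: "bsec \<gamma> g" and fg: "AE x in lborel. f x = g x"
 shows "rec f = rec g"
proof
 fix \<psi> :: "real ^ 'd => real"
 show "rec f \<psi> = rec g \<psi>"
 proof (cases "\<psi> \<in> schwartz")
  case True
  hence "continuous_on UNIV \<psi>" by (intro smooth_imp_continuous) (simp add: schwartz_def)
  hence [measurable]: "band n \<psi> \<in> borel_measurable borel" for n by (rule band_measurable)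
  have [measurable]: "dat f n \<in> borel_measurable borel" "dat g n \<in> borel_measurable borel" for n
   using dat_measurable f g by auto
  have "(\<integral>y. dat f n y * band n \<psi> y) = (\<integral>y. dat g n y * band n \<psi> y)" for n
  proof (rule integral_cong_AE)
   show "AE y in lborel. dat f n y * band n \<psi> y = dat g n y * band n \<psi> y"
    using fg by eventually_elim (simp add: dat_def)
  qed measurable
  thus ?thesis by (simp add: rec_def Syn_def)
 qed (simp add: rec_def)
qed

end

section \<open>Comparing two models\<close>

lemma ennreal_le_of_divide:
 assumes "x / ennreal d <= ennreal c" "0 < d" "0 <= c" shows "x <= ennreal (c * d)"
proof (cases x rule: ennreal_cases)
 case (real y)
 thus ?thesis using assms by (simp add: divide_ennreal ennreal_le_iff divide_le_eq)
next
 case top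
 thus ?thesis using assms by (simp add: ennreal_top_divide top_unique)
qed

lemma ennreal_divide_le:
 assumes "x <= ennreal (c * d)" "0 < d" "0 <= c" shows "x / ennreal d <= ennreal c"
proof (cases x rule: ennreal_cases)
 case (real y)
 thus ?thesis using assms by (simp add: divide_ennreal ennreal_le_iff divide_le_eq)
next
 case top
 thus ?thesis using assms by (simp add: top_unique)
qed

lemma has_pairing_diff:
 assumes "has_pairing r \<xi> \<psi> L" "has_pairing r \<xi>' \<psi> L'"
 shows "has_pairing r (\<lambda>g. \<xi> g - \<xi>' g) \<psi> (L - L')"
 unfolding has_pairing_def
proof (intro allI impI)
 fix u K assume A: "compact K" "\<forall>n::nat. smooth (u n) \<and> supp (u n) \<subseteq> K" "(\<lambda>n. C_norm r (\<lambda>y. u n y - \<psi> y)) \<longlonglongrightarrow> 0"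
 show "(\<lambda>n. \<xi> (u n) - \<xi>' (u n)) \<longlonglongrightarrow> L - L'"
  using assms[unfolded has_pairing_def, rule_format, OF A(1)] A(2,3) by (intro tendsto_diff) auto
qed

lemma abs_pairing_diff:
 assumes "abs_pairing r \<xi> \<psi> < ennreal c" "abs_pairing r \<xi>' \<psi> < ennreal c'"
 shows "abs_pairing r (\<lambda>g. \<xi> g - \<xi>' g) \<psi> <= ennreal (c + c')"
proof -
 obtain L where L: "has_pairing r \<xi> \<psi> L" "ennreal \<bar>L\<bar> < ennreal c"
  using assms(1) unfolding abs_pairing_def Inf_less_iff by blast
 obtain L' where L': "has_pairing r \<xi>' \<psi> L'" "ennreal \<bar>L'\<bar> < ennreal c'"
  using assms(2) unfolding abs_pairing_def Inf_less_iff by blast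
 have "abs_pairing r (\<lambda>g. \<xi> g - \<xi>' g) \<psi> <= ennreal \<bar>L - L'\<bar>"
  unfolding abs_pairing_def using has_pairing_diff[OF L(1) L'(1)] by (intro Inf_lower) blast
 also have "... <= ennreal (c + c')" using L(2) L'(2) by (intro ennreal_leI) (simp add: ennreal_less_iff)
 finally show ?thesis .
qed

lemma abs_pairing_zero: "abs_pairing r (\<lambda>g. 0) \<psi> = 0"
proof -
 have "has_pairing r (\<lambda>g. 0) \<psi> 0" by (simp add: has_pairing_def)
 hence "abs_pairing r (\<lambda>g. 0) \<psi> <= ennreal \<bar>0\<bar>" unfolding abs_pairing_def by (intro Inf_lower) blast
 thus ?thesis by simp
qed

context setting
begin

lemma size_locint:
 assumes p: "1 <= p" "p ~= \<infinity>" and f: "bsec \<gamma> f" "size p f < \<infinity>" and a: "a \<in> \<A>"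
 shows "(\<integral>\<^sup>+y. ennreal (\<N> a (f y)) * indicator (cball 0 \<rho>) y) < \<infinity>"
proof -
 have n: "0 <= \<N> a (f y)" for y by (rule comp_norm_nonneg[OF index_range(1)[OF a]])
 have m: "(\<lambda>y. \<N> a (f y)) \<in> borel_measurable borel" by (rule bsec_comp_norm_measurable[OF f(1) a])
 have "(\<integral>\<^sup>+y. ennreal (\<N> a (f y) / (1 + norm y) ^ (CARD('d) + 2))) < \<infinity>"
  by (rule Lp_weight_finite[OF p m n le_less_trans[OF Lnorm_le_size[OF a] f(2)]])
 thus ?thesis by (rule weight_local[OF n m])
qed

lemma comp_norm_tendsto_linear:
 assumes b: "b \<in> \<A>" and L: "linear L" "!!\<tau>. \<tau> \<in> \<T> ==> \<N> b (L \<tau>) <= K * nrm \<gamma> \<tau>"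
  and \<tau>: "\<tau> \<in> \<T>" "!!n. \<sigma> n \<in> \<T>" and lim: "(\<lambda>n::nat. nrm \<gamma> (\<sigma> n - \<tau>)) \<longlonglongrightarrow> 0"
 shows "(\<lambda>n. \<N> b (w + L (\<sigma> n))) \<longlonglongrightarrow> \<N> b (w + L \<tau>)"
proof (rule LIM_zero_cancel, rule Lim_null_comparison[OF always_eventually])
 have bi: "b \<in> index S" using b by (rule index_range)
 show "\<forall>n. norm (\<N> b (w + L (\<sigma> n)) - \<N> b (w + L \<tau>)) <= K * nrm \<gamma> (\<sigma> n - \<tau>)"
 proof
  fix n
  have "\<sigma> n - \<tau> \<in> \<T>" using \<tau> subspace_T_below by (simp add: subspace_diff)
  from L(2)[OF this] show "norm (\<N> b (w + L (\<sigma> n)) - \<N> b (w + L \<tau>)) <= K * nrm \<gamma> (\<sigma> n - \<tau>)"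
   using comp_norm_abs_diff[OF bi, of "w + L (\<sigma> n)" "w + L \<tau>"] by (simp add: linear_diff[OF L(1)])
 qed
 show "(\<lambda>n. K * nrm \<gamma> (\<sigma> n - \<tau>)) \<longlonglongrightarrow> 0" using tendsto_mult_left[OF lim, of K] by simp
qed

text \<open>Constants that do not depend on the model.\<close>

definition mixC :: real where "mixC = (SOME C. mix_bound \<gamma> (\<A> \<times> (UNIV :: bool set)) fst C)"

lemma mixC: "mix_bound \<gamma> (\<A> \<times> (UNIV :: bool set)) fst mixC"
 unfolding mixC_def by (rule someI_ex, rule mixed_estimate[OF \<gamma>_neg]) (auto simp: finite_index_below index_range)

lemma mixC_pos: "0 < mixC" using mixC by (simp add: mix_bound_def)

definition crudeC :: real where "crudeC = 16 * 4 ^ card \<A> * 3 powr (\<gamma> - \<alpha>)"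

definition pairC :: real where "pairC = (\<Sum>a\<in>\<A>. \<phi>M * CW1 r a)"

definition coreC :: real where "coreC = mixC * (pairC * (real (card \<A> + 1) * crudeC))"

lemma crudeC_ge: "1 <= crudeC" "16 * 4 ^ card \<A> <= crudeC"
proof -
 have 1: "1 <= (3::real) powr (\<gamma> - \<alpha>)" using \<alpha>_less by (intro ge_one_powr_ge_zero) auto
 have 2: "1 <= (4::real) ^ card \<A>" by simp
 show 3: "16 * 4 ^ card \<A> <= crudeC" unfolding crudeC_def using mult_left_mono[OF 1, of "16 * 4 ^ card \<A>"] by simp
 show "1 <= crudeC" using 2 3 by linarith
qed

lemma pairC: "a \<in> \<A> ==> 0 <= \<phi>M * CW1 r a" "a \<in> \<A> ==> \<phi>M * CW1 r a <= pairC" "0 <= pairC"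
proof -
 have 1: "0 <= \<phi>M * CW1 r a" if "a \<in> \<A>" for a
  using \<phi>M(1) CW1_nonneg[of a r] index_range[OF that] by simp
 show "0 <= \<phi>M * CW1 r a" if "a \<in> \<A>" using 1 that .
 show "\<phi>M * CW1 r a <= pairC" if "a \<in> \<A>"
  unfolding pairC_def using that 1 by (intro member_le_sum finite_index_below) auto
 show "0 <= pairC" unfolding pairC_def using 1 by (rule sum_nonneg)
qed

lemma coreC_nonneg: "0 <= coreC"
 unfolding coreC_def using mixC_pos pairC(3) crudeC_ge(1) by simp

text \<open>For increments of length between one and three the triangle inequality suffices, because the
 weights of the modelled norm are of order one there.\<close>

lemma crude_norm:
 assumes p: "1 <= p" "p ~= \<infinity>" and a: "a \<in> \<A>"
  and v: "bsec \<gamma> v" and w: "bsec \<gamma> w1" "bsec \<gamma> w2" and K: "0 <= K1" "0 <= K2"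
  and le: "!!x. F x <= \<N> a (v (x + h)) + 3 powr (\<gamma> - \<alpha>) * (K1 * nrm \<gamma> (w1 x)) + 3 powr (\<gamma> - \<alpha>) * (K2 * nrm \<gamma> (w2 x))"
 shows "Lnorm lborel p (\<lambda>x. ennreal (F x)) \<le>
  ennreal crudeC * (size p v + ennreal K1 * size p w1 + ennreal K2 * size p w2)"
proof -
 let ?c = "3 powr (\<gamma> - \<alpha>)" and ?n = "card \<A>"
 have cn: "0 <= \<N> b \<tau>" if "b \<in> \<A>" for b \<tau> using comp_norm_nonneg[OF index_range(1)[OF that]] .
 have cm[measurable]: "(\<lambda>x. \<N> b (u x)) \<in> borel_measurable borel" if "b \<in> \<A>" "bsec \<gamma> u" for b u
  by (rule bsec_comp_norm_measurable[OF that(2,1)])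
 have nm: "(\<lambda>x. nrm \<gamma> (u x)) \<in> borel_measurable borel" if "bsec \<gamma> u" for u
  unfolding nrm_def using that by (intro borel_measurable_sum cm)
 have nr: "Lnorm lborel p (\<lambda>x. ennreal (nrm \<gamma> (u x))) <= ennreal (4 ^ ?n) * size p u" if u: "bsec \<gamma> u" for u
 proof -
  have "Lnorm lborel p (\<lambda>x. ennreal (nrm \<gamma> (u x))) = Lnorm lborel p (\<lambda>x. \<Sum>b\<in>\<A>. ennreal (\<N> b (u x)))"
   unfolding nrm_def by (simp add: sum_ennreal cn)
  also have "... <= 4 ^ ?n * size p u" unfolding size_def
   by (rule Lnorm_sum[OF p(1) finite_index_below]) (use u cm in simp)
  finally show ?thesis by (simp add: ennreal_power[symmetric])
 qed
 have trm: "Lnorm lborel p (\<lambda>x. ennreal (?c * K) * ennreal (nrm \<gamma> (u x))) <= ennreal (?c * 4 ^ ?n) * (ennreal K * size p u)"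
  if u: "bsec \<gamma> u" and K: "0 <= K" for u K
 proof -
  have "Lnorm lborel p (\<lambda>x. ennreal (?c * K) * ennreal (nrm \<gamma> (u x))) <= ennreal (?c * K) * Lnorm lborel p (\<lambda>x. ennreal (nrm \<gamma> (u x)))"
   by (rule Lnorm_cmult(1)[OF p(1)]) (use K nm[OF u] in auto)
  also have "... <= ennreal (?c * K) * (ennreal (4 ^ ?n) * size p u)" by (rule mult_left_mono[OF nr[OF u]]) simp
  also have "... = ennreal (?c * 4 ^ ?n) * (ennreal K * size p u)"
   using K by (simp add: ennreal_mult mult_ac)
  finally show ?thesis .
 qed
 let ?A = "\<lambda>x. ennreal (\<N> a (v (x + h)))" and ?B = "\<lambda>x. ennreal (?c * K1) * ennreal (nrm \<gamma> (w1 x))"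
  and ?C = "\<lambda>x. ennreal (?c * K2) * ennreal (nrm \<gamma> (w2 x))"
 have m: "?A \<in> borel_measurable lborel" "?B \<in> borel_measurable lborel" "?C \<in> borel_measurable lborel"
 proof -
  have "(\<lambda>x. \<N> a (v x)) \<in> borel_measurable borel" by (rule cm[OF a v])
  hence "(\<lambda>x. \<N> a (v (x + h))) \<in> borel_measurable borel" by measurable
  thus "?A \<in> borel_measurable lborel" by simp
  show "?B \<in> borel_measurable lborel" using nm[OF w(1)] by simp
  show "?C \<in> borel_measurable lborel" using nm[OF w(2)] by simp
 qed
 have A: "Lnorm lborel p ?A <= size p v"
  using Lnorm_translate[OF p(2), of "\<lambda>x. ennreal (\<N> a (v x))" h] cm[OF a v] Lnorm_le_size[OF a, of p v] by simp
 have "Lnorm lborel p (\<lambda>x. ennreal (F x)) <= Lnorm lborel p (\<lambda>x. ?A x + (?B x + ?C x))"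
 proof (rule Lnorm_mono)
  fix x
  have "ennreal (F x) <= ennreal (\<N> a (v (x + h)) + (?c * K1 * nrm \<gamma> (w1 x) + ?c * K2 * nrm \<gamma> (w2 x)))"
   using le[of x] by (intro ennreal_leI) (simp add: mult_ac)
  also have "... = ?A x + (?B x + ?C x)"
   using K cn[OF a] nrm_nonneg by (simp add: ennreal_plus ennreal_mult)
  finally show "ennreal (F x) <= ?A x + (?B x + ?C x)" .
 qed
 also have "... <= 4 * (Lnorm lborel p ?A + Lnorm lborel p (\<lambda>x. ?B x + ?C x))"
  by (rule Lnorm_add[OF p(1) m(1) borel_measurable_add[OF m(2,3)]])
 also have "... <= 4 * (Lnorm lborel p ?A + 4 * (Lnorm lborel p ?B + Lnorm lborel p ?C))"
  by (intro mult_left_mono add_left_mono Lnorm_add[OF p(1) m(2,3)]) simp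
 also have "... <= 4 * (size p v + 4 * (ennreal (?c * 4 ^ ?n) * (ennreal K1 * size p w1) + ennreal (?c * 4 ^ ?n) * (ennreal K2 * size p w2)))"
  by (intro mult_left_mono add_mono A trm w K) auto
 also have "... = 4 * size p v + ennreal crudeC * (ennreal K1 * size p w1) + ennreal crudeC * (ennreal K2 * size p w2)"
 proof -
  have "ennreal crudeC = 4 * (4 * ennreal (?c * 4 ^ ?n))"
  proof -
   have "ennreal crudeC = ennreal (4 * (4 * (?c * 4 ^ ?n)))" by (simp add: crudeC_def mult_ac)
   also have "... = 4 * (4 * ennreal (?c * 4 ^ ?n))" by (subst ennreal_mult, simp, simp)+ simp
   finally show ?thesis .
  qed
  thus ?thesis by (simp only: distrib_left mult_ac add_ac)
 qed
 also have "... <= ennreal crudeC * size p v + ennreal crudeC * (ennreal K1 * size p w1) + ennreal crudeC * (ennreal K2 * size p w2)"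
 proof (intro add_right_mono mult_right_mono)
  have "(4::real) <= 16 * 4 ^ ?n" using one_le_power[of "4::real" ?n] by linarith
  hence "ennreal 4 <= ennreal crudeC" using crudeC_ge(2) by (intro ennreal_leI) linarith
  thus "4 <= ennreal crudeC" by simp
 qed simp
 finally show ?thesis by (simp only: distrib_left)
qed

end

locale two_models = reconstruction s \<phi> R S r \<gamma> \<alpha> P \<Gamma> + M': reconstruction s \<phi> R S r \<gamma> \<alpha> P' \<Gamma>'
 for s :: "'d::finite => nat" and \<phi> R and S :: "('t::real_vector) reg_structure" and r \<gamma> \<alpha>
  and P :: "real ^ 'd => 't => 'd functional" and \<Gamma> :: "real ^ 'd => real ^ 'd => 't => 't"
  and P' :: "real ^ 'd => 't => 'd functional" and \<Gamma>' :: "real ^ 'd => real ^ 'd => 't => 't"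
begin

abbreviation "\<Pi>n' \<equiv> Pi_norm s r S \<gamma> P'"
abbreviation "\<Gamma>n' \<equiv> Gamma_norm s S \<gamma> \<Gamma>'"

text \<open>Every admissible constant of either model bounds the corresponding pairing; the summand one makes
 the bounds strict, so that near-optimal values of the pairings exist.\<close>

lemma Pi_dist_finite: "Pi_dist s r S \<gamma> P P' < \<infinity>"
proof -
 let ?c = "\<Pi>n + 1 + (\<Pi>n' + 1)"
 have "Pi_dist s r S \<gamma> P P' <= ennreal ?c"
  unfolding Pi_dist_def
 proof (intro SUP_least)
  fix x \<eta> l a \<tau> assume \<eta>: "\<eta> \<in> unit_tests s r" and l: "l \<in> {0<..1::real}" and a: "a \<in> \<A>" and \<tau>: "\<tau> \<in> layer S a"
  have ai: "a \<in> index S" "a <= \<gamma>" using index_range[OF a] by auto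
  let ?d = "l powr a * lnorm S a \<tau>"
  show "abs_pairing r (\<lambda>\<psi>. P x \<tau> \<psi> - P' x \<tau> \<psi>) (rescale s \<eta> l x) / ennreal ?d <= ennreal ?c"
  proof (cases "\<tau> = 0")
   case True
   thus ?thesis by (simp add: linear_0[OF P_linear] linear_0[OF M'.P_linear] abs_pairing_zero)
  next
   case False
   hence d: "0 < ?d" using lnorm_nonneg[OF ai(1) \<tau>] lnorm_eq_0[OF ai(1) \<tau>] l by (simp add: less_le)
   have "abs_pairing r (P x \<tau>) (rescale s \<eta> l x) <= ennreal (\<Pi>n * ?d)"
    using Pi_norm_bound l \<eta> \<tau> ai unfolding Pi_bound_def by (simp add: mult.assoc)
   also have "... < ennreal ((\<Pi>n + 1) * ?d)"
    by (rule ennreal_lessI[OF mult_pos_pos[OF _ d] mult_strict_right_mono[OF _ d]]) (use Pi_norm_nonneg in auto)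
   finally have 1: "abs_pairing r (P x \<tau>) (rescale s \<eta> l x) < ennreal ((\<Pi>n + 1) * ?d)" .
   have "abs_pairing r (P' x \<tau>) (rescale s \<eta> l x) <= ennreal (\<Pi>n' * ?d)"
    using M'.Pi_norm_bound l \<eta> \<tau> ai unfolding Pi_bound_def by (simp add: mult.assoc)
   also have "... < ennreal ((\<Pi>n' + 1) * ?d)"
    by (rule ennreal_lessI[OF mult_pos_pos[OF _ d] mult_strict_right_mono[OF _ d]]) (use M'.Pi_norm_nonneg in auto)
   finally have 2: "abs_pairing r (P' x \<tau>) (rescale s \<eta> l x) < ennreal ((\<Pi>n' + 1) * ?d)" .
   have "abs_pairing r (\<lambda>\<psi>. P x \<tau> \<psi> - P' x \<tau> \<psi>) (rescale s \<eta> l x) <= ennreal ((\<Pi>n + 1) * ?d + (\<Pi>n' + 1) * ?d)"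
    by (rule abs_pairing_diff[OF 1 2])
   hence "abs_pairing r (\<lambda>\<psi>. P x \<tau> \<psi> - P' x \<tau> \<psi>) (rescale s \<eta> l x) <= ennreal (?c * ?d)"
    by (simp only: distrib_right)
   thus ?thesis by (rule ennreal_divide_le[OF _ d]) (use Pi_norm_nonneg M'.Pi_norm_nonneg in simp)
  qed
 qed
 thus ?thesis by (rule le_less_trans) simp
qed

definition \<kappa>\<Pi> :: real where "\<kappa>\<Pi> = enn2real (Pi_dist s r S \<gamma> P P')"

lemma \<kappa>\<Pi>: "ennreal \<kappa>\<Pi> = Pi_dist s r S \<gamma> P P'" "0 <= \<kappa>\<Pi>"
 unfolding \<kappa>\<Pi>_def using Pi_dist_finite by auto

lemma P_diff_rescale_le:
 assumes l: "0 < l" "l <= 1" and \<tau>: "\<tau> \<in> \<T>"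
 shows "\<bar>P y \<tau> (rescale s \<phi> l y) - P' y \<tau> (rescale s \<phi> l y)\<bar> <= (\<Sum>a\<in>\<A>. l powr a * (\<phi>M * \<kappa>\<Pi> * \<N> a \<tau>))"
proof (rule layered_bound[OF _ _ _ \<kappa>\<Pi>(2) l \<tau>])
 show "linear (\<lambda>\<tau>. P y \<tau> \<psi> - P' y \<tau> \<psi>)" for \<psi>
  by (intro linear_compose_sub P_linear M'.P_linear)
 show "P y \<tau> (\<lambda>z. c * \<psi> z) - P' y \<tau> (\<lambda>z. c * \<psi> z) = c * (P y \<tau> \<psi> - P' y \<tau> \<psi>)" if "\<psi> \<in> schwartz" for \<tau> \<psi> c
  by (simp add: tempered_cmult[OF P_tempered that] tempered_cmult[OF M'.P_tempered that] right_diff_distrib)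
 fix a \<tau> \<eta> assume a: "a \<in> \<A>" and \<tau>: "\<tau> \<in> layer S a" and \<eta>: "\<eta> \<in> unit_tests s r"
 let ?d = "l powr a * lnorm S a \<tau>"
 have ai: "a \<in> index S" using index_range[OF a] by auto
 show "abs_pairing r (\<lambda>\<psi>. P y \<tau> \<psi> - P' y \<tau> \<psi>) (rescale s \<eta> l y) <= ennreal (\<kappa>\<Pi> * l powr a * lnorm S a \<tau>)"
 proof (cases "\<tau> = 0")
  case True
  thus ?thesis by (simp add: linear_0[OF P_linear] linear_0[OF M'.P_linear] abs_pairing_zero)
 next
  case False
  hence d: "0 < ?d" using lnorm_nonneg[OF ai(1) \<tau>] lnorm_eq_0[OF ai(1) \<tau>] l by (simp add: less_le)
  have "abs_pairing r (\<lambda>\<psi>. P y \<tau> \<psi> - P' y \<tau> \<psi>) (rescale s \<eta> l y) / ennreal ?d <= Pi_dist s r S \<gamma> P P'"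
   unfolding Pi_dist_def
   by (rule SUP_upper2[of y], simp, rule SUP_upper2[OF \<eta>], rule SUP_upper2[of l], use l in simp,
     rule SUP_upper2[OF a], rule SUP_upper2[OF \<tau>], rule order_refl)
  hence "abs_pairing r (\<lambda>\<psi>. P y \<tau> \<psi> - P' y \<tau> \<psi>) (rescale s \<eta> l y) <= ennreal (\<kappa>\<Pi> * ?d)"
   unfolding \<kappa>\<Pi>(1)[symmetric] by (rule ennreal_le_of_divide[OF _ d \<kappa>\<Pi>(2)])
  thus ?thesis by (simp add: mult.assoc)
 qed
qed

lemma Gamma_diff_sum_bound:
 assumes a: "a \<in> \<A>" and b: "b \<in> index S" "b <= a" and \<tau>: "\<tau> \<in> layer S a"
 shows "\<N> b (\<Gamma> x y \<tau> - \<Gamma>' x y \<tau>) <= (\<Gamma>n + \<Gamma>n') * (rpow (snorm s (x - y)) (a - b) * lnorm S a \<tau>)"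
proof -
 have bI: "b \<in> \<A>" using a b by (simp add: index_below_def)
 show ?thesis
  using comp_norm_diff[OF b(1), of "\<Gamma> x y \<tau>" "\<Gamma>' x y \<tau>"] Gamma_layer[OF a bI \<tau>, of x y] M'.Gamma_layer[OF a bI \<tau>, of x y] b(2)
  by (simp add: algebra_simps)
qed

lemma Gamma_dist_finite: "Gamma_dist s S \<gamma> \<Gamma> \<Gamma>' < \<infinity>"
proof -
 have "Gamma_dist s S \<gamma> \<Gamma> \<Gamma>' <= ennreal (\<Gamma>n + \<Gamma>n')"
  unfolding Gamma_dist_def
 proof (intro SUP_least)
  fix x y a b \<tau> assume a: "a \<in> \<A>" and b: "b \<in> {b \<in> index S. b <= a}" and \<tau>: "\<tau> \<in> layer S a"
  let ?c = "\<N> b (\<Gamma> x y \<tau> - \<Gamma>' x y \<tau>)" and ?d = "rpow (snorm s (x - y)) (a - b) * lnorm S a \<tau>"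
  have c: "?c <= (\<Gamma>n + \<Gamma>n') * ?d" using Gamma_diff_sum_bound[OF a _ _ \<tau>, of b x y] b by simp
  have d: "0 <= ?d" using lnorm_nonneg[OF index_range(1)[OF a] \<tau>] by (simp add: rpow_def)
  show "ennreal ?c / ennreal ?d <= ennreal (\<Gamma>n + \<Gamma>n')"
  proof (cases "?d = 0")
   case True
   hence "ennreal ?c = 0" using c by (simp only: True mult_zero_right ennreal_eq_0_iff)
   thus ?thesis by simp
  next
   case False
   have "0 < ?d" by (rule le_neq_trans[OF d not_sym[OF False]])
   thus ?thesis
    by (rule ennreal_divide_le[OF ennreal_leI[OF c]]) (use Gamma_norm_nonneg M'.Gamma_norm_nonneg in simp)
  qed
 qed
 thus ?thesis by (rule le_less_trans) simp
qed

definition \<kappa>\<Gamma> :: real where "\<kappa>\<Gamma> = enn2real (Gamma_dist s S \<gamma> \<Gamma> \<Gamma>')"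

lemma \<kappa>\<Gamma>: "ennreal \<kappa>\<Gamma> = Gamma_dist s S \<gamma> \<Gamma> \<Gamma>'" "0 <= \<kappa>\<Gamma>"
 unfolding \<kappa>\<Gamma>_def using Gamma_dist_finite by auto

lemma Gamma_diff_crude:
 assumes b: "b \<in> \<A>" and \<tau>: "\<tau> \<in> \<T>" and D: "snorm s (x - y) <= D" "1 <= D"
 shows "\<N> b (\<Gamma> x y \<tau> - \<Gamma>' x y \<tau>) <= \<kappa>\<Gamma> * D powr (\<gamma> - \<alpha>) * nrm \<gamma> \<tau>"
proof (rule transport_crude[OF _ _ index_ge \<kappa>\<Gamma>(2) b \<tau> snorm_nonneg D])
 show "linear (\<lambda>\<tau>. \<Gamma> x y \<tau> - \<Gamma>' x y \<tau>)" by (intro linear_compose_sub Gamma_linear M'.Gamma_linear)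
 fix a \<sigma> assume a: "a \<in> \<A>" and \<sigma>: "\<sigma> \<in> layer S a"
 let ?c = "\<N> b (\<Gamma> x y \<sigma> - \<Gamma>' x y \<sigma>)" and ?d = "rpow (snorm s (x - y)) (a - b) * lnorm S a \<sigma>"
 have bi: "b \<in> index S" using b by (rule index_range)
 show "?c <= (if b <= a then \<kappa>\<Gamma> * rpow (snorm s (x - y)) (a - b) * lnorm S a \<sigma> else 0)"
 proof (cases "b <= a")
  case False
  hence "?c <= 0"
   using comp_norm_diff[OF bi, of "\<Gamma> x y \<sigma>" "\<Gamma>' x y \<sigma>"] Gamma_layer[OF a b \<sigma>, of x y] M'.Gamma_layer[OF a b \<sigma>, of x y] by simp
  thus ?thesis using False by simp
 next
  case True
  have c: "?c <= (\<Gamma>n + \<Gamma>n') * ?d" by (rule Gamma_diff_sum_bound[OF a bi True \<sigma>])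
  have d: "0 <= ?d" using lnorm_nonneg[OF index_range(1)[OF a] \<sigma>] by (simp add: rpow_def)
  have "?c <= \<kappa>\<Gamma> * ?d"
  proof (cases "?d = 0")
   case True
   thus ?thesis using c by (simp only: True mult_zero_right)
  next
   case False
   have "ennreal ?c / ennreal ?d <= Gamma_dist s S \<gamma> \<Gamma> \<Gamma>'"
    unfolding Gamma_dist_def
    by (rule SUP_upper2[of x], simp, rule SUP_upper2[of y], simp, rule SUP_upper2[OF a],
      rule SUP_upper2[of b], use bi True in simp, rule SUP_upper2[OF \<sigma>], rule order_refl)
   hence "ennreal ?c <= ennreal (\<kappa>\<Gamma> * ?d)"
    unfolding \<kappa>\<Gamma>(1)[symmetric] by (rule ennreal_le_of_divide[OF _ le_neq_trans[OF d not_sym[OF False]] \<kappa>\<Gamma>(2)])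
   thus ?thesis using d \<kappa>\<Gamma>(2) by (subst (asm) ennreal_le_iff) auto
  qed
  thus ?thesis using True by (simp add: mult.assoc)
 qed
qed

end

lemma nn_integral_shift_kernel:
 fixes F :: "'a::euclidean_space => ennreal"
 assumes "F \<in> borel_measurable borel"
 shows "(\<integral>\<^sup>+y. F y) = (\<integral>\<^sup>+h. F (x + h))"
 using nn_integral_translate[OF assms, of x] by (simp add: add.commute)

lemma sum_prod_bool: "finite A ==> (\<Sum>i\<in>A \<times> (UNIV :: bool set). f i) = (\<Sum>a\<in>A. f (a, True) + f (a, False))"
 for f :: "'a \<times> bool => 'b::comm_monoid_add"
 by (simp add: sum.cartesian_product' UNIV_bool add.commute)

context two_models
begin

section \<open>The reconstruction estimate\<close>

text \<open>The increment of the pair \<open>(f, g)\<close>, and the increment of \<open>g\<close> alone.\<close>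

definition dif :: "(real ^ 'd => 't) => (real ^ 'd => 't) => real ^ 'd => real ^ 'd => 't" where
 "dif f g y x = f y - g y - \<Gamma> y x (f x) + \<Gamma>' y x (g x)"

definition oth :: "(real ^ 'd => 't) => real ^ 'd => real ^ 'd => 't" where
 "oth g y x = g y - \<Gamma>' y x (g x)"

text \<open>Jointly continuous for constant sections; the three sections are then substituted one at a time.\<close>

lemma transport_pair_measurable:
 assumes b: "b \<in> \<A>" and v: "bsec \<gamma> v" and f: "bsec \<gamma> f" and g: "bsec \<gamma> g"
 shows "(\<lambda>p. \<N> b (v (fst p) - \<Gamma> (fst p) (snd p) (f (snd p)) + \<Gamma>' (fst p) (snd p) (g (snd p))))
  \<in> borel_measurable borel"
proof -
 have bi: "b \<in> index S" using b by (rule index_range)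
 have fstm: "fst \<in> borel \<rightarrow>\<^sub>M (borel :: (real ^ 'd) measure)" and sndm: "snd \<in> borel \<rightarrow>\<^sub>M (borel :: (real ^ 'd) measure)"
  by (intro borel_measurable_continuous_onI continuous_intros)+
 let ?T = "\<lambda>p \<tau>1 \<tau>2 \<tau>3. \<N> b (\<tau>1 - \<Gamma> (fst p) (snd p) \<tau>2 + \<Gamma>' (fst p) (snd p) \<tau>3)"
 have base: "(\<lambda>p. ?T p \<tau>1 \<tau>2 \<tau>3) \<in> borel_measurable borel"
  if \<tau>: "\<tau>2 \<in> \<T>" "\<tau>3 \<in> \<T>" for \<tau>1 \<tau>2 \<tau>3
 proof (intro borel_measurable_continuous_onI continuous_at_imp_continuous_on ballI)
  fix p0 :: "(real ^ 'd) \<times> (real ^ 'd)"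
  obtain z y where p0: "p0 = (z, y)" by (cases p0)
  let ?h = "\<lambda>p. ?T p \<tau>1 \<tau>2 \<tau>3"
  let ?A = "\<lambda>p. \<Gamma> (fst p) (snd p) \<tau>2 - \<Gamma> z y \<tau>2" and ?B = "\<lambda>p. \<Gamma>' (fst p) (snd p) \<tau>3 - \<Gamma>' z y \<tau>3"
  have d: "norm (?h p - ?h p0) <= nrm \<gamma> (?A p) + nrm \<gamma> (?B p)" for p
  proof -
   have "norm (?h p - ?h p0) <= \<N> b ((\<tau>1 - \<Gamma> (fst p) (snd p) \<tau>2 + \<Gamma>' (fst p) (snd p) \<tau>3) - (\<tau>1 - \<Gamma> z y \<tau>2 + \<Gamma>' z y \<tau>3))"
    unfolding p0 fst_conv snd_conv real_norm_def by (rule comp_norm_abs_diff[OF bi])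
   also have "... = \<N> b (?B p - ?A p)" by (simp add: algebra_simps)
   also have "... <= \<N> b (?B p) + \<N> b (?A p)" by (rule comp_norm_diff[OF bi])
   finally show ?thesis using comp_norm_le_nrm[OF b, of "?A p"] comp_norm_le_nrm[OF b, of "?B p"] by linarith
  qed
  have "((\<lambda>p. nrm \<gamma> (?A p) + nrm \<gamma> (?B p)) \<longlongrightarrow> 0) (at p0)"
   unfolding p0 using tendsto_add[OF Gamma_continuous[OF \<tau>(1), of z y] M'.Gamma_continuous[OF \<tau>(2), of z y]] by simp
  hence "((\<lambda>p. ?h p - ?h p0) \<longlongrightarrow> 0) (at p0)"
   by (rule Lim_null_comparison[OF always_eventually, rotated]) (intro allI d)
  thus "isCont ?h p0" unfolding isCont_def by (rule LIM_zero_cancel)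
 qed
 have s1: "(\<lambda>p. ?T p (v (fst p)) \<tau>2 \<tau>3) \<in> borel_measurable borel"
  if \<tau>: "\<tau>2 \<in> \<T>" "\<tau>3 \<in> \<T>" for \<tau>2 \<tau>3
 proof (rule bsec_measurable[OF v fstm, where \<Phi> = "\<lambda>p \<tau>. ?T p \<tau> \<tau>2 \<tau>3"])
  show "(\<lambda>p. ?T p \<tau> \<tau>2 \<tau>3) \<in> borel_measurable borel" for \<tau>
   by (rule base[OF \<tau>])
  fix p :: "(real ^ 'd) \<times> (real ^ 'd)" and \<tau> and \<sigma> :: "nat => 't"
  assume a: "\<tau> \<in> \<T>" "!!n. \<sigma> n \<in> \<T>" "(\<lambda>n. nrm \<gamma> (\<sigma> n - \<tau>)) \<longlonglongrightarrow> 0"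
  have e: "\<rho> - \<Gamma> (fst p) (snd p) \<tau>2 + \<Gamma>' (fst p) (snd p) \<tau>3 = (\<Gamma>' (fst p) (snd p) \<tau>3 - \<Gamma> (fst p) (snd p) \<tau>2) + \<rho>" for \<rho>
   by simp
  show "(\<lambda>n. ?T p (\<sigma> n) \<tau>2 \<tau>3) \<longlonglongrightarrow>
   ?T p \<tau> \<tau>2 \<tau>3"
   unfolding e
   by (rule comp_norm_tendsto_linear[OF b _ _ a, where L = "\<lambda>\<tau>. \<tau>" and K = 1])
     (use comp_norm_le_nrm[OF b] in "auto intro: linear_ident")
 qed
 have s2: "(\<lambda>p. ?T p (v (fst p)) (f (snd p)) \<tau>3) \<in> borel_measurable borel"
  if \<tau>: "\<tau>3 \<in> \<T>" for \<tau>3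
 proof (rule bsec_measurable[OF f sndm, where \<Phi> = "\<lambda>p \<tau>. ?T p (v (fst p)) \<tau> \<tau>3"])
  show "(\<lambda>p. ?T p (v (fst p)) \<tau> \<tau>3) \<in> borel_measurable borel"
   if "\<tau> \<in> \<T>" for \<tau> by (rule s1[OF that \<tau>])
  fix p :: "(real ^ 'd) \<times> (real ^ 'd)" and \<tau> and \<sigma> :: "nat => 't"
  assume a: "\<tau> \<in> \<T>" "!!n. \<sigma> n \<in> \<T>" "(\<lambda>n. nrm \<gamma> (\<sigma> n - \<tau>)) \<longlonglongrightarrow> 0"
  have e: "v (fst p) - \<Gamma> (fst p) (snd p) \<rho> + \<Gamma>' (fst p) (snd p) \<tau>3 = (v (fst p) + \<Gamma>' (fst p) (snd p) \<tau>3) + - \<Gamma> (fst p) (snd p) \<rho>" for \<rho>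
   by simp
  let ?D = "snorm s (fst p - snd p) + 1"
  show "(\<lambda>n. ?T p (v (fst p)) (\<sigma> n) \<tau>3) \<longlonglongrightarrow>
   ?T p (v (fst p)) \<tau> \<tau>3"
   unfolding e
  proof (rule comp_norm_tendsto_linear[OF b _ _ a, where L = "\<lambda>\<tau>. - \<Gamma> (fst p) (snd p) \<tau>" and K = "\<Gamma>n * ?D powr (\<gamma> - \<alpha>)"])
   show "linear (\<lambda>\<tau>. - \<Gamma> (fst p) (snd p) \<tau>)" by (rule linear_compose_neg[OF Gamma_linear])
   show "\<N> b (- \<Gamma> (fst p) (snd p) \<tau>) <= \<Gamma>n * ?D powr (\<gamma> - \<alpha>) * nrm \<gamma> \<tau>" if "\<tau> \<in> \<T>" for \<tau>
    unfolding comp_norm_minus[OF bi] by (rule Gamma_crude[OF b that]) auto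
  qed
 qed
 show ?thesis
 proof (rule bsec_measurable[OF g sndm, where \<Phi> = "\<lambda>p \<tau>. ?T p (v (fst p)) (f (snd p)) \<tau>"])
  show "(\<lambda>p. ?T p (v (fst p)) (f (snd p)) \<tau>) \<in> borel_measurable borel"
   if "\<tau> \<in> \<T>" for \<tau> by (rule s2[OF that])
  fix p :: "(real ^ 'd) \<times> (real ^ 'd)" and \<tau> and \<sigma> :: "nat => 't"
  assume a: "\<tau> \<in> \<T>" "!!n. \<sigma> n \<in> \<T>" "(\<lambda>n. nrm \<gamma> (\<sigma> n - \<tau>)) \<longlonglongrightarrow> 0"
  let ?D = "snorm s (fst p - snd p) + 1"
  show "(\<lambda>n. ?T p (v (fst p)) (f (snd p)) (\<sigma> n)) \<longlonglongrightarrow>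
   ?T p (v (fst p)) (f (snd p)) \<tau>"
  proof (rule comp_norm_tendsto_linear[OF b M'.Gamma_linear _ a, where K = "\<Gamma>n' * ?D powr (\<gamma> - \<alpha>)"])
   show "\<N> b (\<Gamma>' (fst p) (snd p) \<tau>) <= \<Gamma>n' * ?D powr (\<gamma> - \<alpha>) * nrm \<gamma> \<tau>" if "\<tau> \<in> \<T>" for \<tau>
    by (rule M'.Gamma_crude[OF b that]) auto
  qed
 qed
qed

lemma dif_oth_measurable:
 assumes b: "b \<in> \<A>" and f: "bsec \<gamma> f" and g: "bsec \<gamma> g"
 shows "(\<lambda>p. \<N> b (dif f g (fst p) (snd p))) \<in> borel_measurable borel"
  and "(\<lambda>p. \<N> b (oth g (fst p) (snd p))) \<in> borel_measurable borel"
proof -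
 show "(\<lambda>p. \<N> b (dif f g (fst p) (snd p))) \<in> borel_measurable borel"
  using transport_pair_measurable[OF b bsec_diff[OF f g] f g] by (simp add: dif_def)
 have m: "bsec \<gamma> (\<lambda>x. - g x)" using bsec_lincomb[OF g g, of "-1" 0] by simp
 show "(\<lambda>p. \<N> b (oth g (fst p) (snd p))) \<in> borel_measurable borel"
  using transport_pair_measurable[OF b g bsec_zero m]
  by (simp add: oth_def linear_0[OF Gamma_linear] linear_neg[OF M'.Gamma_linear])
qed

lemma increment_measurable:
 fixes F :: "real ^ 'd => real ^ 'd => real"
 assumes "(\<lambda>p. F (fst p) (snd p)) \<in> borel_measurable borel"
 shows "(\<lambda>(x, h). ennreal (F (x + h) x)) \<in> borel_measurable borel2" "(\<lambda>y. F y x) \<in> borel_measurable borel"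
proof -
 have "(\<lambda>p :: (real ^ 'd) \<times> (real ^ 'd). (fst p + snd p, fst p)) \<in> borel \<rightarrow>\<^sub>M borel"
  by (intro borel_measurable_continuous_onI continuous_intros)
 from measurable_compose[OF this assms] have "(\<lambda>p. F (fst p + snd p) (fst p)) \<in> borel_measurable borel" by simp
 thus "(\<lambda>(x, h). ennreal (F (x + h) x)) \<in> borel_measurable borel2"
  unfolding borel_prod split_beta by simp
 have "(\<lambda>y :: real ^ 'd. (y, x)) \<in> borel \<rightarrow>\<^sub>M borel"
  by (intro borel_measurable_continuous_onI continuous_intros)
 from measurable_compose[OF this assms] show "(\<lambda>y. F y x) \<in> borel_measurable borel" by simp
qed

definition Incr :: "ennreal => ennreal => (real ^ 'd => real ^ 'd => 't) => real => ennreal" where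
 "Incr p q F a = Lnorm (increment_measure s) q (\<lambda>h. Lnorm lborel p (\<lambda>x. ennreal (\<N> a (F (x + h) x))) *
   ennreal (snorm s h powr (a - \<gamma>)))"

context
 fixes p q :: ennreal and f g :: "real ^ 'd => 't"
 assumes p: "1 <= p" "p ~= \<infinity>" and q: "1 <= q"
  and f: "bsec \<gamma> f" "size p f < \<infinity>" and g: "bsec \<gamma> g" "size p g < \<infinity>"
begin

definition \<Xi> :: "real ^ 'd => 'd functional" where
 "\<Xi> x = (\<lambda>\<psi>. rec f \<psi> - M'.rec g \<psi> - P x (f x) \<psi> + P' x (g x) \<psi>)"

definition gdat :: "real ^ 'd => nat => real ^ 'd => real" where
 "gdat x n y = (let \<psi> = rescale s \<phi> (eps n) y in
   P y (dif f g y x) \<psi> + (P y (oth g y x) \<psi> - P' y (oth g y x) \<psi>))"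

definition gwt :: "real ^ 'd => real => real ^ 'd => real" where
 "gwt x a y = \<phi>M * \<Pi>n * \<N> a (dif f g y x) + \<phi>M * \<kappa>\<Pi> * \<N> a (oth g y x)"

text \<open>The data of \<open>\<Xi> x\<close>, since each of its four terms is a synthesis. Transporting \<open>f x\<close> and \<open>g x\<close> from
 \<open>x\<close> to \<open>y\<close> reveals increments in place of values.\<close>

lemma gdat_eq:
 "gdat x n y = 1 * (1 * dat f n y + (-1) * M'.dat g n y) +
   (-1) * (1 * P x (f x) (rescale s \<phi> (eps n) y) + (-1) * P' x (g x) (rescale s \<phi> (eps n) y))"
 by (simp add: gdat_def dat_def M'.dat_def Let_def dif_def oth_def P_Gamma[of x "f x" y] M'.P_Gamma[of x "g x" y]
  linear_diff[OF P_linear] linear_diff[OF M'.P_linear] linear_add[OF P_linear])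

lemma gdat_measurable: "gdat x n \<in> borel_measurable borel"
proof -
 have [measurable]: "dat f n \<in> borel_measurable borel" "M'.dat g n \<in> borel_measurable borel"
  using dat_measurable[OF f(1)] M'.dat_measurable[OF g(1)] by auto
 have [measurable]: "(\<lambda>y. P x (f x) (rescale s \<phi> (eps n) y)) \<in> borel_measurable borel"
  "(\<lambda>y. P' x (g x) (rescale s \<phi> (eps n) y)) \<in> borel_measurable borel"
  by (intro borel_measurable_continuous_onI tempered_\<phi>_continuous P_tempered M'.P_tempered eps_range)+
 show ?thesis unfolding gdat_eq[abs_def] by measurable
qed

lemma dif_oth_T_below: "dif f g y x \<in> \<T>" "oth g y x \<in> \<T>"
 unfolding dif_def oth_def
 by (intro subspace_add subspace_diff subspace_T_below bsec_T_below[OF f(1)] bsec_T_below[OF g(1)] Gamma_T_below M'.Gamma_T_below)+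

lemma gwt_nonneg: "a \<in> \<A> ==> 0 <= gwt x a y"
 unfolding gwt_def using \<phi>M(1) Pi_norm_nonneg \<kappa>\<Pi>(2) comp_norm_nonneg[OF index_range(1)] by simp

lemma gwt_measurable: "a \<in> \<A> ==> gwt x a \<in> borel_measurable borel"
 unfolding gwt_def[abs_def] using dif_oth_measurable[OF _ f(1) g(1), of a]
 by (intro borel_measurable_add borel_measurable_times borel_measurable_const
  increment_measurable(2)[of "\<lambda>y x. \<N> a (dif f g y x)"] increment_measurable(2)[of "\<lambda>y x. \<N> a (oth g y x)"])

lemma gdat_dominated: "dominated (gdat x) \<A> (gwt x)"
 unfolding dominated_def
proof (intro conjI allI ballI)
 fix n y
 let ?\<psi> = "rescale s \<phi> (eps n) y"
 have "\<bar>gdat x n y\<bar> <= \<bar>P y (dif f g y x) ?\<psi>\<bar> + \<bar>P y (oth g y x) ?\<psi> - P' y (oth g y x) ?\<psi>\<bar>"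
  unfolding gdat_def Let_def by (rule abs_triangle_ineq)
 also have "... <= (\<Sum>a\<in>\<A>. eps n powr a * (\<phi>M * \<Pi>n * \<N> a (dif f g y x))) +
   (\<Sum>a\<in>\<A>. eps n powr a * (\<phi>M * \<kappa>\<Pi> * \<N> a (oth g y x)))"
  by (intro add_mono P_rescale_le P_diff_rescale_le eps_range dif_oth_T_below)
 also have "... = (\<Sum>a\<in>\<A>. eps n powr a * gwt x a y)"
  unfolding gwt_def sum.distrib[symmetric] distrib_left ..
 finally show "\<bar>gdat x n y\<bar> <= (\<Sum>a\<in>\<A>. eps n powr a * gwt x a y)" .
qed (auto simp: finite_index_below gwt_nonneg gwt_measurable gdat_measurable)

lemma gwt_locint: "locint \<A> (gwt x)"
 unfolding locint_def
proof (intro ballI allI)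
 fix a \<rho> assume a: "a \<in> \<A>"
 have ai: "a \<in> index S" using a by (rule index_range)
 have "compact ((\<lambda>y. snorm s (y - x)) ` cball 0 \<rho>)"
  by (intro compact_continuous_image continuous_intros compact_cball)
 hence "bounded ((\<lambda>y. snorm s (y - x)) ` cball 0 \<rho>)" by (rule compact_imp_bounded)
 then obtain M where M: "\<forall>z\<in>(\<lambda>y. snorm s (y - x)) ` cball 0 \<rho>. norm z <= M" unfolding bounded_iff by auto
 define D where "D = max 1 M"
 have D: "snorm s (y - x) <= D" "1 <= D" if "norm y <= \<rho>" for y
 proof -
  have "norm (snorm s (y - x)) <= M" using that by (intro M[rule_format] imageI) simp
  thus "snorm s (y - x) <= D" by (simp add: D_def)
 qed (simp add: D_def)
 define K where "K = \<phi>M * \<Pi>n + \<phi>M * \<kappa>\<Pi>"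
 define c where "c = \<Gamma>n * D powr (\<gamma> - \<alpha>) * nrm \<gamma> (f x) + \<Gamma>n' * D powr (\<gamma> - \<alpha>) * nrm \<gamma> (g x)"
 have c0: "0 <= c" unfolding c_def using Gamma_norm_nonneg M'.Gamma_norm_nonneg nrm_nonneg by simp
 have K0: "0 <= \<phi>M * \<Pi>n" "0 <= \<phi>M * \<kappa>\<Pi>" "0 <= K"
  unfolding K_def using \<phi>M(1) Pi_norm_nonneg \<kappa>\<Pi>(2) by auto
 have cn: "0 <= \<N> a \<tau>" for \<tau> by (rule comp_norm_nonneg[OF ai])
 let ?F = "\<lambda>y. ennreal (\<N> a (f y)) * indicator (cball 0 \<rho>) y"
  and ?G = "\<lambda>y. ennreal (\<N> a (g y)) * indicator (cball 0 \<rho>) y"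
  and ?U = "\<lambda>y :: real ^ 'd. ennreal c * indicator (cball 0 \<rho>) y"
 have [measurable]: "(\<lambda>y. \<N> a (f y)) \<in> borel_measurable borel" "(\<lambda>y. \<N> a (g y)) \<in> borel_measurable borel"
  using bsec_comp_norm_measurable[OF f(1) a] bsec_comp_norm_measurable[OF g(1) a] by auto
 have [measurable]: "cball (0 :: real ^ 'd) \<rho> \<in> sets borel" by simp
 have pt: "ennreal (gwt x a y) * indicator (cball 0 \<rho>) y <= ennreal K * (?F y + ?G y + ?U y)" for y
 proof (cases "norm y <= \<rho>")
  case True
  note G1 = Gamma_crude[OF a bsec_T_below[OF f(1), of x] D[OF True]]
   and G2 = M'.Gamma_crude[OF a bsec_T_below[OF g(1), of x] D[OF True]]
  let ?b = "\<N> a (f y) + \<N> a (g y) + c"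
  have "\<N> a (dif f g y x) <= \<N> a (f y) + \<N> a (g y) + \<N> a (\<Gamma> y x (f x)) + \<N> a (\<Gamma>' y x (g x))"
   unfolding dif_def using comp_norm_add[OF ai, of "f y - g y - \<Gamma> y x (f x)" "\<Gamma>' y x (g x)"]
    comp_norm_diff[OF ai, of "f y - g y" "\<Gamma> y x (f x)"] comp_norm_diff[OF ai, of "f y" "g y"] by linarith
  hence 1: "\<N> a (dif f g y x) <= ?b" using G1 G2 unfolding c_def by linarith
  have "\<N> a (oth g y x) <= \<N> a (g y) + \<N> a (\<Gamma>' y x (g x))"
   unfolding oth_def by (rule comp_norm_diff[OF ai])
  moreover have "0 <= \<Gamma>n * D powr (\<gamma> - \<alpha>) * nrm \<gamma> (f x)" using Gamma_norm_nonneg nrm_nonneg by simp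
  ultimately have 2: "\<N> a (oth g y x) <= ?b" using G2 cn[of "f y"] unfolding c_def by linarith
  have "gwt x a y <= K * ?b"
   unfolding gwt_def K_def distrib_right by (intro add_mono mult_left_mono 1 2 K0)
  hence "ennreal (gwt x a y) <= ennreal (K * ?b)" by (rule ennreal_leI)
  also have "... = ennreal K * (ennreal (\<N> a (f y)) + ennreal (\<N> a (g y)) + ennreal c)"
   using K0(3) cn c0 by (simp add: ennreal_mult ennreal_plus)
  finally show ?thesis using True by simp
 qed simp
 have e: "emeasure lborel (cball (0 :: real ^ 'd) \<rho>) < \<infinity>" by (rule emeasure_compact_finite) simp
 have "(\<integral>\<^sup>+y. ennreal (gwt x a y) * indicator (cball 0 \<rho>) y) <= (\<integral>\<^sup>+y. ennreal K * (?F y + ?G y + ?U y))"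
  by (rule nn_integral_mono) (rule pt)
 also have "... = ennreal K * ((\<integral>\<^sup>+y. ?F y) + (\<integral>\<^sup>+y. ?G y) + (\<integral>\<^sup>+y. ?U y))"
  by (simp add: nn_integral_cmult nn_integral_add)
 also have "... < \<infinity>"
  using size_locint[OF p f a, of \<rho>] size_locint[OF p g a, of \<rho>] e
  by (simp add: ennreal_mult_less_top nn_integral_cmult_indicator)
 finally show "(\<integral>\<^sup>+y. ennreal (gwt x a y) * indicator (cball 0 \<rho>) y) < \<infinity>" .
qed

lemma \<Xi>_Syn:
 assumes \<psi>: "smooth \<psi>" "!!x. \<rho> < norm x ==> \<psi> x = 0"
 shows "\<Xi> x \<psi> = Syn (gdat x) \<psi>"
proof -
 have \<psi>s: "\<psi> \<in> schwartz" by (rule schwartz_compact[OF \<psi>])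
 have R1: "1 <= R" using r_bounds by simp
 have "synth (gdat x) \<psi> (1 * (1 * rec f \<psi> + (-1) * M'.rec g \<psi>) + (-1) * (1 * P x (f x) \<psi> + (-1) * P' x (g x) \<psi>))"
  unfolding gdat_eq[abs_def]
  by (intro synth_lincomb_data rec_tempered(2)[OF p f \<psi>s] M'.rec_tempered(2)[OF p g \<psi>s]
   synth_tempered[OF P_tempered R1 \<psi>] synth_tempered[OF M'.P_tempered R1 \<psi>])
 from synth_Syn[OF this] show ?thesis by (simp add: \<Xi>_def)
qed

definition gfn :: "real \<times> bool => real ^ 'd => real ^ 'd => ennreal" where
 "gfn i x h = ennreal (\<N> (fst i) (if snd i then dif f g (x + h) x else oth g (x + h) x))"

definition gconst :: "real \<times> bool => real" where
 "gconst i = \<phi>M * CW1 r (fst i) * (if snd i then \<Pi>n else \<kappa>\<Pi>)"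

lemma gfn_measurable:
 assumes "fst i \<in> \<A>" shows "(\<lambda>(x, h). gfn i x h) \<in> borel_measurable borel2"
 using increment_measurable(1)[OF dif_oth_measurable(1)[OF assms f(1) g(1)]]
  increment_measurable(1)[OF dif_oth_measurable(2)[OF assms f(1) g(1)]]
 by (cases "snd i") (simp_all add: gfn_def)

text \<open>The data at \<open>x + h\<close> depend on increments over \<open>h\<close> only.\<close>

lemma \<Xi>_pairing:
 assumes \<eta>: "\<eta> \<in> unit_tests s r" and l: "0 < l" "l < 1"
 shows "abs_pairing r (\<Xi> x) (rescale s \<eta> l x) \<le>
  (\<Sum>i\<in>\<A> \<times> UNIV. \<integral>\<^sup>+h. gfn i x h * ennreal (gconst i * ker l h (fst i)))"
proof -
 have "abs_pairing r (\<Xi> x) (rescale s \<eta> l x) \<le>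
  (\<Sum>a\<in>\<A>. \<integral>\<^sup>+y. ennreal (gwt x a y) * ennreal (CW1 r a * ker l (y - x) a))"
 proof (rule Syn_rescale_bound[OF gdat_dominated gwt_locint r_bounds(1,2) _ _ _ \<eta> l(1)])
  show "\<Xi> x \<psi> = Syn (gdat x) \<psi>" if "smooth \<psi>" "!!x. \<rho> < norm x ==> \<psi> x = 0" for \<psi> \<rho>
   by (rule \<Xi>_Syn[OF that])
 qed (use index_range l in auto)
 also have "... = (\<Sum>a\<in>\<A>. (\<integral>\<^sup>+h. gfn (a, True) x h * ennreal (gconst (a, True) * ker l h a)) +
   (\<integral>\<^sup>+h. gfn (a, False) x h * ennreal (gconst (a, False) * ker l h a)))"
 proof (rule sum.cong[OF refl])
  fix a assume a: "a \<in> \<A>"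
  have ai: "a \<in> index S" using a by (rule index_range)
  note [measurable] = gwt_measurable[OF a]
  have gm[measurable]: "gfn (a, b) x \<in> borel_measurable borel" for b
   using section_measurable(1)[OF gfn_measurable[of "(a, b)"], of x] a by simp
  have n: "0 <= CW1 r a" using index_range[OF a] by (intro CW1_nonneg) auto
  have pt: "ennreal (gwt x a (x + h)) * ennreal (CW1 r a * ker l (x + h - x) a) =
   gfn (a, True) x h * ennreal (gconst (a, True) * ker l h a) + gfn (a, False) x h * ennreal (gconst (a, False) * ker l h a)" for h
  proof -
   let ?d = "\<N> a (dif f g (x + h) x)" and ?e = "\<N> a (oth g (x + h) x)" and ?k = "ker l h a"
   have nn: "0 <= ?d" "0 <= ?e" "0 <= ?k" using comp_norm_nonneg[OF ai] ker_nonneg by auto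
   have cc: "0 <= gconst (a, True)" "0 <= gconst (a, False)"
    using n \<phi>M(1) Pi_norm_nonneg \<kappa>\<Pi>(2) by (auto simp: gconst_def)
   have "ennreal (gwt x a (x + h)) * ennreal (CW1 r a * ?k) = ennreal (gwt x a (x + h) * (CW1 r a * ?k))"
    using n nn gwt_nonneg[OF a] by (intro ennreal_mult[symmetric]) auto
   also have "gwt x a (x + h) * (CW1 r a * ?k) = ?d * (gconst (a, True) * ?k) + ?e * (gconst (a, False) * ?k)"
    by (simp add: gwt_def gconst_def algebra_simps)
   also have "ennreal ... = ennreal ?d * ennreal (gconst (a, True) * ?k) + ennreal ?e * ennreal (gconst (a, False) * ?k)"
    using nn cc by (simp add: ennreal_plus ennreal_mult)
   finally show ?thesis by (simp add: gfn_def)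
  qed
  have "(\<integral>\<^sup>+y. ennreal (gwt x a y) * ennreal (CW1 r a * ker l (y - x) a)) =
   (\<integral>\<^sup>+h. ennreal (gwt x a (x + h)) * ennreal (CW1 r a * ker l (x + h - x) a))"
   by (rule nn_integral_shift_kernel) (unfold ker_def, measurable)
  also have "... = (\<integral>\<^sup>+h. gfn (a, True) x h * ennreal (gconst (a, True) * ker l h a)) +
   (\<integral>\<^sup>+h. gfn (a, False) x h * ennreal (gconst (a, False) * ker l h a))"
   unfolding pt by (rule nn_integral_add) measurable
  finally show "(\<integral>\<^sup>+y. ennreal (gwt x a y) * ennreal (CW1 r a * ker l (y - x) a)) = ..." .
 qed
 also have "... = (\<Sum>i\<in>\<A> \<times> UNIV. \<integral>\<^sup>+h. gfn i x h * ennreal (gconst i * ker l h (fst i)))"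
  by (simp add: sum_prod_bool[OF finite_index_below])
 finally show ?thesis .
qed

definition crude1 :: ennreal where
 "crude1 = size p (\<lambda>x. f x - g x) + ennreal \<Gamma>n * size p (\<lambda>x. f x - g x) + ennreal \<kappa>\<Gamma> * size p g"

definition crude2 :: ennreal where "crude2 = size p g + ennreal \<Gamma>n' * size p g"

lemma dif_crude:
 assumes a: "a \<in> \<A>" and h: "snorm s h < 3"
 shows "Lnorm lborel p (\<lambda>x. ennreal (\<N> a (dif f g (x + h) x))) <= ennreal crudeC * crude1"
 unfolding crude1_def
proof (rule crude_norm[OF p a bsec_diff[OF f(1) g(1)] bsec_diff[OF f(1) g(1)] g(1) Gamma_norm_nonneg \<kappa>\<Gamma>(2)])
 fix x
 have ai: "a \<in> index S" using a by (rule index_range)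
 have D: "snorm s (x + h - x) <= 3" "(1::real) <= 3" using h by auto
 have T: "f x - g x \<in> \<T>" using bsec_T_below[OF bsec_diff[OF f(1) g(1)]] .
 have "dif f g (x + h) x = (f (x + h) - g (x + h)) - \<Gamma> (x + h) x (f x - g x) - (\<Gamma> (x + h) x (g x) - \<Gamma>' (x + h) x (g x))"
  by (simp add: dif_def linear_diff[OF Gamma_linear])
 thus "\<N> a (dif f g (x + h) x) <= \<N> a (f (x + h) - g (x + h)) + 3 powr (\<gamma> - \<alpha>) * (\<Gamma>n * nrm \<gamma> (f x - g x)) +
   3 powr (\<gamma> - \<alpha>) * (\<kappa>\<Gamma> * nrm \<gamma> (g x))"
  using comp_norm_diff[OF ai, of "(f (x + h) - g (x + h)) - \<Gamma> (x + h) x (f x - g x)" "\<Gamma> (x + h) x (g x) - \<Gamma>' (x + h) x (g x)"]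
   comp_norm_diff[OF ai, of "f (x + h) - g (x + h)" "\<Gamma> (x + h) x (f x - g x)"]
   Gamma_crude[OF a T D] Gamma_diff_crude[OF a bsec_T_below[OF g(1), of x] D] by (simp add: mult_ac)
qed

lemma oth_crude:
 assumes a: "a \<in> \<A>" and h: "snorm s h < 3"
 shows "Lnorm lborel p (\<lambda>x. ennreal (\<N> a (oth g (x + h) x))) <= ennreal crudeC * crude2"
proof -
 have "Lnorm lborel p (\<lambda>x. ennreal (\<N> a (oth g (x + h) x))) \<le>
  ennreal crudeC * (size p g + ennreal \<Gamma>n' * size p g + ennreal 0 * size p (\<lambda>x. 0))"
 proof (rule crude_norm[OF p a g(1) g(1) bsec_zero M'.Gamma_norm_nonneg order_refl])
  fix x
  have ai: "a \<in> index S" using a by (rule index_range)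
  have D: "snorm s (x + h - x) <= 3" "(1::real) <= 3" using h by auto
  show "\<N> a (oth g (x + h) x) <= \<N> a (g (x + h)) + 3 powr (\<gamma> - \<alpha>) * (\<Gamma>n' * nrm \<gamma> (g x)) +
    3 powr (\<gamma> - \<alpha>) * (0 * nrm \<gamma> 0)"
   unfolding oth_def
   using comp_norm_diff[OF ai, of "g (x + h)" "\<Gamma>' (x + h) x (g x)"] M'.Gamma_crude[OF a bsec_T_below[OF g(1), of x] D]
   by (simp add: mult_ac)
 qed
 thus ?thesis by (simp add: crude2_def)
qed

text \<open>The index set of \<open>mixed_estimate\<close> is doubled: the flag separates the increments of the pair, measured
 by the first model, from those of \<open>g\<close>, which come with the distance of the two models.\<close>

lemma core_estimate:
 "local_norm s r \<gamma> p q \<Xi> <= ennreal coreC *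
  (ennreal \<Pi>n * ((\<Sum>a\<in>\<A>. Incr p q (dif f g) a) + crude1) + ennreal \<kappa>\<Pi> * ((\<Sum>a\<in>\<A>. Incr p q (oth g) a) + crude2))"
proof -
 let ?B = "\<A> \<times> (UNIV :: bool set)" and ?n = "card \<A>"
 let ?Z = "\<lambda>x l. SUP \<eta>\<in>unit_tests s r. abs_pairing r (\<Xi> x) (rescale s \<eta> l x)"
 let ?z = "\<lambda>i. ennreal crudeC * (if snd i then crude1 else crude2)"
 let ?J = "\<lambda>i. Lnorm (increment_measure s) q (\<lambda>h. Lnorm lborel p (\<lambda>x. gfn i x h) * ennreal (snorm s h powr (fst i - \<gamma>)))"
 define X where "X i = (if snd i then Incr p q (dif f g) (fst i) else Incr p q (oth g) (fst i))" for i :: "real \<times> bool"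
 let ?D = "Incr p q (dif f g)" and ?E = "Incr p q (oth g)" and ?c = "ennreal crudeC"
 have JX: "?J i = X i" for i by (simp add: X_def Incr_def gfn_def)
 have "local_norm s r \<gamma> p q \<Xi> <= Lnorm scale_measure_01 q (\<lambda>l. Lnorm lebesgue p (\<lambda>x. ?Z x l / ennreal (l powr \<gamma>)))"
  unfolding local_norm_def by (intro Lnorm_mono SUP_least divide_right_mono_ennreal SUP_upper)
 also have "... <= ennreal mixC * (\<Sum>i\<in>?B. ennreal (gconst i) * (?J i + ?z i))"
 proof (rule mixC[unfolded mix_bound_def, THEN conjunct2, THEN spec[of _ p], THEN spec[of _ q], THEN spec[of _ ?Z],
   THEN spec[of _ gconst], THEN spec[of _ gfn], THEN spec[of _ ?z], THEN mp, THEN mp, THEN mp, THEN mp, THEN mp, THEN mp, OF p q])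
  show "\<forall>i\<in>?B. 0 <= gconst i \<and> (\<lambda>(x, h). gfn i x h) \<in> borel_measurable borel2"
  proof
   fix i assume "i \<in> ?B"
   hence i: "fst i \<in> \<A>" by auto
   show "0 <= gconst i \<and> (\<lambda>(x, h). gfn i x h) \<in> borel_measurable borel2"
    using gfn_measurable[OF i] pairC(1)[OF i] Pi_norm_nonneg \<kappa>\<Pi>(2) unfolding gconst_def by simp
  qed
  show "\<forall>x l. 0 < l --> l < 1 --> ?Z x l <= (\<Sum>i\<in>?B. \<integral>\<^sup>+h. gfn i x h * ennreal (gconst i * ker l h (fst i)))"
   by (intro allI impI SUP_least \<Xi>_pairing)
  show "\<forall>i\<in>?B. \<forall>h. 1 <= snorm s h --> snorm s h < 3 --> Lnorm lborel p (\<lambda>x. gfn i x h) <= ?z i"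
  proof (intro ballI allI impI)
   fix i h assume "i \<in> ?B" and h: "snorm s h < 3"
   hence i: "fst i \<in> \<A>" by auto
   show "Lnorm lborel p (\<lambda>x. gfn i x h) <= ?z i"
    using dif_crude[OF i h] oth_crude[OF i h] by (cases "snd i") (simp_all add: gfn_def)
  qed
 qed
 also have "(\<Sum>i\<in>?B. ennreal (gconst i) * (?J i + ?z i)) = (\<Sum>i\<in>?B. ennreal (gconst i) * (X i + ?z i))"
  by (simp only: JX)
 also have "... = (\<Sum>a\<in>\<A>. ennreal (gconst (a, True)) * (?D a + ?c * crude1) +
   ennreal (gconst (a, False)) * (?E a + ?c * crude2))"
  by (simp add: sum_prod_bool[OF finite_index_below] X_def)
 also have "... <= (\<Sum>a\<in>\<A>. ennreal pairC * (ennreal \<Pi>n * (?D a + ?c * crude1) +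
   ennreal \<kappa>\<Pi> * (?E a + ?c * crude2)))"
 proof (rule sum_mono)
  fix a assume a: "a \<in> \<A>"
  have "ennreal (gconst (a, b)) <= ennreal pairC * ennreal (if b then \<Pi>n else \<kappa>\<Pi>)" for b
  proof -
   have "gconst (a, b) <= pairC * (if b then \<Pi>n else \<kappa>\<Pi>)"
    unfolding gconst_def fst_conv snd_conv using Pi_norm_nonneg \<kappa>\<Pi>(2) by (intro mult_right_mono pairC(2)[OF a]) auto
   hence "ennreal (gconst (a, b)) <= ennreal (pairC * (if b then \<Pi>n else \<kappa>\<Pi>))" by (rule ennreal_leI)
   also have "... = ennreal pairC * ennreal (if b then \<Pi>n else \<kappa>\<Pi>)"
    using Pi_norm_nonneg \<kappa>\<Pi>(2) pairC(3) by (intro ennreal_mult) auto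
   finally show ?thesis .
  qed
  from this[of True] this[of False]
  have "ennreal (gconst (a, True)) * (?D a + ?c * crude1) + ennreal (gconst (a, False)) * (?E a + ?c * crude2)
   <= (ennreal pairC * ennreal \<Pi>n) * (?D a + ?c * crude1) + (ennreal pairC * ennreal \<kappa>\<Pi>) * (?E a + ?c * crude2)"
   by (intro add_mono mult_right_mono) auto
  also have "... = ennreal pairC * (ennreal \<Pi>n * (?D a + ?c * crude1) + ennreal \<kappa>\<Pi> * (?E a + ?c * crude2))"
   by (simp only: distrib_left mult.assoc)
  finally show "ennreal (gconst (a, True)) * (?D a + ?c * crude1) + ennreal (gconst (a, False)) * (?E a + ?c * crude2) <= ..." .
 qed
 also have "... = ennreal pairC * (ennreal \<Pi>n * (\<Sum>a\<in>\<A>. ?D a + ?c * crude1) +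
   ennreal \<kappa>\<Pi> * (\<Sum>a\<in>\<A>. ?E a + ?c * crude2))"
  by (simp only: sum_distrib_left[symmetric] sum.distrib)
 also have "... <= ennreal pairC * (ennreal \<Pi>n * (ennreal (real (?n + 1) * crudeC) * ((\<Sum>a\<in>\<A>. ?D a) + crude1)) +
   ennreal \<kappa>\<Pi> * (ennreal (real (?n + 1) * crudeC) * ((\<Sum>a\<in>\<A>. ?E a) + crude2)))"
 proof -
  have cs: "(\<Sum>a\<in>\<A>. Y a + ?c * z) <= ennreal (real (?n + 1) * crudeC) * ((\<Sum>a\<in>\<A>. Y a) + z)" for Y :: "real => ennreal" and z
  proof -
   have c1: "1 <= crudeC" by (rule crudeC_ge(1))
   have "1 * 1 <= real (?n + 1) * crudeC" using c1 by (intro mult_mono) auto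
   hence 1: "1 <= ennreal (real (?n + 1) * crudeC)" by (simp add: ennreal_1[symmetric] ennreal_leI del: ennreal_1)
   have "real ?n * crudeC <= real (?n + 1) * crudeC" using c1 by (intro mult_right_mono) auto
   hence 2: "ennreal (real ?n * crudeC) <= ennreal (real (?n + 1) * crudeC)" by (rule ennreal_leI)
   have "(\<Sum>a\<in>\<A>. Y a + ?c * z) = 1 * (\<Sum>a\<in>\<A>. Y a) + ennreal (real ?n * crudeC) * z"
    using c1 by (simp add: sum.distrib ennreal_mult ennreal_of_nat_eq_real_of_nat mult.assoc)
   also have "... <= ennreal (real (?n + 1) * crudeC) * (\<Sum>a\<in>\<A>. Y a) + ennreal (real (?n + 1) * crudeC) * z"
    by (intro add_mono mult_right_mono 1 2) auto
   finally show ?thesis by (simp only: distrib_left)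
  qed
  show ?thesis by (intro mult_left_mono add_mono cs) auto
 qed
 also have "... = ennreal pairC * ennreal (real (?n + 1) * crudeC) * (ennreal \<Pi>n * ((\<Sum>a\<in>\<A>. ?D a) + crude1) +
   ennreal \<kappa>\<Pi> * ((\<Sum>a\<in>\<A>. ?E a) + crude2))"
  by (simp only: distrib_left mult_ac)
 finally have "local_norm s r \<gamma> p q \<Xi> <= ennreal mixC * (ennreal pairC * ennreal (real (?n + 1) * crudeC) * (ennreal \<Pi>n * ((\<Sum>a\<in>\<A>. ?D a) + crude1) +
   ennreal \<kappa>\<Pi> * ((\<Sum>a\<in>\<A>. ?E a) + crude2)))"
  by (simp add: mult_left_mono)
 moreover have "ennreal coreC = ennreal mixC * (ennreal pairC * ennreal (real (?n + 1) * crudeC))"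
  unfolding coreC_def using mixC_pos pairC(3) crudeC_ge(1) by (simp add: ennreal_mult)
 ultimately show ?thesis by (simp only: mult.assoc)
qed

end

end

section \<open>The Besov bound\<close>

lemma AE_lborel_translate:
 fixes Q :: "'a::euclidean_space => bool"
 assumes "AE x in lborel. Q x" shows "AE x in lborel. Q (x + h)"
proof -
 have "distr lborel borel ((+) h) = (lborel :: 'a measure)" by (rule lborel_distr_plus)
 hence "AE x in distr lborel borel ((+) h). Q x" using assms by (simp only:)
 hence "AE x in lborel. Q (h + x)" by (rule AE_distrD[rotated]) simp
 thus ?thesis by (simp add: add.commute)
qed

lemma local_norm_cong_AE:
 assumes "AE x in lborel. \<Xi> x = \<Xi>' x" shows "local_norm s r \<kappa> p q \<Xi> = local_norm s r \<kappa> p q \<Xi>'"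
proof -
 have "Lnorm lebesgue p (\<lambda>x. SUP \<eta>\<in>unit_tests s r. abs_pairing r (\<Xi> x) (rescale s \<eta> l x) / ennreal (l powr \<kappa>)) =
  Lnorm lebesgue p (\<lambda>x. SUP \<eta>\<in>unit_tests s r. abs_pairing r (\<Xi>' x) (rescale s \<eta> l x) / ennreal (l powr \<kappa>))" for l
  by (rule Lnorm_cong_AE) (use AE_lborel_lebesgue[OF assms] in "eventually_elim, simp")
 thus ?thesis by (simp add: local_norm_def)
qed

context setting
begin

text \<open>A chosen representative; the operator does not depend on the choice by \<open>rec_cong_AE\<close>.\<close>

definition ver :: "(real ^ 'd => 't) => real ^ 'd => 't" where
 "ver f = (SOME g. bsec \<gamma> g \<and> (AE x in lborel. f x = g x))"

lemma ver: assumes "bsec \<gamma> g" "AE x in lborel. f x = g x"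
 shows "bsec \<gamma> (ver f)" "AE x in lborel. f x = ver f x"
proof -
 have "\<exists>g. bsec \<gamma> g \<and> (AE x in lborel. f x = g x)" using assms by blast
 from someI_ex[OF this] show "bsec \<gamma> (ver f)" "AE x in lborel. f x = ver f x" unfolding ver_def by auto
qed

lemma ver_modelled:
 assumes "f \<in> modelled s S \<gamma> p q \<Gamma>" shows "bsec \<gamma> (ver f)" "AE x in lborel. f x = ver f x"
proof -
 have "\<exists>g. bsec \<gamma> g \<and> (AE x in lborel. f x = g x)"
  using assms by (intro T_measurable_Borel_version) (auto simp: modelled_def)
 thus "bsec \<gamma> (ver f)" "AE x in lborel. f x = ver f x" using ver by blast+
qed

lemma size_cong_AE:
 assumes "p ~= \<infinity>" "AE x in lborel. f x = g x"
 shows "(\<Sum>a\<in>\<A>. Lnorm lebesgue p (\<lambda>x. ennreal (\<N> a (f x)))) = size p g"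
 unfolding size_def Lnorm_lebesgue[OF assms(1)]
 by (intro sum.cong refl Lnorm_cong_AE) (use assms(2) in "eventually_elim, simp")

lemma size_le_modelled_norm:
 assumes "p ~= \<infinity>" "AE x in lborel. f x = g x" shows "size p g <= modelled_norm s S \<gamma> p q \<Gamma> f"
 unfolding modelled_norm_def size_cong_AE[OF assms] by simp

lemma size_ver:
 assumes "p ~= \<infinity>" "f \<in> modelled s S \<gamma> p q \<Gamma>"
 shows "size p (ver f) <= modelled_norm s S \<gamma> p q \<Gamma> f" "size p (ver f) < \<infinity>"
proof -
 show 1: "size p (ver f) <= modelled_norm s S \<gamma> p q \<Gamma> f"
  by (rule size_le_modelled_norm[OF assms(1) ver_modelled(2)[OF assms(2)]])
 show "size p (ver f) < \<infinity>" using assms(2) by (intro le_less_trans[OF 1]) (simp add: modelled_def)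
qed

lemma kernel_masses: "\<exists>C. \<forall>a\<in>\<A>. 0 <= C a \<and>
  (\<forall>l>0. (\<integral>\<^sup>+h. ennreal (ker l h a)) <= ennreal (C a * l powr a))"
proof (rule bchoice, rule ballI)
 fix a assume a: "a \<in> \<A>"
 obtain C where C: "0 < C" "\<forall>l>0. (\<integral>\<^sup>+h. ennreal (max l (snorm s h) powr (- (- a) - real (scale_deg s)))) <= ennreal (C * l powr - (- a))"
  using kernel_mass[of "- a"] index_range(4)[OF a] by auto
 have "(\<integral>\<^sup>+h. ennreal (ker l h a)) <= ennreal (C * l powr a)" if "0 < l" for l
 proof -
  have "(\<integral>\<^sup>+h. ennreal (ker l h a)) <= (\<integral>\<^sup>+h. ennreal (max l (snorm s h) powr (- (- a) - real (scale_deg s))))"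
   by (intro nn_integral_mono ennreal_leI) (simp add: ker_def)
  also have "... <= ennreal (C * l powr a)" using C(2) that by simp
  finally show ?thesis .
 qed
 thus "\<exists>C. 0 <= C \<and> (\<forall>l>0. (\<integral>\<^sup>+h. ennreal (ker l h a)) <= ennreal (C * l powr a))"
  using C(1) by (intro exI[of _ C]) auto
qed

end

context reconstruction
begin

text \<open>Here the local approximations are not subtracted, so a level \<open>a\<close> only contributes the power \<open>l powr a\<close>,
 and the lowest level \<open>\<alpha>\<close> limits the regularity.\<close>

lemma besov_bound:
 assumes p: "1 <= p" "p ~= \<infinity>" and q: "1 <= q"
  and \<beta>: "if q = \<infinity> then \<beta> = \<alpha> else \<beta> < \<alpha>" and r': "\<bar>\<beta>\<bar> < real r'" "r' <= R"
 shows "\<exists>C\<ge>0. \<forall>f. bsec \<gamma> f --> size p f < \<infinity> --> besov_norm s r' \<beta> p q (rec f) <= ennreal C * size p f"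
proof -
 obtain Ck where Ck: "!!a. a \<in> \<A> ==> 0 <= Ck a"
  "!!a l. a \<in> \<A> ==> 0 < l ==> (\<integral>\<^sup>+h. ennreal (ker l h a)) <= ennreal (Ck a * l powr a)"
  using kernel_masses by blast
 have \<beta>\<alpha>: "\<beta> <= \<alpha>" "if q = \<infinity> then 0 <= \<alpha> - \<beta> else 0 < \<alpha> - \<beta>" using \<beta> by (auto split: if_splits)
 obtain C0 where C0: "0 < C0" "!!z. Lnorm scale_measure_01 q (\<lambda>l. z * ennreal (l powr (\<alpha> - \<beta>))) <= ennreal C0 * z"
  using scale_power_norm[OF q \<beta>\<alpha>(2)] by auto
 have r'1: "1 <= r'" using r'(1) by linarith
 have ar: "0 < a + real r'" if "a \<in> \<A>" for a using index_range(2)[OF that] \<beta>\<alpha>(1) r'(1) by linarith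
 have CW: "0 <= CW1 r' a" if "a \<in> \<A>" for a using ar[OF that] index_range(4)[OF that] by (intro CW1_nonneg)
 define k where "k a = \<phi>M * \<Pi>n * (CW1 r' a * Ck a)" for a
 have k0: "0 <= k a" if "a \<in> \<A>" for a unfolding k_def using \<phi>M(1) Pi_norm_nonneg CW[OF that] Ck(1)[OF that] by simp
 define C1 where "C1 = 4 ^ card \<A> * (\<Sum>a\<in>\<A>. k a)"
 have C10: "0 <= C1" unfolding C1_def using k0 by (intro mult_nonneg_nonneg sum_nonneg) auto
 have "besov_norm s r' \<beta> p q (rec f) <= ennreal (C0 * C1) * size p f" if f: "bsec \<gamma> f" "size p f < \<infinity>" for f
 proof -
  define N where "N = size p f"
  let ?inner = "\<lambda>l. Lnorm lebesgue p (\<lambda>x. SUP \<eta>\<in>unit_tests s r'. abs_pairing r' (rec f) (rescale s \<eta> l x) / ennreal (l powr \<beta>))"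
  have inner: "?inner l <= ennreal C1 * N * ennreal (l powr (\<alpha> - \<beta>))" if l: "0 < l" "l < 1" for l
  proof -
   define w where "w a h = CW1 r' a * ker l h a" for a and h :: "real ^ 'd"
   define gg where "gg a x h = ennreal (wt f a (x + h))" for a x h
   have wtm: "wt f a \<in> borel_measurable borel" if "a \<in> \<A>" for a by (rule wt_measurable[OF f(1) that])
   have gm: "(\<lambda>(x, h). gg a x h) \<in> borel_measurable borel2" if a: "a \<in> \<A>" for a
    unfolding gg_def split_beta using wtm[OF a] by measurable
   have wm: "w a \<in> borel_measurable borel" for a unfolding w_def[abs_def] ker_def by measurable
   have w0: "0 <= w a h" if "a \<in> \<A>" for a h using CW[OF that] ker_nonneg by (simp add: w_def)
   have inv: "X / ennreal (l powr \<beta>) = ennreal (l powr - \<beta>) * X" for X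
    using l by (simp add: divide_ennreal_def inverse_ennreal powr_minus mult.commute)
   have T: "(\<integral>\<^sup>+h. ennreal (w a h) * Lnorm lborel p (\<lambda>x. gg a x h)) <= ennreal (k a) * (N * ennreal (l powr \<alpha>))" if a: "a \<in> \<A>" for a
   proof -
    have ai: "a \<in> index S" using a by (rule index_range)
    have ce: "wt f a y = \<phi>M * \<Pi>n * \<N> a (f y)" for y by (simp add: wt_def)
    have c0: "0 <= \<phi>M * \<Pi>n" using \<phi>M(1) Pi_norm_nonneg by simp
    have cm: "(\<lambda>y. ennreal (\<N> a (f y))) \<in> borel_measurable lborel"
     using bsec_comp_norm_measurable[OF f(1) a] by simp
    have "Lnorm lborel p (\<lambda>x. gg a x h) <= ennreal (\<phi>M * \<Pi>n) * N" for h
    proof -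
     have "Lnorm lborel p (\<lambda>x. gg a x h) = Lnorm lborel p (\<lambda>y. ennreal (wt f a y))"
      unfolding gg_def by (rule Lnorm_translate[OF p(2), of "\<lambda>y. ennreal (wt f a y)"]) (use wtm[OF a] in measurable)
     also have "... = Lnorm lborel p (\<lambda>y. ennreal (\<phi>M * \<Pi>n) * ennreal (\<N> a (f y)))"
      unfolding ce using c0 comp_norm_nonneg[OF ai] by (simp add: ennreal_mult)
     also have "... <= ennreal (\<phi>M * \<Pi>n) * Lnorm lborel p (\<lambda>y. ennreal (\<N> a (f y)))"
      by (rule Lnorm_cmult(1)[OF p(1) cm c0])
     also have "... <= ennreal (\<phi>M * \<Pi>n) * N" unfolding N_def by (intro mult_left_mono Lnorm_le_size a) simp
     finally show ?thesis .
    qed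
    hence "(\<integral>\<^sup>+h. ennreal (w a h) * Lnorm lborel p (\<lambda>x. gg a x h)) \<le>
     (\<integral>\<^sup>+h. ennreal (w a h) * (ennreal (\<phi>M * \<Pi>n) * N))"
     by (intro nn_integral_mono mult_left_mono) auto
    also have "... = (\<integral>\<^sup>+h. (ennreal (CW1 r' a) * (ennreal (\<phi>M * \<Pi>n) * N)) * ennreal (ker l h a))"
     unfolding w_def ennreal_mult[OF CW[OF a] ker_nonneg] by (simp only: mult_ac)
    also have "... = (ennreal (CW1 r' a) * (ennreal (\<phi>M * \<Pi>n) * N)) * (\<integral>\<^sup>+h. ennreal (ker l h a))"
     by (rule nn_integral_cmult) measurable
    also have "... <= (ennreal (CW1 r' a) * (ennreal (\<phi>M * \<Pi>n) * N)) * ennreal (Ck a * l powr \<alpha>)"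
    proof (rule mult_left_mono)
     have "(\<integral>\<^sup>+h. ennreal (ker l h a)) <= ennreal (Ck a * l powr a)" by (rule Ck(2)[OF a l(1)])
     also have "... <= ennreal (Ck a * l powr \<alpha>)"
      using l index_range(2)[OF a] by (intro ennreal_leI mult_left_mono powr_mono' Ck(1) a) auto
     finally show "(\<integral>\<^sup>+h. ennreal (ker l h a)) <= ennreal (Ck a * l powr \<alpha>)" .
    qed simp
    also have "... = ennreal (k a) * (N * ennreal (l powr \<alpha>))"
    proof -
     have "ennreal (k a) = ennreal (\<phi>M * \<Pi>n) * (ennreal (CW1 r' a) * ennreal (Ck a))"
      unfolding k_def using c0 CW[OF a] Ck(1)[OF a] by (simp add: ennreal_mult)
     moreover have "ennreal (Ck a * l powr \<alpha>) = ennreal (Ck a) * ennreal (l powr \<alpha>)"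
      using Ck(1)[OF a] by (intro ennreal_mult) auto
     ultimately show ?thesis by (simp only: mult_ac)
    qed
    finally show ?thesis .
   qed
   have pt: "(SUP \<eta>\<in>unit_tests s r'. abs_pairing r' (rec f) (rescale s \<eta> l x) / ennreal (l powr \<beta>)) <= ennreal (l powr - \<beta>) * (\<Sum>a\<in>\<A>. \<integral>\<^sup>+h. gg a x h * ennreal (w a h))" for x
   proof (rule SUP_least)
    fix \<eta> assume \<eta>: "\<eta> \<in> unit_tests s r'"
    have "abs_pairing r' (rec f) (rescale s \<eta> l x) \<le>
     (\<Sum>a\<in>\<A>. \<integral>\<^sup>+y. ennreal (wt f a y) * ennreal (CW1 r' a * ker l (y - x) a))"
    proof (rule Syn_rescale_bound[OF dat_dominated[OF f(1)] wt_locint[OF p f] r'1 r'(2) ar _ _ \<eta> l(1)])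
     show "rec f \<psi> = Syn (dat f) \<psi>" if "smooth \<psi>" "!!x. \<rho> < norm x ==> \<psi> x = 0" for \<psi> \<rho>
      using schwartz_compact[OF that] by (simp add: rec_def)
    qed (use index_range l in auto)
    also have "... = (\<Sum>a\<in>\<A>. \<integral>\<^sup>+h. gg a x h * ennreal (w a h))"
    proof (rule sum.cong[OF refl])
     fix a assume a: "a \<in> \<A>"
     have "(\<lambda>y. ennreal (wt f a y) * ennreal (CW1 r' a * ker l (y - x) a)) \<in> borel_measurable borel"
      unfolding ker_def using wtm[OF a] by measurable
     from nn_integral_shift_kernel[OF this, of x]
     show "(\<integral>\<^sup>+y. ennreal (wt f a y) * ennreal (CW1 r' a * ker l (y - x) a)) = (\<integral>\<^sup>+h. gg a x h * ennreal (w a h))"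
      by (simp add: w_def gg_def)
    qed
    finally show "abs_pairing r' (rec f) (rescale s \<eta> l x) / ennreal (l powr \<beta>) <= ennreal (l powr - \<beta>) * (\<Sum>a\<in>\<A>. \<integral>\<^sup>+h. gg a x h * ennreal (w a h))"
     unfolding inv by (rule mult_left_mono) simp
   qed
   have Tm: "(\<lambda>x. \<Sum>a\<in>\<A>. \<integral>\<^sup>+h. gg a x h * ennreal (w a h)) \<in> borel_measurable lborel"
   proof (rule borel_measurable_sum)
    fix a assume "a \<in> \<A>"
    hence "(\<lambda>p. gg a (fst p) (snd p) * ennreal (w a (snd p))) \<in> borel_measurable borel2"
     using gm wm[of a] unfolding split_beta by measurable
    thus "(\<lambda>x. \<integral>\<^sup>+h. gg a x h * ennreal (w a h)) \<in> borel_measurable lborel"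
     using lborel.borel_measurable_nn_integral[of "\<lambda>x h. gg a x h * ennreal (w a h)" borel] by (simp add: split_beta)
   qed
   have "?inner l <= Lnorm lborel p (\<lambda>x. ennreal (l powr - \<beta>) * (\<Sum>a\<in>\<A>. \<integral>\<^sup>+h. gg a x h * ennreal (w a h)))"
    unfolding Lnorm_lebesgue[OF p(2)] by (rule Lnorm_mono) (rule pt)
   also have "... <= ennreal (l powr - \<beta>) * Lnorm lborel p (\<lambda>x. \<Sum>a\<in>\<A>. \<integral>\<^sup>+h. gg a x h * ennreal (w a h))"
    by (rule Lnorm_cmult(1)[OF p(1) Tm]) auto
   also have "... <= ennreal (l powr - \<beta>) * (4 ^ card \<A> * (\<Sum>a\<in>\<A>. \<integral>\<^sup>+h. ennreal (w a h) * Lnorm lborel p (\<lambda>x. gg a x h)))"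
    by (intro mult_left_mono Lnorm_kernel_sum p finite_index_below gm wm w0) auto
   also have "... <= ennreal (l powr - \<beta>) * (4 ^ card \<A> * (\<Sum>a\<in>\<A>. ennreal (k a) * (N * ennreal (l powr \<alpha>))))"
    by (intro mult_left_mono sum_mono T) auto
   also have "... = ennreal C1 * N * ennreal (l powr (\<alpha> - \<beta>))"
   proof -
    have "(\<Sum>a\<in>\<A>. ennreal (k a) * (N * ennreal (l powr \<alpha>))) = ennreal (\<Sum>a\<in>\<A>. k a) * (N * ennreal (l powr \<alpha>))"
     unfolding sum_distrib_right[symmetric] using k0 by (simp add: sum_ennreal)
    moreover have "ennreal C1 = 4 ^ card \<A> * ennreal (\<Sum>a\<in>\<A>. k a)"
     unfolding C1_def using k0 by (subst ennreal_mult) (auto simp: sum_nonneg ennreal_power[symmetric])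
    moreover have "ennreal (l powr (\<alpha> - \<beta>)) = ennreal (l powr - \<beta>) * ennreal (l powr \<alpha>)"
     by (simp add: ennreal_mult[symmetric] powr_add[symmetric])
    ultimately show ?thesis by (simp only: mult_ac)
   qed
   finally show ?thesis .
  qed
  have "besov_norm s r' \<beta> p q (rec f) <= Lnorm scale_measure_01 q (\<lambda>l. ennreal C1 * N * ennreal (l powr (\<alpha> - \<beta>)))"
   unfolding besov_norm_def local_norm_def
   by (rule Lnorm_mono_AE) (use AE_scales in "eventually_elim, use inner in blast")
  also have "... <= ennreal C0 * (ennreal C1 * N)" by (rule C0(2))
  also have "... = ennreal (C0 * C1) * N" using C0(1) C10 by (simp add: ennreal_mult mult.assoc)
  finally show ?thesis by (simp add: N_def)
 qed
 thus ?thesis using C0(1) C10 by (intro exI[of _ "C0 * C1"]) auto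
qed

definition Rop :: "(real ^ 'd => 't) => 'd functional" where "Rop f = rec (ver f)"

lemma Rop_linear:
 assumes p: "1 <= p" "p ~= \<infinity>" shows "linear_map_on (modelled s S \<gamma> p q \<Gamma>) Rop"
 unfolding linear_map_on_def
proof (intro ballI allI)
 fix f g a b assume f: "f \<in> modelled s S \<gamma> p q \<Gamma>" and g: "g \<in> modelled s S \<gamma> p q \<Gamma>"
 note vf = ver_modelled[OF f] and vg = ver_modelled[OF g]
 let ?u = "\<lambda>x. a *\<^sub>R f x + b *\<^sub>R g x" and ?v = "\<lambda>x. a *\<^sub>R ver f x + b *\<^sub>R ver g x"
 have bv: "bsec \<gamma> ?v" by (rule bsec_lincomb[OF vf(1) vg(1)])
 have ae: "AE x in lborel. ?u x = ?v x" using vf(2) vg(2) by eventually_elim simp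
 have "AE x in lborel. ver ?u x = ?v x" using ver(2)[OF bv ae] ae by eventually_elim simp
 hence "rec (ver ?u) = rec ?v" by (rule rec_cong_AE[OF ver(1)[OF bv ae] bv])
 thus "Rop ?u = (\<lambda>\<psi>. a * Rop f \<psi> + b * Rop g \<psi>)"
  unfolding Rop_def using rec_lincomb[OF p vf(1) size_ver(2)[OF p(2) f] vg(1) size_ver(2)[OF p(2) g], of a b] by simp
qed

lemma Rop_continuous:
 assumes p: "1 <= p" "p ~= \<infinity>" and q: "1 <= q"
  and \<beta>: "if q = \<infinity> then \<beta> = \<alpha> else \<beta> < \<alpha>" and r': "\<bar>\<beta>\<bar> < real r'" "r' <= R"
 shows "continuous_map_norm (modelled s S \<gamma> p q \<Gamma>) (modelled_norm s S \<gamma> p q \<Gamma>)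
  (besov s r' \<beta> p q) (besov_norm s r' \<beta> p q) Rop"
proof -
 obtain C where C: "0 <= C" "!!f. bsec \<gamma> f ==> size p f < \<infinity> ==> besov_norm s r' \<beta> p q (rec f) <= ennreal C * size p f"
  using besov_bound[OF p q \<beta> r'] by auto
 show ?thesis
  unfolding continuous_map_norm_def
 proof (intro conjI ballI allI impI)
  fix f assume f: "f \<in> modelled s S \<gamma> p q \<Gamma>"
  note vf = ver_modelled[OF f] and sf = size_ver(2)[OF p(2) f]
  have "besov_norm s r' \<beta> p q (rec (ver f)) <= ennreal C * size p (ver f)" by (rule C(2)[OF vf(1) sf])
  also have "... < \<infinity>" using sf by (simp add: ennreal_mult_less_top)
  finally show "Rop f \<in> besov s r' \<beta> p q"
   using rec_tempered(1)[OF p vf(1) sf] by (simp add: besov_def Rop_def)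
  fix \<epsilon> :: ennreal assume \<epsilon>: "0 < \<epsilon>"
  have "\<exists>\<delta>>0. \<forall>x<\<delta>. ennreal C * x < \<epsilon>"
  proof (cases \<epsilon> rule: ennreal_cases)
   case (real e)
   hence e: "0 < e" using \<epsilon> by simp
   have "ennreal C * x < \<epsilon>" if x: "x < ennreal (e / (C + 1))" for x
   proof -
    have "ennreal C * x <= ennreal C * ennreal (e / (C + 1))" using x by (intro mult_left_mono) auto
    also have "... = ennreal (C * (e / (C + 1)))" using C(1) e by (intro ennreal_mult[symmetric]) auto
    also have "... < ennreal e"
     using C(1) e by (intro ennreal_lessI) (auto simp: divide_less_eq field_simps)
    finally show ?thesis using real by simp
   qed
   thus ?thesis using e C(1) by (intro exI[of _ "ennreal (e / (C + 1))"]) auto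
  next
   case top
   have "ennreal C * x < \<epsilon>" if "x < 1" for x
    using order.strict_trans[OF that ennreal_one_less_top] unfolding top by (simp add: ennreal_mult_less_top)
   thus ?thesis by (intro exI[of _ 1]) auto
  qed
  then obtain \<delta> where \<delta>: "0 < \<delta>" "!!x. x < \<delta> ==> ennreal C * x < \<epsilon>" by auto
  show "\<exists>\<delta>>0. \<forall>g\<in>modelled s S \<gamma> p q \<Gamma>. modelled_norm s S \<gamma> p q \<Gamma> (\<lambda>x. g x - f x) < \<delta> -->
    besov_norm s r' \<beta> p q (\<lambda>\<psi>. Rop g \<psi> - Rop f \<psi>) < \<epsilon>"
  proof (intro exI[of _ \<delta>] conjI \<delta>(1) ballI impI)
   fix g assume g: "g \<in> modelled s S \<gamma> p q \<Gamma>" and less: "modelled_norm s S \<gamma> p q \<Gamma> (\<lambda>x. g x - f x) < \<delta>"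
   note vg = ver_modelled[OF g] and sg = size_ver(2)[OF p(2) g]
   let ?h = "\<lambda>x. 1 *\<^sub>R ver g x + (-1) *\<^sub>R ver f x"
   have bh: "bsec \<gamma> ?h" by (rule bsec_lincomb[OF vg(1) vf(1)])
   have ae: "AE x in lborel. g x - f x = ?h x" using vf(2) vg(2) by eventually_elim simp
   have sh: "size p ?h < \<delta>" using size_le_modelled_norm[OF p(2) ae, of q \<Gamma>] less by (rule le_less_trans)
   hence "size p ?h < \<infinity>" by (rule less_le_trans) simp
   hence "besov_norm s r' \<beta> p q (rec ?h) <= ennreal C * size p ?h" by (rule C(2)[OF bh])
   also have "... < \<epsilon>" by (rule \<delta>(2)[OF sh])
   also have "rec ?h = (\<lambda>\<psi>. Rop g \<psi> - Rop f \<psi>)"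
    using rec_lincomb[OF p vg(1) sg vf(1) sf, of 1 "-1"] by (simp add: Rop_def)
   finally show "besov_norm s r' \<beta> p q (\<lambda>\<psi>. Rop g \<psi> - Rop f \<psi>) < \<epsilon>" .
  qed
 qed
qed

end

context two_models
begin

lemma Incr_eq:
 assumes p: "1 <= p" "p ~= \<infinity>" and F: "!!h. AE x in lborel. F0 (x + h) x = F (x + h) x"
  and m: "(\<lambda>p. \<N> a (F (fst p) (snd p))) \<in> borel_measurable borel"
 shows "Lnorm (increment_measure s) q (\<lambda>h. Lnorm lebesgue p (\<lambda>x.
   ennreal (\<N> a (F0 (x + h) x) / snorm s h powr (\<gamma> - a)))) = Incr p q F a"
proof -
 have "Lnorm lebesgue p (\<lambda>x. ennreal (\<N> a (F0 (x + h) x) / snorm s h powr (\<gamma> - a))) =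
  Lnorm lborel p (\<lambda>x. ennreal (\<N> a (F (x + h) x))) * ennreal (snorm s h powr (a - \<gamma>))" for h
 proof -
  have e: "ennreal (c / snorm s h powr (\<gamma> - a)) = ennreal (snorm s h powr (a - \<gamma>)) * ennreal c" for c
  proof -
   have "c / snorm s h powr (\<gamma> - a) = snorm s h powr (a - \<gamma>) * c"
    using powr_minus[of "snorm s h" "\<gamma> - a"] by (simp add: divide_inverse mult.commute)
   thus ?thesis by (simp add: ennreal_mult')
  qed
  have gm: "(\<lambda>x. ennreal (\<N> a (F (x + h) x))) \<in> borel_measurable lborel"
   using section_measurable(2)[OF increment_measurable(1)[OF m], of h] by simp
  have "Lnorm lebesgue p (\<lambda>x. ennreal (\<N> a (F0 (x + h) x) / snorm s h powr (\<gamma> - a))) =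
   Lnorm lborel p (\<lambda>x. ennreal (snorm s h powr (a - \<gamma>)) * ennreal (\<N> a (F (x + h) x)))"
   unfolding Lnorm_lebesgue[OF p(2)] e
   by (rule Lnorm_cong_AE) (use F[of h] in "eventually_elim, simp")
  also have "... = ennreal (snorm s h powr (a - \<gamma>)) * Lnorm lborel p (\<lambda>x. ennreal (\<N> a (F (x + h) x)))"
   by (rule Lnorm_cmult(2)[OF p(1) gm _ p(2)]) simp
  finally show ?thesis by (simp only: mult.commute)
 qed
 thus ?thesis by (simp add: Incr_def)
qed

lemma dif_oth_cong_AE:
 assumes "AE x in lborel. f0 x = f x" "AE x in lborel. g0 x = g x"
 shows "AE x in lborel. dif f0 g0 (x + h) x = dif f g (x + h) x" "AE x in lborel. oth g0 (x + h) x = oth g (x + h) x"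
proof -
 show "AE x in lborel. dif f0 g0 (x + h) x = dif f g (x + h) x"
  using assms AE_lborel_translate[OF assms(1), of h] AE_lborel_translate[OF assms(2), of h]
  unfolding dif_def by eventually_elim simp
 show "AE x in lborel. oth g0 (x + h) x = oth g (x + h) x"
  using assms(2) AE_lborel_translate[OF assms(2), of h]
  unfolding oth_def by eventually_elim simp
qed

text \<open>Summing \<open>core_estimate\<close> over the finitely many levels replaces the maximum in the distance by a
 multiple; the factor depends on the norms of both models.\<close>

lemma comparison:
 assumes p: "1 <= p" "p ~= \<infinity>" and q: "1 <= q"
 shows "\<exists>K>0. \<forall>f\<in>modelled s S \<gamma> p q \<Gamma>. \<forall>g\<in>modelled s S \<gamma> p q \<Gamma>'.
  local_norm s r \<gamma> p q (\<lambda>x \<psi>. Rop f \<psi> - M'.Rop g \<psi> - P x (f x) \<psi> + P' x (g x) \<psi>) <= ennreal K *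
   (modelled_dist s S \<gamma> p q \<Gamma> \<Gamma>' f g + modelled_norm s S \<gamma> p q \<Gamma>' g * (Pi_dist s r S \<gamma> P P' + Gamma_dist s S \<gamma> \<Gamma> \<Gamma>'))"
proof -
 let ?n = "real (card \<A>)"
 define k where "k = \<Pi>n * (?n * (2 + \<Gamma>n)) + \<Pi>n + (2 + \<Gamma>n')"
 note nn = Pi_norm_nonneg Gamma_norm_nonneg M'.Gamma_norm_nonneg
 have k: "\<Pi>n * (?n * (2 + \<Gamma>n)) <= k" "\<Pi>n <= k" "2 + \<Gamma>n' <= k" "0 <= k"
  unfolding k_def using nn by (auto intro!: add_nonneg_nonneg mult_nonneg_nonneg)
 have "local_norm s r \<gamma> p q (\<lambda>x \<psi>. Rop f0 \<psi> - M'.Rop g0 \<psi> - P x (f0 x) \<psi> + P' x (g0 x) \<psi>) <= ennreal (coreC * k + 1) *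
   (modelled_dist s S \<gamma> p q \<Gamma> \<Gamma>' f0 g0 + modelled_norm s S \<gamma> p q \<Gamma>' g0 * (Pi_dist s r S \<gamma> P P' + Gamma_dist s S \<gamma> \<Gamma> \<Gamma>'))"
  if f0: "f0 \<in> modelled s S \<gamma> p q \<Gamma>" and g0: "g0 \<in> modelled s S \<gamma> p q \<Gamma>'" for f0 g0
 proof -
  define f where "f = ver f0"
  define g where "g = ver g0"
  note vf = ver_modelled[OF f0, folded f_def] and sf = size_ver[OF p(2) f0, folded f_def]
  note vg = ver_modelled[OF g0, folded g_def] and sg = size_ver[OF p(2) g0, folded g_def]
  define md where "md = modelled_dist s S \<gamma> p q \<Gamma> \<Gamma>' f0 g0"
  define mn where "mn = modelled_norm s S \<gamma> p q \<Gamma>' g0"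
  have dt: "Lnorm lebesgue p (\<lambda>x. ennreal (\<N> a (f0 x - g0 x))) + Incr p q (dif f g) a <= md" if a: "a \<in> \<A>" for a
  proof -
   have "Incr p q (dif f g) a = Lnorm (increment_measure s) q (\<lambda>h. Lnorm lebesgue p (\<lambda>x.
     ennreal (\<N> a (dif f0 g0 (x + h) x) / snorm s h powr (\<gamma> - a))))"
    by (rule Incr_eq[symmetric, OF p dif_oth_cong_AE(1)[OF vf(2) vg(2)] dif_oth_measurable(1)[OF a vf(1) vg(1)]])
   thus ?thesis
    unfolding md_def modelled_dist_def using a by (auto simp: dif_def intro!: Max_ge finite_imageI finite_index_below)
  qed
  have ae: "AE x in lborel. f0 x - g0 x = f x - g x" using vf(2) vg(2) by eventually_elim simp
  have n: "(\<Sum>a\<in>\<A>. md) = ennreal ?n * md" by (simp add: ennreal_of_nat_eq_real_of_nat)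
  have 1: "size p (\<lambda>x. f x - g x) <= ennreal ?n * md"
   unfolding size_cong_AE[OF p(2) ae, symmetric] n[symmetric]
   by (intro sum_mono order_trans[OF _ dt]) auto
  have 2: "(\<Sum>a\<in>\<A>. Incr p q (dif f g) a) <= ennreal ?n * md"
   unfolding n[symmetric] by (intro sum_mono order_trans[OF _ dt]) auto
  have 3: "(\<Sum>a\<in>\<A>. Incr p q (oth g) a) <= mn"
  proof -
   have "(\<Sum>a\<in>\<A>. Incr p q (oth g) a) = (\<Sum>a\<in>\<A>. Lnorm (increment_measure s) q (\<lambda>h. Lnorm lebesgue p (\<lambda>x.
     ennreal (\<N> a (oth g0 (x + h) x) / snorm s h powr (\<gamma> - a)))))"
    by (intro sum.cong refl Incr_eq[symmetric, OF p dif_oth_cong_AE(2)[OF vf(2) vg(2)] dif_oth_measurable(2)[OF _ vf(1) vg(1)]])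
   thus ?thesis unfolding mn_def modelled_norm_def oth_def by simp
  qed
  have "local_norm s r \<gamma> p q (\<lambda>x \<psi>. Rop f0 \<psi> - M'.Rop g0 \<psi> - P x (f0 x) \<psi> + P' x (g0 x) \<psi>) = local_norm s r \<gamma> p q (\<Xi> f g)"
  proof (rule local_norm_cong_AE)
   show "AE x in lborel. (\<lambda>\<psi>. Rop f0 \<psi> - M'.Rop g0 \<psi> - P x (f0 x) \<psi> + P' x (g0 x) \<psi>) = \<Xi> f g x"
    using vf(2) vg(2)
   proof eventually_elim
    case (elim x)
    show ?case unfolding \<Xi>_def[OF p q vf(1) sf(2) vg(1) sg(2)] Rop_def M'.Rop_def f_def[symmetric] g_def[symmetric] elim ..
   qed
  qed
  also have "... <= ennreal coreC * (ennreal \<Pi>n * ((\<Sum>a\<in>\<A>. Incr p q (dif f g) a) + crude1 p f g) +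
    ennreal \<kappa>\<Pi> * ((\<Sum>a\<in>\<A>. Incr p q (oth g) a) + crude2 p g))"
   by (rule core_estimate[OF p q vf(1) sf(2) vg(1) sg(2)])
  also have "... <= ennreal coreC * (ennreal \<Pi>n * (ennreal ?n * md + (ennreal ?n * md + ennreal \<Gamma>n * (ennreal ?n * md) + ennreal \<kappa>\<Gamma> * mn)) +
    ennreal \<kappa>\<Pi> * (mn + (mn + ennreal \<Gamma>n' * mn)))"
   unfolding crude1_def[OF p q vf(1) sf(2) vg(1) sg(2)] crude2_def[OF p q vf(1) sf(2) vg(1) sg(2)]
   using sg(1)[folded mn_def] by (intro mult_left_mono add_mono 1 2 3) auto
  also have "... = ennreal coreC * (ennreal (\<Pi>n * (?n * (2 + \<Gamma>n))) * md + ennreal \<Pi>n * (ennreal \<kappa>\<Gamma> * mn) + ennreal (2 + \<Gamma>n') * (ennreal \<kappa>\<Pi> * mn))"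
  proof -
   have e1: "ennreal (\<Pi>n * (?n * (2 + \<Gamma>n))) = ennreal \<Pi>n * (ennreal ?n * (2 + ennreal \<Gamma>n))"
    using nn by (simp add: ennreal_mult ennreal_plus)
   have e2: "ennreal (2 + \<Gamma>n') = 2 + ennreal \<Gamma>n'" using nn by (simp add: ennreal_plus)
   have two: "(2::ennreal) * z = z + z" for z by (rule mult_2)
   show ?thesis unfolding e1 e2 by (simp only: distrib_left distrib_right two mult.assoc mult_ac add_ac)
  qed
  also have "... <= ennreal coreC * (ennreal k * md + ennreal k * (ennreal \<kappa>\<Gamma> * mn) + ennreal k * (ennreal \<kappa>\<Pi> * mn))"
   by (intro mult_left_mono add_mono mult_right_mono ennreal_leI k) auto
  also have "... = ennreal (coreC * k) * (md + mn * (Pi_dist s r S \<gamma> P P' + Gamma_dist s S \<gamma> \<Gamma> \<Gamma>'))"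
   unfolding \<kappa>\<Pi>(1)[symmetric] \<kappa>\<Gamma>(1)[symmetric] ennreal_mult[OF coreC_nonneg k(4)]
   by (simp only: distrib_left mult_ac add_ac)
  also have "... <= ennreal (coreC * k + 1) * (md + mn * (Pi_dist s r S \<gamma> P P' + Gamma_dist s S \<gamma> \<Gamma> \<Gamma>'))"
   by (intro mult_right_mono ennreal_leI) auto
  finally show ?thesis by (simp only: md_def mn_def)
 qed
 thus ?thesis using coreC_nonneg k(4) by (intro exI[of _ "coreC * k + 1"]) (auto intro: add_nonneg_pos)
qed

end

context reconstruction
begin

text \<open>The comparison of a model with itself and of \<open>f\<close> with zero, where all distances drop out and the
 constant is the one fixed before the model.\<close>

lemma reconstruction_estimate:
 assumes p: "1 <= p" "p ~= \<infinity>" and q: "1 <= q"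
 shows "reconstruction_bound s r S \<gamma> p q P \<Gamma> (coreC + 1) Rop"
 unfolding reconstruction_bound_def
proof
 interpret T: two_models s \<phi> R S r \<gamma> \<alpha> P \<Gamma> P \<Gamma> by unfold_locales
 fix f0 assume f0: "f0 \<in> modelled s S \<gamma> p q \<Gamma>"
 define f where "f = ver f0"
 let ?Z = "\<lambda>x :: real ^ 'd. 0 :: 't"
 note vf = ver_modelled[OF f0, folded f_def] and sf = size_ver[OF p(2) f0, folded f_def]
 note cx = p q vf(1) sf(2) bsec_zero
 have s0: "size p ?Z = 0" by (rule size_zero[OF p(1)])
 have s0': "size p ?Z < \<infinity>" by (simp add: s0)
 let ?J = "\<Sum>a\<in>\<A>. T.Incr p q (T.dif f ?Z) a"
 have mn: "modelled_norm s S \<gamma> p q \<Gamma> f0 = size p f + ?J"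
 proof -
  have ae: "AE x in lborel. ?Z x = ?Z x" by simp
  have "?J = (\<Sum>a\<in>\<A>. Lnorm (increment_measure s) q (\<lambda>h. Lnorm lebesgue p (\<lambda>x.
     ennreal (\<N> a (T.dif f0 ?Z (x + h) x) / snorm s h powr (\<gamma> - a)))))"
   by (intro sum.cong refl T.Incr_eq[symmetric, OF p T.dif_oth_cong_AE(1)[OF vf(2) ae] T.dif_oth_measurable(1)[OF _ vf(1) bsec_zero]])
  thus ?thesis unfolding modelled_norm_def size_cong_AE[OF p(2) vf(2)]
   by (simp add: T.dif_def linear_0[OF Gamma_linear])
 qed
 have "local_norm s r \<gamma> p q (\<lambda>x \<psi>. Rop f0 \<psi> - P x (f0 x) \<psi>) = local_norm s r \<gamma> p q (T.\<Xi> f ?Z)"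
 proof (rule local_norm_cong_AE)
  show "AE x in lborel. (\<lambda>\<psi>. Rop f0 \<psi> - P x (f0 x) \<psi>) = T.\<Xi> f ?Z x"
   using vf(2)
  proof eventually_elim
   case (elim x)
   show ?case unfolding T.\<Xi>_def[OF cx s0'] Rop_def f_def[symmetric] elim rec_zero by (simp add: linear_0[OF P_linear])
  qed
 qed
 also have "... <= ennreal coreC * (ennreal \<Pi>n * (?J + T.crude1 p f ?Z) +
   ennreal T.\<kappa>\<Pi> * ((\<Sum>a\<in>\<A>. T.Incr p q (T.oth ?Z) a) + T.crude2 p ?Z))"
  by (rule T.core_estimate[OF cx s0'])
 also have "T.crude1 p f ?Z = size p f + ennreal \<Gamma>n * size p f" unfolding T.crude1_def[OF cx s0'] s0 by simp
 also have "T.crude2 p ?Z = 0" unfolding T.crude2_def[OF cx s0'] s0 by simp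
 also have "(\<Sum>a\<in>\<A>. T.Incr p q (T.oth ?Z) a) = 0"
  using p q by (intro sum.neutral ballI) (simp add: T.Incr_def T.oth_def linear_0[OF Gamma_linear] index_range)
 also have "ennreal coreC * (ennreal \<Pi>n * (?J + (size p f + ennreal \<Gamma>n * size p f)) + ennreal T.\<kappa>\<Pi> * (0 + 0)) \<le>
  ennreal (coreC + 1) * (ennreal \<Pi>n * (ennreal (1 + \<Gamma>n) * (size p f + ?J)))"
 proof -
  have e: "ennreal (1 + \<Gamma>n) = 1 + ennreal \<Gamma>n" using Gamma_norm_nonneg by (simp add: ennreal_plus)
  have "?J + (size p f + ennreal \<Gamma>n * size p f) <= ennreal (1 + \<Gamma>n) * (size p f + ?J)"
   unfolding e by (simp add: distrib_left distrib_right add_ac add_left_mono)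
  thus ?thesis using coreC_nonneg by (simp add: mult_mono ennreal_leI mult_left_mono)
 qed
 also have "... = ennreal ((coreC + 1) * \<Pi>n * (1 + \<Gamma>n)) * modelled_norm s S \<gamma> p q \<Gamma> f0"
  unfolding mn using coreC_nonneg Pi_norm_nonneg Gamma_norm_nonneg by (simp add: ennreal_mult mult.assoc)
 finally show "local_norm s r \<gamma> p q (\<lambda>x \<psi>. Rop f0 \<psi> - P x (f0 x) \<psi>) \<le>
  ennreal ((coreC + 1) * \<Pi>n * (1 + \<Gamma>n)) * modelled_norm s S \<gamma> p q \<Gamma> f0" .
qed

end

theorem theorem2p11:
  fixes s :: "'d::finite \<Rightarrow> nat"
    and S :: "('t::real_vector) reg_structure"
    and p q :: ennreal
    and \<alpha> \<alpha>bar \<gamma> :: real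
    and r r' :: nat
  assumes "\<And>i. 1 \<le> s i"
    and "regularity_structure S"
    and "1 \<le> p" and "p < \<infinity>" and "1 \<le> q"
    and "\<alpha> \<in> index S" and "\<And>a. a \<in> index S \<Longrightarrow> \<alpha> \<le> a"
    and "\<alpha> < \<gamma>" and "\<gamma> < 0"
    and "if q = \<infinity> then \<alpha>bar = \<alpha> else \<alpha>bar < \<alpha>"
    and "\<bar>\<alpha>\<bar> < real r"
    and "\<bar>\<alpha>bar\<bar> < real r'"
  shows "\<exists>C>0.
    (\<forall>P \<Gamma>. model s r S P \<Gamma> \<longrightarrow>
      (\<exists>R. linear_map_on (modelled s S \<gamma> p q \<Gamma>) R \<and>
           continuous_map_norm (modelled s S \<gamma> p q \<Gamma>) (modelled_norm s S \<gamma> p q \<Gamma>)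
             (besov s r' \<alpha>bar p q) (besov_norm s r' \<alpha>bar p q) R \<and>
           reconstruction_bound s r S \<gamma> p q P \<Gamma> C R)) \<and>
    (\<forall>P \<Gamma> P' \<Gamma>'. model s r S P \<Gamma> \<and> model s r S P' \<Gamma>' \<longrightarrow>
      (\<exists>R R'.
           continuous_map_norm (modelled s S \<gamma> p q \<Gamma>) (modelled_norm s S \<gamma> p q \<Gamma>)
             (besov s r' \<alpha>bar p q) (besov_norm s r' \<alpha>bar p q) R \<and>
           continuous_map_norm (modelled s S \<gamma> p q \<Gamma>') (modelled_norm s S \<gamma> p q \<Gamma>')
             (besov s r' \<alpha>bar p q) (besov_norm s r' \<alpha>bar p q) R' \<and>
           reconstruction_bound s r S \<gamma> p q P \<Gamma> C R \<and>
           reconstruction_bound s r S \<gamma> p q P' \<Gamma>' C R' \<and>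
           (\<exists>K>0. \<forall>f\<in>modelled s S \<gamma> p q \<Gamma>. \<forall>g\<in>modelled s S \<gamma> p q \<Gamma>'.
              local_norm s r \<gamma> p q (\<lambda>x \<phi>. R f \<phi> - R' g \<phi> - P x (f x) \<phi> + P' x (g x) \<phi>)
                \<le> ennreal K *
                   (modelled_dist s S \<gamma> p q \<Gamma> \<Gamma>' f g +
                    modelled_norm s S \<gamma> p q \<Gamma>' g * (Pi_dist s r S \<gamma> P P' + Gamma_dist s S \<gamma> \<Gamma> \<Gamma>')))))"
proof -
 define N where "N = max r r'"
 have sc: "scaling s" by (rule scaling.intro) (rule assms(1))
 obtain \<phi> where \<phi>: "mollifier s \<phi> N" using scaling.mollifier_exists[OF sc] by blast
 have rs: "reg_struct S" by (rule reg_struct.intro) (rule assms(2))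
 have r1: "1 <= r" using assms(11) by linarith
 have st: "setting s \<phi> N S r \<gamma> \<alpha>"
  by (rule setting.intro[OF \<phi> rs], rule setting_axioms.intro) (use assms(7-9,11) r1 in \<open>auto simp: N_def\<close>)
 have pq: "1 <= p" "p ~= \<infinity>" "1 <= q" using assms(3-5) by auto
 have r': "r' <= N" by (simp add: N_def)
 have rec: "reconstruction s \<phi> N S r \<gamma> \<alpha> P \<Gamma>" if "model s r S P \<Gamma>" for P \<Gamma>
  by (rule reconstruction.intro[OF st model_bounds.intro[OF sc rs]], rule model_bounds_axioms.intro)
    (use that assms(7-9) in auto)
 interpret setting s \<phi> N S r \<gamma> \<alpha> by (rule st)
 show ?thesis
 proof (intro exI[of _ "coreC + 1"] conjI allI impI, goal_cases)
  case 1
  show ?case using coreC_nonneg by simp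
 next
  case (2 P \<Gamma>)
  then interpret M: reconstruction s \<phi> N S r \<gamma> \<alpha> P \<Gamma> by (rule rec)
  show ?case
   by (intro exI[of _ M.Rop] conjI M.Rop_linear M.Rop_continuous M.reconstruction_estimate pq assms(10,12) r')
 next
  case (3 P \<Gamma> P' \<Gamma>')
  hence "two_models s \<phi> N S r \<gamma> \<alpha> P \<Gamma> P' \<Gamma>'" by (intro two_models.intro rec) auto
  then interpret M: two_models s \<phi> N S r \<gamma> \<alpha> P \<Gamma> P' \<Gamma>' .
  show ?case
   by (intro exI[of _ M.Rop] exI[of _ M.M'.Rop] conjI M.Rop_continuous M.M'.Rop_continuous
    M.reconstruction_estimate M.M'.reconstruction_estimate M.comparison pq assms(10,12) r')
 qed
qed

end
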